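(* One has $\mathcal{D}_{\triangleright}[\gamma]=\mathcal{D}_{*}[\mathcal{N}]=\mathcal{D}_{\boxplus}[\mathcal{S}]$, where $\gamma$ is the standard arc-sine law, $\mathcal{N}$ is the standard normal law and $\mathcal{S}$ is the standard semicircle law.
   Context: Let $\mathbb{C}^{+}=\{z\in\mathbb{C}:\Im z>0\}$ and let $\mathcal{M}$ be the set of all Borel probability measures on $\mathbb{R}$. For $\mu\in\mathcal{M}$ let $G_\mu(z)=\int_{-\infty}^{\infty}\frac{1}{z-t}\,d\mu(t)$ and $F_\mu=1/G_\mu$ on $\mathbb{C}^{+}$; $F_\mu$ determines $\mu$. The monotone convolution $\mu\triangleright\nu\in\mathcal{M}$ is the measure determined by $F_{\mu\triangleright\nu}(z)=F_\mu(F_\nu(z))$, $z\in\mathbb{C}^{+}$. The symbol $*$ denotes classical convolution and $\boxplus$ denotes Voiculescu's free additive convolution on $\mathcal{M}$. For $\star\in\{\triangleright,*,\boxplus\}$, $\mu^{\star n}$ is the $n$-fold $\star$-convolution power of $\mu$. For $b>0$, $D_b\mu(A)=\mu(b^{-1}A)$ for Borel sets $A$. The symbol $\Rightarrow$ denotes weak convergence of probability measures. For $\nu\in\mathcal{M}$, $\nu\ne\delta_0$, the strict domain of attraction $\mathcal{D}_{\star}[\nu]$ of $\nu$ relative to $\star$ is the set of all $\mu\in\mathcal{M}$ for which there exists a sequence $B_n>0$ with $D_{1/B_n}\mu^{\star n}\Rightarrow\nu$ as $n\to\infty$. The standard arc-sine law $\gamma$ has density $\pi^{-1}(2-x^2)^{-1/2}$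 on $(-\sqrt2,\sqrt2)$; the standard normal law and the standard semicircle law both have mean $0$ and variance $1$ (the semicircle law has density $\frac{1}{2\pi}\sqrt{4-x^2}$ on $[-2,2]$). *)

theory Defs
  imports "HOL-Probability.Probability"
begin

text \<open>
  The set \<open>\<M>\<close> of Borel probability measures on the real line is rendered by the library predicate
  \<open>real_distribution\<close>, and weak convergence of such measures by \<open>weak_conv_m\<close>.
\<close>

definition upper_half_plane :: "complex set" where
  "upper_half_plane = {z. Im z > 0}"

definition cauchy_transform :: "real measure \<Rightarrow> complex \<Rightarrow> complex" where
  "cauchy_transform \<mu> z = (LINT t|\<mu>. 1 / (z - complex_of_real t))"

definition F_transform :: "real measure \<Rightarrow> complex \<Rightarrow> complex" where
  "F_transform \<mu> z = 1 / cauchy_transform \<mu> z"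

definition monotone_convolution :: "real measure \<Rightarrow> real measure \<Rightarrow> real measure" where
  "monotone_convolution \<mu> \<nu> =
     (THE \<rho>. real_distribution \<rho> \<and>
        (\<forall>z\<in>upper_half_plane. F_transform \<rho> z = F_transform \<mu> (F_transform \<nu> z)))"

definition truncated_cone :: "real \<Rightarrow> real \<Rightarrow> complex set" where
  "truncated_cone \<alpha> \<beta> = {z. Im z > \<beta> \<and> \<bar>Re z\<bar> < \<alpha> * Im z}"

text \<open>
  Free convolution of arbitrary (possibly unboundedly supported) measures is defined as in
  Bercovici and Voiculescu, Free convolution of measures with unbounded support (1993).
  The transform \<open>F_transform \<mu>\<close> need not be injective on the upper half-plane, but it is injective
  on some truncated cone, whose image contains another truncated cone.  The Voiculescu transform
  is \<open>\<phi>(z) = F\<^sup>-\<^sup>1(z) - z\<close> for that inverse.  Since the cones are not canonical, the notion is a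
  relation; by the identity theorem, two Voiculescu transforms of the same measure that are
  defined on truncated cones agree on the intersection of these cones.
\<close>

definition voiculescu_transform_on ::
    "real measure \<Rightarrow> complex set \<Rightarrow> (complex \<Rightarrow> complex) \<Rightarrow> bool" where
  "voiculescu_transform_on \<mu> D \<phi> \<longleftrightarrow>
     (\<exists>\<alpha>>0. \<exists>\<beta>>0.
        inj_on (F_transform \<mu>) (truncated_cone \<alpha> \<beta>) \<and>
        D \<subseteq> F_transform \<mu> ` truncated_cone \<alpha> \<beta> \<and>
        (\<forall>z\<in>D. \<phi> z = the_inv_into (truncated_cone \<alpha> \<beta>) (F_transform \<mu>) z - z))"

definition free_convolution :: "real measure \<Rightarrow> real measure \<Rightarrow> real measure" where
  "free_convolution \<mu> \<nu> =
     (THE \<rho>. real_distribution \<rho> \<and>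
        (\<exists>\<alpha>>0. \<exists>\<beta>>0. \<exists>\<phi> \<psi>.
           voiculescu_transform_on \<mu> (truncated_cone \<alpha> \<beta>) \<phi> \<and>
           voiculescu_transform_on \<nu> (truncated_cone \<alpha> \<beta>) \<psi> \<and>
           voiculescu_transform_on \<rho> (truncated_cone \<alpha> \<beta>) (\<lambda>z. \<phi> z + \<psi> z)))"

text \<open>
  The point mass at 0 is the unit of each of the three convolutions, so it serves as the 0-th power.
\<close>

definition convolution_power ::
    "(real measure \<Rightarrow> real measure \<Rightarrow> real measure) \<Rightarrow> real measure \<Rightarrow> nat \<Rightarrow> real measure" where
  "convolution_power conv \<mu> n = (conv \<mu> ^^ n) (return borel 0)"

text \<open>\<open>dilation b \<mu> A = \<mu> (b\<^sup>-\<^sup>1 A)\<close>, since \<open>b\<^sup>-\<^sup>1 A\<close> is the preimage of \<open>A\<close> under \<open>x \<mapsto> b x\<close>.\<close>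

definition dilation :: "real \<Rightarrow> real measure \<Rightarrow> real measure" where
  "dilation b \<mu> = distr \<mu> borel (\<lambda>x. b * x)"

text \<open>Only meaningful for \<open>\<nu> \<noteq> return borel 0\<close>.\<close>

definition strict_domain_of_attraction ::
    "(real measure \<Rightarrow> real measure \<Rightarrow> real measure) \<Rightarrow> real measure \<Rightarrow> real measure set" where
  "strict_domain_of_attraction conv \<nu> =
     {\<mu>. real_distribution \<mu> \<and>
        (\<exists>B :: nat \<Rightarrow> real. (\<forall>n. B n > 0) \<and>
           weak_conv_m (\<lambda>n. dilation (1 / B n) (convolution_power conv \<mu> n)) \<nu>)}"

definition arcsine_distribution :: "real measure" where
  "arcsine_distribution =
     density lborel (\<lambda>x. ennreal (indicator {- sqrt 2<..<sqrt 2} x * (1 / (pi * sqrt (2 - x\<^sup>2)))))"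

definition semicircle_distribution :: "real measure" where
  "semicircle_distribution =
     density lborel (\<lambda>x. ennreal (indicator {- 2..2} x * (1 / (2 * pi) * sqrt (4 - x\<^sup>2))))"

end

theory Submission
  imports Defs "HOL-Complex_Analysis.Complex_Analysis" "HOL-Real_Asymp.Real_Asymp"
begin

text \<open>
  Put \<open>\<mu>\<^sub>n = dilation (1 / B n) \<mu>\<close> and \<open>V\<^sub>n z = n (F z - z)\<close> with \<open>F\<close> the reciprocal Cauchy transform of \<open>\<mu>\<^sub>n\<close>.
  For each of the three convolutions the \<open>n\<close>-th power of \<open>\<mu>\<^sub>n\<close> tends to the respective limit law if and only if
  \<open>V\<^sub>n z \<rightarrow> - 1 / z\<close> on the upper half-plane; so even the norming constants can be chosen the same.
  The classical case passes from \<open>V\<^sub>n\<close> to the characteristic function through \<open>n \<integral> t\<^sup>2 / (t\<^sup>2 + y\<^sup>2) d\<mu>\<^sub>n\<close>.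
  In the free case the transform of the power at \<open>z\<close> is \<open>F \<omega>\<close>, where \<open>\<omega> = z + (n - 1) (F \<omega> - \<omega>)\<close> by subordination, and in the
  limit this is the equation \<open>\<omega> = z - 1 / \<omega>\<close> of the semicircle law.
  In the monotone case the transform of the power is the iterate \<open>F\<^sup>n\<close>, that is, Euler's method for \<open>dw/dt = - 1 / w\<close>, with limit
  \<open>\<surd>(z\<^sup>2 - 2)\<close>.
  Conversely, if the iterates tend to \<open>\<Phi> z = \<surd>(z\<^sup>2 - 2)\<close>, then the \<open>V\<^sub>n\<close> are bounded, and commuting \<open>F\<close> with \<open>F\<^sup>n\<close> shows
  that \<open>z V\<^sub>n z\<close> is asymptotically \<open>\<Phi>\<close>-invariant; since the \<open>\<Phi>\<close>-orbits of any two points approach each other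
  hyperbolically, it is asymptotically constant, and the constant must be \<open>- 1\<close>.
\<close>

text \<open>\<open>monotone_convolution\<close> and \<open>free_convolution\<close> are definite
  descriptions, so nothing can be said about them before a measure with the prescribed transform is
  known to exist and to be unique; this is why Cauchy transforms are first characterised, by a
  Poisson integral. No moments are assumed, so increments are tested against bounded kernels such as
  \<open>t / (z - t)\<close> only. Since \<open>Im (F z) \<ge> Im z\<close>, every
  \<open>n (F z - z)\<close> maps the half-plane into its closure, and Schwarz-Pick turns a bound at
  one point into bounds everywhere, uniformly in \<open>n\<close>. The three converse directions
  differ in difficulty: the free equation can be solved for the increment at
  \<open>\<omega>\<close>, and the classical one by a logarithm, but the iterate \<open>F^n\<close>
  offers no such linearisation. There, boundedness of the increment is read off from the orbit of
  \<open>8 \<i>\<close> itself. The weight \<open>z\<close> in \<open>z V z\<close> comes from the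
  derivative \<open>z / \<Phi> z\<close> of \<open>\<Phi>\<close>: commutation makes
  \<open>V (\<Phi> z)\<close> asymptotically \<open>V z\<close> times this derivative.\<close>

lemma upper_half_plane_iff [simp]: "z \<in> upper_half_plane \<longleftrightarrow> Im z > 0"
  by (simp add: upper_half_plane_def)

lemma open_upper_half_plane [simp]: "open upper_half_plane"
  unfolding upper_half_plane_def by (rule open_halfspace_Im_gt)

lemma convex_upper_half_plane: "convex upper_half_plane"
  unfolding upper_half_plane_def by (rule convex_halfspace_Im_gt)

lemma connected_upper_half_plane: "connected upper_half_plane"
  by (rule convex_connected [OF convex_upper_half_plane])

section \<open>The Schwarz-Pick lemma in the upper half-plane\<close>

lemma norm_diff_less_norm_diff_cnj:
  assumes "Im w > 0" "Im c > 0"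
  shows "norm (w - c) < norm (w - cnj c)"
proof -
  have "(norm (w - c))\<^sup>2 < (norm (w - cnj c))\<^sup>2"
    using mult_pos_pos[OF assms] unfolding cmod_power2 by (simp add: power2_eq_square algebra_simps)
  thus ?thesis by (rule power2_less_imp_less) simp
qed

text \<open>Transport to the unit disc: \<open>p\<close> maps the disc into the half-plane with
  \<open>p 0 = b\<close>, \<open>g\<close> follows \<open>f \<circ> p\<close> by the Cayley map
  centred at \<open>f b\<close>, and the Schwarz lemma is applied at the preimage
  \<open>\<xi>\<close> of \<open>a\<close>. The product form survives the limit in which
  \<open>f\<close> becomes real.\<close>

lemma schwarz_pick_strict:
  assumes hol: "f holomorphic_on upper_half_plane"
    and pos: "\<And>z. Im z > 0 \<Longrightarrow> Im (f z) > 0"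
    and a: "Im a > 0" and b: "Im b > 0"
  shows "norm (f a - f b) * norm (a - cnj b) \<le> norm (a - b) * norm (f a - cnj (f b))"
proof -
  define p where "p = (\<lambda>\<zeta>. (b - cnj b * \<zeta>) / (1 - \<zeta>))"
  define g where "g = (\<lambda>\<zeta>. (f (p \<zeta>) - f b) / (f (p \<zeta>) - cnj (f b)))"
  have p_pos: "Im (p \<zeta>) > 0" if "norm \<zeta> < 1" for \<zeta>
  proof -
    have "(norm \<zeta>)\<^sup>2 < 1" using that by (simp add: abs_square_less_1)
    hence "(Re \<zeta>)\<^sup>2 + (Im \<zeta>)\<^sup>2 < 1" by (simp add: cmod_power2)
    hence "Im b * (1 - ((Re \<zeta>)\<^sup>2 + (Im \<zeta>)\<^sup>2)) > 0" using b by simp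
    moreover have "Im ((b - cnj b * \<zeta>) * cnj (1 - \<zeta>)) = Im b * (1 - ((Re \<zeta>)\<^sup>2 + (Im \<zeta>)\<^sup>2))"
      by (simp add: power2_eq_square algebra_simps)
    ultimately show ?thesis unfolding p_def by (simp only: Im_complex_div_gt_0)
  qed
  have ne: "w \<noteq> cnj c" if "Im w > 0" "Im c > 0" for w c using that by (auto simp: complex_eq_iff)
  have "p holomorphic_on ball 0 1" unfolding p_def by (intro holomorphic_intros) auto
  moreover have "p ` ball 0 1 \<subseteq> upper_half_plane" using p_pos by auto
  ultimately have "(f \<circ> p) holomorphic_on ball 0 1"
    using hol by (metis holomorphic_on_compose_gen)
  hence g_hol: "g holomorphic_on ball 0 1" unfolding g_def o_def
    using ne[OF pos[OF p_pos] pos[OF b]] by (intro holomorphic_intros) auto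
  have g0: "g 0 = 0" by (simp add: g_def p_def)
  have g1: "norm (g \<zeta>) < 1" if "norm \<zeta> < 1" for \<zeta>
    using norm_diff_less_norm_diff_cnj[OF pos[OF p_pos[OF that]] pos[OF b]] ne[OF pos[OF p_pos[OF that]] pos[OF b]]
    by (simp add: g_def norm_divide divide_less_eq_1)
  define \<xi> where "\<xi> = (a - b) / (a - cnj b)"
  have nab: "a - cnj b \<noteq> 0" using ne[OF a b] by simp
  have \<xi>1: "norm \<xi> < 1"
    using norm_diff_less_norm_diff_cnj[OF a b] nab by (simp add: \<xi>_def norm_divide divide_less_eq_1)
  have bb: "b - cnj b \<noteq> 0" using ne[OF b b] by simp
  have "1 - \<xi> = (b - cnj b) / (a - cnj b)" using nab by (simp add: \<xi>_def field_simps)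
  moreover have "b - cnj b * \<xi> = a * (b - cnj b) / (a - cnj b)" using nab by (simp add: \<xi>_def field_simps)
  ultimately have "p \<xi> = a" using bb nab by (simp add: p_def)
  hence "norm ((f a - f b) / (f a - cnj (f b))) \<le> norm ((a - b) / (a - cnj b))"
    using Schwarz_Lemma(1)[OF g_hol g0 g1 \<xi>1] by (simp add: g_def \<xi>_def)
  thus ?thesis using nab ne[OF pos[OF a] pos[OF b]]
    by (simp add: norm_divide field_simps)
qed

text \<open>The translate \<open>f + \<i> e\<close> has positive imaginary part, and the inequality
  is continuous in \<open>e\<close>. Allowing real values matters because \<open>F z - z\<close> is
  a real constant when the measure is a point mass.\<close>

lemma schwarz_pick:
  assumes hol: "f holomorphic_on upper_half_plane"
    and nonneg: "\<And>z. Im z > 0 \<Longrightarrow> Im (f z) \<ge> 0"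
    and a: "Im a > 0" and b: "Im b > 0"
  shows "norm (f a - f b) * norm (a - cnj b) \<le> norm (a - b) * norm (f a - cnj (f b))"
proof -
  have e: "norm (f a - f b) * norm (a - cnj b) \<le> norm (a - b) * norm (f a - cnj (f b) + 2 * \<i> * of_real e)"
    if "e > 0" for e
  proof -
    have "norm ((f a + \<i> * of_real e) - (f b + \<i> * of_real e)) * norm (a - cnj b)
        \<le> norm (a - b) * norm ((f a + \<i> * of_real e) - cnj (f b + \<i> * of_real e))"
    proof (rule schwarz_pick_strict[where f = "\<lambda>z. f z + \<i> * of_real e", OF _ _ a b])
      show "(\<lambda>z. f z + \<i> * of_real e) holomorphic_on upper_half_plane"
        by (intro holomorphic_intros hol)
      show "Im (f z + \<i> * of_real e) > 0" if "Im z > 0" for z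
        using nonneg[OF that] \<open>e > 0\<close> by simp
    qed
    thus ?thesis by (simp add: algebra_simps)
  qed
  have "((\<lambda>e. norm (a - b) * norm (f a - cnj (f b) + 2 * \<i> * of_real e))
        \<longlongrightarrow> norm (a - b) * norm (f a - cnj (f b) + 2 * \<i> * of_real 0)) (at_right 0)"
    by (intro tendsto_intros)
  moreover have "eventually (\<lambda>e. norm (f a - f b) * norm (a - cnj b)
      \<le> norm (a - b) * norm (f a - cnj (f b) + 2 * \<i> * of_real e)) (at_right 0)"
    using eventually_at_right_less[of "0::real"] by eventually_elim (rule e)
  ultimately show ?thesis by (intro tendsto_lowerbound[where F = "at_right (0::real)"]) auto
qed

text \<open>The triangle inequality \<open>|f a - cnj (f b)| \<le> |f a - f b| + 2 Im (f b)\<close>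
  eliminates \<open>f a\<close> from the right-hand side, so that the value at one point controls
  the oscillation everywhere.\<close>

lemma schwarz_pick_distance:
  assumes hol: "f holomorphic_on upper_half_plane"
    and nonneg: "\<And>z. Im z > 0 \<Longrightarrow> Im (f z) \<ge> 0"
    and a: "Im a > 0" and b: "Im b > 0"
  shows "norm (f a - f b) * (norm (a - cnj b) - norm (a - b)) \<le> 2 * norm (a - b) * Im (f b)"
proof -
  have "f a - cnj (f b) = (f a - f b) + 2 * \<i> * of_real (Im (f b))"
    by (simp add: complex_eq_iff)
  hence "norm (f a - cnj (f b)) \<le> norm (f a - f b) + norm (2 * \<i> * of_real (Im (f b)))"
    by (metis norm_triangle_ineq)
  also have "norm (2 * \<i> * of_real (Im (f b))) = 2 * Im (f b)"
    using nonneg[OF b] by (simp add: norm_mult)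
  finally have "norm (a - b) * norm (f a - cnj (f b)) \<le> norm (a - b) * (norm (f a - f b) + 2 * Im (f b))"
    by (intro mult_left_mono) auto
  with schwarz_pick[OF hol nonneg a b] show ?thesis by (simp add: algebra_simps)
qed

text \<open>Harnack form of the preceding bound: near \<open>b\<close> the hyperbolic factor is at
  least \<open>2 (Im b - |a - b|)\<close>.\<close>

lemma schwarz_pick_local:
  assumes hol: "f holomorphic_on upper_half_plane"
    and nonneg: "\<And>z. Im z > 0 \<Longrightarrow> Im (f z) \<ge> 0"
    and b: "Im b > 0" and ab: "norm (a - b) < Im b"
  shows "norm (f a - f b) * (Im b - norm (a - b)) \<le> norm (a - b) * Im (f b)"
proof -
  have a: "Im a > 0" using abs_Im_le_cmod[of "a - b"] ab by simp
  have "a - cnj b = (a - b) + 2 * \<i> * of_real (Im b)" by (simp add: complex_eq_iff)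
  hence "norm (2 * \<i> * of_real (Im b)) \<le> norm (a - cnj b) + norm (a - b)"
    by (metis add.commute norm_triangle_sub add_diff_cancel_left' norm_minus_commute)
  hence "2 * Im b - 2 * norm (a - b) \<le> norm (a - cnj b) - norm (a - b)"
    using b by (simp add: norm_mult)
  hence "norm (f a - f b) * (2 * Im b - 2 * norm (a - b))
     \<le> norm (f a - f b) * (norm (a - cnj b) - norm (a - b))"
    by (intro mult_left_mono) auto
  with schwarz_pick_distance[OF hol nonneg a b] show ?thesis by (simp add: algebra_simps)
qed

text \<open>Maximum principle: the right-hand side of the distance bound vanishes while its factor
  on the left is strictly positive.\<close>

lemma schwarz_pick_constant:
  assumes hol: "f holomorphic_on upper_half_plane"
    and nonneg: "\<And>z. Im z > 0 \<Longrightarrow> Im (f z) \<ge> 0"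
    and a: "Im a > 0" and b: "Im b > 0" and z: "Im (f b) = 0"
  shows "f a = f b"
proof -
  have "norm (f a - f b) * (norm (a - cnj b) - norm (a - b)) \<le> 0"
    using schwarz_pick_distance[OF hol nonneg a b] z by simp
  with norm_diff_less_norm_diff_cnj[OF a b] show ?thesis
    by (simp add: mult_le_0_iff)
qed

subsection \<open>Cauchy transforms\<close>

lemma norm_diff_of_real_ge: "Im z > 0 \<Longrightarrow> norm (z - of_real t) \<ge> Im z"
  using abs_Im_le_cmod[of "z - of_real t"] by simp

lemma diff_of_real_nonzero: "Im z > 0 \<Longrightarrow> z - of_real t \<noteq> 0"
  by (auto simp: complex_eq_iff)

lemma norm_inverse_diff_of_real_le:
  assumes "Im z > 0" shows "norm (1 / (z - of_real t)) \<le> 1 / Im z"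
  using norm_diff_of_real_ge[OF assms, of t] assms
  by (simp add: norm_divide frac_le)

lemma (in real_distribution) prob_UNIV [simp]: "prob UNIV = 1"
  using prob_space by simp

lemma (in real_distribution) integrable_bounded_complex:
  fixes f :: "real \<Rightarrow> complex"
  assumes "f \<in> borel_measurable borel" "\<And>t. norm (f t) \<le> B"
  shows "integrable M f"
  by (rule integrable_const_bound[where B = B]) (use assms in auto)

lemma (in real_distribution) integrable_bounded_real:
  fixes f :: "real \<Rightarrow> real"
  assumes "f \<in> borel_measurable borel" "\<And>t. \<bar>f t\<bar> \<le> B"
  shows "integrable M f"
  by (rule integrable_const_bound[where B = B]) (use assms in auto)

lemma (in real_distribution) integrable_cauchy_kernel:
  assumes "Im z > 0" shows "integrable M (\<lambda>t. 1 / (z - of_real t))"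
  by (rule integrable_bounded_complex[where B = "1 / Im z"])
     (use norm_inverse_diff_of_real_le[OF assms] in auto)

lemma (in real_distribution) norm_cauchy_transform_le:
  assumes "Im z > 0" shows "norm (cauchy_transform M z) \<le> 1 / Im z"
proof -
  have "norm (cauchy_transform M z) \<le> (LINT t|M. norm (1 / (z - of_real t)))"
    unfolding cauchy_transform_def by (rule integral_norm_bound)
  also have "\<dots> \<le> (LINT t|M. 1 / Im z)"
    by (intro integral_mono integrable_norm integrable_cauchy_kernel assms norm_inverse_diff_of_real_le) auto
  finally show ?thesis by (simp add: prob_space)
qed

lemma Im_inverse_diff_of_real:
  "Im (1 / (z - of_real t)) = - Im z / (norm (z - of_real t))\<^sup>2"
  by (simp add: Im_divide cmod_power2)

lemma (in real_distribution) integrable_poisson: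
  assumes "Im z > 0" shows "integrable M (\<lambda>t. 1 / (norm (z - of_real t))\<^sup>2)"
proof (rule integrable_bounded_real[where B = "1 / (Im z)\<^sup>2"])
  fix t
  have "(Im z)\<^sup>2 \<le> (norm (z - of_real t))\<^sup>2"
    using norm_diff_of_real_ge[OF assms, of t] assms by (intro power_mono) auto
  thus "\<bar>1 / (norm (z - of_real t))\<^sup>2\<bar> \<le> 1 / (Im z)\<^sup>2" using assms by (simp add: frac_le)
qed measurable

lemma (in real_distribution) Im_cauchy_transform:
  assumes "Im z > 0"
  shows "Im (cauchy_transform M z) = - Im z * (LINT t|M. 1 / (norm (z - of_real t))\<^sup>2)"
proof -
  have "Im (cauchy_transform M z) = (LINT t|M. Im (1 / (z - of_real t)))"
    unfolding cauchy_transform_def using integrable_cauchy_kernel[OF assms] by (simp only: integral_Im)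
  also have "\<dots> = (LINT t|M. (- Im z) * (1 / (norm (z - of_real t))\<^sup>2))"
    unfolding Im_inverse_diff_of_real by simp
  finally show ?thesis by (simp only: integral_mult_right_zero)
qed

text \<open>Jensen for the square, obtained from nonnegativity of a variance. The right-hand side is
  \<open>- Im G / Im z\<close>, which makes this the inequality \<open>Im F \<ge> Im z\<close> in
  disguise.\<close>

lemma (in real_distribution) norm_cauchy_transform_sq_le:
  assumes "Im z > 0"
  shows "(norm (cauchy_transform M z))\<^sup>2 \<le> (LINT t|M. 1 / (norm (z - of_real t))\<^sup>2)"
proof -
  have "norm (cauchy_transform M z) \<le> (LINT t|M. norm (1 / (z - of_real t)))"
    unfolding cauchy_transform_def by (rule integral_norm_bound)
  hence "(norm (cauchy_transform M z))\<^sup>2 \<le> (LINT t|M. norm (1 / (z - of_real t)))\<^sup>2"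
    by (intro power_mono) auto
  also have "\<dots> \<le> (LINT t|M. (norm (1 / (z - of_real t)))\<^sup>2)"
  proof -
    have "variance (\<lambda>t. norm (1 / (z - of_real t))) \<ge> 0" by simp
    moreover have "integrable M (\<lambda>t. (norm (1 / (z - of_real t)))\<^sup>2)"
      using integrable_poisson[OF assms] by (simp add: norm_divide power_divide)
    ultimately show ?thesis
      using variance_eq[OF integrable_norm[OF integrable_cauchy_kernel[OF assms]]] by simp
  qed
  finally show ?thesis by (simp add: norm_divide power_divide)
qed

lemma (in real_distribution) Im_cauchy_transform_neg:
  assumes "Im z > 0" shows "Im (cauchy_transform M z) < 0"
proof -
  have "(LINT t|M. 1 / (norm (z - of_real t))\<^sup>2) > 0"
  proof (rule ccontr)
    assume "\<not> ?thesis"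
    moreover have "(LINT t|M. 1 / (norm (z - of_real t))\<^sup>2) \<ge> 0" by (intro integral_nonneg_AE) auto
    ultimately have "(LINT t|M. 1 / (norm (z - of_real t))\<^sup>2) = 0" by linarith
    hence "AE t in M. 1 / (norm (z - of_real t))\<^sup>2 = 0"
      by (subst (asm) integral_nonneg_eq_0_iff_AE[OF integrable_poisson[OF assms]]) auto
    hence "AE t in M. False" by eventually_elim (use diff_of_real_nonzero[OF assms] in auto)
    thus False by simp
  qed
  thus ?thesis using assms by (simp add: Im_cauchy_transform)
qed

lemma (in real_distribution) cauchy_transform_nonzero:
  "Im z > 0 \<Longrightarrow> cauchy_transform M z \<noteq> 0"
  using Im_cauchy_transform_neg[of z] by auto

lemma (in real_distribution) Im_F_transform_ge:
  assumes "Im z > 0" shows "Im (F_transform M z) \<ge> Im z"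
proof -
  let ?G = "cauchy_transform M z"
  have pos: "(norm ?G)\<^sup>2 > 0" using cauchy_transform_nonzero[OF assms] by simp
  have "Im (F_transform M z) = - Im ?G / (norm ?G)\<^sup>2"
    by (simp add: F_transform_def Im_divide cmod_power2)
  also have "\<dots> \<ge> Im z"
    using mult_left_mono[OF norm_cauchy_transform_sq_le[OF assms], of "Im z"] assms pos
    by (simp add: Im_cauchy_transform pos_le_divide_eq)
  finally show ?thesis .
qed

lemma (in real_distribution) has_field_derivative_cauchy_transform:
  assumes "Im z > 0"
  shows "(cauchy_transform M has_field_derivative (LINT t|M. - 1 / (z - of_real t)\<^sup>2)) (at z)"
proof -
  let ?D = "LINT t|M. - 1 / (z - of_real t)\<^sup>2"
  let ?y = "Im z"
  have int2: "integrable M (\<lambda>t. - 1 / (z - of_real t)\<^sup>2)"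
  proof (rule integrable_bounded_complex[where B = "1 / ?y\<^sup>2"])
    fix t show "norm (- 1 / (z - of_real t)\<^sup>2) \<le> 1 / ?y\<^sup>2"
      using norm_diff_of_real_ge[OF assms, of t] assms
      by (simp add: norm_divide norm_power frac_le power_mono)
  qed measurable
  \<comment> \<open>Differentiation under the integral with an explicit remainder: the kernel error
    is \<open>(w - z) / ((z - t)^2 (w - t))\<close>, and within half the height of \<open>z\<close>
    the last factor has modulus at least \<open>Im z / 2\<close>.\<close>
  have est: "norm ((cauchy_transform M w - cauchy_transform M z) / (w - z) - ?D) \<le> norm (w - z) * (2 / ?y ^ 3)"
    if w: "w \<noteq> z" "norm (w - z) < ?y / 2" for w
  proof -
    have Imw: "Im w > ?y / 2" using abs_Im_le_cmod[of "w - z"] w by simp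
    hence Imw0: "Im w > 0" using assms by simp
    have eq: "((1 / (w - of_real t) - 1 / (z - of_real t)) / (w - z) - - 1 / (z - of_real t)\<^sup>2)
        = (w - z) / ((z - of_real t)\<^sup>2 * (w - of_real t))" for t
      using diff_of_real_nonzero[OF assms, of t] diff_of_real_nonzero[OF Imw0, of t] w
      by (simp add: divide_simps power2_eq_square) (simp add: algebra_simps)
    have bd: "norm ((w - z) / ((z - of_real t)\<^sup>2 * (w - of_real t))) \<le> norm (w - z) * (2 / ?y ^ 3)" for t
    proof -
      have "?y\<^sup>2 * (?y / 2) \<le> (norm (z - of_real t))\<^sup>2 * norm (w - of_real t)"
        using norm_diff_of_real_ge[OF assms, of t] norm_diff_of_real_ge[OF Imw0, of t] Imw assms
        by (intro mult_mono power_mono) auto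
      hence "norm (w - z) / ((norm (z - of_real t))\<^sup>2 * norm (w - of_real t)) \<le> norm (w - z) / (?y\<^sup>2 * (?y / 2))"
        using assms by (intro frac_le) auto
      thus ?thesis by (simp add: norm_divide norm_mult norm_power power2_eq_square power3_eq_cube)
    qed
    have "(cauchy_transform M w - cauchy_transform M z) / (w - z) - ?D
       = (LINT t|M. (1 / (w - of_real t) - 1 / (z - of_real t)) / (w - z) - - 1 / (z - of_real t)\<^sup>2)"
      unfolding cauchy_transform_def
      using integrable_cauchy_kernel[OF assms] integrable_cauchy_kernel[OF Imw0] int2
      by simp
    also have "\<dots> = (LINT t|M. (w - z) / ((z - of_real t)\<^sup>2 * (w - of_real t)))" unfolding eq ..
    also have "norm \<dots> \<le> (LINT t|M. norm ((w - z) / ((z - of_real t)\<^sup>2 * (w - of_real t))))"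
      by (rule integral_norm_bound)
    also have "\<dots> \<le> (LINT t|M. norm (w - z) * (2 / ?y ^ 3))"
      by (intro integral_mono integrable_norm integrable_bounded_complex[OF _ bd] bd) auto
    finally show ?thesis by (simp add: prob_space)
  qed
  have "((\<lambda>w. (cauchy_transform M w - cauchy_transform M z) / (w - z)) \<longlongrightarrow> ?D) (at z)"
  proof (rule LIM_zero_cancel, rule Lim_null_comparison)
    show "\<forall>\<^sub>F w in at z. norm ((cauchy_transform M w - cauchy_transform M z) / (w - z) - ?D)
        \<le> norm (w - z) * (2 / ?y ^ 3)"
      unfolding eventually_at dist_norm
      by (intro exI[of _ "?y / 2"] conjI ballI impI est) (use assms in auto)
    show "((\<lambda>w. norm (w - z) * (2 / ?y ^ 3)) \<longlongrightarrow> 0) (at z)"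
      by (rule tendsto_eq_intros refl)+ simp_all
  qed
  thus ?thesis by (simp add: has_field_derivative_iff)
qed

lemma (in real_distribution) holomorphic_cauchy_transform:
  "cauchy_transform M holomorphic_on upper_half_plane"
  unfolding holomorphic_on_def field_differentiable_def
  using has_field_derivative_cauchy_transform has_field_derivative_at_within by fastforce

lemma (in real_distribution) holomorphic_F_transform:
  "F_transform M holomorphic_on upper_half_plane"
  unfolding F_transform_def
  by (intro holomorphic_intros holomorphic_cauchy_transform) (auto dest: cauchy_transform_nonzero)

subsection \<open>Asymptotics in cones\<close>

lemma truncated_cone_iff:
  "z \<in> truncated_cone \<alpha> \<beta> \<longleftrightarrow> Im z > \<beta> \<and> \<bar>Re z\<bar> < \<alpha> * Im z"
  by (simp add: truncated_cone_def)

lemma convex_truncated_cone: "convex (truncated_cone \<alpha> \<beta>)"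
proof -
  have "truncated_cone \<alpha> \<beta> = {z. Im z > \<beta>} \<inter> {z. inner (Complex 1 (- \<alpha>)) z < 0} \<inter> {z. inner (Complex (- 1) (- \<alpha>)) z < 0}"
    by (auto simp: truncated_cone_def inner_complex_def)
  thus ?thesis
    by (simp add: convex_Int convex_halfspace_Im_gt convex_halfspace_lt)
qed

lemma open_truncated_cone: "open (truncated_cone \<alpha> \<beta>)"
proof -
  have "truncated_cone \<alpha> \<beta> = {z. Im z > \<beta>} \<inter> {z. inner (Complex 1 (- \<alpha>)) z < 0} \<inter> {z. inner (Complex (- 1) (- \<alpha>)) z < 0}"
    by (auto simp: truncated_cone_def inner_complex_def)
  thus ?thesis
    by (simp add: open_Int open_halfspace_Im_gt open_halfspace_lt)
qed

lemma norm_le_in_cone: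
  assumes "z \<in> truncated_cone \<alpha> \<beta>" "\<beta> \<ge> 0"
  shows "norm z \<le> (1 + \<alpha>) * Im z"
  using cmod_le[of z] assms by (auto simp: truncated_cone_iff algebra_simps)

text \<open>The bound \<open>min (\<bar>t\<bar> / \<beta>) (2 + \<alpha>)\<close> is uniform on the cone and tends to zero as \<open>\<beta> \<rightarrow> \<infinity>\<close>.\<close>

lemma norm_quotient_in_cone_le:
  assumes z: "z \<in> truncated_cone \<alpha> \<beta>" and \<beta>: "\<beta> > 0"
  shows "norm (of_real t / (z - of_real t)) \<le> min (\<bar>t\<bar> / \<beta>) (2 + \<alpha>)"
proof -
  have y: "Im z > 0" and yb: "Im z \<ge> \<beta>" using z \<beta> by (auto simp: truncated_cone_iff)
  have n: "norm (z - of_real t) \<ge> Im z" "norm (z - of_real t) > 0"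
    using norm_diff_of_real_ge[OF y, of t] y by linarith+
  have 1: "norm (of_real t / (z - of_real t)) \<le> \<bar>t\<bar> / \<beta>"
    using n yb \<beta> by (simp add: norm_divide frac_le)
  have "\<bar>t\<bar> \<le> norm (z - of_real t) + norm z"
    by (metis norm_of_real norm_minus_commute norm_triangle_sub add.commute)
  also have "norm z \<le> (1 + \<alpha>) * Im z" by (rule norm_le_in_cone[OF z]) (use \<beta> in auto)
  also have "\<dots> \<le> (1 + \<alpha>) * norm (z - of_real t)"
  proof (rule mult_left_mono)
    have "0 < \<alpha> * Im z" using z by (auto simp: truncated_cone_iff)
    thus "0 \<le> 1 + \<alpha>" using y by (simp add: zero_less_mult_iff)
  qed (rule n)
  finally have "\<bar>t\<bar> \<le> (2 + \<alpha>) * norm (z - of_real t)" by (simp add: algebra_simps)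
  hence "norm (of_real t / (z - of_real t)) \<le> 2 + \<alpha>"
    using n by (simp add: norm_divide divide_le_eq)
  with 1 show ?thesis by simp
qed

lemma (in real_distribution) cauchy_transform_minus_one:
  assumes "Im z > 0"
  shows "integrable M (\<lambda>t. of_real t / (z - of_real t))"
    and "z * cauchy_transform M z - 1 = (LINT t|M. of_real t / (z - of_real t))"
proof -
  have eq: "(\<lambda>t. of_real t / (z - of_real t)) = (\<lambda>t. z * (1 / (z - of_real t)) - 1)"
    using diff_of_real_nonzero[OF assms] by (auto simp: divide_simps)
  show "integrable M (\<lambda>t. of_real t / (z - of_real t))"
    unfolding eq by (intro Bochner_Integration.integrable_diff integrable_mult_right integrable_cauchy_kernel assms) auto
  have "(LINT t|M. of_real t / (z - of_real t)) = (LINT t|M. z * (1 / (z - of_real t))) - (LINT t|M. 1)"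
    unfolding eq by (intro Bochner_Integration.integral_diff integrable_mult_right integrable_cauchy_kernel assms) auto
  thus "z * cauchy_transform M z - 1 = (LINT t|M. of_real t / (z - of_real t))"
    unfolding cauchy_transform_def by (simp only: integral_mult_right_zero) simp
qed

text \<open>The majorant of \<open>t / (z - t)\<close> is uniform over the cone before integration,
  so dominated convergence in \<open>\<beta>\<close> alone gives a uniform statement.\<close>

lemma (in real_distribution) cauchy_transform_cone_asymptotics:
  assumes "\<epsilon> > 0" "\<alpha> > 0"
  shows "\<exists>\<beta>>0. \<forall>z\<in>truncated_cone \<alpha> \<beta>. norm (z * cauchy_transform M z - 1) \<le> \<epsilon>"
proof -
  let ?I = "\<lambda>\<beta>. LINT t|M. min (\<bar>t\<bar> / \<beta>) (2 + \<alpha>)"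
  have "((\<lambda>n. ?I (real (Suc n))) \<longlongrightarrow> (LINT t|M. 0)) sequentially"
  proof (rule integral_dominated_convergence[where w = "\<lambda>t. 2 + \<alpha>"])
    show "AE t in M. (\<lambda>n. min (\<bar>t\<bar> / real (Suc n)) (2 + \<alpha>)) \<longlonglongrightarrow> 0"
    proof (rule AE_I2)
      fix t :: real
      have "(\<lambda>n. min (\<bar>t\<bar> / real (Suc n)) (2 + \<alpha>)) \<longlonglongrightarrow> min 0 (2 + \<alpha>)"
        by (intro tendsto_min LIMSEQ_Suc[OF lim_const_over_n] tendsto_const)
      thus "(\<lambda>n. min (\<bar>t\<bar> / real (Suc n)) (2 + \<alpha>)) \<longlonglongrightarrow> 0" using assms by simp
    qed
  qed (use assms in auto)
  hence "\<forall>\<^sub>F n in sequentially. ?I (real (Suc n)) < \<epsilon>" using assms by (intro order_tendstoD) auto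
  then obtain n where n: "?I (real (Suc n)) < \<epsilon>" by (meson eventually_happens' sequentially_bot)
  show ?thesis
  proof (intro exI[of _ "real (Suc n)"] conjI ballI)
    fix z assume z: "z \<in> truncated_cone \<alpha> (real (Suc n))"
    hence y: "Im z > 0" by (auto simp: truncated_cone_iff)
    have "norm (z * cauchy_transform M z - 1) \<le> (LINT t|M. norm (complex_of_real t / (z - of_real t)))"
      unfolding cauchy_transform_minus_one(2)[OF y] by (rule integral_norm_bound)
    also have "\<dots> \<le> ?I (real (Suc n))"
    proof (rule integral_mono)
      show "integrable M (\<lambda>t. min (\<bar>t\<bar> / real (Suc n)) (2 + \<alpha>))"
        by (rule integrable_bounded_real[where B = "2 + \<alpha>"]) (use assms in auto)
      show "integrable M (\<lambda>t. norm (complex_of_real t / (z - of_real t)))"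
        by (intro integrable_norm cauchy_transform_minus_one(1) y)
      show "norm (complex_of_real t / (z - of_real t)) \<le> min (\<bar>t\<bar> / real (Suc n)) (2 + \<alpha>)" for t
        by (rule norm_quotient_in_cone_le[OF z]) simp
    qed
    finally show "norm (z * cauchy_transform M z - 1) \<le> \<epsilon>" using n by simp
  qed simp
qed

lemma (in real_distribution) F_transform_cone_asymptotics:
  assumes "\<epsilon> > 0" "\<alpha> > 0"
  shows "\<exists>\<beta>>0. \<forall>z\<in>truncated_cone \<alpha> \<beta>. norm (F_transform M z - z) \<le> \<epsilon> * Im z"
proof -
  \<comment> \<open>The loss from \<open>z G - 1\<close> to \<open>F - z\<close> is a factor
    \<open>2 (1 + \<alpha>)\<close>: one part from \<open>|z| \<le> (1 + \<alpha>) Im z\<close>, one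
    from \<open>|z G| \<ge> 1/2\<close>.\<close>
  define e where "e = min (1/2) (\<epsilon> / (2 * (1 + \<alpha>)))"
  have e: "e > 0" "e \<le> 1/2" "2 * (1 + \<alpha>) * e \<le> \<epsilon>"
  proof -
    have "e \<le> \<epsilon> / (2 * (1 + \<alpha>))" by (simp add: e_def)
    thus "2 * (1 + \<alpha>) * e \<le> \<epsilon>" using assms by (simp add: pos_le_divide_eq mult.commute)
    show "e \<le> 1 / 2" unfolding e_def by (rule min.cobounded1)
  qed (use assms in \<open>auto simp: e_def\<close>)
  obtain \<beta> where \<beta>: "\<beta> > 0" "\<forall>z\<in>truncated_cone \<alpha> \<beta>. norm (z * cauchy_transform M z - 1) \<le> e"
    using cauchy_transform_cone_asymptotics[OF e(1) assms(2)] by auto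
  show ?thesis
  proof (intro exI[of _ \<beta>] conjI ballI \<beta>(1))
    fix z assume z: "z \<in> truncated_cone \<alpha> \<beta>"
    hence y: "Im z > 0" using \<beta> by (auto simp: truncated_cone_iff)
    define w where "w = z * cauchy_transform M z"
    have w1: "norm (w - 1) \<le> e" using \<beta>(2) z by (auto simp: w_def)
    have w2: "norm w \<ge> 1/2" using norm_triangle_ineq2[of 1 "1 - w"] w1 e by (simp add: norm_minus_commute)
    have z0: "z \<noteq> 0" using y by auto
    have "F_transform M z = z / w" using z0 by (simp add: w_def F_transform_def)
    moreover have "w \<noteq> 0" using w2 by auto
    ultimately have "F_transform M z - z = z * (1 - w) / w" by (simp add: field_simps)
    hence "norm (F_transform M z - z) = norm z * norm (w - 1) / norm w"
      by (simp add: norm_mult norm_divide norm_minus_commute)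
    also have "\<dots> \<le> ((1 + \<alpha>) * Im z) * e / (1/2)"
      using w1 w2 norm_le_in_cone[OF z] \<beta>(1) y assms e by (intro frac_le mult_mono) auto
    also have "\<dots> = (2 * (1 + \<alpha>) * e) * Im z" by simp
    also have "\<dots> \<le> \<epsilon> * Im z" using e y by (intro mult_right_mono) auto
    finally show "norm (F_transform M z - z) \<le> \<epsilon> * Im z" .
  qed
qed

lemma (in real_distribution) holomorphic_F_transform_minus_id:
  "(\<lambda>z. F_transform M z - z) holomorphic_on upper_half_plane"
  by (intro holomorphic_intros holomorphic_F_transform)

text \<open>For points closer than half the larger height, Schwarz-Pick converts the size bound
  \<open>(\<epsilon> / 4) Im z\<close> into a Lipschitz bound; for distant points the size bound is
  itself small against \<open>|u - v|\<close>. A small Lipschitz constant yields injectivity of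
  \<open>F\<close> and contraction of the subordination iteration.\<close>

lemma (in real_distribution) F_transform_cone_Lipschitz:
  assumes "\<epsilon> > 0" "\<alpha> > 0"
  shows "\<exists>\<beta>>0. \<forall>u\<in>truncated_cone \<alpha> \<beta>. \<forall>v\<in>truncated_cone \<alpha> \<beta>.
     norm ((F_transform M u - u) - (F_transform M v - v)) \<le> \<epsilon> * norm (u - v)"
proof -
  obtain \<beta> where \<beta>: "\<beta> > 0" "\<forall>z\<in>truncated_cone \<alpha> \<beta>. norm (F_transform M z - z) \<le> (\<epsilon> / 4) * Im z"
    using F_transform_cone_asymptotics[of "\<epsilon> / 4" \<alpha>] assms by auto
  let ?f = "\<lambda>z. F_transform M z - z"
  have main: "norm (?f u - ?f v) \<le> \<epsilon> * norm (u - v)"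
    if u: "u \<in> truncated_cone \<alpha> \<beta>" and v: "v \<in> truncated_cone \<alpha> \<beta>" and uv: "Im u \<le> Im v" for u v
  proof (cases "norm (u - v) < Im v / 2")
    case True
    have y: "Im v > 0" "Im u > 0" using u v \<beta> by (auto simp: truncated_cone_iff)
    have "norm (?f u - ?f v) * (Im v - norm (u - v)) \<le> norm (u - v) * Im (?f v)"
      by (rule schwarz_pick_local[where f = ?f])
         (use holomorphic_F_transform_minus_id Im_F_transform_ge y True in auto)
    also have "\<dots> \<le> norm (u - v) * ((\<epsilon> / 4) * Im v)"
      using \<beta>(2) v abs_Im_le_cmod[of "?f v"] by (intro mult_left_mono) (force, auto)
    finally have "norm (?f u - ?f v) * (Im v - norm (u - v)) \<le> norm (u - v) * ((\<epsilon> / 4) * Im v)" .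
    moreover have "norm (?f u - ?f v) * (Im v / 2) \<le> norm (?f u - ?f v) * (Im v - norm (u - v))"
      using True by (intro mult_left_mono) auto
    ultimately have "norm (?f u - ?f v) * (Im v / 2) \<le> (norm (u - v) * (\<epsilon> / 2)) * (Im v / 2)"
      by (simp add: algebra_simps)
    hence "norm (?f u - ?f v) \<le> norm (u - v) * (\<epsilon> / 2)" using y by (simp add: mult_le_cancel_right)
    also have "\<dots> \<le> \<epsilon> * norm (u - v)" using assms by (simp add: mult.commute mult_left_mono)
    finally show ?thesis .
  next
    case False
    have "norm (?f u - ?f v) \<le> norm (?f u) + norm (?f v)" by (rule norm_triangle_ineq4)
    also have "\<dots> \<le> (\<epsilon> / 4) * Im u + (\<epsilon> / 4) * Im v" using \<beta>(2) u v by (intro add_mono) auto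
    also have "\<dots> \<le> (\<epsilon> / 4) * Im v + (\<epsilon> / 4) * Im v"
      using assms uv by (intro add_mono mult_left_mono) auto
    also have "\<dots> = \<epsilon> * (Im v / 2)" by simp
    also have "\<dots> \<le> \<epsilon> * norm (u - v)" using False assms by (intro mult_left_mono) auto
    finally show ?thesis .
  qed
  show ?thesis
  proof (intro exI[of _ \<beta>] conjI ballI \<beta>(1))
    fix u v assume "u \<in> truncated_cone \<alpha> \<beta>" "v \<in> truncated_cone \<alpha> \<beta>"
    thus "norm (?f u - ?f v) \<le> \<epsilon> * norm (u - v)"
      using main[of u v] main[of v u] by (cases "Im u \<le> Im v") (auto simp: norm_minus_commute)
  qed
qed

subsection \<open>Uniqueness and continuity\<close>

text \<open>Mean value theorem, together with \<open>2 |y| \<le> 1 + y^2\<close> to see that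
  \<open>1 / (1 + y^2)\<close> is 1-Lipschitz. The error is uniform in both variables, as
  differentiation under an arbitrary measure requires.\<close>

lemma arctan_first_order:
  fixes x y :: real
  shows "\<bar>arctan x - arctan y - (x - y) / (1 + y\<^sup>2)\<bar> \<le> (x - y)\<^sup>2"
proof -
  have "\<exists>z. \<bar>z - y\<bar> \<le> \<bar>x - y\<bar> \<and> arctan x - arctan y = (x - y) / (1 + z\<^sup>2)"
  proof (cases x y rule: linorder_cases)
    case less
    obtain z where z: "x < z" "z < y" "arctan y - arctan x = (y - x) * inverse (1 + z\<^sup>2)"
      using MVT2[OF less, of arctan "\<lambda>z. inverse (1 + z\<^sup>2)"] DERIV_arctan by blast
    have "arctan x - arctan y = - ((y - x) * inverse (1 + z\<^sup>2))" using z(3) by linarith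
    also have "\<dots> = (x - y) / (1 + z\<^sup>2)" by (simp add: divide_inverse left_diff_distrib)
    finally show ?thesis using z by (intro exI[of _ z]) auto
  next
    case greater
    obtain z where "y < z" "z < x" "arctan x - arctan y = (x - y) * inverse (1 + z\<^sup>2)"
      using MVT2[OF greater, of arctan "\<lambda>z. inverse (1 + z\<^sup>2)"] DERIV_arctan by blast
    thus ?thesis by (intro exI[of _ z]) (auto simp: field_simps)
  qed auto
  then obtain z where z: "\<bar>z - y\<bar> \<le> \<bar>x - y\<bar>" "arctan x - arctan y = (x - y) / (1 + z\<^sup>2)" by auto
  have pos: "(1 + z\<^sup>2) * (1 + y\<^sup>2) > 0" by (simp add: add_pos_nonneg)
  have p: "1 + z\<^sup>2 > 0" "1 + y\<^sup>2 > 0" by (simp_all add: add_pos_nonneg)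
  have "(x - y) / (1 + z\<^sup>2) - (x - y) / (1 + y\<^sup>2) = (x - y) * (1 / (1 + z\<^sup>2) - 1 / (1 + y\<^sup>2))"
    by (simp add: algebra_simps)
  also have "1 / (1 + z\<^sup>2) - 1 / (1 + y\<^sup>2) = (y - z) * ((y + z) / ((1 + z\<^sup>2) * (1 + y\<^sup>2)))"
    using p by (simp add: divide_simps) (simp add: algebra_simps power2_eq_square)
  finally have eq: "\<bar>(x - y) / (1 + z\<^sup>2) - (x - y) / (1 + y\<^sup>2)\<bar>
      = \<bar>x - y\<bar> * (\<bar>z - y\<bar> * \<bar>(y + z) / ((1 + z\<^sup>2) * (1 + y\<^sup>2))\<bar>)"
    by (simp add: abs_mult abs_minus_commute)
  have "\<bar>y + z\<bar> \<le> (1 + z\<^sup>2) * (1 + y\<^sup>2)"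
  proof -
    have "2 * \<bar>y\<bar> \<le> 1 + y\<^sup>2" "2 * \<bar>z\<bar> \<le> 1 + z\<^sup>2"
      using zero_le_power2[of "\<bar>y\<bar> - 1"] zero_le_power2[of "\<bar>z\<bar> - 1"] unfolding power2_diff by simp_all
    moreover have "(1 + z\<^sup>2) * (1 + y\<^sup>2) = 1 + z\<^sup>2 + y\<^sup>2 + z\<^sup>2 * y\<^sup>2" by (simp add: algebra_simps)
    moreover have "z\<^sup>2 * y\<^sup>2 \<ge> 0" "z\<^sup>2 \<ge> 0" "y\<^sup>2 \<ge> 0" by simp_all
    ultimately show ?thesis using abs_triangle_ineq[of y z] by linarith
  qed
  hence "\<bar>(y + z) / ((1 + z\<^sup>2) * (1 + y\<^sup>2))\<bar> \<le> 1" using pos by (simp add: abs_divide)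
  hence "\<bar>x - y\<bar> * (\<bar>z - y\<bar> * \<bar>(y + z) / ((1 + z\<^sup>2) * (1 + y\<^sup>2))\<bar>) \<le> \<bar>x - y\<bar> * (\<bar>x - y\<bar> * 1)"
    using z(1) by (intro mult_left_mono mult_mono) auto
  thus ?thesis unfolding z(2) eq by (simp add: power2_eq_square abs_mult_self_eq)
qed

lemma abs_arctan_le_pi: "\<bar>arctan x\<bar> \<le> pi"
  using arctan_bounded[of x] pi_gt_zero by linarith

lemma (in real_distribution) integrable_arctan:
  "integrable M (\<lambda>t. arctan ((b - t) / h))"
  by (rule integrable_bounded_real[where B = pi]) (use abs_arctan_le_pi in auto)

text \<open>Stieltjes inversion in integrated form: the derivative of
  \<open>arctan ((b - t) / h)\<close> in \<open>b\<close> is the Poisson kernel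
  \<open>h / ((b - t)^2 + h^2)\<close>, whose integral is \<open>- Im G\<close> at
  \<open>b + \<i> h\<close>.\<close>

lemma (in real_distribution) has_field_derivative_arctan_average:
  assumes h: "h > 0"
  shows "((\<lambda>b. LINT t|M. arctan ((b - t) / h)) has_real_derivative
           - Im (cauchy_transform M (Complex b h))) (at b)"
proof -
  let ?A = "\<lambda>b. LINT t|M. arctan ((b - t) / h)"
  let ?k = "\<lambda>t. (1 / h) / (1 + ((b - t) / h)\<^sup>2)"
  have k_eq: "?k t = h * (1 / (norm (Complex b h - of_real t))\<^sup>2)" for t
    unfolding cmod_power2 using h
    by (simp add: divide_simps add_pos_nonneg power2_eq_square)
  have k_int: "integrable M ?k"
    unfolding k_eq using integrable_poisson[of "Complex b h"] h by (intro integrable_mult_right) simp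
  have D: "- Im (cauchy_transform M (Complex b h)) = (LINT t|M. ?k t)"
    unfolding k_eq integral_mult_right_zero using h by (simp add: Im_cauchy_transform)
  have est: "\<bar>(?A c - ?A b) / (c - b) - (LINT t|M. ?k t)\<bar> \<le> \<bar>c - b\<bar> / h\<^sup>2" if c: "c \<noteq> b" for c
  proof -
    let ?r = "\<lambda>t. (arctan ((c - t) / h) - arctan ((b - t) / h)) / (c - b) - ?k t"
    have r: "\<bar>?r t\<bar> \<le> \<bar>c - b\<bar> / h\<^sup>2" for t
    proof -
      have d: "(c - t) / h - (b - t) / h = (c - b) / h" by (simp add: diff_divide_distrib)
      have kt: "?k t = ((c - b) / h) / (1 + ((b - t) / h)\<^sup>2) / (c - b)" using c by simp
      have "?r t = (arctan ((c - t) / h) - arctan ((b - t) / h) - ((c - b) / h) / (1 + ((b - t) / h)\<^sup>2)) / (c - b)"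
        unfolding kt by (rule diff_divide_distrib [symmetric])
      hence "\<bar>?r t\<bar> = \<bar>arctan ((c - t) / h) - arctan ((b - t) / h) - ((c - b) / h) / (1 + ((b - t) / h)\<^sup>2)\<bar> / \<bar>c - b\<bar>"
        by (simp only: abs_divide)
      also have "\<dots> \<le> ((c - b) / h)\<^sup>2 / \<bar>c - b\<bar>"
        using arctan_first_order[of "(c - t) / h" "(b - t) / h"] unfolding d by (intro divide_right_mono) auto
      also have "\<dots> = \<bar>c - b\<bar> / h\<^sup>2"
        using c by (simp add: power_divide divide_simps power2_eq_square abs_mult_self_eq)
      finally show ?thesis .
    qed
    have int: "integrable M (\<lambda>t. (arctan ((c - t) / h) - arctan ((b - t) / h)) / (c - b))"
      by (rule integrable_divide_zero, rule Bochner_Integration.integrable_diff[OF integrable_arctan integrable_arctan])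
    have "(LINT t|M. ?r t) = (LINT t|M. (arctan ((c - t) / h) - arctan ((b - t) / h)) / (c - b)) - (LINT t|M. ?k t)"
      by (rule Bochner_Integration.integral_diff[OF int k_int])
    hence eq: "(?A c - ?A b) / (c - b) - (LINT t|M. ?k t) = (LINT t|M. ?r t)"
      by (simp only: integral_divide_zero Bochner_Integration.integral_diff[OF integrable_arctan integrable_arctan])
    have "(LINT t|M. \<bar>?r t\<bar>) \<le> (LINT t|M. \<bar>c - b\<bar> / h\<^sup>2)"
    proof (rule integral_mono)
      show "integrable M (\<lambda>t. \<bar>?r t\<bar>)"
        by (rule integrable_abs, rule Bochner_Integration.integrable_diff[OF int k_int])
      show "\<bar>?r t\<bar> \<le> \<bar>c - b\<bar> / h\<^sup>2" for t by (rule r)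
    qed simp
    hence "\<bar>LINT t|M. ?r t\<bar> \<le> \<bar>c - b\<bar> / h\<^sup>2"
      by (intro order_trans[OF integral_abs_bound]) simp
    thus "\<bar>(?A c - ?A b) / (c - b) - (LINT t|M. ?k t)\<bar> \<le> \<bar>c - b\<bar> / h\<^sup>2" unfolding eq .
  qed
  have "((\<lambda>c. (?A c - ?A b) / (c - b)) \<longlongrightarrow> (LINT t|M. ?k t)) (at b)"
  proof (rule LIM_zero_cancel, rule Lim_null_comparison)
    show "\<forall>\<^sub>F c in at b. norm ((?A c - ?A b) / (c - b) - (LINT t|M. ?k t)) \<le> \<bar>c - b\<bar> / h\<^sup>2"
      unfolding eventually_at real_norm_def by (intro exI[of _ 1] conjI ballI impI est) auto
    have "((\<lambda>c. \<bar>c - b\<bar> / h\<^sup>2) \<longlongrightarrow> \<bar>b - b\<bar> / h\<^sup>2) (at b)"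
      using h by (intro tendsto_intros) auto
    thus "((\<lambda>c. \<bar>c - b\<bar> / h\<^sup>2) \<longlongrightarrow> 0) (at b)" by simp
  qed
  thus ?thesis unfolding D by (simp add: has_field_derivative_iff)
qed

lemma arctan_scaled_tendsto: "(\<lambda>n. arctan (x * real (Suc n))) \<longlonglongrightarrow> pi / 2 * sgn x"
proof (cases x "0::real" rule: linorder_cases)
  case less
  have "filterlim (\<lambda>n. x * real (Suc n)) at_bot sequentially"
    by (intro filterlim_tendsto_neg_mult_at_bot[OF tendsto_const less]
        filterlim_compose[OF filterlim_real_sequentially] filterlim_Suc)
  from filterlim_compose[OF tendsto_arctan_at_bot this] show ?thesis using less by simp
next
  case greater
  have "filterlim (\<lambda>n. x * real (Suc n)) at_top sequentially"
    by (intro filterlim_tendsto_pos_mult_at_top[OF tendsto_const greater]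
        filterlim_compose[OF filterlim_real_sequentially] filterlim_Suc)
  from filterlim_compose[OF tendsto_arctan_at_top this] show ?thesis using greater by simp
qed simp

lemma arctan_shift_tendsto: "(\<lambda>n. arctan ((- real n - t) / h)) \<longlonglongrightarrow> - (pi / 2)" if "h > 0"
proof -
  have "filterlim (\<lambda>n. (- real n - t) / h) at_bot sequentially"
    using that by real_asymp
  from filterlim_compose[OF tendsto_arctan_at_bot this] show ?thesis .
qed

text \<open>Equal transforms give arctan averages with equal derivatives; their common limit at
  \<open>b = - \<infinity>\<close> removes the constant. Letting \<open>h\<close> tend to 0 turns
  arctan averages into averages of \<open>sgn\<close>, and these determine the distribution
  function.\<close>

theorem cauchy_transform_unique:
  assumes "real_distribution M" "real_distribution N"
    and eq: "\<And>z. Im z > 0 \<Longrightarrow> cauchy_transform M z = cauchy_transform N z"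
  shows "M = N"
proof -
  interpret M: real_distribution M by fact
  interpret N: real_distribution N by fact
  have arctan_eq: "(LINT t|M. arctan ((b - t) / h)) = (LINT t|N. arctan ((b - t) / h))" if h: "h > 0" for b h
  proof -
    let ?d = "\<lambda>b. (LINT t|M. arctan ((b - t) / h)) - (LINT t|N. arctan ((b - t) / h))"
    have lim: "(\<lambda>n. LINT t|L. arctan ((- real n - t) / h)) \<longlonglongrightarrow> - (pi / 2)" if "real_distribution L" for L
    proof -
      interpret L: real_distribution L by fact
      have "(\<lambda>n. LINT t|L. arctan ((- real n - t) / h)) \<longlonglongrightarrow> (LINT t|L. - (pi / 2))"
        by (rule integral_dominated_convergence[where w = "\<lambda>_. pi"])
           (use h abs_arctan_le_pi arctan_shift_tendsto in auto)
      thus ?thesis by simp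
    qed
    have "(?d has_real_derivative 0) (at b)" for b
      using DERIV_diff[OF M.has_field_derivative_arctan_average[OF h, of b]
          N.has_field_derivative_arctan_average[OF h, of b]] eq[of "Complex b h"] h by simp
    hence const: "?d b = ?d c" for b c by (intro DERIV_isconst_all) auto
    have "(\<lambda>n. ?d (- real n)) \<longlonglongrightarrow> - (pi / 2) - - (pi / 2)"
      by (intro tendsto_diff lim assms)
    moreover have "(\<lambda>n. ?d (- real n)) = (\<lambda>n. ?d b)" using const by blast
    ultimately have "?d b = 0" by (simp add: LIMSEQ_const_iff)
    thus ?thesis by simp
  qed
  have sgn_eq: "(LINT t|M. sgn (b - t)) = (LINT t|N. sgn (b - t))" for b
  proof -
    have lim: "(\<lambda>n. LINT t|L. arctan ((b - t) / (1 / real (Suc n)))) \<longlonglongrightarrow> (LINT t|L. pi / 2 * sgn (b - t))"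
      if "real_distribution L" for L
    proof -
      interpret L: real_distribution L by fact
      show ?thesis
        by (rule integral_dominated_convergence[where w = "\<lambda>_. pi"])
           (use abs_arctan_le_pi arctan_scaled_tendsto in \<open>auto simp del: of_nat_Suc\<close>)
    qed
    have "(LINT t|M. pi / 2 * sgn (b - t)) = (LINT t|N. pi / 2 * sgn (b - t))"
    proof (rule LIMSEQ_unique[OF lim[OF assms(1)]])
      have "(LINT t|M. arctan ((b - t) / (1 / real (Suc n)))) = (LINT t|N. arctan ((b - t) / (1 / real (Suc n))))" for n
        by (rule arctan_eq) simp
      thus "(\<lambda>n. LINT t|M. arctan ((b - t) / (1 / real (Suc n)))) \<longlonglongrightarrow> (LINT t|N. pi / 2 * sgn (b - t))"
        using lim[OF assms(2)] by (simp only:)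
    qed
    thus ?thesis by simp
  qed
  have cdf_eq: "cdf M b = cdf N b" for b
  proof -
    \<comment> \<open>\<open>sgn (b - t)\<close> gives an atom at \<open>b\<close> the weight 0.
      Approaching \<open>b\<close> from the right counts the atom fully, which matches the closed
      half-line of \<open>cdf\<close>.\<close>
    have lim: "(\<lambda>n. LINT t|L. sgn (b + 1 / real (Suc n) - t)) \<longlonglongrightarrow> 2 * cdf L b - 1"
      if "real_distribution L" for L
    proof -
      interpret L: real_distribution L by fact
      have ind: "integrable L (indicat_real {..b})" by (rule L.integrable_bounded_real[where B = 1]) auto
      have "(\<lambda>n. LINT t|L. sgn (b + 1 / real (Suc n) - t)) \<longlonglongrightarrow> (LINT t|L. 2 * indicat_real {..b} t - 1)"
      proof (rule integral_dominated_convergence[where w = "\<lambda>_. 1"])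
        show "AE t in L. (\<lambda>n. sgn (b + 1 / real (Suc n) - t)) \<longlonglongrightarrow> 2 * indicat_real {..b} t - 1"
        proof (rule AE_I2)
          fix t
          have l: "(\<lambda>n. 1 / real (Suc n)) \<longlonglongrightarrow> 0" by (rule LIMSEQ_Suc[OF lim_const_over_n])
          show "(\<lambda>n. sgn (b + 1 / real (Suc n) - t)) \<longlonglongrightarrow> 2 * indicat_real {..b} t - 1"
          proof (cases "t \<le> b")
            case True
            hence "sgn (b + 1 / real (Suc n) - t) = 1" for n
            proof -
              have "0 < 1 / real (Suc n)" by simp
              hence "0 < b + 1 / real (Suc n) - t" using True by linarith
              thus ?thesis by (rule sgn_pos)
            qed
            thus ?thesis using True by simp
          next
            case False
            hence "\<forall>\<^sub>F n in sequentially. 1 / real (Suc n) < t - b" by (intro order_tendstoD[OF l]) auto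
            hence "\<forall>\<^sub>F n in sequentially. sgn (b + 1 / real (Suc n) - t) = 2 * indicat_real {..b} t - 1"
              by eventually_elim (use False in \<open>auto simp: sgn_if simp del: of_nat_Suc\<close>)
            thus ?thesis by (rule tendsto_eventually)
          qed
        qed
      qed (auto simp: sgn_if)
      also have "(LINT t|L. 2 * indicat_real {..b} t - 1) = 2 * cdf L b - 1"
        using ind by (simp add: cdf_def)
      finally show ?thesis .
    qed
    have "2 * cdf M b - 1 = 2 * cdf N b - 1"
      by (rule LIMSEQ_unique[OF lim[OF assms(1)]]) (use lim[OF assms(2)] in \<open>simp only: sgn_eq\<close>)
    thus ?thesis by simp
  qed
  thus ?thesis using assms by (intro cdf_unique) auto
qed

lemma cauchy_transform_unique_open:
  assumes "real_distribution M" "real_distribution N"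
    and S: "open S" "S \<noteq> {}" "S \<subseteq> upper_half_plane"
    and eq: "\<And>z. z \<in> S \<Longrightarrow> cauchy_transform M z = cauchy_transform N z"
  shows "M = N"
proof (rule cauchy_transform_unique[OF assms(1,2)])
  fix z :: complex assume "Im z > 0"
  thus "cauchy_transform M z = cauchy_transform N z"
    using analytic_continuation_open[OF S(1) open_upper_half_plane S(2) connected_upper_half_plane S(3)
        real_distribution.holomorphic_cauchy_transform[OF assms(1)]
        real_distribution.holomorphic_cauchy_transform[OF assms(2)] eq] by simp
qed

lemma F_transform_unique_open:
  assumes "real_distribution M" "real_distribution N"
    and S: "open S" "S \<noteq> {}" "S \<subseteq> upper_half_plane"
    and eq: "\<And>z. z \<in> S \<Longrightarrow> F_transform M z = F_transform N z"
  shows "M = N"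
proof (rule cauchy_transform_unique_open[OF assms(1,2) S])
  fix z assume "z \<in> S"
  from eq[OF this] show "cauchy_transform M z = cauchy_transform N z"
    by (simp add: F_transform_def)
qed

section \<open>Weak convergence and pointwise convergence of the transforms\<close>

lemma weak_conv_imp_cauchy_transform:
  assumes "\<And>n. real_distribution (M n)" "real_distribution N" "weak_conv_m M N" and z: "Im z > 0"
  shows "(\<lambda>n. cauchy_transform (M n) z) \<longlonglongrightarrow> cauchy_transform N z"
  unfolding cauchy_transform_def
proof (rule weak_conv_imp_integral_bdd_continuous_conv[OF assms(1-3), where B = "1 / Im z"])
  show "isCont (\<lambda>t. 1 / (z - complex_of_real t)) x" for x
    using diff_of_real_nonzero[OF z] by (intro continuous_intros) auto
  show "norm (1 / (z - complex_of_real x)) \<le> 1 / Im z" for x by (rule norm_inverse_diff_of_real_le[OF z])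
qed

lemma weak_conv_imp_F_transform:
  assumes "\<And>n. real_distribution (M n)" "real_distribution N" "weak_conv_m M N" and z: "Im z > 0"
  shows "(\<lambda>n. F_transform (M n) z) \<longlonglongrightarrow> F_transform N z"
  unfolding F_transform_def
  using weak_conv_imp_cauchy_transform[OF assms] real_distribution.cauchy_transform_nonzero[OF assms(2) z]
  by (intro tendsto_intros)

text \<open>Each single measure has small tails, so the finitely many exceptional indices are
  absorbed into a maximum of radii.\<close>

lemma tightI:
  assumes "\<And>n. real_distribution (M n)"
    and tail: "\<And>\<epsilon>. \<epsilon> > 0 \<Longrightarrow> \<exists>Y. \<forall>\<^sub>F n in sequentially. measure (M n) {t. \<bar>t\<bar> > Y} < \<epsilon>"
  shows "tight M"
  unfolding tight_def
proof (intro conjI allI impI assms(1))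
  fix \<epsilon> :: real assume e: "\<epsilon> > 0"
  have single: "\<exists>Y. measure (M n) {t. \<bar>t\<bar> > Y} < \<epsilon>" for n
  proof -
    interpret real_distribution "M n" by (rule assms)
    have "(\<lambda>k. measure (M n) {t. \<bar>t\<bar> > real k}) \<longlonglongrightarrow> measure (M n) (\<Inter>k. {t. \<bar>t\<bar> > real k})"
      by (intro finite_Lim_measure_decseq) (auto simp: decseq_def)
    moreover have "(\<Inter>k. {t::real. \<bar>t\<bar> > real k}) = {}"
    proof (intro equals0I)
      fix t :: real assume "t \<in> (\<Inter>k. {t. \<bar>t\<bar> > real k})"
      moreover obtain k where "\<bar>t\<bar> \<le> real k" using real_arch_simple by blast
      ultimately show False by (auto simp: not_less dest: spec[of _ k])
    qed
    ultimately have "(\<lambda>k. measure (M n) {t. \<bar>t\<bar> > real k}) \<longlonglongrightarrow> 0" by simp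
    hence "\<forall>\<^sub>F k in sequentially. measure (M n) {t. \<bar>t\<bar> > real k} < \<epsilon>" using e by (rule order_tendstoD)
    thus ?thesis by (meson eventually_happens' sequentially_bot)
  qed
  then obtain Y where Y: "measure (M n) {t. \<bar>t\<bar> > Y n} < \<epsilon>" for n by metis
  obtain Z n0 where Z: "\<And>n. n \<ge> n0 \<Longrightarrow> measure (M n) {t. \<bar>t\<bar> > Z} < \<epsilon>"
    using tail[OF e] by (auto simp: eventually_sequentially)
  define R where "R = Max (insert 0 (insert Z (Y ` {..<n0})))"
  have R0: "R \<ge> 0" and RZ: "R \<ge> Z" and RY: "n < n0 \<Longrightarrow> R \<ge> Y n" for n
    unfolding R_def by (rule Max_ge; simp)+
  show "\<exists>a b. a < b \<and> (\<forall>n. measure (M n) {a<..b} > 1 - \<epsilon>)"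
  proof (rule exI[of _ "- R - 1"], rule exI[of _ "R + 1"], intro conjI allI)
    fix n
    interpret real_distribution "M n" by (rule assms)
    have sub: "{t. \<bar>t\<bar> > R} \<subseteq> {t. \<bar>t\<bar> > (if n < n0 then Y n else Z)}"
      using RZ RY[of n] by (auto simp del: not_less)
    have "measure (M n) {t. \<bar>t\<bar> > R} \<le> measure (M n) {t. \<bar>t\<bar> > (if n < n0 then Y n else Z)}"
      by (intro finite_measure_mono sub) auto
    also have "\<dots> < \<epsilon>" using Y[of n] Z[of n] by auto
    finally have "measure (M n) {t. \<bar>t\<bar> > R} < \<epsilon>" .
    moreover have "measure (M n) (- {- R - 1<..R + 1}) \<le> measure (M n) {t. \<bar>t\<bar> > R}"
      by (intro finite_measure_mono) auto
    ultimately have "measure (M n) (- {- R - 1<..R + 1}) < \<epsilon>" by linarith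
    thus "measure (M n) {- R - 1<..R + 1} > 1 - \<epsilon>"
      using prob_compl[of "{- R - 1<..R + 1}"] by (simp add: Compl_eq_Diff_UNIV)
  qed (use R0 in simp)
qed

text \<open>\<open>1 + y Im (G (\<i> y))\<close> is the integral of
  \<open>t^2 / (t^2 + y^2)\<close>, and this integrand is at least 1/2 for
  \<open>|t| > y\<close>.\<close>

lemma (in real_distribution) tail_le_Im_cauchy_transform:
  assumes y: "y > 0"
  shows "prob {t. \<bar>t\<bar> > y} \<le> 2 * (1 + y * Im (cauchy_transform M (\<i> * of_real y)))"
proof -
  let ?G = "cauchy_transform M (\<i> * of_real y)"
  have n: "(norm (\<i> * of_real y - of_real t))\<^sup>2 = y\<^sup>2 + t\<^sup>2" for t by (simp add: cmod_power2)
  have int: "integrable M (\<lambda>t. 1 / (y\<^sup>2 + t\<^sup>2))"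
    using integrable_poisson[of "\<i> * of_real y"] y unfolding n by simp
  have "prob {t. \<bar>t\<bar> > y} = (LINT t|M. indicat_real {t. \<bar>t\<bar> > y} t)" by simp
  also have "\<dots> \<le> (LINT t|M. 2 * (1 - y\<^sup>2 * (1 / (y\<^sup>2 + t\<^sup>2))))"
  proof (rule integral_mono)
    show "integrable M (indicat_real {t. \<bar>t\<bar> > y})" by (rule integrable_bounded_real[where B = 1]) auto
    show "integrable M (\<lambda>t. 2 * (1 - y\<^sup>2 * (1 / (y\<^sup>2 + t\<^sup>2))))"
      by (intro integrable_mult_right Bochner_Integration.integrable_diff int) auto
    fix t :: real
    have p: "y\<^sup>2 + t\<^sup>2 > 0" using y by (simp add: add_pos_nonneg)
    show "indicat_real {t. \<bar>t\<bar> > y} t \<le> 2 * (1 - y\<^sup>2 * (1 / (y\<^sup>2 + t\<^sup>2)))"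
    proof (cases "\<bar>t\<bar> > y")
      case True
      hence "y\<^sup>2 \<le> t\<^sup>2" using y by (metis abs_of_pos less_imp_le power2_abs power_mono)
      thus ?thesis using p True by (simp add: field_simps)
    next
      case False thus ?thesis using p by (simp add: field_simps)
    qed
  qed
  also have "\<dots> = 2 * (1 - y\<^sup>2 * (LINT t|M. 1 / (y\<^sup>2 + t\<^sup>2)))"
    by (subst integral_mult_right_zero, subst Bochner_Integration.integral_diff)
       (use int in \<open>auto intro: integrable_mult_right simp del: times_divide_eq_right\<close>)
  also have "\<dots> = 2 * (1 + y * Im ?G)"
  proof -
    have "Im ?G = - y * (LINT t|M. 1 / (y\<^sup>2 + t\<^sup>2))"
      using y Im_cauchy_transform[of "\<i> * of_real y"] unfolding n by simp
    thus ?thesis by (simp add: power2_eq_square)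
  qed
  finally show ?thesis .
qed

lemma (in real_distribution) tail_le_cauchy_transform:
  assumes y: "y > 0"
  shows "prob {t. \<bar>t\<bar> > y} \<le> 2 * norm (\<i> * of_real y * cauchy_transform M (\<i> * of_real y) - 1)"
  using tail_le_Im_cauchy_transform[OF y] abs_Re_le_cmod[of "\<i> * of_real y * cauchy_transform M (\<i> * of_real y) - 1"]
  by simp

lemma (in real_distribution) cauchy_transform_imaginary_axis:
  assumes "\<epsilon> > 0"
  shows "\<exists>b>0. \<forall>y>b. norm (\<i> * of_real y * cauchy_transform M (\<i> * of_real y) - 1) \<le> \<epsilon>"
proof -
  obtain \<beta> where "\<beta> > 0" "\<forall>z\<in>truncated_cone 1 \<beta>. norm (z * cauchy_transform M z - 1) \<le> \<epsilon>"
    using cauchy_transform_cone_asymptotics[OF assms, of 1] by auto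
  thus ?thesis by (intro exI[of _ \<beta>]) (auto simp: truncated_cone_iff)
qed

text \<open>Tails of \<open>M n\<close> are bounded by the transform at one high point of the
  imaginary axis, which gives tightness. Every subsequential limit then has the transform of
  \<open>N\<close> on a half-plane, hence equals \<open>N\<close>.\<close>

theorem cauchy_transform_imp_weak_conv:
  assumes M: "\<And>n. real_distribution (M n)" and N: "real_distribution N"
    and lim: "\<And>z. Im z > c \<Longrightarrow> (\<lambda>n. cauchy_transform (M n) z) \<longlonglongrightarrow> cauchy_transform N z"
  shows "weak_conv_m M N"
proof (rule tight_subseq_weak_converge[OF M N])
  interpret N: real_distribution N by (rule N)
  show "tight M"
  proof (rule tightI[OF M])
    fix \<epsilon> :: real assume e: "\<epsilon> > 0"
    obtain b where b: "b > 0" "\<And>y. y > b \<Longrightarrow> norm (\<i> * of_real y * cauchy_transform N (\<i> * of_real y) - 1) \<le> \<epsilon> / 4"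
      using N.cauchy_transform_imaginary_axis[of "\<epsilon> / 4"] e by auto
    define y where "y = max b c + 1"
    have y: "y > b" "y > c" "y > 0" using b by (auto simp: y_def)
    have "(\<lambda>n. 2 * norm (\<i> * of_real y * cauchy_transform (M n) (\<i> * of_real y) - 1))
      \<longlonglongrightarrow> 2 * norm (\<i> * of_real y * cauchy_transform N (\<i> * of_real y) - 1)"
      by (intro tendsto_intros lim) (use y in auto)
    moreover have "2 * norm (\<i> * of_real y * cauchy_transform N (\<i> * of_real y) - 1) < \<epsilon>"
      using b(2)[OF y(1)] e by simp
    ultimately have "\<forall>\<^sub>F n in sequentially. 2 * norm (\<i> * of_real y * cauchy_transform (M n) (\<i> * of_real y) - 1) < \<epsilon>"
      by (rule order_tendstoD)
    hence "\<forall>\<^sub>F n in sequentially. measure (M n) {t. \<bar>t\<bar> > y} < \<epsilon>"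
      by eventually_elim (use real_distribution.tail_le_cauchy_transform[OF M y(3)] in \<open>meson le_less_trans\<close>)
    thus "\<exists>Y. \<forall>\<^sub>F n in sequentially. measure (M n) {t. \<bar>t\<bar> > Y} < \<epsilon>" by blast
  qed
  fix s :: "nat \<Rightarrow> nat" and \<nu> assume s: "strict_mono s" and \<nu>: "real_distribution \<nu>" "weak_conv_m (M \<circ> s) \<nu>"
  have "cauchy_transform \<nu> z = cauchy_transform N z" if "Im z > max c 0" for z
  proof (rule LIMSEQ_unique)
    show "(\<lambda>n. cauchy_transform ((M \<circ> s) n) z) \<longlonglongrightarrow> cauchy_transform \<nu> z"
      using that by (intro weak_conv_imp_cauchy_transform \<nu>) (auto intro: M)
    show "(\<lambda>n. cauchy_transform ((M \<circ> s) n) z) \<longlonglongrightarrow> cauchy_transform N z"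
      using LIMSEQ_subseq_LIMSEQ[OF lim s, of z] that by (simp add: o_def)
  qed
  hence "\<nu> = N"
    by (intro cauchy_transform_unique_open[where S = "{z. Im z > max c 0}"] \<nu> N open_halfspace_Im_gt)
       (auto intro!: exI[of _ "Complex 0 (max c 0 + 1)"])
  thus "weak_conv_m (M \<circ> s) N" using \<nu> by simp
qed

lemma F_transform_imp_weak_conv:
  assumes M: "\<And>n. real_distribution (M n)" and N: "real_distribution N"
    and lim: "\<And>z. Im z > c \<Longrightarrow> (\<lambda>n. F_transform (M n) z) \<longlonglongrightarrow> F_transform N z"
  shows "weak_conv_m M N"
proof (rule cauchy_transform_imp_weak_conv[OF M N])
  fix z assume z: "Im z > max c 0"
  interpret N: real_distribution N by (rule N)
  have "F_transform N z \<noteq> 0" using N.Im_F_transform_ge[of z] z by auto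
  hence "(\<lambda>n. 1 / F_transform (M n) z) \<longlonglongrightarrow> 1 / F_transform N z"
    using z by (intro tendsto_intros lim) auto
  thus "(\<lambda>n. cauchy_transform (M n) z) \<longlonglongrightarrow> cauchy_transform N z" by (simp add: F_transform_def)
qed

subsection \<open>Existence of measures with a given reciprocal Cauchy transform\<close>

lemma poisson_kernel_lborel:
  assumes y: "y > 0"
  shows "integrable lborel (\<lambda>t. 1 / (norm (of_real t - Complex x y))\<^sup>2)"
    and "(LBINT t. 1 / (norm (of_real t - Complex x y))\<^sup>2) = pi / y"
proof -
  have I: "integrable lborel (\<lambda>t::real. inverse (1 + t\<^sup>2))" "(LBINT t::real. inverse (1 + t\<^sup>2)) = pi"
    using integrable_inverse_1_plus_square LBINT_inverse_1_plus_square
    by (simp_all add: set_integrable_def interval_lebesgue_integral_def set_lebesgue_integral_def)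
  have eq: "1 / (norm (of_real (x + y * t) - Complex x y))\<^sup>2 = (1 / y\<^sup>2) * inverse (1 + t\<^sup>2)" for t
  proof -
    have "(norm (of_real (x + y * t) - Complex x y))\<^sup>2 = y\<^sup>2 * (1 + t\<^sup>2)"
      by (simp add: cmod_power2 power_mult_distrib algebra_simps)
    thus ?thesis by (simp add: divide_inverse)
  qed
  have "integrable lborel (\<lambda>t. 1 / (norm (of_real (x + y * t) - Complex x y))\<^sup>2)"
    unfolding eq by (rule integrable_mult_right[OF I(1)])
  thus "integrable lborel (\<lambda>t. 1 / (norm (of_real t - Complex x y))\<^sup>2)"
    using y by (subst (asm) lborel_integrable_real_affine_iff) auto
  have "(LBINT t. 1 / (norm (of_real t - Complex x y))\<^sup>2)
      = \<bar>y\<bar> *\<^sub>R (LBINT t. 1 / (norm (of_real (x + y * t) - Complex x y))\<^sup>2)"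
    using y by (intro lborel_integral_real_affine) auto
  also have "\<dots> = y * ((1 / y\<^sup>2) * pi)" unfolding eq integral_mult_right_zero I(2) using y by simp
  finally show "(LBINT t. 1 / (norm (of_real t - Complex x y))\<^sup>2) = pi / y"
    using y by (simp add: power2_eq_square)
qed

text \<open>Subtracting \<open>f z\<close> removes the pole at \<open>z\<close>, so that no winding number has to be computed; the
  conjugate pole makes the contribution of the large semicircle vanish.\<close>

lemma half_plane_cauchy_limit:
  assumes e: "e > 0" and hol: "f holomorphic_on {\<xi>. Im \<xi> > - e}"
    and bound: "\<And>\<xi>. Im \<xi> \<ge> 0 \<Longrightarrow> norm (f \<xi>) \<le> B" and z: "Im z > 0"
  shows "(\<lambda>n. integral {- real n..real n} (\<lambda>t. (f (of_real t) - f z) / of_real ((norm (of_real t - z))\<^sup>2))) \<longlonglongrightarrow> 0"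
proof (rule Lim_null_comparison)
  \<comment> \<open>The depth \<open>min e (Im z)\<close> keeps \<open>S\<close> inside the domain
    of \<open>f\<close> and above the conjugate pole, while \<open>S\<close> still contains the real
    segment and the semicircle.\<close>
  define S where "S = {\<xi>. Im \<xi> > - min e (Im z)}"
  define k where "k = (\<lambda>\<xi>. (f \<xi> - f z) / (\<xi> - cnj z) / (\<xi> - z))"
  have B0: "B \<ge> 0" by (rule order_trans[OF norm_ge_zero bound[of 0]]) simp
  have convS: "convex S" and openS: "open S"
    unfolding S_def by (rule convex_halfspace_Im_gt, rule open_halfspace_Im_gt)
  have holS: "(\<lambda>\<xi>. (f \<xi> - f z) / (\<xi> - cnj z)) holomorphic_on S"
    by (intro holomorphic_intros holomorphic_on_subset[OF hol]) (auto simp: S_def complex_eq_iff)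
  have zS: "z \<in> interior S" using z e openS by (simp add: S_def interior_open)
  have kt: "k (of_real t) = (f (of_real t) - f z) / of_real ((norm (of_real t - z))\<^sup>2)" for t
  proof -
    have "complex_of_real ((norm (of_real t - z))\<^sup>2) = (of_real t - z) * cnj (of_real t - z)"
      by (rule complex_norm_square)
    thus ?thesis by (simp add: k_def mult.commute)
  qed
  have main: "norm (integral {- R..R} (\<lambda>t. k (of_real t))) \<le> 8 * B * pi / R" if R: "R > 2 * norm z + 1" for R :: real
  proof -
    have R0: "R > 0" using R norm_ge_zero[of z] by linarith
    let ?a = "part_circlepath 0 R 0 pi" and ?l = "linepath (- of_real R) (of_real R) :: real \<Rightarrow> complex"
    have Im_a: "Im \<xi> \<ge> 0" "norm \<xi> = R" if "\<xi> \<in> path_image ?a" for \<xi>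
    proof -
      show "Im \<xi> \<ge> 0"
        using that R0 by (auto simp: path_image_part_circlepath exp_Euler cos_of_real sin_of_real
            intro!: mult_nonneg_nonneg sin_ge_zero)
      show "norm \<xi> = R" using in_path_image_part_circlepath[OF that] R0 by simp
    qed
    have l_S: "path_image ?l \<subseteq> S - {z}"
    proof -
      have "path_image ?l \<subseteq> {\<xi>. Im \<xi> = 0}"
        by (auto simp: closed_segment_def)
      thus ?thesis using z e by (auto simp: S_def)
    qed
    have a_S: "path_image ?a \<subseteq> S - {z}"
    proof
      fix \<xi> assume "\<xi> \<in> path_image ?a"
      note Im_a[OF this]
      moreover have "norm z < R" using R R0 by linarith
      ultimately show "\<xi> \<in> S - {z}" using z e by (auto simp: S_def)
    qed
    have fin: "pathfinish ?a = pathstart ?l" by (simp add: exp_Euler)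
    have clo: "pathfinish (?a +++ ?l) = pathstart (?a +++ ?l)" by simp
    have "(k has_contour_integral (2 * pi * \<i> * winding_number (?a +++ ?l) z * ((f z - f z) / (z - cnj z)))) (?a +++ ?l)"
      unfolding k_def
      by (rule Cauchy_integral_formula_convex_simple[OF convS holS zS])
         (use fin clo a_S l_S in \<open>auto simp: path_image_join\<close>)
    hence k0: "(k has_contour_integral 0) (?a +++ ?l)" by simp
    have int_a: "k contour_integrable_on ?a" and int_l: "k contour_integrable_on ?l"
      using k0 fin contour_integrable_join[of ?a ?l k] by (auto simp: contour_integrable_on_def)
    have sum0: "contour_integral ?a k + contour_integral ?l k = 0"
      using contour_integral_join[OF int_a int_l] contour_integral_unique[OF k0] by simp
    have l_eq: "contour_integral ?l k = integral {- R..R} (\<lambda>t. k (of_real t))"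
      using contour_integral_linepath_Reals_eq[of "- of_real R" "of_real R" k] R0 by simp
    have "norm (contour_integral ?a k) \<le> (8 * B / R\<^sup>2) * R * \<bar>pi - 0\<bar>"
    proof (rule contour_integral_bound_part_circlepath[OF int_a])
      fix \<xi> assume \<xi>: "\<xi> \<in> path_image ?a"
      have n1: "norm (\<xi> - z) \<ge> R / 2" using norm_triangle_ineq2[of \<xi> z] Im_a(2)[OF \<xi>] R by linarith
      have n2: "norm (\<xi> - cnj z) \<ge> R / 2" using norm_triangle_ineq2[of \<xi> "cnj z"] Im_a(2)[OF \<xi>] R by simp
      have "norm (f \<xi> - f z) \<le> B + B"
        using norm_triangle_ineq4[of "f \<xi>" "f z"] bound[OF Im_a(1)[OF \<xi>]] bound[of z] z by linarith
      hence "norm (k \<xi>) \<le> (2 * B) / (R / 2) / (R / 2)"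
        unfolding k_def norm_divide using n1 n2 R0 B0 by (intro frac_le) auto
      thus "norm (k \<xi>) \<le> 8 * B / R\<^sup>2" by (simp add: power2_eq_square)
    qed (use B0 R0 in auto)
    hence "norm (contour_integral ?a k) \<le> 8 * B * pi / R" using R0 by (simp add: power2_eq_square)
    moreover have "norm (contour_integral ?l k) = norm (contour_integral ?a k)"
      using sum0 by (metis add_eq_0_iff norm_minus_cancel)
    ultimately show ?thesis unfolding l_eq by simp
  qed
  have "\<forall>\<^sub>F n in sequentially. real n > 2 * norm z + 1"
    using filterlim_real_sequentially by (rule filterlim_at_top_dense[THEN iffD1, rule_format])
  thus "\<forall>\<^sub>F n in sequentially. norm (integral {- real n..real n}
      (\<lambda>t. (f (of_real t) - f z) / of_real ((norm (of_real t - z))\<^sup>2))) \<le> 8 * B * pi / real n"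
    by eventually_elim (use main in \<open>simp add: kt\<close>)
  show "(\<lambda>n. 8 * B * pi / real n) \<longlonglongrightarrow> 0" by (rule lim_const_over_n)
qed

text \<open>The difference \<open>f t - f z\<close> is bounded, so the limit of truncated integrals
  is an absolutely convergent integral equal to 0. Its imaginary part, with the mass
  \<open>pi / Im z\<close> of the Poisson kernel, is the Poisson formula.\<close>

lemma half_plane_poisson:
  assumes e: "e > 0" and hol: "f holomorphic_on {\<xi>. Im \<xi> > - e}"
    and bound: "\<And>\<xi>. Im \<xi> \<ge> 0 \<Longrightarrow> norm (f \<xi>) \<le> B" and z: "Im z > 0"
  shows "integrable lborel (\<lambda>t. Im (f (of_real t)) / (norm (of_real t - z))\<^sup>2)"
    and "(LBINT t. Im (f (of_real t)) / (norm (of_real t - z))\<^sup>2) = pi / Im z * Im (f z)"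
proof -
  let ?k = "\<lambda>t. 1 / (norm (of_real t - z))\<^sup>2"
  have k: "integrable lborel ?k" "(LBINT t. ?k t) = pi / Im z"
    using poisson_kernel_lborel[OF z, of "Re z"] by (simp_all add: complex_surj)
  have cont: "continuous_on UNIV (\<lambda>t. f (complex_of_real t))"
    by (rule continuous_on_compose2[OF holomorphic_on_imp_continuous_on[OF hol]])
       (use e in \<open>auto intro!: continuous_intros\<close>)
  hence meas: "(\<lambda>t. f (complex_of_real t)) \<in> borel_measurable borel" by (rule borel_measurable_continuous_onI)
  define g where "g = (\<lambda>t. (f (of_real t) - f z) / of_real ((norm (of_real t - z))\<^sup>2))"
  have g_meas: "g \<in> borel_measurable borel" unfolding g_def using meas by measurable
  have g_int: "integrable lborel g"
  proof (rule Bochner_Integration.integrable_bound[OF integrable_mult_right[OF k(1), of "2 * B"]])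
    show "AE t in lborel. norm (g t) \<le> norm (2 * B * (1 / (norm (of_real t - z))\<^sup>2))"
    proof (rule AE_I2)
      fix t :: real
      have "norm (f (of_real t) - f z) \<le> 2 * B"
        using norm_triangle_ineq4[of "f (of_real t)" "f z"] bound[of "of_real t"] bound[of z] z by simp
      thus "norm (g t) \<le> norm (2 * B * (1 / (norm (of_real t - z))\<^sup>2))"
        by (simp add: g_def norm_divide norm_power divide_right_mono order_trans[OF _ abs_ge_self])
    qed
  qed (use g_meas in simp)
  have lim: "(\<lambda>n. LBINT t. indicator {- real n..real n} t *\<^sub>R g t) \<longlonglongrightarrow> (LBINT t. g t)"
  proof (rule integral_dominated_convergence[where w = "\<lambda>t. norm (g t)"])
    show "AE t in lborel. (\<lambda>n. indicator {- real n..real n} t *\<^sub>R g t) \<longlonglongrightarrow> g t"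
    proof (rule AE_I2)
      fix t :: real
      have "\<forall>\<^sub>F n in sequentially. real n \<ge> \<bar>t\<bar>"
        using filterlim_real_sequentially by (rule filterlim_at_top[THEN iffD1, rule_format])
      hence "\<forall>\<^sub>F n in sequentially. indicator {- real n..real n} t *\<^sub>R g t = g t"
        by eventually_elim (auto simp: indicator_def)
      thus "(\<lambda>n. indicator {- real n..real n} t *\<^sub>R g t) \<longlonglongrightarrow> g t" by (rule tendsto_eventually)
    qed
  qed (use g_int g_meas in \<open>auto simp: indicator_def\<close>)
  have "(LBINT t. indicator {- real n..real n} t *\<^sub>R g t) = integral {- real n..real n} g" for n
    using set_borel_integral_eq_integral(2)[of "{- real n..real n}" g] g_int
    by (simp add: set_lebesgue_integral_def set_integrable_def integrable_mult_indicator)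
  hence "(LBINT t. g t) = 0"
    using lim half_plane_cauchy_limit[OF e hol bound z] LIMSEQ_unique unfolding g_def by (simp add: LIMSEQ_unique)
  hence Im0: "(LBINT t. Im (g t)) = 0" using g_int by (simp add: integral_Im)
  have Im_g: "Im (g t) = Im (f (of_real t)) / (norm (of_real t - z))\<^sup>2 - Im (f z) * ?k t" for t
    unfolding g_def by (simp add: Im_divide_of_real diff_divide_distrib)
  have eq: "(\<lambda>t. Im (f (of_real t)) / (norm (of_real t - z))\<^sup>2) = (\<lambda>t. Im (g t) + Im (f z) * ?k t)"
    unfolding Im_g by simp
  have "integrable lborel (\<lambda>t. Im (g t))" using g_int by (rule integrable_Im)
  note ig = this integrable_mult_right[OF k(1), of "Im (f z)"]
  show "integrable lborel (\<lambda>t. Im (f (of_real t)) / (norm (of_real t - z))\<^sup>2)"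
    unfolding eq by (rule Bochner_Integration.integrable_add[OF ig])
  show "(LBINT t. Im (f (of_real t)) / (norm (of_real t - z))\<^sup>2) = pi / Im z * Im (f z)"
    unfolding eq Bochner_Integration.integral_add[OF ig] Im0 integral_mult_right_zero k(2) by simp
qed

text \<open>The measure is the Stieltjes candidate with density
  \<open>- Im (G (t + \<i> h)) / pi\<close>. Shifting by \<open>h\<close> makes the function bounded
  and analytic across the real axis, so the Poisson formula applies to it.\<close>

lemma cauchy_transform_translate_exists:
  assumes hol: "G holomorphic_on upper_half_plane"
    and bound: "\<And>z. Im z > 0 \<Longrightarrow> norm (G z) \<le> 1 / Im z"
    and nonpos: "\<And>z. Im z > 0 \<Longrightarrow> Im (G z) \<le> 0"
    and lim: "((\<lambda>y. y * Im (G (\<i> * of_real y))) \<longlongrightarrow> - 1) at_top"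
    and h: "h > 0"
  shows "\<exists>M. real_distribution M \<and> (\<forall>z. Im z > 0 \<longrightarrow> Im (cauchy_transform M z) = Im (G (z + \<i> * of_real h)))"
proof -
  define f where "f = (\<lambda>\<xi>. G (\<xi> + \<i> * of_real h))"
  define d where "d = (\<lambda>t::real. - Im (f (of_real t)) / pi)"
  have f_hol: "f holomorphic_on {\<xi>. Im \<xi> > - h}"
  proof -
    have "(G \<circ> (\<lambda>\<xi>. \<xi> + \<i> * of_real h)) holomorphic_on {\<xi>. Im \<xi> > - h}"
      by (rule holomorphic_on_compose_gen[OF _ hol]) (auto intro!: holomorphic_intros)
    thus ?thesis by (simp add: f_def o_def)
  qed
  have f_bound: "norm (f \<xi>) \<le> 1 / h" if "Im \<xi> \<ge> 0" for \<xi>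
  proof -
    have "norm (f \<xi>) \<le> 1 / (Im \<xi> + h)" using bound[of "\<xi> + \<i> * of_real h"] that h by (simp add: f_def)
    also have "\<dots> \<le> 1 / h" using that h by (intro frac_le) auto
    finally show ?thesis .
  qed

  have cont: "continuous_on UNIV (\<lambda>t. f (complex_of_real t))"
    by (rule continuous_on_compose2[OF holomorphic_on_imp_continuous_on[OF f_hol]])
       (use h in \<open>auto intro!: continuous_intros\<close>)
  hence "(\<lambda>t. f (complex_of_real t)) \<in> borel_measurable borel" by (rule borel_measurable_continuous_onI)
  hence d_meas [measurable]: "d \<in> borel_measurable borel" unfolding d_def by measurable
  have d_nonneg: "d t \<ge> 0" for t using nonpos[of "of_real t + \<i> * of_real h"] h
    by (simp add: d_def f_def divide_nonpos_pos)
  have kernel: "integrable lborel (\<lambda>t. d t / (norm (of_real t - z))\<^sup>2)"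
    "(LBINT t. d t / (norm (of_real t - z))\<^sup>2) = - Im (f z) / Im z" if z: "Im z > 0" for z
  proof -
    have eq: "(\<lambda>t. d t / (norm (of_real t - z))\<^sup>2) = (\<lambda>t. (- 1 / pi) * (Im (f (of_real t)) / (norm (of_real t - z))\<^sup>2))"
      by (simp add: d_def)
    have p: "integrable lborel (\<lambda>t. Im (f (of_real t)) / (norm (of_real t - z))\<^sup>2)"
      by (rule half_plane_poisson(1)[OF h f_hol f_bound z])
    have p': "(LBINT t. Im (f (of_real t)) / (norm (of_real t - z))\<^sup>2) = pi / Im z * Im (f z)"
      by (rule half_plane_poisson(2)[OF h f_hol f_bound z])
    show "integrable lborel (\<lambda>t. d t / (norm (of_real t - z))\<^sup>2)"
      unfolding eq by (rule integrable_mult_right[OF p])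
    show "(LBINT t. d t / (norm (of_real t - z))\<^sup>2) = - Im (f z) / Im z"
      unfolding eq integral_mult_right_zero p' using z by simp
  qed
  have mass: "integrable lborel d" "(LBINT t. d t) = 1"
  proof -
    \<comment> \<open>Poisson kernels with poles at \<open>\<i> n\<close>, rescaled to increase to
      1. Monotone convergence then reads off the total mass from the behaviour of \<open>G\<close>
      at infinity.\<close>
    define u where "u = (\<lambda>n t. real n ^ 2 * (d t / (norm (of_real t - \<i> * of_real (real n)))\<^sup>2))"
    have u_eq: "u n t = d t * ((real n)\<^sup>2 / (t\<^sup>2 + (real n)\<^sup>2))" for n t
      by (simp add: u_def cmod_power2)
    have u_int: "integrable lborel (u n)" for n
    proof (cases "n = 0")
      case False
      thus ?thesis unfolding u_def by (intro integrable_mult_right kernel(1)) simp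
    qed (simp add: u_def)
    have u_lint: "(LBINT t. u n t) = - real n * Im (f (\<i> * of_real (real n)))" for n
    proof (cases "n = 0")
      case False
      thus ?thesis unfolding u_def integral_mult_right_zero
        by (subst kernel(2)) (simp_all add: power2_eq_square)
    qed (simp add: u_def)
    have "((\<lambda>y. - (y / (y + h)) * ((y + h) * Im (G (\<i> * of_real (y + h))))) \<longlongrightarrow> - 1 * - 1) at_top"
    proof (intro tendsto_mult tendsto_minus)
      show "((\<lambda>y. y / (y + h)) \<longlongrightarrow> 1) at_top" by real_asymp
      show "((\<lambda>y. (y + h) * Im (G (\<i> * of_real (y + h)))) \<longlongrightarrow> - 1) at_top"
        by (rule filterlim_compose[OF lim]) real_asymp
    qed
    moreover have "\<forall>\<^sub>F y in at_top. - (y / (y + h)) * ((y + h) * Im (G (\<i> * of_real (y + h)))) = - y * Im (f (\<i> * of_real y))"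
    proof (rule eventually_mono[OF eventually_gt_at_top[of 0]])
      fix y :: real assume y: "y > 0"
      have "f (\<i> * of_real y) = G (\<i> * of_real (y + h))" by (simp add: f_def ring_distribs)
      thus "- (y / (y + h)) * ((y + h) * Im (G (\<i> * of_real (y + h)))) = - y * Im (f (\<i> * of_real y))"
        using y h by simp
    qed
    ultimately have "((\<lambda>y. - y * Im (f (\<i> * of_real y))) \<longlongrightarrow> - 1 * - 1) at_top"
      by (rule Lim_transform_eventually)
    hence "((\<lambda>y. - y * Im (f (\<i> * of_real y))) \<longlongrightarrow> 1) at_top" by simp
    from filterlim_compose[OF this filterlim_real_sequentially]
    have ilim: "(\<lambda>n. LBINT t. u n t) \<longlonglongrightarrow> 1" by (simp add: u_lint)
    have mono: "mono (\<lambda>n. u n t)" for t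
    proof (rule monoI)
      fix m n :: nat assume mn: "m \<le> n"
      have "(real m)\<^sup>2 / (t\<^sup>2 + (real m)\<^sup>2) \<le> (real n)\<^sup>2 / (t\<^sup>2 + (real n)\<^sup>2)"
      proof (cases "m = 0")
        case False
        hence p: "t\<^sup>2 + (real m)\<^sup>2 > 0" "t\<^sup>2 + (real n)\<^sup>2 > 0" using mn by (auto intro!: add_nonneg_pos)
        have "t\<^sup>2 * (real m)\<^sup>2 \<le> t\<^sup>2 * (real n)\<^sup>2" using mn by (intro mult_left_mono power_mono) auto
        thus ?thesis using p by (simp add: divide_simps algebra_simps)
      qed auto
      thus "u m t \<le> u n t" unfolding u_eq using d_nonneg by (intro mult_left_mono)
    qed
    have conv: "(\<lambda>n. u n t) \<longlonglongrightarrow> d t" for t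
    proof -
      have "(\<lambda>n. (real n)\<^sup>2 / (t\<^sup>2 + (real n)\<^sup>2)) \<longlonglongrightarrow> 1" by real_asymp
      from tendsto_mult[OF tendsto_const[of "d t"] this] show ?thesis by (simp add: u_eq)
    qed
    have pos: "u n t \<ge> 0" for n t unfolding u_eq using d_nonneg by simp
    show "integrable lborel d" "(LBINT t. d t) = 1"
      using integral_monotone_convergence_nonneg[of lborel u d 1] u_int mono pos conv ilim d_meas by auto
  qed
  define M where "M = density lborel (\<lambda>t. ennreal (d t))"
  have "emeasure M UNIV = (\<integral>\<^sup>+ t. ennreal (d t) \<partial>lborel)" by (simp add: M_def emeasure_density)
  also have "\<dots> = 1" using nn_integral_eq_integral[OF mass(1)] d_nonneg mass(2) by simp
  finally have "prob_space M" by (intro prob_spaceI) (simp add: M_def)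
  hence M: "real_distribution M"
    by (simp add: real_distribution_def real_distribution_axioms_def M_def)
  interpret real_distribution M by (rule M)
  show ?thesis
  proof (intro exI[of _ M] conjI M allI impI)
    fix z assume z: "Im z > 0"
    have "(LINT t|M. 1 / (norm (z - of_real t))\<^sup>2) = (LBINT t. d t *\<^sub>R (1 / (norm (z - of_real t))\<^sup>2))"
      unfolding M_def by (rule integral_density) (use d_nonneg in auto)
    also have "\<dots> = (LBINT t. d t / (norm (of_real t - z))\<^sup>2)"
      by (simp add: norm_minus_commute)
    finally show "Im (cauchy_transform M z) = Im (G (z + \<i> * of_real h))"
      using z by (simp add: Im_cauchy_transform kernel(2) f_def)
  qed
qed

text \<open>The measures belonging to the translates by \<open>h n\<close> are tight, and a weak
  limit has the right imaginary part. Two transforms with equal imaginary parts differ by a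
  constant, which decay along the imaginary axis forces to be 0.\<close>

theorem cauchy_transform_exists:
  assumes hol: "G holomorphic_on upper_half_plane"
    and bound: "\<And>z. Im z > 0 \<Longrightarrow> norm (G z) \<le> 1 / Im z"
    and nonpos: "\<And>z. Im z > 0 \<Longrightarrow> Im (G z) \<le> 0"
    and lim: "((\<lambda>y. \<i> * of_real y * G (\<i> * of_real y)) \<longlongrightarrow> 1) at_top"
  shows "\<exists>M. real_distribution M \<and> (\<forall>z. Im z > 0 \<longrightarrow> cauchy_transform M z = G z)"
proof -
  have lim': "((\<lambda>y. y * Im (G (\<i> * of_real y))) \<longlongrightarrow> - 1) at_top"
    using tendsto_minus[OF tendsto_Re[OF lim]] by simp
  define h where "h n = 1 / real (Suc n)" for n
  have h: "h n > 0" "h n \<le> 1" for n by (auto simp: h_def)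
  have h_lim: "h \<longlonglongrightarrow> 0" unfolding h_def by (rule LIMSEQ_Suc[OF lim_const_over_n])
  obtain M where M: "\<And>n. real_distribution (M n)"
    and ImM: "\<And>n z. Im z > 0 \<Longrightarrow> Im (cauchy_transform (M n) z) = Im (G (z + \<i> * of_real (h n)))"
    using cauchy_transform_translate_exists[OF hol bound nonpos lim' h(1)] by metis
  have "tight M"
  proof (rule tightI[OF M])
    fix \<epsilon> :: real assume e: "\<epsilon> > 0"
    \<comment> \<open>The tail bound comes out as \<open>4 \<delta>\<close>, since the mass defect
      and the shift by \<open>h n\<close> each contribute at most \<open>\<delta>\<close> before the
      factor 2.\<close>
    define \<delta> where "\<delta> = min (1/2) (\<epsilon> / 5)"
    have \<delta>: "0 < \<delta>" "\<delta> \<le> 1/2" "\<delta> \<le> \<epsilon> / 5" using e by (auto simp: \<delta>_def)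
    have "\<forall>\<^sub>F y in at_top. y * Im (G (\<i> * of_real y)) < - 1 + \<delta>"
      using lim' \<delta> by (intro order_tendstoD) auto
    then obtain b where b: "\<And>y. y \<ge> b \<Longrightarrow> y * Im (G (\<i> * of_real y)) < - 1 + \<delta>"
      by (auto simp: eventually_at_top_linorder)
    \<comment> \<open>With \<open>y \<ge> 1 / \<delta>\<close>, a shift of height at most 1 changes
      \<open>y\<close> by a factor no smaller than \<open>1 - \<delta>\<close>, for all
      \<open>n\<close> at once.\<close>
    define y where "y = max 1 (max b (1 / \<delta>))"
    have y: "y > 0" "y \<ge> b" "y \<ge> 1 / \<delta>" by (auto simp: y_def)
    have y\<delta>: "y * \<delta> \<ge> 1" using y(3) \<delta>(1) by (simp add: divide_le_eq)
    have "measure (M n) {t. \<bar>t\<bar> > y} < \<epsilon>" for n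
    proof -
      have "(y + h n) * Im (G (\<i> * of_real (y + h n))) < - 1 + \<delta>" using b[of "y + h n"] y h[of n] by simp
      hence "Im (G (\<i> * of_real (y + h n))) \<le> (- 1 + \<delta>) / (y + h n)"
        using y h[of n] by (simp add: pos_le_divide_eq mult.commute)
      hence "y * Im (G (\<i> * of_real (y + h n))) \<le> y * ((- 1 + \<delta>) / (y + h n))"
        using y by (intro mult_left_mono) auto
      also have "\<dots> = - (y / (y + h n)) * (1 - \<delta>)" by (simp add: divide_inverse algebra_simps)
      also have "\<dots> \<le> - (1 - \<delta>) * (1 - \<delta>)"
      proof -
        have "(1 - \<delta>) * (y + h n) \<le> y"
        proof -
          have "(1 - \<delta>) * h n \<le> 1 * 1" using \<delta> h[of n] by (intro mult_mono) auto
          thus ?thesis using y\<delta> by (simp add: algebra_simps)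
        qed
        hence "1 - \<delta> \<le> y / (y + h n)" using y h[of n] by (simp add: pos_le_divide_eq)
        hence "(1 - \<delta>) * (1 - \<delta>) \<le> y / (y + h n) * (1 - \<delta>)" using \<delta> by (intro mult_right_mono) auto
        thus ?thesis by (simp only: minus_mult_left [symmetric] neg_le_iff_le)
      qed
      also have "\<dots> \<le> - 1 + 2 * \<delta>" by (simp add: algebra_simps)
      finally have *: "y * Im (G (\<i> * of_real (y + h n))) \<le> - 1 + 2 * \<delta>" .
      have "measure (M n) {t. \<bar>t\<bar> > y} \<le> 2 * (1 + y * Im (cauchy_transform (M n) (\<i> * of_real y)))"
        by (rule real_distribution.tail_le_Im_cauchy_transform[OF M y(1)])
      also have "Im (cauchy_transform (M n) (\<i> * of_real y)) = Im (G (\<i> * of_real (y + h n)))"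
        using ImM[of "\<i> * of_real y" n] y by (simp add: ring_distribs)
      also have "2 * (1 + y * Im (G (\<i> * of_real (y + h n)))) \<le> 2 * (1 + (- 1 + 2 * \<delta>))"
        by (intro mult_left_mono add_left_mono *) simp
      also have "\<dots> < \<epsilon>" using \<delta> e by simp
      finally show ?thesis .
    qed
    thus "\<exists>Y. \<forall>\<^sub>F n in sequentially. measure (M n) {t. \<bar>t\<bar> > Y} < \<epsilon>" by (auto intro!: exI[of _ y] always_eventually)
  qed
  from tight_imp_convergent_subsubsequence[OF this strict_mono_id]
  obtain r N where r: "strict_mono r" and N: "real_distribution N" and wc: "weak_conv_m (M \<circ> r) N"
    by (auto simp: o_def)
  interpret N: real_distribution N by (rule N)
  have ImN: "Im (cauchy_transform N z) = Im (G z)" if z: "Im z > 0" for z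
  proof (rule LIMSEQ_unique)
    show "(\<lambda>n. Im (cauchy_transform ((M \<circ> r) n) z)) \<longlonglongrightarrow> Im (cauchy_transform N z)"
      by (intro tendsto_Im weak_conv_imp_cauchy_transform N wc z) (simp add: M)
    have "(\<lambda>n. h (r n)) \<longlonglongrightarrow> 0" using LIMSEQ_subseq_LIMSEQ[OF h_lim r] by (simp add: o_def)
    hence "(\<lambda>n. z + \<i> * of_real (h (r n))) \<longlonglongrightarrow> z + \<i> * of_real 0" by (intro tendsto_intros)
    moreover have "isCont G (z + \<i> * of_real 0)"
      using holomorphic_on_imp_continuous_on[OF hol] z
      by (simp add: continuous_on_eq_continuous_at)
    ultimately have "(\<lambda>n. G (z + \<i> * of_real (h (r n)))) \<longlonglongrightarrow> G (z + \<i> * of_real 0)"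
      by (rule isCont_tendsto_compose[rotated])
    from tendsto_Im[OF this] show "(\<lambda>n. Im (cauchy_transform ((M \<circ> r) n) z)) \<longlonglongrightarrow> Im (G z)"
      by (simp add: ImM z)
  qed
  define c where "c = cauchy_transform N \<i> - G \<i>"
  have const: "cauchy_transform N z - G z = c" if "Im z > 0" for z
    unfolding c_def
    by (rule schwarz_pick_constant[where f = "\<lambda>z. cauchy_transform N z - G z"])
       (use ImN that in \<open>auto intro!: holomorphic_intros hol N.holomorphic_cauchy_transform\<close>)
  have "c = 0"
  proof (rule ccontr)
    assume "c \<noteq> 0"
    have "norm c * y \<le> 2" if y: "y > 0" for y
    proof -
      have "norm c \<le> 1 / y + 1 / y"
        using norm_triangle_ineq4[of "cauchy_transform N (\<i> * of_real y)" "G (\<i> * of_real y)"]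
          bound[of "\<i> * of_real y"] N.norm_cauchy_transform_le[of "\<i> * of_real y"] const[of "\<i> * of_real y"] y by simp
      thus ?thesis using y by (simp add: field_simps)
    qed
    from this[of "3 / norm c"] \<open>c \<noteq> 0\<close> show False by simp
  qed
  thus ?thesis using const N by auto
qed

text \<open>Apply the criterion for Cauchy transforms to \<open>1 / f\<close>. The condition
  \<open>near\<close> expresses total mass one; it excludes for instance \<open>f z = 2 z\<close>,
  which also increases imaginary parts.\<close>

theorem F_transform_exists:
  assumes hol: "f holomorphic_on upper_half_plane"
    and Im_ge: "\<And>z. Im z > 0 \<Longrightarrow> Im (f z) \<ge> Im z"
    and near: "\<And>\<epsilon>. \<epsilon> > 0 \<Longrightarrow> \<exists>b. \<forall>y>b. norm (f (\<i> * of_real y) - \<i> * of_real y) \<le> \<epsilon> * y"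
  shows "\<exists>M. real_distribution M \<and> (\<forall>z. Im z > 0 \<longrightarrow> F_transform M z = f z)"
proof -
  have nz: "f z \<noteq> 0" if "Im z > 0" for z using Im_ge[OF that] that by auto
  have lim: "((\<lambda>y. f (\<i> * of_real y) / (\<i> * of_real y)) \<longlongrightarrow> 1) at_top"
  proof (rule tendstoI)
    fix \<epsilon> :: real assume e: "\<epsilon> > 0"
    obtain b where b: "\<And>y. y > b \<Longrightarrow> norm (f (\<i> * of_real y) - \<i> * of_real y) \<le> \<epsilon> / 2 * y"
      using near[of "\<epsilon> / 2"] e by auto
    show "\<forall>\<^sub>F y in at_top. dist (f (\<i> * of_real y) / (\<i> * of_real y)) 1 < \<epsilon>"
    proof (rule eventually_mono[OF eventually_gt_at_top[of "max 0 b"]])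
      fix y assume y: "y > max 0 b"
      have "f (\<i> * of_real y) / (\<i> * of_real y) - 1 = (f (\<i> * of_real y) - \<i> * of_real y) / (\<i> * of_real y)"
        using y by (simp add: diff_divide_distrib)
      hence "dist (f (\<i> * of_real y) / (\<i> * of_real y)) 1 = norm (f (\<i> * of_real y) - \<i> * of_real y) / y"
        using y by (simp add: dist_norm norm_divide norm_mult)
      also have "\<dots> \<le> \<epsilon> / 2" using b[of y] y by (simp add: divide_le_eq)
      finally show "dist (f (\<i> * of_real y) / (\<i> * of_real y)) 1 < \<epsilon>" using e by simp
    qed
  qed
  have "\<exists>M. real_distribution M \<and> (\<forall>z. Im z > 0 \<longrightarrow> cauchy_transform M z = 1 / f z)"
  proof (rule cauchy_transform_exists)
    show "(\<lambda>z. 1 / f z) holomorphic_on upper_half_plane"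
      using nz by (intro holomorphic_intros hol) auto
    show "norm (1 / f z) \<le> 1 / Im z" if "Im z > 0" for z
      using Im_ge[OF that] abs_Im_le_cmod[of "f z"] that by (simp add: norm_divide frac_le)
    show "Im (1 / f z) \<le> 0" if "Im z > 0" for z
      using Im_ge[OF that] that by (simp add: Im_divide)
    have "((\<lambda>y. 1 / (f (\<i> * of_real y) / (\<i> * of_real y))) \<longlongrightarrow> 1 / 1) at_top"
      by (intro tendsto_intros lim) simp
    thus "((\<lambda>y. \<i> * of_real y * (1 / f (\<i> * of_real y))) \<longlongrightarrow> 1) at_top" by simp
  qed
  thus ?thesis by (auto simp: F_transform_def)
qed

subsection \<open>Monotone convolution powers\<close>

lemma upper_half_plane_nonempty: "upper_half_plane \<noteq> {}"
proof -
  have "\<i> \<in> upper_half_plane" by simp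
  thus ?thesis by blast
qed

lemma real_distribution_return_0: "real_distribution (return borel (0::real))"
  by (simp add: real_distribution_def real_distribution_axioms_def prob_space_return)

lemma F_transform_return_0: "F_transform (return borel 0) z = z"
  by (simp add: F_transform_def cauchy_transform_def integral_return)

text \<open>The point \<open>f (\<i> y)\<close> leaves the axis by at most \<open>y / 4\<close> in
  each coordinate and so stays in the cone of aperture 1. This is where asymptotics in cones, rather
  than on the axis alone, are used.\<close>

lemma (in real_distribution) F_transform_near_identity_compose:
  assumes near: "\<And>\<epsilon>. \<epsilon> > 0 \<Longrightarrow> \<exists>b. \<forall>y>b. norm (f (\<i> * of_real y) - \<i> * of_real y) \<le> \<epsilon> * y"
    and e: "\<epsilon> > 0"
  shows "\<exists>b. \<forall>y>b. norm (F_transform M (f (\<i> * of_real y)) - \<i> * of_real y) \<le> \<epsilon> * y"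
proof -
  define \<delta> where "\<delta> = min (1/4) (\<epsilon> / 2)"
  have \<delta>: "\<delta> > 0" "\<delta> \<le> 1/4" "\<delta> \<le> \<epsilon> / 2" using e by (auto simp: \<delta>_def)
  obtain b where b: "\<And>y. y > b \<Longrightarrow> norm (f (\<i> * of_real y) - \<i> * of_real y) \<le> \<delta> * y"
    using near[OF \<delta>(1)] by auto
  obtain \<beta> where \<beta>: "\<beta> > 0" "\<And>w. w \<in> truncated_cone 1 \<beta> \<Longrightarrow> norm (F_transform M w - w) \<le> (\<epsilon> / 4) * Im w"
    using F_transform_cone_asymptotics[of "\<epsilon> / 4" 1] e by auto
  show ?thesis
  proof (intro exI[of _ "max b (2 * \<beta>)"] allI impI)
    fix y assume y: "y > max b (2 * \<beta>)"
    hence y0: "y > 0" "y > b" "y > 2 * \<beta>" using \<beta> by auto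
    define w where "w = f (\<i> * of_real y)"
    have w: "norm (w - \<i> * of_real y) \<le> \<delta> * y" unfolding w_def by (rule b[OF y0(2)])
    have "\<delta> * y \<le> 1/4 * y" using \<delta> y0 by (intro mult_right_mono) auto
    hence "\<bar>Re w\<bar> \<le> y / 4" "\<bar>Im w - y\<bar> \<le> y / 4"
      using abs_Re_le_cmod[of "w - \<i> * of_real y"] abs_Im_le_cmod[of "w - \<i> * of_real y"] w by auto
    hence r: "Re w \<le> y / 4" "- Re w \<le> y / 4" "Im w \<le> y + y / 4" "y - y / 4 \<le> Im w"
      unfolding abs_le_iff by linarith+
    hence Imw: "Im w \<le> 2 * y" using y0 by linarith
    have "Im w > \<beta>" "\<bar>Re w\<bar> < Im w" using r y0 unfolding abs_less_iff by linarith+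
    hence "w \<in> truncated_cone 1 \<beta>" by (simp add: truncated_cone_iff)
    from \<beta>(2)[OF this] have "norm (F_transform M w - w) \<le> (\<epsilon> / 4) * Im w" .
    also have "\<dots> \<le> (\<epsilon> / 4) * (2 * y)" using Imw e by (intro mult_left_mono) auto
    finally have "norm (F_transform M w - w) \<le> (\<epsilon> / 2) * y" by simp
    moreover have "\<delta> * y \<le> (\<epsilon> / 2) * y" using \<delta> y0 by (intro mult_right_mono) auto
    moreover have "norm (F_transform M w - \<i> * of_real y) \<le> norm (F_transform M w - w) + norm (w - \<i> * of_real y)"
      using norm_triangle_ineq[of "F_transform M w - w" "w - \<i> * of_real y"] by simp
    ultimately have "norm (F_transform M w - \<i> * of_real y) \<le> (\<epsilon> / 2) * y + (\<epsilon> / 2) * y" using w by linarith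
    thus "norm (F_transform M (f (\<i> * of_real y)) - \<i> * of_real y) \<le> \<epsilon> * y" by (simp add: w_def)
  qed
qed

lemma (in real_distribution) F_transform_near_identity:
  assumes "\<epsilon> > 0"
  shows "\<exists>b. \<forall>y>b. norm (F_transform M (\<i> * of_real y) - \<i> * of_real y) \<le> \<epsilon> * y"
  by (rule F_transform_near_identity_compose[of "\<lambda>z. z", OF _ assms]) (auto intro!: exI[of _ 0])

text \<open>The composition of two \<open>F_transform\<close>s meets the criterion for being an
  \<open>F_transform\<close>, and the transform determines the measure; hence the definite
  description denotes.\<close>

lemma monotone_convolution:
  assumes "real_distribution M" "real_distribution N"
  shows "real_distribution (monotone_convolution M N)"
    and "\<And>z. Im z > 0 \<Longrightarrow> F_transform (monotone_convolution M N) z = F_transform M (F_transform N z)"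
proof -
  interpret M: real_distribution M by fact
  interpret N: real_distribution N by fact
  let ?P = "\<lambda>\<rho>. real_distribution \<rho> \<and> (\<forall>z\<in>upper_half_plane. F_transform \<rho> z = F_transform M (F_transform N z))"
  have N_pos: "Im (F_transform N z) > 0" if "Im z > 0" for z using N.Im_F_transform_ge[OF that] that by simp
  have "\<exists>\<rho>. real_distribution \<rho> \<and> (\<forall>z. Im z > 0 \<longrightarrow> F_transform \<rho> z = F_transform M (F_transform N z))"
  proof (rule F_transform_exists)
    have "(F_transform M \<circ> F_transform N) holomorphic_on upper_half_plane"
      by (rule holomorphic_on_compose_gen[OF N.holomorphic_F_transform M.holomorphic_F_transform]) (use N_pos in auto)
    thus "(\<lambda>z. F_transform M (F_transform N z)) holomorphic_on upper_half_plane" by (simp add: o_def)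
    show "Im z \<le> Im (F_transform M (F_transform N z))" if "Im z > 0" for z
      using N.Im_F_transform_ge[OF that] M.Im_F_transform_ge[OF N_pos[OF that]] by simp
    show "\<exists>b. \<forall>y>b. norm (F_transform M (F_transform N (\<i> * of_real y)) - \<i> * of_real y) \<le> \<epsilon> * y" if "\<epsilon> > 0" for \<epsilon>
      by (rule M.F_transform_near_identity_compose[OF N.F_transform_near_identity that])
  qed
  then obtain \<rho> where "real_distribution \<rho>"
    "\<forall>z. Im z > 0 \<longrightarrow> F_transform \<rho> z = F_transform M (F_transform N z)" by blast
  hence \<rho>: "?P \<rho>" by simp
  have "monotone_convolution M N = \<rho>" unfolding monotone_convolution_def
  proof (rule the_equality)
    show "?P \<rho>" by (rule \<rho>)
  next
    fix \<rho>' assume \<rho>': "?P \<rho>'"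
    show "\<rho>' = \<rho>"
      by (rule F_transform_unique_open[OF _ _ open_upper_half_plane upper_half_plane_nonempty])
         (use \<rho> \<rho>' in auto)
  qed
  thus "real_distribution (monotone_convolution M N)"
    and "\<And>z. Im z > 0 \<Longrightarrow> F_transform (monotone_convolution M N) z = F_transform M (F_transform N z)"
    using \<rho> by auto
qed

lemma monotone_convolution_power:
  assumes M: "real_distribution M"
  shows "real_distribution (convolution_power monotone_convolution M n)"
    and "Im z > 0 \<Longrightarrow> F_transform (convolution_power monotone_convolution M n) z = (F_transform M ^^ n) z"
proof -
  have "real_distribution (convolution_power monotone_convolution M n) \<and>
    (\<forall>z. Im z > 0 \<longrightarrow> F_transform (convolution_power monotone_convolution M n) z = (F_transform M ^^ n) z)"
    by (induction n)
       (auto simp: convolution_power_def real_distribution_return_0 F_transform_return_0 monotone_convolution[OF M])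
  thus "real_distribution (convolution_power monotone_convolution M n)"
    and "Im z > 0 \<Longrightarrow> F_transform (convolution_power monotone_convolution M n) z = (F_transform M ^^ n) z"
    by auto
qed

lemma (in real_distribution) real_distribution_dilation: "real_distribution (dilation b M)"
proof -
  have "prob_space (dilation b M)" unfolding dilation_def by (rule prob_space_distr) simp
  thus ?thesis by (simp add: real_distribution_def real_distribution_axioms_def dilation_def)
qed

lemma (in real_distribution) cauchy_transform_dilation:
  "cauchy_transform (dilation b M) z = (LINT t|M. 1 / (z - of_real (b * t)))"
  unfolding cauchy_transform_def dilation_def by (subst integral_distr) auto

lemma (in real_distribution) F_transform_dilation:
  assumes "b > 0"
  shows "F_transform (dilation (1 / b) M) z = F_transform M (of_real b * z) / of_real b"
proof -
  have eq: "1 / (z - of_real (1 / b * t)) = of_real b * (1 / (of_real b * z - of_real t))" for t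
  proof -
    have "of_real b * (z - of_real (1 / b * t)) = of_real b * z - complex_of_real t"
      using assms by (simp add: right_diff_distrib)
    moreover have "1 / x = c * (1 / (c * x))" if "c \<noteq> 0" for c x :: complex using that by simp
    ultimately show ?thesis using assms by (metis of_real_eq_0_iff less_irrefl)
  qed
  have "cauchy_transform (dilation (1 / b) M) z = of_real b * cauchy_transform M (of_real b * z)"
    unfolding cauchy_transform_dilation eq unfolding cauchy_transform_def by (rule integral_mult_right_zero)
  thus ?thesis by (simp add: F_transform_def)
qed

subsection \<open>Voiculescu transforms\<close>

lemma truncated_cone_mono: "\<alpha> \<le> \<alpha>' \<Longrightarrow> \<beta>' \<le> \<beta> \<Longrightarrow> \<beta> \<ge> 0 \<Longrightarrow> truncated_cone \<alpha> \<beta> \<subseteq> truncated_cone \<alpha>' \<beta>'"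
proof
  fix z assume "\<alpha> \<le> \<alpha>'" "\<beta>' \<le> \<beta>" "\<beta> \<ge> 0" and z: "z \<in> truncated_cone \<alpha> \<beta>"
  moreover from this have "\<alpha> * Im z \<le> \<alpha>' * Im z" by (intro mult_right_mono) (auto simp: truncated_cone_iff)
  ultimately show "z \<in> truncated_cone \<alpha>' \<beta>'"
    unfolding truncated_cone_iff by (meson le_less_trans less_le_trans)
qed

text \<open>A move by \<open>c Im w\<close> raises the half-aperture to at most
  \<open>(\<alpha> / 2 + c) / (1 - c)\<close>, which is at most \<open>\<alpha>\<close> exactly when
  \<open>c (1 + \<alpha>) \<le> \<alpha> / 2\<close>; this also forces \<open>c < 1/2\<close>, so
  the height is at most halved.\<close>

lemma cball_subset_truncated_cone:
  assumes w: "w \<in> truncated_cone (\<alpha> / 2) (2 * b)" and \<alpha>: "\<alpha> > 0" and b: "b \<ge> 0"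
    and c: "c > 0" "c * (1 + \<alpha>) \<le> \<alpha> / 2" and u: "norm (u - w) \<le> c * Im w"
  shows "u \<in> truncated_cone \<alpha> b"
proof -
  have y: "Im w > 2 * b" "Im w > 0" and x: "\<bar>Re w\<bar> < \<alpha> / 2 * Im w"
    using w b by (auto simp: truncated_cone_iff)
  have c2: "c < 1/2"
  proof (rule ccontr)
    assume "\<not> c < 1/2"
    hence "1/2 * (1 + \<alpha>) \<le> c * (1 + \<alpha>)" using \<alpha> by (intro mult_right_mono) auto
    also note c(2)
    finally show False by (simp add: field_simps)
  qed
  have I: "Im u \<ge> Im w - c * Im w" and R: "\<bar>Re u\<bar> \<le> \<bar>Re w\<bar> + c * Im w"
    using abs_Im_le_cmod[of "u - w"] abs_Re_le_cmod[of "u - w"] u by auto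
  have "c * Im w < 1/2 * Im w" using c2 y by (intro mult_strict_right_mono) auto
  hence "Im u > b" using I y by linarith
  moreover have "\<bar>Re u\<bar> < \<alpha> * Im u"
  proof -
    have "c * (1 + \<alpha>) * Im w \<le> \<alpha> / 2 * Im w" using c y by (intro mult_right_mono) auto
    hence "\<alpha> / 2 * Im w + c * Im w \<le> \<alpha> * (Im w - c * Im w)" by (simp add: algebra_simps)
    also have "\<dots> \<le> \<alpha> * Im u" using I \<alpha> by (intro mult_left_mono) auto
    finally show ?thesis using R x by linarith
  qed
  ultimately show ?thesis by (simp add: truncated_cone_iff)
qed

text \<open>Solving \<open>F u = w\<close> is a fixed point problem for
  \<open>u \<mapsto> w - (F u - u)\<close>. High in the cone, \<open>F u - u\<close> is small
  against \<open>Im w\<close>, so a ball around \<open>w\<close> is mapped into itself and Brouwer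
  applies.\<close>

lemma (in real_distribution) F_transform_inverse_in_cone:
  assumes \<alpha>: "\<alpha> > 0"
  shows "\<exists>b'\<ge>b. b' > 0 \<and> (\<forall>w\<in>truncated_cone (\<alpha> / 2) b'. \<exists>u\<in>truncated_cone \<alpha> b. F_transform M u = w)"
proof -
  define c where "c = \<alpha> / (2 * (1 + \<alpha>))"
  have c: "c > 0" "c * (1 + \<alpha>) \<le> \<alpha> / 2" "c \<le> 1/2" using \<alpha> by (auto simp: c_def field_simps)
  obtain \<beta> where \<beta>: "\<beta> > 0" "\<And>z. z \<in> truncated_cone \<alpha> \<beta> \<Longrightarrow> norm (F_transform M z - z) \<le> (c / 2) * Im z"
    using F_transform_cone_asymptotics[of "c / 2" \<alpha>] c \<alpha> by auto
  define b0 where "b0 = max \<beta> b"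
  have b0: "b0 > 0" "b0 \<ge> \<beta>" "b0 \<ge> b" using \<beta> by (auto simp: b0_def)
  show ?thesis
  proof (intro exI[of _ "2 * b0"] conjI ballI)
    fix w assume w: "w \<in> truncated_cone (\<alpha> / 2) (2 * b0)"
    have y: "Im w > 0" using w b0 by (auto simp: truncated_cone_iff)
    have sub: "u \<in> truncated_cone \<alpha> b0" if "u \<in> cball w (c * Im w)" for u
      by (rule cball_subset_truncated_cone[OF w \<alpha> _ c(1,2)])
         (use that b0 in \<open>auto simp: dist_norm norm_minus_commute\<close>)
    have up: "Im u > 0" if "u \<in> cball w (c * Im w)" for u
      using sub[OF that] b0 by (auto simp: truncated_cone_iff)
    have "\<exists>u\<in>cball w (c * Im w). w - (F_transform M u - u) = u"
    proof (rule brouwer[of "cball w (c * Im w)" "\<lambda>u. w - (F_transform M u - u)"])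
      show "continuous_on (cball w (c * Im w)) (\<lambda>u. w - (F_transform M u - u))"
        using up by (intro continuous_intros continuous_on_subset[OF holomorphic_on_imp_continuous_on[OF holomorphic_F_transform]]) auto
      show "(\<lambda>u. w - (F_transform M u - u)) \<in> cball w (c * Im w) \<rightarrow> cball w (c * Im w)"
      proof
        fix u assume u: "u \<in> cball w (c * Im w)"
        have "Im u \<le> 2 * Im w"
        proof -
          have "c * Im w \<le> 1/2 * Im w" using c y by (intro mult_right_mono) auto
          moreover have "Im u - Im w \<le> c * Im w"
            using abs_Im_le_cmod[of "u - w"] u by (simp add: dist_norm norm_minus_commute)
          ultimately show ?thesis using y by linarith
        qed
        moreover have "u \<in> truncated_cone \<alpha> \<beta>" using sub[OF u] b0 by (auto simp: truncated_cone_iff)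
        ultimately have "norm (F_transform M u - u) \<le> (c / 2) * (2 * Im w)"
          using \<beta>(2)[of u] c by (meson mult_left_mono order_trans half_gt_zero less_imp_le)
        thus "w - (F_transform M u - u) \<in> cball w (c * Im w)" by (simp add: dist_norm)
      qed
    qed (use mult_pos_pos[OF c(1) y] in auto)
    then obtain u where u: "u \<in> cball w (c * Im w)" "w - (F_transform M u - u) = u" by auto
    show "\<exists>u\<in>truncated_cone \<alpha> b. F_transform M u = w"
      using u sub[OF u(1)] b0 by (intro bexI[of _ u]) (auto simp: truncated_cone_iff algebra_simps)
  qed (use b0 in auto)
qed

lemma (in real_distribution) inj_on_F_transform_cone:
  assumes \<alpha>: "\<alpha> > 0"
  shows "\<exists>b>0. inj_on (F_transform M) (truncated_cone \<alpha> b)"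
proof -
  obtain \<beta> where \<beta>: "\<beta> > 0" "\<forall>u\<in>truncated_cone \<alpha> \<beta>. \<forall>v\<in>truncated_cone \<alpha> \<beta>.
     norm ((F_transform M u - u) - (F_transform M v - v)) \<le> (1/2) * norm (u - v)"
    using F_transform_cone_Lipschitz[of "1/2" \<alpha>] \<alpha> by auto
  have "inj_on (F_transform M) (truncated_cone \<alpha> \<beta>)"
  proof (rule inj_onI)
    fix u v assume "u \<in> truncated_cone \<alpha> \<beta>" "v \<in> truncated_cone \<alpha> \<beta>" "F_transform M u = F_transform M v"
    with \<beta>(2) have "norm (v - u) \<le> (1/2) * norm (u - v)" by force
    thus "u = v" by (simp add: norm_minus_commute)
  qed
  with \<beta> show ?thesis by auto
qed

lemma (in real_distribution) F_transform_maps_cone: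
  assumes \<alpha>: "\<alpha> > 0"
  shows "\<exists>b'\<ge>b. b' > 0 \<and> (\<forall>u\<in>truncated_cone (\<alpha> / 2) b'. F_transform M u \<in> truncated_cone \<alpha> b)"
proof -
  obtain \<beta> where \<beta>: "\<beta> > 0" "\<And>z. z \<in> truncated_cone (\<alpha> / 2) \<beta> \<Longrightarrow> norm (F_transform M z - z) \<le> (\<alpha> / 2) * Im z"
    using F_transform_cone_asymptotics[of "\<alpha> / 2" "\<alpha> / 2"] \<alpha> by auto
  show ?thesis
  proof (intro exI[of _ "max \<beta> b"] conjI ballI)
    fix u assume u: "u \<in> truncated_cone (\<alpha> / 2) (max \<beta> b)"
    hence y: "Im u > 0" "Im u > b" "\<bar>Re u\<bar> < \<alpha> / 2 * Im u" and u': "u \<in> truncated_cone (\<alpha> / 2) \<beta>"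
      using \<beta>(1) by (auto simp: truncated_cone_iff)
    note I = Im_F_transform_ge[OF y(1)]
    have "\<bar>Re (F_transform M u)\<bar> \<le> \<bar>Re u\<bar> + (\<alpha> / 2) * Im u"
      using abs_Re_le_cmod[of "F_transform M u - u"] \<beta>(2)[OF u'] by simp
    also have "\<dots> < \<alpha> * Im u" using y by simp
    also have "\<dots> \<le> \<alpha> * Im (F_transform M u)" using I \<alpha> by simp
    finally show "F_transform M u \<in> truncated_cone \<alpha> b" using I y by (simp add: truncated_cone_iff)
  qed (use \<beta> in auto)
qed

lemma voiculescu_transform_onE:
  assumes "voiculescu_transform_on M D \<phi>"
  obtains \<alpha> \<beta> where "\<alpha> > 0" "\<beta> > 0" "inj_on (F_transform M) (truncated_cone \<alpha> \<beta>)"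
    "\<And>u. u \<in> truncated_cone \<alpha> \<beta> \<Longrightarrow> F_transform M u \<in> D \<Longrightarrow> \<phi> (F_transform M u) = u - F_transform M u"
    "\<And>w. w \<in> D \<Longrightarrow> F_transform M (\<phi> w + w) = w"
proof -
  obtain \<alpha> \<beta> where ab: "\<alpha> > 0" "\<beta> > 0" and inj: "inj_on (F_transform M) (truncated_cone \<alpha> \<beta>)"
    and D: "D \<subseteq> F_transform M ` truncated_cone \<alpha> \<beta>"
    and \<phi>: "\<forall>z\<in>D. \<phi> z = the_inv_into (truncated_cone \<alpha> \<beta>) (F_transform M) z - z"
    using assms unfolding voiculescu_transform_on_def by blast
  show ?thesis
  proof (rule that[OF ab inj])
    fix u assume "u \<in> truncated_cone \<alpha> \<beta>" "F_transform M u \<in> D"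
    thus "\<phi> (F_transform M u) = u - F_transform M u" using \<phi> by (simp add: the_inv_into_f_f[OF inj])
  next
    fix w assume "w \<in> D"
    thus "F_transform M (\<phi> w + w) = w" using \<phi> D by (simp add: f_the_inv_into_f[OF inj] subset_iff)
  qed
qed

lemma voiculescu_transform_onI:
  assumes "\<alpha> > 0" "\<beta> > 0" and inj: "inj_on (F_transform M) (truncated_cone \<alpha> \<beta>)"
    and "\<And>w. w \<in> D \<Longrightarrow> \<exists>u\<in>truncated_cone \<alpha> \<beta>. F_transform M u = w \<and> \<phi> w = u - w"
  shows "voiculescu_transform_on M D \<phi>"
  unfolding voiculescu_transform_on_def
  using assms(1,2) inj assms(4) by (fastforce simp: the_inv_into_f_f[OF inj])

text \<open>The two transforms may come from inverses on different cones. A point high in a narrow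
  cone has a preimage lying in both, and injectivity on each identifies both inverses with
  it.\<close>

lemma voiculescu_transform_on_agree:
  assumes M: "real_distribution M" and v: "voiculescu_transform_on M (truncated_cone \<alpha> \<beta>) \<phi>"
    "voiculescu_transform_on M (truncated_cone \<alpha>' \<beta>') \<phi>'" and pos: "\<alpha> > 0" "\<alpha>' > 0"
  shows "\<exists>a>0. \<exists>b>0. \<forall>w\<in>truncated_cone a b. \<phi> w = \<phi>' w"
proof -
  interpret real_distribution M by (rule M)
  obtain a1 b1 where 1: "a1 > 0" "b1 > 0"
    "\<And>u. u \<in> truncated_cone a1 b1 \<Longrightarrow> F_transform M u \<in> truncated_cone \<alpha> \<beta> \<Longrightarrow> \<phi> (F_transform M u) = u - F_transform M u"
    using voiculescu_transform_onE[OF v(1)] by metis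
  obtain a2 b2 where 2: "a2 > 0" "b2 > 0"
    "\<And>u. u \<in> truncated_cone a2 b2 \<Longrightarrow> F_transform M u \<in> truncated_cone \<alpha>' \<beta>' \<Longrightarrow> \<phi>' (F_transform M u) = u - F_transform M u"
    using voiculescu_transform_onE[OF v(2)] by metis
  define a where "a = min (min a1 a2) (min \<alpha> \<alpha>')"
  define b where "b = max (max b1 b2) (max \<beta> \<beta>')"
  have a: "a > 0" "a \<le> a1" "a \<le> a2" "a \<le> \<alpha>" "a \<le> \<alpha>'" using 1 2 pos by (auto simp: a_def)
  have b: "b > 0" "b \<ge> b1" "b \<ge> b2" "b \<ge> \<beta>" "b \<ge> \<beta>'" using 1 2 by (auto simp: b_def)
  obtain b' where b': "b' \<ge> b" "b' > 0" "\<And>w. w \<in> truncated_cone (a / 2) b' \<Longrightarrow> \<exists>u\<in>truncated_cone a b. F_transform M u = w"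
    using F_transform_inverse_in_cone[OF a(1), of b] by blast
  show ?thesis
  proof (rule exI[of _ "a / 2"], rule conjI, rule half_gt_zero[OF a(1)], rule exI[of _ b'], intro conjI ballI b'(2))
    fix w assume w: "w \<in> truncated_cone (a / 2) b'"
    then obtain u where u: "u \<in> truncated_cone a b" "F_transform M u = w" using b'(3) by blast
    have "w \<in> truncated_cone \<alpha> \<beta>" "w \<in> truncated_cone \<alpha>' \<beta>'"
      using truncated_cone_mono[of "a / 2" _ _ b'] w a b b' by (smt (verit) subsetD field_sum_of_halves)+
    moreover have "u \<in> truncated_cone a1 b1" "u \<in> truncated_cone a2 b2"
      using truncated_cone_mono[of a _ _ b] u a b by (smt (verit) subsetD)+
    ultimately show "\<phi> w = \<phi>' w" using 1(3)[of u] 2(3)[of u] u(2) by simp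
  qed
qed

text \<open>For \<open>w = F_transform M u\<close> one has
  \<open>u = \<phi> w + w = \<phi>' w + w\<close>, and the right inverse property for
  \<open>N\<close> gives \<open>F_transform N u = w\<close>. Thus the transforms agree on an open
  cone.\<close>

lemma voiculescu_transform_on_unique:
  assumes M: "real_distribution M" and N: "real_distribution N"
    and v: "voiculescu_transform_on M (truncated_cone \<alpha> \<beta>) \<phi>" "voiculescu_transform_on N (truncated_cone \<alpha>' \<beta>') \<phi>'"
    and pos: "\<alpha> > 0" "\<alpha>' > 0" "a > 0" and eq: "\<And>w. w \<in> truncated_cone a b \<Longrightarrow> \<phi> w = \<phi>' w"
  shows "M = N"
proof -
  interpret M: real_distribution M by (rule M)
  obtain a1 b1 where 1: "a1 > 0" "b1 > 0"
    "\<And>u. u \<in> truncated_cone a1 b1 \<Longrightarrow> F_transform M u \<in> truncated_cone \<alpha> \<beta> \<Longrightarrow> \<phi> (F_transform M u) = u - F_transform M u"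
    using voiculescu_transform_onE[OF v(1)] by metis
  have 2: "\<And>w. w \<in> truncated_cone \<alpha>' \<beta>' \<Longrightarrow> F_transform N (\<phi>' w + w) = w"
    using voiculescu_transform_onE[OF v(2)] by metis
  define c where "c = min (min a1 a) (min \<alpha> \<alpha>')"
  define d where "d = max (max b1 b) (max \<beta> \<beta>')"
  have c: "c > 0" "c \<le> a1" "c \<le> a" "c \<le> \<alpha>" "c \<le> \<alpha>'" using 1 pos by (auto simp: c_def)
  have d: "d > 0" "d \<ge> b1" "d \<ge> b" "d \<ge> \<beta>" "d \<ge> \<beta>'" using 1 by (auto simp: d_def)
  obtain d' where d': "d' \<ge> d" "d' > 0" "\<And>u. u \<in> truncated_cone (c / 2) d' \<Longrightarrow> F_transform M u \<in> truncated_cone c d"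
    using M.F_transform_maps_cone[OF c(1), of d] by blast
  show ?thesis
  proof (rule F_transform_unique_open[OF M N open_truncated_cone, of "c / 2" d'])
    have "Complex 0 (d' + 1) \<in> truncated_cone (c / 2) d'" using c(1) d'(2) by (simp add: truncated_cone_iff)
    thus "truncated_cone (c / 2) d' \<noteq> {}" by blast
    show "truncated_cone (c / 2) d' \<subseteq> upper_half_plane" using d' by (auto simp: truncated_cone_iff)
    fix u assume u: "u \<in> truncated_cone (c / 2) d'"
    define w where "w = F_transform M u"
    have w: "w \<in> truncated_cone c d" unfolding w_def by (rule d'(3)[OF u])
    have "w \<in> truncated_cone \<alpha> \<beta>" "w \<in> truncated_cone \<alpha>' \<beta>'" "w \<in> truncated_cone a b"
      using truncated_cone_mono[of c _ _ d] w c d by (smt (verit) subsetD)+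
    moreover have "u \<in> truncated_cone a1 b1"
      using truncated_cone_mono[of "c / 2" a1 b1 d'] u c d d' by (smt (verit) subsetD field_sum_of_halves)
    ultimately have "\<phi> w = u - w" "\<phi>' w = \<phi> w" "F_transform N (\<phi>' w + w) = w"
      using 1(3)[of u] 2[of w] eq[of w] by (auto simp: w_def)
    thus "F_transform M u = F_transform N u" by (simp add: w_def)
  qed
qed

lemma free_convolution_eqI:
  assumes M: "real_distribution M" and N: "real_distribution N" and R: "real_distribution \<rho>"
    and pos: "\<alpha> > 0" "\<beta> > 0"
    and v: "voiculescu_transform_on M (truncated_cone \<alpha> \<beta>) \<phi>"
      "voiculescu_transform_on N (truncated_cone \<alpha> \<beta>) \<psi>"
      "voiculescu_transform_on \<rho> (truncated_cone \<alpha> \<beta>) (\<lambda>z. \<phi> z + \<psi> z)"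
  shows "free_convolution M N = \<rho>"
  unfolding free_convolution_def
proof (rule the_equality)
  show "real_distribution \<rho> \<and> (\<exists>\<alpha>>0. \<exists>\<beta>>0. \<exists>\<phi> \<psi>. voiculescu_transform_on M (truncated_cone \<alpha> \<beta>) \<phi> \<and>
     voiculescu_transform_on N (truncated_cone \<alpha> \<beta>) \<psi> \<and> voiculescu_transform_on \<rho> (truncated_cone \<alpha> \<beta>) (\<lambda>z. \<phi> z + \<psi> z))"
    using R pos v by blast
next
  fix \<rho>' assume "real_distribution \<rho>' \<and> (\<exists>\<alpha>>0. \<exists>\<beta>>0. \<exists>\<phi> \<psi>. voiculescu_transform_on M (truncated_cone \<alpha> \<beta>) \<phi> \<and>
     voiculescu_transform_on N (truncated_cone \<alpha> \<beta>) \<psi> \<and> voiculescu_transform_on \<rho>' (truncated_cone \<alpha> \<beta>) (\<lambda>z. \<phi> z + \<psi> z))"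
  then obtain \<alpha>' \<beta>' \<phi>' \<psi>' where R': "real_distribution \<rho>'" and pos': "\<alpha>' > 0" "\<beta>' > 0"
    and v': "voiculescu_transform_on M (truncated_cone \<alpha>' \<beta>') \<phi>'"
      "voiculescu_transform_on N (truncated_cone \<alpha>' \<beta>') \<psi>'"
      "voiculescu_transform_on \<rho>' (truncated_cone \<alpha>' \<beta>') (\<lambda>z. \<phi>' z + \<psi>' z)" by blast
  obtain a1 b1 where 1: "a1 > 0" "b1 > 0" "\<And>w. w \<in> truncated_cone a1 b1 \<Longrightarrow> \<phi>' w = \<phi> w"
    using voiculescu_transform_on_agree[OF M v'(1) v(1) pos'(1) pos(1)] by blast
  obtain a2 b2 where 2: "a2 > 0" "b2 > 0" "\<And>w. w \<in> truncated_cone a2 b2 \<Longrightarrow> \<psi>' w = \<psi> w"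
    using voiculescu_transform_on_agree[OF N v'(2) v(2) pos'(1) pos(1)] by blast
  show "\<rho>' = \<rho>"
  proof (rule voiculescu_transform_on_unique[OF R' R v'(3) v(3) pos'(1) pos(1), of "min a1 a2" "max b1 b2"])
    fix w assume "w \<in> truncated_cone (min a1 a2) (max b1 b2)"
    hence "w \<in> truncated_cone a1 b1" "w \<in> truncated_cone a2 b2"
      using truncated_cone_mono[of "min a1 a2" _ _ "max b1 b2"] 1 2 by (smt (verit) subsetD)+
    thus "\<phi>' w + \<psi>' w = \<phi> w + \<psi> w" using 1 2 by simp
  qed (use 1 2 in auto)
qed

subsection \<open>Free convolution powers by subordination\<close>

text \<open>Picard iteration for the subordination equation
  \<open>\<omega> = z + k (F \<omega> - \<omega>)\<close>. The fixed point with
  \<open>k = n - 1\<close> produces the free power with exponent \<open>n\<close>.\<close>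

primrec subordination_iterate :: "real measure \<Rightarrow> real \<Rightarrow> nat \<Rightarrow> complex \<Rightarrow> complex" where
  "subordination_iterate M k 0 z = z"
| "subordination_iterate M k (Suc j) z =
     z + of_real k * (F_transform M (subordination_iterate M k j z) - subordination_iterate M k j z)"

context real_distribution
begin

lemma Im_subordination_iterate_ge:
  assumes "k \<ge> 0" "Im z > 0" shows "Im (subordination_iterate M k j z) \<ge> Im z"
proof (induction j)
  case (Suc j)
  hence "Im (F_transform M (subordination_iterate M k j z)) \<ge> Im (subordination_iterate M k j z)"
    using assms by (intro Im_F_transform_ge) linarith
  thus ?case using assms by simp
qed simp

lemma holomorphic_subordination_iterate:
  assumes "k \<ge> 0" shows "subordination_iterate M k j holomorphic_on upper_half_plane"
proof (induction j)
  case (Suc j)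
  have "(F_transform M \<circ> subordination_iterate M k j) holomorphic_on upper_half_plane"
  proof (rule holomorphic_on_compose_gen[OF Suc holomorphic_F_transform])
    show "subordination_iterate M k j ` upper_half_plane \<subseteq> upper_half_plane"
    proof (intro subsetI, elim imageE)
      fix w z assume "w = subordination_iterate M k j z" "z \<in> upper_half_plane"
      thus "w \<in> upper_half_plane" using Im_subordination_iterate_ge[OF assms, of z j] by simp
    qed
  qed
  thus ?case using Suc by (auto intro!: holomorphic_intros simp: o_def)
qed (auto intro!: holomorphic_intros)

text \<open>Induction on \<open>j\<close>: as long as the iterate is within \<open>Im z / 4\<close>
  of \<open>z\<close> it lies in the cone of aperture 2 at height at most \<open>2 Im z\<close>, and
  \<open>\<delta>\<close> is chosen so that \<open>k\<close> times the displacement there is again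
  at most \<open>\<epsilon> Im z\<close>.\<close>

lemma subordination_iterate_near:
  assumes k: "k \<ge> 0" and e: "\<epsilon> > 0" "\<epsilon> \<le> 1/4"
  shows "\<exists>b\<ge>b0. b > 0 \<and> (\<forall>z\<in>truncated_cone 1 b. \<forall>j. norm (subordination_iterate M k j z - z) \<le> \<epsilon> * Im z)"
proof -
  define \<delta> where "\<delta> = \<epsilon> / (2 * (k + 1))"
  have \<delta>: "\<delta> > 0" "k * \<delta> \<le> \<epsilon> / 2"
  proof -
    show "\<delta> > 0" using k e by (simp add: \<delta>_def)
    have "k * \<delta> = (k / (k + 1)) * (\<epsilon> / 2)" by (simp add: \<delta>_def)
    also have "\<dots> \<le> 1 * (\<epsilon> / 2)" using k e by (intro mult_right_mono) auto
    finally show "k * \<delta> \<le> \<epsilon> / 2" by simp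
  qed
  obtain \<beta> where \<beta>: "\<beta> > 0" "\<And>u. u \<in> truncated_cone 2 \<beta> \<Longrightarrow> norm (F_transform M u - u) \<le> \<delta> * Im u"
    using F_transform_cone_asymptotics[OF \<delta>(1), of 2] by auto
  show ?thesis
  proof (rule exI[of _ "max b0 (2 * \<beta>)"], intro conjI ballI allI)
    fix z j assume z: "z \<in> truncated_cone 1 (max b0 (2 * \<beta>))"
    hence y: "Im z > 0" using \<beta> by (auto simp: truncated_cone_iff)
    show "norm (subordination_iterate M k j z - z) \<le> \<epsilon> * Im z"
    proof (induction j)
      case 0 show ?case using e y by simp
    next
      case (Suc j)
      let ?u = "subordination_iterate M k j z"
      have "\<epsilon> * Im z \<le> 1/4 * Im z" using e y by (intro mult_right_mono) auto
      with Suc have u: "norm (?u - z) \<le> 1/4 * Im z" by linarith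
      have "?u \<in> truncated_cone 2 \<beta>"
        by (rule cball_subset_truncated_cone[OF _ _ _ _ _ u]) (use z \<beta> in \<open>auto simp: truncated_cone_iff\<close>)
      hence "norm (F_transform M ?u - ?u) \<le> \<delta> * Im ?u" by (rule \<beta>(2))
      also have "\<dots> \<le> \<delta> * (2 * Im z)"
        using abs_Im_le_cmod[of "?u - z"] u \<delta> y by (intro mult_left_mono) auto
      finally have "k * norm (F_transform M ?u - ?u) \<le> k * (\<delta> * (2 * Im z))" using k by (intro mult_left_mono)
      also have "\<dots> = (k * \<delta>) * (2 * Im z)" by simp
      also have "\<dots> \<le> (\<epsilon> / 2) * (2 * Im z)" using \<delta> y by (intro mult_right_mono) auto
      finally show ?case using k by (simp add: norm_mult)
    qed
  qed (use \<beta> in auto)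
qed

text \<open>High in the cone the iteration contracts by \<open>k L \<le> 1/2\<close>. Vanishing of
  successive differences is what makes every subsequential limit a fixed point.\<close>

lemma subordination_iterate_converges:
  assumes k: "k \<ge> 0"
  shows "\<exists>b>0. \<forall>z\<in>truncated_cone 1 b.
    (\<lambda>j. subordination_iterate M k (Suc j) z - subordination_iterate M k j z) \<longlonglongrightarrow> 0"
proof -
  define L where "L = 1 / (2 * (k + 1))"
  have L: "L > 0" "k * L \<le> 1/2" using k by (auto simp: L_def divide_simps)
  obtain \<beta> where \<beta>: "\<beta> > 0" "\<And>u v. u \<in> truncated_cone 2 \<beta> \<Longrightarrow> v \<in> truncated_cone 2 \<beta> \<Longrightarrow>
      norm ((F_transform M u - u) - (F_transform M v - v)) \<le> L * norm (u - v)"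
    using F_transform_cone_Lipschitz[OF L(1), of 2] by auto
  obtain b where b: "b \<ge> 2 * \<beta>" "b > 0"
    "\<And>z j. z \<in> truncated_cone 1 b \<Longrightarrow> norm (subordination_iterate M k j z - z) \<le> 1/4 * Im z"
    using subordination_iterate_near[OF k, of "1/4" "2 * \<beta>"] by auto
  show ?thesis
  proof (intro exI[of _ b] conjI ballI b(2))
    fix z assume z: "z \<in> truncated_cone 1 b"
    let ?w = "\<lambda>j. subordination_iterate M k j z"
    have w: "?w j \<in> truncated_cone 2 \<beta>" for j
      by (rule cball_subset_truncated_cone[OF _ _ _ _ _ b(3)[OF z]]) (use z b \<beta> in \<open>auto simp: truncated_cone_iff\<close>)
    have step: "norm (?w (Suc (Suc j)) - ?w (Suc j)) \<le> 1/2 * norm (?w (Suc j) - ?w j)" for j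
    proof -
      have "?w (Suc (Suc j)) - ?w (Suc j)
         = of_real k * ((F_transform M (?w (Suc j)) - ?w (Suc j)) - (F_transform M (?w j) - ?w j))"
        by (simp add: algebra_simps)
      hence "norm (?w (Suc (Suc j)) - ?w (Suc j))
         = k * norm ((F_transform M (?w (Suc j)) - ?w (Suc j)) - (F_transform M (?w j) - ?w j))"
        using k by (metis norm_mult norm_of_real abs_of_nonneg)
      also have "\<dots> \<le> k * (L * norm (?w (Suc j) - ?w j))" by (intro mult_left_mono \<beta>(2) w k)
      also have "\<dots> = (k * L) * norm (?w (Suc j) - ?w j)" by simp
      also have "\<dots> \<le> 1/2 * norm (?w (Suc j) - ?w j)" using L by (intro mult_right_mono) auto
      finally show ?thesis .
    qed
    have bound: "norm (?w (Suc j) - ?w j) \<le> norm (?w 1 - ?w 0) * (1/2) ^ j" for j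
    proof (induction j)
      case (Suc j)
      show ?case using step[of j] Suc by simp
    qed simp
    have "(\<lambda>j. norm (?w 1 - ?w 0) * (1/2) ^ j) \<longlonglongrightarrow> norm (?w 1 - ?w 0) * 0"
      by (intro tendsto_mult tendsto_const LIMSEQ_realpow_zero) auto
    hence lim: "(\<lambda>j. norm (?w 1 - ?w 0) * (1/2) ^ j) \<longlonglongrightarrow> 0" by (simp only: mult_zero_right)
    show "(\<lambda>j. ?w (Suc j) - ?w j) \<longlonglongrightarrow> 0"
      by (rule Lim_null_comparison[OF always_eventually lim]) (rule allI, rule bound)
  qed
qed

text \<open>Contraction is available only high in a cone. A locally uniform subsequential limit on
  the whole half-plane comes from Montel, and the fixed point equation spreads from the cone by
  analytic continuation.\<close>

theorem subordination_function_exists: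
  assumes k: "k \<ge> 0"
  shows "\<exists>\<omega>. \<omega> holomorphic_on upper_half_plane \<and>
    (\<forall>z. Im z > 0 \<longrightarrow> Im (\<omega> z) \<ge> Im z \<and> \<omega> z = z + of_real k * (F_transform M (\<omega> z) - \<omega> z)) \<and>
    (\<forall>\<epsilon>>0. \<exists>b. \<forall>y>b. norm (\<omega> (\<i> * of_real y) - \<i> * of_real y) \<le> \<epsilon> * y)"
proof -
  let ?w = "subordination_iterate M k"
  \<comment> \<open>The iterates have no evident upper bound; inverting about \<open>- \<i>\<close>
    makes them bounded by 1. The price is to show that the limit \<open>G\<close> has no zeros, so
    that the inversion can be undone.\<close>
  define g where "g = (\<lambda>j z. 1 / (?w j z + \<i>))"
  have den: "Im (?w j z + \<i>) > 1" if "Im z > 0" for j z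
    using Im_subordination_iterate_ge[OF k that, of j] that by simp
  have den0: "?w j z + \<i> \<noteq> 0" if "Im z > 0" for j z
    using den[OF that, of j] by (metis less_numeral_extra(1) not_less_iff_gr_or_eq order_less_trans zero_complex.sel(2))
  have g_hol: "g j holomorphic_on upper_half_plane" for j
    unfolding g_def using den0 by (intro holomorphic_intros holomorphic_subordination_iterate k) auto
  have g_bound: "norm (g j z) \<le> 1" if "Im z > 0" for j z
  proof -
    have "norm (?w j z + \<i>) \<ge> 1" using den[OF that, of j] abs_Im_le_cmod[of "?w j z + \<i>"] by linarith
    thus ?thesis by (simp add: g_def norm_divide divide_le_eq_1)
  qed
  obtain G r where G: "G holomorphic_on upper_half_plane" and r: "strict_mono r"
    and conv: "\<And>z. Im z > 0 \<Longrightarrow> (\<lambda>n. g (r n) z) \<longlonglongrightarrow> G z"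
  proof (rule Montel[of upper_half_plane "range g" g])
    show "\<exists>B. \<forall>h\<in>range g. \<forall>z\<in>K. norm (h z) \<le> B" if "compact K" "K \<subseteq> upper_half_plane" for K
      using that g_bound by (intro exI[of _ 1]) (auto simp: subset_iff)
  qed (use g_hol in auto)
  obtain b1 where b1: "b1 > 0" "\<And>z. z \<in> truncated_cone 1 b1 \<Longrightarrow> (\<lambda>j. ?w (Suc j) z - ?w j z) \<longlonglongrightarrow> 0"
    using subordination_iterate_converges[OF k] by blast
  obtain b where b: "b \<ge> b1" "b > 0"
    "\<And>z j. z \<in> truncated_cone 1 b \<Longrightarrow> norm (?w j z - z) \<le> 1/4 * Im z"
    using subordination_iterate_near[OF k, of "1/4" b1] by auto
  have cone_up: "Im z > 0" if "z \<in> truncated_cone 1 b" for z using that b by (auto simp: truncated_cone_iff)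
  \<comment> \<open>In the cone the iterates stay within \<open>Im z / 4\<close> of
    \<open>z\<close>, so the inverted sequence is bounded away from 0.\<close>
  have G_cone: "G z \<noteq> 0" if z: "z \<in> truncated_cone 1 b" for z
  proof
    assume "G z = 0"
    define R where "R = norm z + 1/4 * Im z + 1"
    have "norm (g j z) \<ge> 1 / R" for j
    proof -
      have "norm (?w j z + \<i>) \<le> norm (?w j z - z) + norm z + norm \<i>"
        using norm_triangle_ineq[of "?w j z" \<i>] norm_triangle_sub[of "?w j z" z] by linarith
      also have "\<dots> \<le> R" using b(3)[OF z, of j] by (simp add: R_def)
      finally have "norm (?w j z + \<i>) \<le> R" .
      moreover have "norm (?w j z + \<i>) > 0" using den0[OF cone_up[OF z]] by simp
      ultimately show ?thesis by (simp add: g_def norm_divide frac_le)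
    qed
    hence "norm (G z) \<ge> 1 / R"
      by (intro LIMSEQ_le_const[OF tendsto_norm[OF conv[OF cone_up[OF z]]]]) auto
    moreover have "R > 0" using cone_up[OF z] by (simp add: R_def add_nonneg_pos)
    ultimately show False using \<open>G z = 0\<close> by (simp add: divide_le_0_iff)
  qed
  define z0 where "z0 = Complex 0 (b + 1)"
  have z0: "z0 \<in> truncated_cone 1 b" using b by (simp add: z0_def truncated_cone_iff)
  \<comment> \<open>A zero of \<open>G\<close> is a real value of \<open>- G\<close>, whose
    imaginary part is nonnegative; by the maximum principle \<open>G\<close> would vanish
    identically, against the cone.\<close>
  have G_nz: "G z \<noteq> 0" if z: "Im z > 0" for z
  proof
    assume G0: "G z = 0"
    have "- G z0 = - G z"
    proof (rule schwarz_pick_constant[where f = "\<lambda>z. - G z"])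
      show "0 \<le> Im (- G u)" if u: "Im u > 0" for u
      proof -
        have "Im (g j u) \<le> 0" for j
          using den[OF u, of j] unfolding g_def by (simp add: Im_divide divide_nonpos_nonneg)
        hence "Im (G u) \<le> 0" by (intro LIMSEQ_le_const2[OF tendsto_Im[OF conv[OF u]]]) auto
        thus ?thesis by simp
      qed
    qed (use G G0 z cone_up[OF z0] in \<open>auto intro!: holomorphic_intros\<close>)
    with G0 G_cone[OF z0] show False by simp
  qed
  define \<omega> where "\<omega> z = 1 / G z - \<i>" for z
  have \<omega>_hol: "\<omega> holomorphic_on upper_half_plane"
    unfolding \<omega>_def using G_nz by (intro holomorphic_intros G) auto
  have \<omega>_conv: "(\<lambda>n. ?w (r n) z) \<longlonglongrightarrow> \<omega> z" if z: "Im z > 0" for z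
  proof -
    have "(\<lambda>n. 1 / g (r n) z - \<i>) \<longlonglongrightarrow> 1 / G z - \<i>" by (intro tendsto_intros conv z G_nz)
    thus ?thesis by (simp add: g_def \<omega>_def)
  qed
  have \<omega>_Im: "Im (\<omega> z) \<ge> Im z" if z: "Im z > 0" for z
    by (rule LIMSEQ_le_const[OF tendsto_Im[OF \<omega>_conv[OF z]]]) (use Im_subordination_iterate_ge[OF k z] in auto)
  have comp_hol: "(\<lambda>z. F_transform M (\<omega> z)) holomorphic_on upper_half_plane"
  proof -
    have "(F_transform M \<circ> \<omega>) holomorphic_on upper_half_plane"
    proof (rule holomorphic_on_compose_gen[OF \<omega>_hol holomorphic_F_transform], intro subsetI, elim imageE)
      fix w z assume "w = \<omega> z" "z \<in> upper_half_plane"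
      thus "w \<in> upper_half_plane" using \<omega>_Im[of z] by simp
    qed
    thus ?thesis by (simp add: o_def)
  qed
  have fixed_cone: "\<omega> z = z + of_real k * (F_transform M (\<omega> z) - \<omega> z)" if z: "z \<in> truncated_cone 1 b" for z
  proof -
    have y: "Im z > 0" by (rule cone_up[OF z])
    have y': "Im (\<omega> z) > 0" using \<omega>_Im[OF y] y by simp
    have z1: "z \<in> truncated_cone 1 b1" using z b by (auto simp: truncated_cone_iff)
    have "isCont (F_transform M) (\<omega> z)"
      using holomorphic_on_imp_continuous_on[OF holomorphic_F_transform] y'
      by (simp add: continuous_on_eq_continuous_at)
    hence "(\<lambda>n. F_transform M (?w (r n) z)) \<longlonglongrightarrow> F_transform M (\<omega> z)"
      by (rule isCont_tendsto_compose[OF _ \<omega>_conv[OF y]])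
    hence "(\<lambda>n. ?w (Suc (r n)) z) \<longlonglongrightarrow> z + of_real k * (F_transform M (\<omega> z) - \<omega> z)"
      unfolding subordination_iterate.simps by (intro tendsto_intros \<omega>_conv y)
    moreover have "(\<lambda>n. (?w (Suc (r n)) z - ?w (r n) z) + ?w (r n) z) \<longlonglongrightarrow> 0 + \<omega> z"
      using LIMSEQ_subseq_LIMSEQ[OF b1(2)[OF z1] r] by (intro tendsto_add \<omega>_conv y) (simp add: o_def)
    hence "(\<lambda>n. ?w (Suc (r n)) z) \<longlonglongrightarrow> \<omega> z" by simp
    ultimately show ?thesis by (metis LIMSEQ_unique)
  qed
  have fixed: "\<omega> z = z + of_real k * (F_transform M (\<omega> z) - \<omega> z)" if z: "Im z > 0" for z
  proof (rule analytic_continuation_open[OF open_truncated_cone open_upper_half_plane _ connected_upper_half_plane _ \<omega>_hol _ fixed_cone])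
    show "truncated_cone 1 b \<noteq> {}" using z0 by blast
    show "truncated_cone 1 b \<subseteq> upper_half_plane" using cone_up by auto
    show "(\<lambda>z. z + of_real k * (F_transform M (\<omega> z) - \<omega> z)) holomorphic_on upper_half_plane"
      by (intro holomorphic_intros comp_hol \<omega>_hol)
  qed (use z in auto)
  have near: "\<exists>b. \<forall>y>b. norm (\<omega> (\<i> * of_real y) - \<i> * of_real y) \<le> \<epsilon> * y" if e: "\<epsilon> > 0" for \<epsilon>
  proof -
    obtain b' where b': "b' > 0" "\<And>z j. z \<in> truncated_cone 1 b' \<Longrightarrow> norm (?w j z - z) \<le> min \<epsilon> (1/4) * Im z"
    proof -
      have "min \<epsilon> (1/4) > 0" "min \<epsilon> (1/4) \<le> 1/4" using e by simp_all
      from subordination_iterate_near[OF k this, of 0] show ?thesis using that by blast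
    qed
    show ?thesis
    proof (intro exI[of _ b'] allI impI)
      fix y assume y: "y > b'"
      have c: "\<i> * of_real y \<in> truncated_cone 1 b'" using y b' by (simp add: truncated_cone_iff)
      have "norm (\<omega> (\<i> * of_real y) - \<i> * of_real y) \<le> min \<epsilon> (1/4) * Im (\<i> * of_real y)"
        by (rule LIMSEQ_le_const2[OF tendsto_norm[OF tendsto_diff[OF \<omega>_conv tendsto_const]]])
           (use y b' b'(2)[OF c] in auto)
      also have "\<dots> \<le> \<epsilon> * y" using y b' by (simp add: mult_right_mono)
      finally show "norm (\<omega> (\<i> * of_real y) - \<i> * of_real y) \<le> \<epsilon> * y" .
    qed
  qed
  show ?thesis using \<omega>_hol \<omega>_Im fixed near by blast
qed

end

text \<open>Describes \<open>\<rho>\<close> as the free power of \<open>M\<close> with exponent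
  \<open>k + 1\<close>: with \<open>w = F_transform \<rho> z\<close> the last equation says
  \<open>z - w = (k + 1) (\<omega> z - w)\<close>, a multiple of the Voiculescu transform of
  \<open>M\<close> at \<open>w\<close>. Exponent one is \<open>k = 0\<close> with
  \<open>\<omega>\<close> the identity.\<close>

definition subordinated :: "real measure \<Rightarrow> nat \<Rightarrow> real measure \<Rightarrow> (complex \<Rightarrow> complex) \<Rightarrow> bool" where
  "subordinated M k \<rho> \<omega> \<longleftrightarrow> real_distribution \<rho> \<and> \<omega> holomorphic_on upper_half_plane \<and>
     (\<forall>z. Im z > 0 \<longrightarrow> Im (\<omega> z) \<ge> Im z \<and> F_transform \<rho> z = F_transform M (\<omega> z) \<and>
        \<omega> z = z + of_nat k * (F_transform M (\<omega> z) - \<omega> z))"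

lemma (in real_distribution) subordinated_exists: "\<exists>\<rho> \<omega>. subordinated M k \<rho> \<omega>"
proof -
  obtain \<omega> where \<omega>: "\<omega> holomorphic_on upper_half_plane"
    "\<And>z. Im z > 0 \<Longrightarrow> Im (\<omega> z) \<ge> Im z" "\<And>z. Im z > 0 \<Longrightarrow> \<omega> z = z + of_nat k * (F_transform M (\<omega> z) - \<omega> z)"
    "\<And>\<epsilon>. \<epsilon> > 0 \<Longrightarrow> \<exists>b. \<forall>y>b. norm (\<omega> (\<i> * of_real y) - \<i> * of_real y) \<le> \<epsilon> * y"
    using subordination_function_exists[of "real k"] by (auto simp: of_real_of_nat_eq)
  have pos: "Im (\<omega> z) > 0" if "Im z > 0" for z using \<omega>(2)[OF that] that by simp
  have "\<exists>\<rho>. real_distribution \<rho> \<and> (\<forall>z. Im z > 0 \<longrightarrow> F_transform \<rho> z = F_transform M (\<omega> z))"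
  proof (rule F_transform_exists)
    have "(F_transform M \<circ> \<omega>) holomorphic_on upper_half_plane"
      by (rule holomorphic_on_compose_gen[OF \<omega>(1) holomorphic_F_transform]) (use pos in auto)
    thus "(\<lambda>z. F_transform M (\<omega> z)) holomorphic_on upper_half_plane" by (simp add: o_def)
    show "Im z \<le> Im (F_transform M (\<omega> z))" if "Im z > 0" for z
      using Im_F_transform_ge[OF pos[OF that]] \<omega>(2)[OF that] by simp
    show "\<exists>b. \<forall>y>b. norm (F_transform M (\<omega> (\<i> * of_real y)) - \<i> * of_real y) \<le> \<epsilon> * y" if "\<epsilon> > 0" for \<epsilon>
      by (rule F_transform_near_identity_compose[OF \<omega>(4) that])
  qed
  thus ?thesis unfolding subordinated_def using \<omega>(1-3) by blast
qed

text \<open>Cones are convex, so \<open>\<omega> u\<close>, a convex combination of \<open>u\<close> and \<open>w\<close>, stays in the cone on which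
  \<open>F_transform M\<close> is injective.\<close>

lemma subordinated_voiculescu:
  assumes M: "real_distribution M" and s: "subordinated M k \<rho> \<omega>"
  shows "\<exists>b0>0. \<forall>b\<ge>b0. \<exists>b'>0. \<forall>\<beta>\<ge>b'. voiculescu_transform_on \<rho> (truncated_cone (1/2) \<beta>)
     (\<lambda>w. of_nat (Suc k) * (the_inv_into (truncated_cone 1 b) (F_transform M) w - w))"
proof -
  interpret M: real_distribution M by (rule M)
  interpret R: real_distribution \<rho> using s by (simp add: subordinated_def)
  obtain b1 where b1: "b1 > 0" "inj_on (F_transform M) (truncated_cone 1 b1)"
    using M.inj_on_F_transform_cone[of 1] by auto
  obtain b2 where b2: "b2 > 0" "inj_on (F_transform \<rho>) (truncated_cone 1 b2)"
    using R.inj_on_F_transform_cone[of 1] by auto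
  show ?thesis
  proof (rule exI[of _ "max b1 b2"], intro conjI allI impI)
    fix b assume b: "max b1 b2 \<le> b"
    have b0: "b > 0" using b b1 by simp
    have injM: "inj_on (F_transform M) (truncated_cone 1 b)"
      by (rule inj_on_subset[OF b1(2) truncated_cone_mono]) (use b b0 in auto)
    have injR: "inj_on (F_transform \<rho>) (truncated_cone 1 b)"
      by (rule inj_on_subset[OF b2(2) truncated_cone_mono]) (use b b0 in auto)
    obtain b' where b': "b' \<ge> b" "b' > 0" "\<And>w. w \<in> truncated_cone (1/2) b' \<Longrightarrow> \<exists>u\<in>truncated_cone 1 b. F_transform \<rho> u = w"
      using R.F_transform_inverse_in_cone[of 1 b] by auto
    show "\<exists>b'>0. \<forall>\<beta>\<ge>b'. voiculescu_transform_on \<rho> (truncated_cone (1/2) \<beta>)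
     (\<lambda>w. of_nat (Suc k) * (the_inv_into (truncated_cone 1 b) (F_transform M) w - w))"
    proof (rule exI[of _ b'], intro conjI allI impI b'(2))
      fix \<beta> assume \<beta>: "b' \<le> \<beta>"
      show "voiculescu_transform_on \<rho> (truncated_cone (1/2) \<beta>)
        (\<lambda>w. of_nat (Suc k) * (the_inv_into (truncated_cone 1 b) (F_transform M) w - w))"
      proof (rule voiculescu_transform_onI[OF _ b0 injR])
        fix w assume w: "w \<in> truncated_cone (1/2) \<beta>"
        hence w': "w \<in> truncated_cone (1/2) b'" "w \<in> truncated_cone 1 b"
          using \<beta> b' b0 by (auto simp: truncated_cone_iff)
        obtain u where u: "u \<in> truncated_cone 1 b" "F_transform \<rho> u = w" using b'(3)[OF w'(1)] by blast
        have y: "Im u > 0" using u b0 by (auto simp: truncated_cone_iff)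
        have \<omega>: "F_transform M (\<omega> u) = w" "\<omega> u = u + of_nat k * (w - \<omega> u)"
          using s y u(2) by (auto simp: subordinated_def)
        have "of_nat (Suc k) * \<omega> u = u + of_nat k * w" using \<omega>(2) by (simp add: algebra_simps)
        hence "\<omega> u = (1 / of_nat (Suc k)) * u + (of_nat k / of_nat (Suc k)) * w"
          by (simp add: field_simps del: of_nat_Suc)
        also have "\<dots> = (1 / real (Suc k)) *\<^sub>R u + (real k / real (Suc k)) *\<^sub>R w"
          by (simp add: scaleR_conv_of_real)
        also have "\<dots> \<in> truncated_cone 1 b"
          by (rule convexD[OF convex_truncated_cone u(1) w'(2)]) (auto simp: field_simps)
        finally have "the_inv_into (truncated_cone 1 b) (F_transform M) w = \<omega> u"
          using \<omega>(1) by (metis the_inv_into_f_f[OF injM])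
        moreover have "of_nat (Suc k) * (\<omega> u - w) = u - w"
          using \<open>of_nat (Suc k) * \<omega> u = u + of_nat k * w\<close> by (simp add: algebra_simps)
        ultimately show "\<exists>u\<in>truncated_cone 1 b. F_transform \<rho> u = w \<and>
           of_nat (Suc k) * (the_inv_into (truncated_cone 1 b) (F_transform M) w - w) = u - w"
          using u by (intro bexI[of _ u]) auto
      qed simp
    qed
  qed (use b1 in auto)
qed

lemma subordinated_self: "real_distribution M \<Longrightarrow> subordinated M 0 M (\<lambda>z. z)"
  by (auto simp: subordinated_def)

lemma return_0_voiculescu:
  assumes "\<beta> > 0"
  shows "voiculescu_transform_on (return borel 0) (truncated_cone (1/2) \<beta>) (\<lambda>w. of_nat 0 * \<phi> w)"
  by (rule voiculescu_transform_onI[of "1/2" \<beta>]) (use assms in \<open>auto simp: F_transform_return_0 inj_on_def\<close>)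

text \<open>Induction on the exponent: the measure built by subordination has Voiculescu transform
  \<open>n + 1\<close> times that of \<open>M\<close>, hence it is the free convolution of
  \<open>M\<close> with the previous power.\<close>

theorem free_convolution_power:
  assumes M: "real_distribution M"
  shows "real_distribution (convolution_power free_convolution M n)"
    and "n = Suc k \<Longrightarrow> \<exists>\<omega>. subordinated M k (convolution_power free_convolution M n) \<omega>"
proof -
  let ?P = "\<lambda>n. convolution_power free_convolution M n"
  \<comment> \<open>Says that the Voiculescu transform is \<open>n\<close> times that of
    \<open>M\<close>. It is demanded for every large \<open>b\<close> and every large
    \<open>\<beta>\<close> so that the three measures in a convolution step can share one inverse of
    \<open>F_transform M\<close> and one cone.\<close>
  let ?V = "\<lambda>n \<rho>. \<exists>b0>0. \<forall>b\<ge>b0. \<exists>b'>0. \<forall>\<beta>\<ge>b'. voiculescu_transform_on \<rho> (truncated_cone (1/2) \<beta>)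
     (\<lambda>w. of_nat n * (the_inv_into (truncated_cone 1 b) (F_transform M) w - w))"
  have step: "free_convolution M N = \<rho>" if N: "real_distribution N" "?V n N" and s: "subordinated M n \<rho> \<omega>" for N n \<rho> \<omega>
  proof -
    have \<rho>: "real_distribution \<rho>" using s by (simp add: subordinated_def)
    obtain b1 where b1: "\<And>b. b \<ge> b1 \<Longrightarrow> \<exists>b'>0. \<forall>\<beta>\<ge>b'. voiculescu_transform_on M (truncated_cone (1/2) \<beta>)
       (\<lambda>w. of_nat (Suc 0) * (the_inv_into (truncated_cone 1 b) (F_transform M) w - w))"
      using subordinated_voiculescu[OF M subordinated_self[OF M]] by blast
    obtain b2 where b2: "\<And>b. b \<ge> b2 \<Longrightarrow> \<exists>b'>0. \<forall>\<beta>\<ge>b'. voiculescu_transform_on N (truncated_cone (1/2) \<beta>)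
       (\<lambda>w. of_nat n * (the_inv_into (truncated_cone 1 b) (F_transform M) w - w))"
      using N(2) by blast
    obtain b3 where b3: "\<And>b. b \<ge> b3 \<Longrightarrow> \<exists>b'>0. \<forall>\<beta>\<ge>b'. voiculescu_transform_on \<rho> (truncated_cone (1/2) \<beta>)
       (\<lambda>w. of_nat (Suc n) * (the_inv_into (truncated_cone 1 b) (F_transform M) w - w))"
      using subordinated_voiculescu[OF M s] by blast
    define b where "b = max b1 (max b2 b3)"
    have bb: "b1 \<le> b" "b2 \<le> b" "b3 \<le> b" by (auto simp: b_def)
    define \<phi> where "\<phi> = (\<lambda>w. the_inv_into (truncated_cone 1 b) (F_transform M) w - w)"
    obtain c1 where c1: "c1 > 0" "\<And>\<beta>. \<beta> \<ge> c1 \<Longrightarrow> voiculescu_transform_on M (truncated_cone (1/2) \<beta>) (\<lambda>w. of_nat (Suc 0) * \<phi> w)"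
      using b1[OF bb(1)] unfolding \<phi>_def by blast
    obtain c2 where c2: "c2 > 0" "\<And>\<beta>. \<beta> \<ge> c2 \<Longrightarrow> voiculescu_transform_on N (truncated_cone (1/2) \<beta>) (\<lambda>w. of_nat n * \<phi> w)"
      using b2[OF bb(2)] unfolding \<phi>_def by blast
    obtain c3 where c3: "c3 > 0" "\<And>\<beta>. \<beta> \<ge> c3 \<Longrightarrow> voiculescu_transform_on \<rho> (truncated_cone (1/2) \<beta>) (\<lambda>w. of_nat (Suc n) * \<phi> w)"
      using b3[OF bb(3)] unfolding \<phi>_def by blast
    define c where "c = max c1 (max c2 c3)"
    have eq: "(\<lambda>w. of_nat (Suc n) * \<phi> w) = (\<lambda>w. of_nat (Suc 0) * \<phi> w + of_nat n * \<phi> w)" by (simp add: algebra_simps)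
    show ?thesis
    proof (rule free_convolution_eqI[OF M N(1) \<rho>, of "1/2" c])
      show "voiculescu_transform_on M (truncated_cone (1/2) c) (\<lambda>w. of_nat (Suc 0) * \<phi> w)"
        by (rule c1(2)) (simp add: c_def)
      show "voiculescu_transform_on N (truncated_cone (1/2) c) (\<lambda>w. of_nat n * \<phi> w)"
        by (rule c2(2)) (simp add: c_def)
      show "voiculescu_transform_on \<rho> (truncated_cone (1/2) c) (\<lambda>w. of_nat (Suc 0) * \<phi> w + of_nat n * \<phi> w)"
        unfolding eq [symmetric] by (rule c3(2)) (simp add: c_def)
    qed (use c1 in \<open>auto simp: c_def\<close>)
  qed
  have all: "real_distribution (?P n) \<and> ?V n (?P n) \<and> (\<forall>k. n = Suc k \<longrightarrow> (\<exists>\<omega>. subordinated M k (?P n) \<omega>))" for n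
  proof (induction n)
    case 0
    have "?V 0 (return borel 0)"
      using return_0_voiculescu by (intro exI[of _ 1] conjI allI impI) auto
    thus ?case by (simp add: convolution_power_def real_distribution_return_0)
  next
    case (Suc n)
    obtain \<rho> \<omega> where s: "subordinated M n \<rho> \<omega>" using real_distribution.subordinated_exists[OF M] by blast
    have "?P (Suc n) = free_convolution M (?P n)" by (simp add: convolution_power_def)
    also have "\<dots> = \<rho>" using step[OF _ _ s, of "?P n"] Suc by blast
    finally have eq: "?P (Suc n) = \<rho>" .
    have "?V (Suc n) \<rho>" by (rule subordinated_voiculescu[OF M s])
    moreover have "real_distribution \<rho>" using s by (simp add: subordinated_def)
    ultimately show ?case unfolding eq using s by blast
  qed
  show "real_distribution (?P n)" using all by blast
  show "n = Suc k \<Longrightarrow> \<exists>\<omega>. subordinated M k (?P n) \<omega>" using all by blast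
qed

subsection \<open>The arc-sine and semicircle laws\<close>

text \<open>The integrand may blow up at the end points, as the arc-sine density does; continuity of
  the antiderivative and nonnegativity then give integrability as well.\<close>

lemma integral_FTC_nonneg:
  fixes f F :: "real \<Rightarrow> real"
  assumes ab: "a < b" and cont: "continuous_on {a..b} F"
    and deriv: "\<And>x. a < x \<Longrightarrow> x < b \<Longrightarrow> (F has_real_derivative f x) (at x)"
    and f: "\<And>x. a < x \<Longrightarrow> x < b \<Longrightarrow> isCont f x" "\<And>x. a < x \<Longrightarrow> x < b \<Longrightarrow> f x \<ge> 0"
  shows "integrable lborel (\<lambda>x. indicator {a<..<b} x * f x)"
    and "(LBINT x. indicator {a<..<b} x * f x) = F b - F a"
proof -
  have A: "((F \<circ> real_of_ereal) \<longlongrightarrow> F a) (at_right (ereal a))"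
    and B: "((F \<circ> real_of_ereal) \<longlongrightarrow> F b) (at_left (ereal b))"
    using continuous_on_Icc_at_rightD[OF cont ab] continuous_on_Icc_at_leftD[OF cont ab]
    by (simp_all add: ereal_tendsto_simps)
  have "set_integrable lborel (einterval (ereal a) (ereal b)) f" "(LBINT x=ereal a..ereal b. f x) = F b - F a"
    using interval_integral_FTC_nonneg[of "ereal a" "ereal b" F f "F a" "F b"] ab deriv f A B by auto
  thus "integrable lborel (\<lambda>x. indicator {a<..<b} x * f x)"
    and "(LBINT x. indicator {a<..<b} x * f x) = F b - F a"
    using ab by (simp_all add: set_integrable_def interval_lebesgue_integral_def set_lebesgue_integral_def einterval_eq)
qed

lemma square_less_square_if_between:
  fixes x s :: real
  assumes "- s < x" "x < s" shows "x\<^sup>2 < s\<^sup>2"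
  using assms by (intro power2_strict_mono) auto

text \<open>The antiderivatives are written with \<open>arcsin\<close> rather than \<open>arctan\<close> so that they extend continuously to
  the end points.\<close>

lemma arcsin_scaled:
  fixes s :: real
  assumes s: "s > 0"
  shows "continuous_on {- s..s} (\<lambda>x. arcsin (x / s))"
    and "\<And>x. - s < x \<Longrightarrow> x < s \<Longrightarrow> ((\<lambda>x. arcsin (x / s)) has_real_derivative 1 / sqrt (s\<^sup>2 - x\<^sup>2)) (at x)"
proof -
  show "continuous_on {- s..s} (\<lambda>x. arcsin (x / s))"
    using s by (intro continuous_on_arcsin continuous_intros) (auto simp: field_simps)
  fix x assume x: "- s < x" "x < s"

  have "sqrt (1 - (x / s)\<^sup>2) = sqrt (s\<^sup>2 - x\<^sup>2) / s"
  proof -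
    have "1 - (x / s)\<^sup>2 = (s\<^sup>2 - x\<^sup>2) / s\<^sup>2" using s by (simp add: field_simps)
    thus ?thesis using s by (simp add: real_sqrt_divide)
  qed
  moreover have "((\<lambda>x. arcsin (x / s)) has_real_derivative inverse (sqrt (1 - (x / s)\<^sup>2)) * (1 / s)) (at x)"
    using x s by (auto intro!: derivative_eq_intros simp: field_simps)
  ultimately show "((\<lambda>x. arcsin (x / s)) has_real_derivative 1 / sqrt (s\<^sup>2 - x\<^sup>2)) (at x)"
    using s by (simp add: inverse_eq_divide)
qed

text \<open>\<open>H\<close> is an antiderivative, up to a factor, of the Poisson kernel times the
  arc-sine density on \<open>(-s, s)\<close>. Everything rests on
  \<open>1 - g^2 = y^2 (s^2 - x^2) / (s^2 (x^2 + y^2))\<close>, which also shows that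
  \<open>g\<close> runs from -1 to 1.\<close>

lemma arcsin_poisson:
  fixes s y :: real
  assumes s: "s > 0" and y: "y > 0"
  defines "H \<equiv> \<lambda>x. arcsin (x * sqrt (y\<^sup>2 + s\<^sup>2) / (s * sqrt (x\<^sup>2 + y\<^sup>2)))"
  shows "continuous_on {- s..s} H" and "H s = pi / 2" and "H (- s) = - (pi / 2)"
    and "\<And>x. - s < x \<Longrightarrow> x < s \<Longrightarrow>
      (H has_real_derivative sqrt (y\<^sup>2 + s\<^sup>2) * y / ((x\<^sup>2 + y\<^sup>2) * sqrt (s\<^sup>2 - x\<^sup>2))) (at x)"
proof -
  define c where "c = sqrt (y\<^sup>2 + s\<^sup>2)"
  define r where "r x = sqrt (x\<^sup>2 + y\<^sup>2)" for x
  define g where "g x = x * c / (s * r x)" for x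
  have Hg: "H = (\<lambda>x. arcsin (g x))" by (simp add: H_def g_def c_def r_def)
  have c: "c > 0" "c\<^sup>2 = y\<^sup>2 + s\<^sup>2" using y by (auto simp: c_def add_pos_nonneg)
  have r: "r x > 0" "(r x)\<^sup>2 = x\<^sup>2 + y\<^sup>2" for x using y by (auto simp: r_def add_nonneg_pos)
  have g2: "1 - (g x)\<^sup>2 = y\<^sup>2 * (s\<^sup>2 - x\<^sup>2) / (s\<^sup>2 * (r x)\<^sup>2)" for x
  proof -
    have "(g x)\<^sup>2 = x\<^sup>2 * c\<^sup>2 / (s\<^sup>2 * (r x)\<^sup>2)" by (simp add: g_def power_mult_distrib power_divide)
    hence "1 - (g x)\<^sup>2 = (s\<^sup>2 * (r x)\<^sup>2 - x\<^sup>2 * c\<^sup>2) / (s\<^sup>2 * (r x)\<^sup>2)"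
      using s r(1)[of x] by (simp add: diff_divide_distrib)
    also have "s\<^sup>2 * (r x)\<^sup>2 - x\<^sup>2 * c\<^sup>2 = y\<^sup>2 * (s\<^sup>2 - x\<^sup>2)" by (simp add: r(2) c(2) algebra_simps)
    finally show ?thesis .
  qed
  have g_le: "\<bar>g x\<bar> \<le> 1" if "\<bar>x\<bar> \<le> s" for x
  proof -
    have "x\<^sup>2 \<le> s\<^sup>2" using that s by (metis abs_le_square_iff abs_of_pos)
    hence "1 - (g x)\<^sup>2 \<ge> 0" unfolding g2 by simp
    thus ?thesis by (simp add: abs_square_le_1)
  qed
  have g_cont: "continuous_on UNIV g"
  proof -
    have "s * r x \<noteq> 0" for x using s r(1)[of x] by simp
    thus ?thesis unfolding g_def r_def by (intro continuous_intros) auto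
  qed
  show "continuous_on {- s..s} H"
    unfolding Hg
    by (intro continuous_on_arcsin continuous_on_subset[OF g_cont]) (use g_le in \<open>auto simp: abs_le_iff\<close>)
  have rs: "r s = c" "r (- s) = c" by (simp_all add: r_def c_def add.commute)
  show "H s = pi / 2" "H (- s) = - (pi / 2)"
    unfolding Hg g_def rs using s c by simp_all
  fix x assume x: "- s < x" "x < s"
  have q: "s\<^sup>2 - x\<^sup>2 > 0" using square_less_square_if_between[OF x] by simp
  hence g_lt: "\<bar>g x\<bar> < 1"
  proof -
    have "1 - (g x)\<^sup>2 > 0" unfolding g2 using q s y r(1)[of x] by simp
    thus ?thesis by (simp add: abs_square_less_1)
  qed
  have r': "(r has_real_derivative x / r x) (at x)"
    unfolding r_def using r(1)[of x] unfolding r_def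
    by (auto intro!: derivative_eq_intros simp: divide_simps add_nonneg_pos y)
  have g': "(g has_real_derivative c * y\<^sup>2 / (s * (r x) ^ 3)) (at x)"
  proof -
    have "((\<lambda>x. x * c / (s * r x)) has_real_derivative (1 * c * (s * r x) - x * c * (s * (x / r x))) / ((s * r x) * (s * r x))) (at x)"
      by (rule derivative_eq_intros r' refl | use s r(1)[of x] in simp)+
    also have "(1 * c * (s * r x) - x * c * (s * (x / r x))) / ((s * r x) * (s * r x)) = c * ((r x)\<^sup>2 - x\<^sup>2) / (s * (r x) ^ 3)"
      using s r(1)[of x] by (simp add: field_simps power2_eq_square power3_eq_cube)
    also have "(r x)\<^sup>2 - x\<^sup>2 = y\<^sup>2" by (simp add: r(2))
    finally show ?thesis unfolding g_def[abs_def] .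
  qed
  have "((\<lambda>x. arcsin (g x)) has_real_derivative inverse (sqrt (1 - (g x)\<^sup>2)) * (c * y\<^sup>2 / (s * (r x) ^ 3))) (at x)"
    by (rule DERIV_chain2[OF DERIV_arcsin g']) (use g_lt in \<open>auto simp: abs_less_iff\<close>)
  also have "sqrt (1 - (g x)\<^sup>2) = y * sqrt (s\<^sup>2 - x\<^sup>2) / (s * r x)"
    unfolding g2 using s y r(1)[of x] by (simp add: real_sqrt_divide real_sqrt_mult)
  also have "inverse (y * sqrt (s\<^sup>2 - x\<^sup>2) / (s * r x)) * (c * y\<^sup>2 / (s * (r x) ^ 3))
      = c * y / ((r x)\<^sup>2 * sqrt (s\<^sup>2 - x\<^sup>2))"
    using s y r(1)[of x] q by (simp add: field_simps power2_eq_square power3_eq_cube)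
  finally show "(H has_real_derivative sqrt (y\<^sup>2 + s\<^sup>2) * y / ((x\<^sup>2 + y\<^sup>2) * sqrt (s\<^sup>2 - x\<^sup>2))) (at x)"
    unfolding Hg r(2) c_def .
qed

lemma real_distribution_density:
  assumes d: "d \<in> borel_measurable borel" "\<And>t. d t \<ge> 0" "integrable lborel d" "(LBINT t. d t) = 1"
  shows "real_distribution (density lborel (\<lambda>t. ennreal (d t)))"
proof -
  have "emeasure (density lborel (\<lambda>t. ennreal (d t))) UNIV = (\<integral>\<^sup>+ t. ennreal (d t) \<partial>lborel)"
    using d by (simp add: emeasure_density)
  also have "\<dots> = 1" using nn_integral_eq_integral[OF d(3)] d by simp
  finally have "prob_space (density lborel (\<lambda>t. ennreal (d t)))" by (intro prob_spaceI) simp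
  thus ?thesis by (simp add: real_distribution_def real_distribution_axioms_def)
qed

text \<open>On the imaginary axis the real part of the kernel is odd in \<open>t\<close> and
  integrates to 0, leaving one real Poisson integral.\<close>

lemma cauchy_transform_even_density:
  assumes d: "d \<in> borel_measurable borel" "\<And>t. d t \<ge> 0" "integrable lborel d" "(LBINT t. d t) = 1"
    and even: "\<And>t. d (- t) = d t" and y: "y > 0"
  shows "cauchy_transform (density lborel (\<lambda>t. ennreal (d t))) (\<i> * of_real y)
     = - \<i> * of_real (LBINT t. d t * (y / (t\<^sup>2 + y\<^sup>2)))"
proof -
  let ?M = "density lborel (\<lambda>t. ennreal (d t))"
  interpret real_distribution ?M by (rule real_distribution_density[OF d])
  have z: "Im (\<i> * of_real y) > 0" using y by simp
  have dens: "(LINT t|?M. f t) = (LBINT t. d t * f t)" if "f \<in> borel_measurable borel" for f :: "real \<Rightarrow> real"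
    using integral_density[of f lborel d] d that by simp
  have Re: "Re (1 / (\<i> * of_real y - of_real t)) = - t / (t\<^sup>2 + y\<^sup>2)" for t
    by (simp add: Re_divide power2_eq_square)
  have Im: "Im (1 / (\<i> * of_real y - of_real t)) = - (y / (t\<^sup>2 + y\<^sup>2))" for t
    by (simp add: Im_divide power2_eq_square)
  have "Re (cauchy_transform ?M (\<i> * of_real y)) = (LINT t|?M. Re (1 / (\<i> * of_real y - of_real t)))"
    unfolding cauchy_transform_def using integrable_cauchy_kernel[OF z] by (simp only: integral_Re)
  also have "\<dots> = (LBINT t. d t * (- t / (t\<^sup>2 + y\<^sup>2)))" unfolding Re by (intro dens) measurable
  also have "\<dots> = 0"
  proof -
    have "(LBINT t. d t * (- t / (t\<^sup>2 + y\<^sup>2))) = \<bar>- 1\<bar> *\<^sub>R (LBINT t. d (0 + - 1 * t) * (- (0 + - 1 * t) / ((0 + - 1 * t)\<^sup>2 + y\<^sup>2)))"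
      by (rule lborel_integral_real_affine) simp
    also have "\<dots> = (LBINT t. - (d t * (- t / (t\<^sup>2 + y\<^sup>2))))" by (simp add: even)
    also have "\<dots> = - (LBINT t. d t * (- t / (t\<^sup>2 + y\<^sup>2)))" by (rule Bochner_Integration.integral_minus)
    finally show ?thesis by linarith
  qed
  finally have R: "Re (cauchy_transform ?M (\<i> * of_real y)) = 0" .
  have "Im (cauchy_transform ?M (\<i> * of_real y)) = (LINT t|?M. Im (1 / (\<i> * of_real y - of_real t)))"
    unfolding cauchy_transform_def using integrable_cauchy_kernel[OF z] by (simp only: integral_Im)
  also have "\<dots> = (LBINT t. d t * (- (y / (t\<^sup>2 + y\<^sup>2))))" unfolding Im by (intro dens) measurable
  also have "\<dots> = - (LBINT t. d t * (y / (t\<^sup>2 + y\<^sup>2)))" by simp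
  finally show ?thesis using R by (simp add: complex_eq_iff)
qed

lemma holomorphic_zero_on_imaginary_axis:
  assumes hol: "f holomorphic_on upper_half_plane" and zero: "\<And>y. y > 0 \<Longrightarrow> f (\<i> * of_real y) = 0"
    and z: "Im z > 0"
  shows "f z = 0"
proof (rule analytic_continuation[OF hol open_upper_half_plane connected_upper_half_plane, of "(\<lambda>y. \<i> * of_real y) ` {0<..}" \<i>])
  show "\<i> islimpt (\<lambda>y. \<i> * complex_of_real y) ` {0<..}"
    unfolding islimpt_sequential
  proof (intro exI[of _ "\<lambda>n. \<i> * complex_of_real (1 + 1 / real (Suc n))"] conjI allI)
    fix n
    have "1 + 1 / real (Suc n) \<in> {0<..}" by (simp add: add_pos_pos)
    moreover have "\<i> * complex_of_real (1 + 1 / real (Suc n)) \<noteq> \<i>" by (simp add: complex_eq_iff)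
    ultimately show "\<i> * complex_of_real (1 + 1 / real (Suc n)) \<in> (\<lambda>y. \<i> * complex_of_real y) ` {0<..} - {\<i>}" by blast
  next
    have "(\<lambda>n. 1 / real (Suc n)) \<longlonglongrightarrow> 0" by (rule LIMSEQ_Suc[OF lim_const_over_n])
    hence "(\<lambda>n. \<i> * complex_of_real (1 + 1 / real (Suc n))) \<longlonglongrightarrow> \<i> * complex_of_real (1 + 0)"
      by (intro tendsto_mult tendsto_const tendsto_of_real tendsto_add)
    thus "(\<lambda>n. \<i> * complex_of_real (1 + 1 / real (Suc n))) \<longlonglongrightarrow> \<i>" by simp
  qed
qed (use zero z in auto)

lemma arcsine_distribution_props:
  shows "real_distribution arcsine_distribution"
    and "y > 0 \<Longrightarrow> cauchy_transform arcsine_distribution (\<i> * of_real y) = - \<i> / of_real (sqrt (y\<^sup>2 + 2))"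
proof -
  define d where "d x = indicator {- sqrt 2<..<sqrt 2} x * (1 / (pi * sqrt (2 - x\<^sup>2)))" for x :: real
  have s: "sqrt 2 > (0::real)" "(sqrt 2)\<^sup>2 = (2::real)" by simp_all
  have q: "2 - x\<^sup>2 > 0" if "- sqrt 2 < x" "x < sqrt 2" for x :: real
    using square_less_square_if_between[OF that] by simp
  have d_meas: "d \<in> borel_measurable borel" unfolding d_def by measurable
  have d_nonneg: "d x \<ge> 0" for x using q[of x] by (auto simp: d_def indicator_def)
  have even: "d (- t) = d t" for t by (auto simp: d_def indicator_def)
  note J = arcsin_scaled[OF s(1), unfolded s(2)]
  have mass: "integrable lborel d" "(LBINT t. d t) = 1"
  proof -
    have D: "((\<lambda>x. arcsin (x / sqrt 2) / pi) has_real_derivative 1 / (pi * sqrt (2 - x\<^sup>2))) (at x)"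
      if "- sqrt 2 < x" "x < sqrt 2" for x
      using DERIV_cdivide[OF J(2)[OF that], of pi] by (simp add: mult.commute)
    have C: "isCont (\<lambda>x. 1 / (pi * sqrt (2 - x\<^sup>2))) x" if "- sqrt 2 < x" "x < sqrt 2" for x
      using q[OF that] by (intro continuous_intros) auto
    have N: "1 / (pi * sqrt (2 - x\<^sup>2)) \<ge> 0" if "- sqrt 2 < x" "x < sqrt 2" for x
      using q[OF that] by simp
    note FTC = integral_FTC_nonneg[of "- sqrt 2" "sqrt 2", OF _ _ D C N]
    show "integrable lborel d" "(LBINT t. d t) = 1"
      unfolding d_def using FTC J(1) by (simp_all add: continuous_on_divide)
  qed
  have eq: "arcsine_distribution = density lborel (\<lambda>x. ennreal (d x))"
    unfolding arcsine_distribution_def d_def ..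
  show "real_distribution arcsine_distribution"
    unfolding eq by (rule real_distribution_density[OF d_meas d_nonneg mass])
  assume y: "y > 0"
  define c where "c = sqrt (y\<^sup>2 + 2)"
  have c: "c > 0" by (simp add: c_def add_nonneg_pos)
  note H = arcsin_poisson[OF s(1) y, unfolded s(2)]
  let ?H = "\<lambda>x. arcsin (x * sqrt (y\<^sup>2 + 2) / (sqrt 2 * sqrt (x\<^sup>2 + y\<^sup>2)))"
  have D: "((\<lambda>x. ?H x / (pi * c)) has_real_derivative 1 / (pi * sqrt (2 - x\<^sup>2)) * (y / (x\<^sup>2 + y\<^sup>2))) (at x)"
    if "- sqrt 2 < x" "x < sqrt 2" for x
    using DERIV_cdivide[OF H(4)[OF that], of "pi * c"] c by (simp add: c_def mult_ac)
  have p: "x\<^sup>2 + y\<^sup>2 > 0" for x using y by (simp add: add_nonneg_pos)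
  have C: "isCont (\<lambda>x. 1 / (pi * sqrt (2 - x\<^sup>2)) * (y / (x\<^sup>2 + y\<^sup>2))) x" if "- sqrt 2 < x" "x < sqrt 2" for x
    using q[OF that] p[of x] by (intro continuous_intros) auto
  have N: "1 / (pi * sqrt (2 - x\<^sup>2)) * (y / (x\<^sup>2 + y\<^sup>2)) \<ge> 0" if "- sqrt 2 < x" "x < sqrt 2" for x
    using q[OF that] p[of x] y by simp
  have "(LBINT t. d t * (y / (t\<^sup>2 + y\<^sup>2))) = ?H (sqrt 2) / (pi * c) - ?H (- sqrt 2) / (pi * c)"
    using integral_FTC_nonneg(2)[of "- sqrt 2" "sqrt 2", OF _ _ D C N] H(1) c
    by (simp add: d_def mult.assoc continuous_on_divide del: minus_mult_left)
  also have "\<dots> = 1 / c"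
  proof -
    have h: "?H (sqrt 2) = pi / 2" "?H (- sqrt 2) = - (pi / 2)"
      using H(2,3) by (simp_all only: s(2) power2_minus)
    show ?thesis unfolding h using c by (simp add: field_simps)
  qed
  finally show "cauchy_transform arcsine_distribution (\<i> * of_real y) = - \<i> / of_real (sqrt (y\<^sup>2 + 2))"
    unfolding eq using cauchy_transform_even_density[OF d_meas d_nonneg mass even y]
    by (simp add: c_def divide_inverse)
qed

lemma semicircle_distribution_props:
  shows "real_distribution semicircle_distribution"
    and "y > 0 \<Longrightarrow> cauchy_transform semicircle_distribution (\<i> * of_real y) = - \<i> * of_real ((sqrt (y\<^sup>2 + 4) - y) / 2)"
proof -
  define d where "d x = indicator {- 2..2} x * (1 / (2 * pi) * sqrt (4 - x\<^sup>2))" for x :: real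
  have d_open: "d x = indicator {- 2<..<2} x * (1 / (2 * pi) * sqrt (4 - x\<^sup>2))" for x
    by (auto simp: d_def indicator_def not_less)
  have q: "4 - x\<^sup>2 > 0" if "- 2 < x" "x < 2" for x :: real
    using that abs_square_less_1[of "x / 2"] by (simp add: power_divide)
  have d_meas: "d \<in> borel_measurable borel" unfolding d_def by measurable
  have d_nonneg: "d x \<ge> 0" for x using q[of x] by (auto simp: d_open indicator_def)
  have even: "d (- t) = d t" for t by (auto simp: d_def indicator_def)
  have s: "(2::real) > 0" "(2::real)\<^sup>2 = 4" by simp_all
  note J = arcsin_scaled[OF s(1), unfolded s(2)]
  have mass: "integrable lborel d" "(LBINT t. d t) = 1"
  proof -
    let ?F = "\<lambda>x. (x * sqrt (4 - x\<^sup>2) + 4 * arcsin (x / 2)) / (4 * pi)"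
    have D: "(?F has_real_derivative 1 / (2 * pi) * sqrt (4 - x\<^sup>2)) (at x)" if x: "- 2 < x" "x < 2" for x
    proof -
      note qx = q[OF x]
      have "((\<lambda>x. x * sqrt (4 - x\<^sup>2)) has_real_derivative sqrt (4 - x\<^sup>2) - x\<^sup>2 / sqrt (4 - x\<^sup>2)) (at x)"
        using qx by (auto intro!: derivative_eq_intros simp: field_simps power2_eq_square)
      hence "(?F has_real_derivative ((sqrt (4 - x\<^sup>2) - x\<^sup>2 / sqrt (4 - x\<^sup>2)) + 4 * (1 / sqrt (4 - x\<^sup>2))) / (4 * pi)) (at x)"
        by (intro DERIV_cdivide DERIV_add DERIV_cmult J(2) x)
      also have "(sqrt (4 - x\<^sup>2) - x\<^sup>2 / sqrt (4 - x\<^sup>2)) + 4 * (1 / sqrt (4 - x\<^sup>2)) = 2 * sqrt (4 - x\<^sup>2)"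
      proof -
        have "(4 - x\<^sup>2) / sqrt (4 - x\<^sup>2) = sqrt (4 - x\<^sup>2)" using qx by (simp add: real_div_sqrt)
        thus ?thesis by (simp add: diff_divide_distrib)
      qed
      finally show ?thesis by simp
    qed
    have C: "isCont (\<lambda>x. 1 / (2 * pi) * sqrt (4 - x\<^sup>2)) x" for x by (intro continuous_intros) auto
    have cont: "continuous_on {- 2..2} ?F" by (intro continuous_intros J(1)) auto
    have N: "1 / (2 * pi) * sqrt (4 - x\<^sup>2) \<ge> 0" if "- 2 < x" "x < 2" for x using q[OF that] by simp
    note FTC = integral_FTC_nonneg[of "- 2" 2 ?F, OF _ cont D C N]
    show "integrable lborel d" unfolding d_open by (rule FTC(1)) simp_all
    have "(LBINT t. d t) = ?F 2 - ?F (- 2)" unfolding d_open by (rule FTC(2)) simp_all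
    also have "\<dots> = 1" by (simp add: field_simps)
    finally show "(LBINT t. d t) = 1" .
  qed
  have eq: "semicircle_distribution = density lborel (\<lambda>x. ennreal (d x))"
    unfolding semicircle_distribution_def d_def ..
  show "real_distribution semicircle_distribution"
    unfolding eq by (rule real_distribution_density[OF d_meas d_nonneg mass])
  assume y: "y > 0"
  define c where "c = sqrt (y\<^sup>2 + 4)"
  have c: "c > 0" "c\<^sup>2 = y\<^sup>2 + 4" by (simp_all add: c_def add_nonneg_pos)
  note H = arcsin_poisson[OF s(1) y, unfolded s(2)]
  let ?H = "\<lambda>x. arcsin (x * sqrt (y\<^sup>2 + 4) / (2 * sqrt (x\<^sup>2 + y\<^sup>2)))"
  \<comment> \<open>Writing \<open>4 - x^2 = (y^2 + 4) - (x^2 + y^2)\<close> splits the integrand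
    into a Poisson kernel against \<open>1 / sqrt (4 - x^2)\<close> and a multiple of
    \<open>1 / sqrt (4 - x^2)\<close>, whose antiderivatives are \<open>?H\<close> and the plain
    \<open>arcsin\<close>.\<close>
  let ?F = "\<lambda>x. (c * ?H x - y * arcsin (x / 2)) / (2 * pi)"
  have p: "x\<^sup>2 + y\<^sup>2 > 0" for x using y by (simp add: add_nonneg_pos)
  have D: "(?F has_real_derivative 1 / (2 * pi) * sqrt (4 - x\<^sup>2) * (y / (x\<^sup>2 + y\<^sup>2))) (at x)"
    if x: "- 2 < x" "x < 2" for x
  proof -
    note qx = q[OF x]
    have "(?F has_real_derivative (c * (c * y / ((x\<^sup>2 + y\<^sup>2) * sqrt (4 - x\<^sup>2))) - y * (1 / sqrt (4 - x\<^sup>2))) / (2 * pi)) (at x)"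
      unfolding c_def by (intro DERIV_cdivide DERIV_diff DERIV_cmult J(2) H(4) x)
    also have "c * (c * y / ((x\<^sup>2 + y\<^sup>2) * sqrt (4 - x\<^sup>2))) - y * (1 / sqrt (4 - x\<^sup>2))
       = ((4 - x\<^sup>2) / sqrt (4 - x\<^sup>2)) * (y / (x\<^sup>2 + y\<^sup>2))"
    proof -
      have e: "c * (c * y / ((x\<^sup>2 + y\<^sup>2) * sqrt (4 - x\<^sup>2))) = (y\<^sup>2 + 4) * y / ((x\<^sup>2 + y\<^sup>2) * sqrt (4 - x\<^sup>2))"
        unfolding c(2) [symmetric] by (simp add: power2_eq_square)
      show ?thesis using qx y unfolding e by (simp add: divide_simps) (simp add: algebra_simps)
    qed
    also have "(4 - x\<^sup>2) / sqrt (4 - x\<^sup>2) = sqrt (4 - x\<^sup>2)" using qx by (simp add: real_div_sqrt)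
    finally show ?thesis by (simp add: mult_ac)
  qed
  have C: "isCont (\<lambda>x. 1 / (2 * pi) * sqrt (4 - x\<^sup>2) * (y / (x\<^sup>2 + y\<^sup>2))) x" for x
    using p[of x] by (intro continuous_intros) auto
  have N: "1 / (2 * pi) * sqrt (4 - x\<^sup>2) * (y / (x\<^sup>2 + y\<^sup>2)) \<ge> 0" if "- 2 < x" "x < 2" for x
    using q[OF that] p[of x] y by simp
  have cont: "continuous_on {- 2..2} ?F" by (intro continuous_intros J(1) H(1)) auto
  have "(LBINT t. d t * (y / (t\<^sup>2 + y\<^sup>2))) = ?F 2 - ?F (- 2)"
    using integral_FTC_nonneg(2)[of "- 2" 2 ?F, OF _ cont D C N] by (simp add: d_open mult.assoc)
  also have "\<dots> = (c - y) / 2"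
  proof -
    have h: "?H 2 = pi / 2" "?H (- 2) = - (pi / 2)"
      using H(2,3) by (simp_all only: s(2) power2_minus)
    show ?thesis unfolding h by (simp add: field_simps)
  qed
  finally have I: "(LBINT t. d t * (y / (t\<^sup>2 + y\<^sup>2))) = (c - y) / 2" .
  show "cauchy_transform semicircle_distribution (\<i> * of_real y) = - \<i> * of_real ((sqrt (y\<^sup>2 + 4) - y) / 2)"
    unfolding eq cauchy_transform_even_density[OF d_meas d_nonneg mass even y] I c_def ..
qed

interpretation arcsine: real_distribution arcsine_distribution by (rule arcsine_distribution_props)
interpretation semicircle: real_distribution semicircle_distribution by (rule semicircle_distribution_props)

text \<open>A polynomial identity extends from the imaginary axis without any choice of square root.
  The branch is recovered later from \<open>Im F \<ge> Im z\<close>.\<close>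

lemma cauchy_transform_arcsine:
  assumes z: "Im z > 0" shows "(cauchy_transform arcsine_distribution z)\<^sup>2 * (z\<^sup>2 - 2) = 1"
proof -
  have "(cauchy_transform arcsine_distribution z)\<^sup>2 * (z\<^sup>2 - 2) - 1 = 0"
  proof (rule holomorphic_zero_on_imaginary_axis[OF _ _ z])
    show "(\<lambda>z. (cauchy_transform arcsine_distribution z)\<^sup>2 * (z\<^sup>2 - 2) - 1) holomorphic_on upper_half_plane"
      by (intro holomorphic_intros arcsine.holomorphic_cauchy_transform)
    fix y :: real assume y: "y > 0"
    have "complex_of_real (sqrt (y\<^sup>2 + 2)) ^ 2 = of_real (y\<^sup>2 + 2)"
      by (simp only: of_real_power [symmetric]) simp
    moreover have "of_real (y\<^sup>2 + 2) \<noteq> (0 :: complex)"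
      by (simp only: of_real_eq_0_iff) (simp add: add_nonneg_pos less_imp_neq[symmetric])
    ultimately show "(cauchy_transform arcsine_distribution (\<i> * of_real y))\<^sup>2 * ((\<i> * of_real y)\<^sup>2 - 2) - 1 = 0"
      unfolding arcsine_distribution_props(2)[OF y] by (simp add: power_divide power_mult_distrib field_simps)
  qed
  thus ?thesis by simp
qed

lemma F_transform_arcsine:
  assumes z: "Im z > 0" shows "(F_transform arcsine_distribution z)\<^sup>2 = z\<^sup>2 - 2"
  using cauchy_transform_arcsine[OF z] arcsine.cauchy_transform_nonzero[OF z]
  by (simp add: F_transform_def power_divide field_simps)

lemma cauchy_transform_semicircle:
  assumes z: "Im z > 0"
  shows "(cauchy_transform semicircle_distribution z)\<^sup>2 - z * cauchy_transform semicircle_distribution z + 1 = 0"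
proof (rule holomorphic_zero_on_imaginary_axis[OF _ _ z])
  show "(\<lambda>z. (cauchy_transform semicircle_distribution z)\<^sup>2 - z * cauchy_transform semicircle_distribution z + 1)
      holomorphic_on upper_half_plane"
    by (intro holomorphic_intros semicircle.holomorphic_cauchy_transform)
  fix y :: real assume y: "y > 0"
  define x where "x = (sqrt (y\<^sup>2 + 4) - y) / 2"
  have "2 * x + y = sqrt (y\<^sup>2 + 4)" by (simp add: x_def field_simps)
  hence "(2 * x + y)\<^sup>2 = y\<^sup>2 + 4" by (simp add: add_nonneg_nonneg)
  hence "x\<^sup>2 + y * x = 1" by (simp add: power2_eq_square algebra_simps)
  hence "complex_of_real (x\<^sup>2 + y * x) = 1" by simp
  hence "(of_real x)\<^sup>2 + of_real y * complex_of_real x = 1" by simp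
  thus "(cauchy_transform semicircle_distribution (\<i> * of_real y))\<^sup>2
     - \<i> * of_real y * cauchy_transform semicircle_distribution (\<i> * of_real y) + 1 = 0"
    unfolding semicircle_distribution_props(2)[OF y] x_def [symmetric]
    by (simp add: power_mult_distrib algebra_simps)
qed

lemma F_transform_semicircle:
  assumes z: "Im z > 0"
  shows "F_transform semicircle_distribution z + 1 / F_transform semicircle_distribution z = z"
proof -
  let ?G = "cauchy_transform semicircle_distribution z"
  have "?G \<noteq> 0" by (rule semicircle.cauchy_transform_nonzero[OF z])
  moreover have "?G * (1 / ?G + ?G) = ?G * z"
    using cauchy_transform_semicircle[OF z] \<open>?G \<noteq> 0\<close> by (simp add: power2_eq_square algebra_simps)
  ultimately show ?thesis by (simp add: F_transform_def)
qed

subsection \<open>Gaussian increments\<close>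

text \<open>The condition through which the three domains of attraction are compared:
  for \<open>M n = dilation (1 / B n) \<mu>\<close> it does not refer to any of the convolutions.\<close>

definition gaussian_increments :: "(nat \<Rightarrow> real measure) \<Rightarrow> complex \<Rightarrow> bool" where
  "gaussian_increments M z \<longleftrightarrow> (\<lambda>n. of_nat n * (F_transform (M n) z - z)) \<longlonglongrightarrow> - 1 / z"

lemma of_nat_mult_tendsto_imp_tendsto_0:
  fixes f :: "nat \<Rightarrow> complex"
  assumes "(\<lambda>n. of_nat n * f n) \<longlonglongrightarrow> l"
  shows "f \<longlonglongrightarrow> 0"
proof -
  have "(\<lambda>n. (1 / of_nat n) * (of_nat n * f n)) \<longlonglongrightarrow> 0 * l"
    by (intro tendsto_mult assms lim_1_over_n)
  moreover have "\<forall>\<^sub>F n in sequentially. (1 / of_nat n) * (of_nat n * f n) = f n"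
    using eventually_gt_at_top[of 0] by eventually_elim simp
  ultimately show ?thesis by (simp add: Lim_transform_eventually)
qed

text \<open>With \<open>w = z G\<close> one has \<open>F - z = - z (w - 1) / w\<close>, and
  \<open>w\<close> tends to 1 under either condition. The right-hand condition is linear in the
  measure, which opens it to integral estimates.\<close>

lemma gaussian_increments_iff:
  assumes M: "\<And>n. real_distribution (M n)" and z: "Im z > 0"
  shows "gaussian_increments M z \<longleftrightarrow> (\<lambda>n. of_nat n * (LINT t|M n. of_real t / (z - of_real t))) \<longlonglongrightarrow> 1 / z\<^sup>2"
proof -
  have z0: "z \<noteq> 0" using z by auto
  define w where "w n = z * cauchy_transform (M n) z" for n
  define h where "h n = F_transform (M n) z - z" for n
  have w1: "(LINT t|M n. of_real t / (z - of_real t)) = w n - 1" for n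
    using real_distribution.cauchy_transform_minus_one(2)[OF M z] by (simp add: w_def)
  have w0: "w n \<noteq> 0" for n using real_distribution.cauchy_transform_nonzero[OF M z] z0 by (simp add: w_def)
  have hw: "h n = - z * (w n - 1) / w n" for n
  proof -
    have "F_transform (M n) z = z / w n" using z0 by (simp add: w_def F_transform_def)
    thus ?thesis using w0[of n] by (simp add: h_def field_simps)
  qed
  have zh: "z + h n = z / w n" for n using w0[of n] by (simp add: hw field_simps)
  have wh: "w n - 1 = - h n / (z + h n)" for n unfolding zh hw using w0[of n] z0 by (simp add: field_simps)
  show ?thesis unfolding gaussian_increments_def w1 h_def [symmetric]
  proof
    assume L: "(\<lambda>n. of_nat n * h n) \<longlonglongrightarrow> - 1 / z"
    have "h \<longlonglongrightarrow> 0" by (rule of_nat_mult_tendsto_imp_tendsto_0[OF L])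
    hence "(\<lambda>n. - (of_nat n * h n) / (z + h n)) \<longlonglongrightarrow> - (- 1 / z) / (z + 0)"
      using z0 by (intro tendsto_intros L) auto
    thus "(\<lambda>n. of_nat n * (w n - 1)) \<longlonglongrightarrow> 1 / z\<^sup>2"
      unfolding wh using z0 by (simp add: power2_eq_square)
  next
    assume L: "(\<lambda>n. of_nat n * (w n - 1)) \<longlonglongrightarrow> 1 / z\<^sup>2"
    have "(\<lambda>n. w n - 1) \<longlonglongrightarrow> 0" by (rule of_nat_mult_tendsto_imp_tendsto_0[OF L])
    hence "w \<longlonglongrightarrow> 1" by (simp add: LIM_zero_iff)
    hence "(\<lambda>n. - z * (of_nat n * (w n - 1)) / w n) \<longlonglongrightarrow> - z * (1 / z\<^sup>2) / 1"
      by (intro tendsto_intros L) auto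
    thus "(\<lambda>n. of_nat n * h n) \<longlonglongrightarrow> - 1 / z"
      unfolding hw using z0 by (simp add: power2_eq_square mult_ac)
  qed
qed

text \<open>Two points of the imaginary axis give \<open>n \<integral> t\<^sup>2 / (t\<^sup>2 + y\<^sup>2) d\<mu>\<^sub>n \<rightarrow> 1 / y\<^sup>2\<close> for two values of \<open>y\<close>, and the
  combination of the two integrals in which the limit cancels shows that the fourth order part is negligible.\<close>

lemma integral_tendsto_second_order:
  fixes f :: "real \<Rightarrow> complex"
  assumes M: "\<And>n. real_distribution (M n)"
    and y: "y1 > 0" "y2 > 0" "y1 \<noteq> y2"
    and G: "gaussian_increments M (\<i> * of_real y1)" "gaussian_increments M (\<i> * of_real y2)"
    and f: "f \<in> borel_measurable borel" "\<And>t. norm (f t) \<le> B"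
      "\<And>t. norm (f t - a * of_real t - c * of_real (t\<^sup>2)) \<le> C * \<bar>t\<bar> ^ 3"
  shows "(\<lambda>n. of_nat n * (LINT t|M n. f t)) \<longlonglongrightarrow> c"
proof -
  define q where "q y t = t\<^sup>2 / (t\<^sup>2 + y\<^sup>2)" for y t :: real
  define s where "s y t = t / (t\<^sup>2 + y\<^sup>2)" for y t :: real
  have den: "t\<^sup>2 + y\<^sup>2 > 0" if "y > 0" for t y :: real using that by (simp add: add_nonneg_pos)
  have q_bound: "\<bar>q y t\<bar> \<le> 1" "q y t \<ge> 0" if "y > 0" for y t using den[OF that, of t] by (auto simp: q_def)
  have s_bound: "\<bar>s y t\<bar> \<le> 1 / y" if "y > 0" for y t
  proof -
    have "0 \<le> (\<bar>t\<bar> - y)\<^sup>2" by simp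
    hence "2 * \<bar>t\<bar> * y \<le> t\<^sup>2 + y\<^sup>2" by (simp add: power2_diff)
    hence "\<bar>t\<bar> * y \<le> t\<^sup>2 + y\<^sup>2" using that mult_nonneg_nonneg[of "\<bar>t\<bar>" y] by linarith
    thus ?thesis using den[OF that, of t] that by (simp add: s_def field_simps)
  qed
  have int: "integrable (M n) g" if "g \<in> borel_measurable borel" "\<And>t. \<bar>g t\<bar> \<le> K" for g :: "real \<Rightarrow> real" and K n
    using real_distribution.integrable_bounded_real[OF M that] .
  have intc: "integrable (M n) g" if "g \<in> borel_measurable borel" "\<And>t. norm (g t) \<le> K" for g :: "real \<Rightarrow> complex" and K n
    using real_distribution.integrable_bounded_complex[OF M that] .
  have q_int: "integrable (M n) (q y)" if "y > 0" for n y
    using q_bound[OF that] by (intro int[of _ 1]) (simp_all add: q_def[abs_def])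
  have s_int: "integrable (M n) (s y)" if "y > 0" for n y
    using s_bound[OF that] by (intro int[of _ "1 / y"]) (simp_all add: s_def[abs_def])
  have lims: "(\<lambda>n. real n * (LINT t|M n. q y t)) \<longlonglongrightarrow> 1 / y\<^sup>2" "(\<lambda>n. real n * (LINT t|M n. s y t)) \<longlonglongrightarrow> 0"
    if y: "y > 0" and G: "gaussian_increments M (\<i> * of_real y)" for y
  proof -
    let ?z = "\<i> * complex_of_real y"
    have z: "Im ?z > 0" using y by simp
    have L: "(\<lambda>n. of_nat n * (LINT t|M n. of_real t / (?z - of_real t))) \<longlonglongrightarrow> 1 / ?z\<^sup>2"
      using G gaussian_increments_iff[OF M z] by simp
    have Re: "Re (of_real t / (?z - of_real t)) = - q y t" for t
      by (simp add: q_def Re_divide power2_eq_square)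
    have Im: "Im (of_real t / (?z - of_real t)) = - y * s y t" for t
      by (simp add: s_def Im_divide power2_eq_square mult_ac)
    note k = real_distribution.cauchy_transform_minus_one(1)[OF M z]
    have "Re (of_nat n * (LINT t|M n. of_real t / (?z - of_real t))) = - (real n * (LINT t|M n. q y t))" for n
    proof -
      have "Re (LINT t|M n. of_real t / (?z - of_real t)) = - (LINT t|M n. q y t)"
        unfolding integral_Re[OF k, symmetric] Re by (rule Bochner_Integration.integral_minus)
      thus ?thesis by (simp only: times_complex.sel complex_Re_of_nat complex_Im_of_nat mult_zero_left diff_zero mult_minus_right)
    qed
    hence "(\<lambda>n. - (real n * (LINT t|M n. q y t))) \<longlonglongrightarrow> - (1 / y\<^sup>2)"
      using tendsto_Re[OF L] by (simp add: power_mult_distrib)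
    thus "(\<lambda>n. real n * (LINT t|M n. q y t)) \<longlonglongrightarrow> 1 / y\<^sup>2" using tendsto_minus by fastforce
    have "Im (of_nat n * (LINT t|M n. of_real t / (?z - of_real t))) = - y * (real n * (LINT t|M n. s y t))" for n
    proof -
      have "Im (LINT t|M n. of_real t / (?z - of_real t)) = - y * (LINT t|M n. s y t)"
        unfolding integral_Im[OF k, symmetric] Im by (rule integral_mult_right_zero)
      thus ?thesis by (simp only: times_complex.sel complex_Re_of_nat complex_Im_of_nat mult_zero_left add_0_right mult.left_commute)
    qed
    hence "(\<lambda>n. - y * (real n * (LINT t|M n. s y t))) \<longlonglongrightarrow> 0"
      using tendsto_Im[OF L] by (simp add: power_mult_distrib)
    from tendsto_mult[OF tendsto_const[of "- 1 / y"] this]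
    show "(\<lambda>n. real n * (LINT t|M n. s y t)) \<longlonglongrightarrow> 0" using y by simp
  qed
  define p where "p t = q y1 t * q y2 t" for t
  have p_eq: "p t = (y1\<^sup>2 * q y1 t - y2\<^sup>2 * q y2 t) / (y1\<^sup>2 - y2\<^sup>2)" for t
  proof -
    have "X / (X + a) * (X / (X + b)) = (a * (X / (X + a)) - b * (X / (X + b))) / (a - b)"
      if "X + a > 0" "X + b > 0" "a \<noteq> b" for X a b :: real
      using that by (simp add: divide_simps) (simp add: algebra_simps)
    moreover have "y1\<^sup>2 \<noteq> y2\<^sup>2" using y by (simp add: power2_eq_iff)
    ultimately show ?thesis using den[OF y(1), of t] den[OF y(2), of t] unfolding p_def q_def by blast
  qed
  have p_lim: "(\<lambda>n. real n * (LINT t|M n. p t)) \<longlonglongrightarrow> 0"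
  proof -
    have "(LINT t|M n. p t) = (y1\<^sup>2 * (LINT t|M n. q y1 t) - y2\<^sup>2 * (LINT t|M n. q y2 t)) / (y1\<^sup>2 - y2\<^sup>2)" for n
      unfolding p_eq using q_int[OF y(1), of n] q_int[OF y(2), of n] by simp
    hence eq: "real n * (LINT t|M n. p t)
      = (y1\<^sup>2 * (real n * (LINT t|M n. q y1 t)) - y2\<^sup>2 * (real n * (LINT t|M n. q y2 t))) / (y1\<^sup>2 - y2\<^sup>2)" for n
      by (simp add: right_diff_distrib mult_ac)
    have "(\<lambda>n. (y1\<^sup>2 * (real n * (LINT t|M n. q y1 t)) - y2\<^sup>2 * (real n * (LINT t|M n. q y2 t))) / (y1\<^sup>2 - y2\<^sup>2))
      \<longlonglongrightarrow> (y1\<^sup>2 * (1 / y1\<^sup>2) - y2\<^sup>2 * (1 / y2\<^sup>2)) / (y1\<^sup>2 - y2\<^sup>2)"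
      using y by (intro tendsto_intros lims G) (auto simp: power2_eq_iff)
    thus ?thesis unfolding eq using y by simp
  qed
  have p_bound: "\<bar>p t\<bar> \<le> 1" for t
    unfolding p_def abs_mult using q_bound[OF y(1), of t] q_bound[OF y(2), of t] by (intro mult_le_one) auto
  have p_int: "integrable (M n) p" for n
    using p_bound by (intro int[of _ 1]) (auto simp: p_def[abs_def] q_def)
  \<comment> \<open>Near 0 the bounded functions \<open>y1^2 s\<close> and \<open>y1^2 q\<close>
    agree with \<open>t\<close> and \<open>t^2\<close> up to cubic errors. Subtracting them leaves a
    bounded remainder of third order, while their own scaled integrals have known limits 0 and
    1.\<close>
  define \<rho> where "\<rho> t = f t - a * of_real (y1\<^sup>2) * of_real (s y1 t) - c * of_real (y1\<^sup>2) * of_real (q y1 t)" for t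
  have \<rho>_meas: "\<rho> \<in> borel_measurable borel" unfolding \<rho>_def[abs_def] s_def q_def using f(1) by measurable
  define K where "K = B + norm a * y1 + norm c * y1\<^sup>2"
  have \<rho>_bound: "norm (\<rho> t) \<le> K" for t
  proof -
    have "norm (\<rho> t) \<le> norm (f t) + norm (a * of_real (y1\<^sup>2) * of_real (s y1 t)) + norm (c * of_real (y1\<^sup>2) * of_real (q y1 t))"
      unfolding \<rho>_def by (rule order_trans[OF norm_triangle_ineq4 add_right_mono[OF norm_triangle_ineq4]])
    also have "norm (a * of_real (y1\<^sup>2) * of_real (s y1 t)) = norm a * y1\<^sup>2 * \<bar>s y1 t\<bar>" by (simp add: norm_mult norm_power)
    also have "\<dots> \<le> norm a * y1\<^sup>2 * (1 / y1)" using s_bound[OF y(1), of t] by (intro mult_left_mono) auto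
    also have "\<dots> = norm a * y1" using y by (simp add: power2_eq_square)
    also have "norm (c * of_real (y1\<^sup>2) * of_real (q y1 t)) = norm c * y1\<^sup>2 * \<bar>q y1 t\<bar>" by (simp add: norm_mult norm_power)
    also have "\<dots> \<le> norm c * y1\<^sup>2 * 1" using q_bound[OF y(1), of t] by (intro mult_left_mono) auto
    finally show ?thesis using f(2)[of t] by (simp add: K_def)
  qed
  have K0: "K \<ge> 0" using order_trans[OF norm_ge_zero \<rho>_bound] .
  define C' where "C' = \<bar>C\<bar> + norm a / y1\<^sup>2 + norm c / y1\<^sup>2"
  have C'0: "C' \<ge> 0" by (simp add: C'_def)
  have \<rho>_small: "norm (\<rho> t) \<le> C' * \<bar>t\<bar> ^ 3" if t: "\<bar>t\<bar> \<le> 1" for t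
  proof -
    have q_le: "\<bar>q y1 t\<bar> \<le> t\<^sup>2 / y1\<^sup>2" using den[OF y(1), of t] y(1) by (auto simp: q_def intro!: frac_le)
    have id: "t - y1\<^sup>2 * s y1 t = t * q y1 t" "t\<^sup>2 - y1\<^sup>2 * q y1 t = t\<^sup>2 * q y1 t"
      using den[OF y(1), of t]
      by (simp_all add: s_def q_def divide_simps) (simp_all add: algebra_simps power2_eq_square power4_eq_xxxx)
    have "\<rho> t = (f t - a * of_real t - c * of_real (t\<^sup>2)) + a * of_real (t - y1\<^sup>2 * s y1 t) + c * of_real (t\<^sup>2 - y1\<^sup>2 * q y1 t)"
      by (simp add: \<rho>_def algebra_simps)
    hence "\<rho> t = (f t - a * of_real t - c * of_real (t\<^sup>2)) + a * of_real (t * q y1 t) + c * of_real (t\<^sup>2 * q y1 t)"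
      unfolding id .
    hence "norm (\<rho> t) \<le> norm (f t - a * of_real t - c * of_real (t\<^sup>2)) + norm (a * of_real (t * q y1 t)) + norm (c * of_real (t\<^sup>2 * q y1 t))"
      by (metis norm_triangle_le add_right_mono norm_triangle_ineq)
    also have "\<dots> \<le> \<bar>C\<bar> * \<bar>t\<bar> ^ 3 + (norm a / y1\<^sup>2) * \<bar>t\<bar> ^ 3 + (norm c / y1\<^sup>2) * \<bar>t\<bar> ^ 3"
    proof (intro add_mono)
      show "norm (f t - a * of_real t - c * of_real (t\<^sup>2)) \<le> \<bar>C\<bar> * \<bar>t\<bar> ^ 3"
        by (rule order_trans[OF f(3)]) (intro mult_right_mono, auto)
      have "norm (a * of_real (t * q y1 t)) = norm a * (\<bar>t\<bar> * \<bar>q y1 t\<bar>)" by (simp add: norm_mult abs_mult)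
      also have "\<dots> \<le> norm a * (\<bar>t\<bar> * (t\<^sup>2 / y1\<^sup>2))" using q_le by (intro mult_left_mono) auto
      also have "\<dots> = (norm a / y1\<^sup>2) * \<bar>t\<bar> ^ 3" by (simp add: power2_eq_square power3_eq_cube)
      finally show "norm (a * of_real (t * q y1 t)) \<le> (norm a / y1\<^sup>2) * \<bar>t\<bar> ^ 3" .
      have "norm (c * of_real (t\<^sup>2 * q y1 t)) = norm c * (\<bar>t\<bar> * \<bar>t\<bar> * \<bar>q y1 t\<bar>)"
        by (simp add: norm_mult abs_mult power2_eq_square)
      also have "\<dots> \<le> norm c * (1 * \<bar>t\<bar> * (t\<^sup>2 / y1\<^sup>2))" using q_le t by (intro mult_left_mono mult_mono) auto
      also have "\<dots> = (norm c / y1\<^sup>2) * \<bar>t\<bar> ^ 3" by (simp add: power2_eq_square power3_eq_cube)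
      finally show "norm (c * of_real (t\<^sup>2 * q y1 t)) \<le> (norm c / y1\<^sup>2) * \<bar>t\<bar> ^ 3" .
    qed
    finally show ?thesis by (simp add: C'_def algebra_simps)
  qed
  have \<rho>_lim: "(\<lambda>n. of_nat n * (LINT t|M n. \<rho> t)) \<longlonglongrightarrow> 0"
  proof (rule tendstoI)
    fix \<epsilon> :: real assume e: "\<epsilon> > 0"
    define D where "D = C' * (1 + y1\<^sup>2) * (1 / y1\<^sup>2 + 1) + 1"
    have D: "D > 0" using C'0 y by (simp add: D_def add_nonneg_pos)
    define \<delta> where "\<delta> = min 1 (\<epsilon> / (2 * D))"
    have \<delta>: "0 < \<delta>" "\<delta> \<le> 1" "\<delta> * D \<le> \<epsilon> / 2"
    proof -
      have "\<delta> \<le> \<epsilon> / (2 * D)" by (simp add: \<delta>_def)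
      thus "\<delta> * D \<le> \<epsilon> / 2" using D by (simp add: field_simps)
    qed (use e D in \<open>auto simp: \<delta>_def\<close>)
    have p\<delta>: "p \<delta> > 0" using \<delta> y by (simp add: p_def q_def add_pos_pos)
    define K' where "K' = K / p \<delta>"
    have K'0: "K' \<ge> 0" using K0 p\<delta> by (simp add: K'_def)
    \<comment> \<open>Inside \<open>|t| < \<delta>\<close> the cubic bound supplies a factor
      \<open>\<delta>\<close> in front of \<open>q y1\<close>, whose scaled integral converges.
      Outside, the remainder is bounded and \<open>p\<close> is at least \<open>p \<delta>\<close>,
      so it is dominated by \<open>p\<close>, whose scaled integral tends to 0.\<close>
    have \<rho>_le: "norm (\<rho> t) \<le> \<delta> * (C' * (1 + y1\<^sup>2)) * q y1 t + K' * p t" for t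
    proof (cases "\<bar>t\<bar> < \<delta>")
      case True
      hence t1: "\<bar>t\<bar> \<le> 1" using \<delta> by simp
      have "t\<^sup>2 \<le> 1" using t1 by (simp add: abs_square_le_1)
      hence "t\<^sup>2 + y1\<^sup>2 \<le> 1 + y1\<^sup>2" by simp
      hence "q y1 t * (t\<^sup>2 + y1\<^sup>2) \<le> q y1 t * (1 + y1\<^sup>2)" using q_bound[OF y(1), of t] by (intro mult_left_mono) auto
      moreover have "q y1 t * (t\<^sup>2 + y1\<^sup>2) = t\<^sup>2" using y(1) by (simp add: q_def)
      ultimately have t2: "t\<^sup>2 \<le> (1 + y1\<^sup>2) * q y1 t" by (simp only: mult.commute)
      have "norm (\<rho> t) \<le> C' * \<bar>t\<bar> ^ 3" by (rule \<rho>_small[OF t1])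
      also have "\<dots> = C' * (\<bar>t\<bar> * t\<^sup>2)" by (simp add: power3_eq_cube power2_eq_square)
      also have "\<dots> \<le> C' * (\<delta> * ((1 + y1\<^sup>2) * q y1 t))"
        using t2 True C'0 \<delta> by (intro mult_left_mono mult_mono) auto
      also have "\<dots> = \<delta> * (C' * (1 + y1\<^sup>2)) * q y1 t" by simp
      also have "\<dots> \<le> \<dots> + K' * p t"
        using K'0 q_bound[OF y(1), of t] q_bound[OF y(2), of t] by (simp add: p_def)
      finally show ?thesis .
    next
      case False
      have mono: "q y \<delta> \<le> q y t" if "y > 0" for y
      proof -
        have "\<delta>\<^sup>2 \<le> t\<^sup>2" using False \<delta> by (simp add: abs_le_square_iff [symmetric])
        hence "\<delta>\<^sup>2 * y\<^sup>2 \<le> t\<^sup>2 * y\<^sup>2" by (intro mult_right_mono) auto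
        thus ?thesis using den[OF that, of t] den[OF that, of \<delta>] by (simp add: q_def divide_simps) (simp add: algebra_simps)
      qed
      have "p \<delta> \<le> p t" unfolding p_def
        by (intro mult_mono mono y q_bound(2))
      hence "K \<le> K' * p t" using K0 p\<delta> by (simp add: K'_def field_simps mult_left_mono)
      moreover have "\<delta> * (C' * (1 + y1\<^sup>2)) * q y1 t \<ge> 0" using \<delta> C'0 q_bound[OF y(1), of t] by simp
      ultimately show ?thesis using \<rho>_bound[of t] by linarith
    qed
    let ?U = "\<lambda>n. \<delta> * (C' * (1 + y1\<^sup>2)) * (real n * (LINT t|M n. q y1 t)) + K' * (real n * (LINT t|M n. p t))"
    have est: "norm (of_nat n * (LINT t|M n. \<rho> t)) \<le> ?U n" for n
    proof -
      have "norm (LINT t|M n. \<rho> t) \<le> (LINT t|M n. norm (\<rho> t))" by (rule integral_norm_bound)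
      also have "\<dots> \<le> (LINT t|M n. \<delta> * (C' * (1 + y1\<^sup>2)) * q y1 t + K' * p t)"
        by (intro integral_mono integrable_norm intc[OF \<rho>_meas \<rho>_bound] Bochner_Integration.integrable_add
            integrable_mult_right q_int p_int y \<rho>_le)
      also have "\<dots> = \<delta> * (C' * (1 + y1\<^sup>2)) * (LINT t|M n. q y1 t) + K' * (LINT t|M n. p t)"
        using q_int[OF y(1), of n] p_int[of n] by simp
      finally have "real n * norm (LINT t|M n. \<rho> t) \<le> real n * (\<delta> * (C' * (1 + y1\<^sup>2)) * (LINT t|M n. q y1 t) + K' * (LINT t|M n. p t))"
        by (intro mult_left_mono) auto
      thus ?thesis by (simp add: norm_mult algebra_simps)
    qed
    have "?U \<longlonglongrightarrow> \<delta> * (C' * (1 + y1\<^sup>2)) * (1 / y1\<^sup>2) + K' * 0" by (intro tendsto_intros lims p_lim y G)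
    moreover have "\<delta> * (C' * (1 + y1\<^sup>2)) * (1 / y1\<^sup>2) + K' * 0 < \<epsilon>"
    proof -
      have "C' * (1 + y1\<^sup>2) * (1 / y1\<^sup>2) \<le> D" using C'0 y by (simp add: D_def algebra_simps add_nonneg_nonneg)
      hence "\<delta> * (C' * (1 + y1\<^sup>2) * (1 / y1\<^sup>2)) \<le> \<delta> * D" using \<delta> by (intro mult_left_mono) auto
      thus ?thesis using \<delta> e by simp
    qed
    ultimately have "\<forall>\<^sub>F n in sequentially. ?U n < \<epsilon>" by (rule order_tendstoD)
    thus "\<forall>\<^sub>F n in sequentially. dist (of_nat n * (LINT t|M n. \<rho> t)) 0 < \<epsilon>"
      by eventually_elim (use est in \<open>auto intro: le_less_trans\<close>)
  qed
  have split: "of_nat n * (LINT t|M n. f t) = a * of_real (y1\<^sup>2) * of_real (real n * (LINT t|M n. s y1 t))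
      + c * of_real (y1\<^sup>2) * of_real (real n * (LINT t|M n. q y1 t)) + of_nat n * (LINT t|M n. \<rho> t)" for n
  proof -
    have si: "integrable (M n) (\<lambda>t. complex_of_real (s y1 t))" "integrable (M n) (\<lambda>t. complex_of_real (q y1 t))"
      using s_int[OF y(1), of n] q_int[OF y(1), of n] by (simp_all add: integrable_of_real)
    have fi: "integrable (M n) f" by (rule intc[OF f(1,2)])
    have "(LINT t|M n. \<rho> t) = (LINT t|M n. f t) - a * of_real (y1\<^sup>2) * (LINT t|M n. of_real (s y1 t))
        - c * of_real (y1\<^sup>2) * (LINT t|M n. of_real (q y1 t))"
      unfolding \<rho>_def using si fi by simp
    hence "(LINT t|M n. f t) = (LINT t|M n. \<rho> t) + a * of_real (y1\<^sup>2) * of_real (LINT t|M n. s y1 t)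
        + c * of_real (y1\<^sup>2) * of_real (LINT t|M n. q y1 t)"
      by (simp add: integral_of_real[of "M n"] algebra_simps)
    thus ?thesis by (simp only: of_real_mult of_real_of_nat_eq) (simp add: algebra_simps)
  qed
  have "(\<lambda>n. a * of_real (y1\<^sup>2) * of_real (real n * (LINT t|M n. s y1 t))
      + c * of_real (y1\<^sup>2) * of_real (real n * (LINT t|M n. q y1 t)) + of_nat n * (LINT t|M n. \<rho> t))
      \<longlonglongrightarrow> a * of_real (y1\<^sup>2) * of_real 0 + c * of_real (y1\<^sup>2) * of_real (1 / y1\<^sup>2) + 0"
    by (intro tendsto_add tendsto_mult tendsto_const tendsto_of_real \<rho>_lim lims[OF y(1) G(1)])
  moreover have "a * of_real (y1\<^sup>2) * of_real 0 + c * of_real (y1\<^sup>2) * of_real (1 / y1\<^sup>2) + 0 = c"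
    using y by simp
  ultimately show ?thesis unfolding split by (simp only:)
qed

text \<open>The kernel expands as \<open>t / (z - t) = t / z + t^2 / z^2 + O(|t|^3)\<close>, so the
  second order limit applies with \<open>c = 1 / z^2\<close>.\<close>

lemma gaussian_increments_everywhere:
  assumes M: "\<And>n. real_distribution (M n)"
    and y: "y1 > 0" "y2 > 0" "y1 \<noteq> y2"
    and G: "gaussian_increments M (\<i> * of_real y1)" "gaussian_increments M (\<i> * of_real y2)"
    and z: "Im z > 0"
  shows "gaussian_increments M z"
proof -
  have z0: "z \<noteq> 0" using z by auto
  have "(\<lambda>n. of_nat n * (LINT t|M n. of_real t / (z - of_real t))) \<longlonglongrightarrow> 1 / z\<^sup>2"
  proof (rule integral_tendsto_second_order[OF M y G, where B = "norm z / Im z + 1" and a = "1 / z" and C = "1 / ((norm z)\<^sup>2 * Im z)"])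
    fix t :: real
    have d: "z - of_real t \<noteq> 0" "norm (z - of_real t) \<ge> Im z"
      using diff_of_real_nonzero[OF z] norm_diff_of_real_ge[OF z] by auto
    have "of_real t / (z - of_real t) = z * (1 / (z - of_real t)) - 1" using d by (simp add: divide_simps)
    hence "norm (of_real t / (z - of_real t)) \<le> norm (z * (1 / (z - of_real t))) + norm (1 :: complex)"
      by (metis norm_triangle_ineq4)
    also have "norm (z * (1 / (z - of_real t))) \<le> norm z * (1 / Im z)"
      unfolding norm_mult by (intro mult_left_mono norm_inverse_diff_of_real_le z) auto
    finally show "norm (of_real t / (z - of_real t)) \<le> norm z / Im z + 1" by simp
    have "of_real t / (z - of_real t) - 1 / z * of_real t - 1 / z\<^sup>2 * of_real (t\<^sup>2) = of_real t ^ 3 / (z\<^sup>2 * (z - of_real t))"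
      using d z0 by (simp add: divide_simps) (simp add: algebra_simps power2_eq_square power3_eq_cube)
    also have "norm \<dots> = \<bar>t\<bar> ^ 3 / ((norm z)\<^sup>2 * norm (z - of_real t))"
      by (simp add: norm_divide norm_mult norm_power)
    also have "\<dots> \<le> \<bar>t\<bar> ^ 3 / ((norm z)\<^sup>2 * Im z)" using d z z0 by (intro frac_le mult_left_mono) auto
    finally show "norm (of_real t / (z - of_real t) - 1 / z * of_real t - 1 / z\<^sup>2 * of_real (t\<^sup>2)) \<le> 1 / ((norm z)\<^sup>2 * Im z) * \<bar>t\<bar> ^ 3"
      by simp
  qed measurable
  thus ?thesis using gaussian_increments_iff[OF M z] by simp
qed

subsection \<open>The classical central limit theorem\<close>

lemma real_distribution_convolution:
  assumes "real_distribution M" "real_distribution N"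
  shows "real_distribution (convolution M N)"
    and "char (convolution M N) t = char M t * char N t"
proof -
  interpret M: real_distribution M by fact
  interpret N: real_distribution N by fact
  interpret P: pair_prob_space M N ..
  have meas: "(\<lambda>(x, y). x + y) \<in> measurable (M \<Otimes>\<^sub>M N) (borel :: real measure)" by measurable
  have "prob_space (convolution M N)" unfolding convolution_def by (rule P.prob_space_distr[OF meas])
  thus "real_distribution (convolution M N)"
    by (simp add: real_distribution_def real_distribution_axioms_def)
  have int: "integrable (M \<Otimes>\<^sub>M N) (\<lambda>(x, y). iexp (t * x) * iexp (t * y))"
    by (rule P.integrable_const_bound[where B = 1]) (auto simp: norm_mult split_beta)
  have "char (convolution M N) t = (LINT p|(M \<Otimes>\<^sub>M N). iexp (t * (case p of (x, y) \<Rightarrow> x + y)))"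
    unfolding char_def convolution_def by (rule integral_distr[OF meas]) measurable
  also have "\<dots> = (LINT p|(M \<Otimes>\<^sub>M N). (case p of (x, y) \<Rightarrow> iexp (t * x) * iexp (t * y)))"
    by (rule Bochner_Integration.integral_cong) (auto simp: ring_distribs exp_add)
  also have "\<dots> = (LINT x|M. LINT y|N. iexp (t * x) * iexp (t * y))"
    using P.integral_fst'[OF int] by simp
  also have "\<dots> = char M t * char N t" unfolding char_def by simp
  finally show "char (convolution M N) t = char M t * char N t" .
qed

lemma classical_convolution_power:
  assumes M: "real_distribution M"
  shows "real_distribution (convolution_power convolution M n)"
    and "char (convolution_power convolution M n) t = char M t ^ n"
proof -
  have "real_distribution (convolution_power convolution M n) \<and> (\<forall>t. char (convolution_power convolution M n) t = char M t ^ n)"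
  proof (induction n)
    case 0
    show ?case by (simp add: convolution_power_def real_distribution_return_0 char_def integral_return)
  next
    case (Suc n)
    thus ?case using real_distribution_convolution[OF M, of "convolution_power convolution M n"]
      by (simp add: convolution_power_def)
  qed
  thus "real_distribution (convolution_power convolution M n)"
    and "char (convolution_power convolution M n) t = char M t ^ n" by auto
qed

lemma (in real_distribution) char_dilation: "char (dilation b M) t = char M (b * t)"
  unfolding char_def dilation_def by (subst integral_distr) (auto simp: mult_ac)

text \<open>Second order limit for the kernel \<open>iexp (s t) - 1\<close>, whose quadratic
  coefficient is \<open>- s^2 / 2\<close>.\<close>

lemma char_gaussian_increments:
  assumes M: "\<And>n. real_distribution (M n)"
    and G: "\<And>y. y > 0 \<Longrightarrow> gaussian_increments M (\<i> * of_real y)"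
  shows "(\<lambda>n. of_nat n * (char (M n) s - 1)) \<longlonglongrightarrow> - of_real (s\<^sup>2 / 2)"
proof -
  have "(\<lambda>n. of_nat n * (LINT t|M n. iexp (s * t) - 1)) \<longlonglongrightarrow> - of_real (s\<^sup>2 / 2)"
  proof (rule integral_tendsto_second_order[OF M, of 1 2, where B = 2 and a = "\<i> * of_real s" and C = "\<bar>s\<bar> ^ 3"])
    fix t :: real
    show "norm (iexp (s * t) - 1) \<le> 2" using norm_triangle_ineq4[of "iexp (s * t)" 1] by simp
    have "norm (iexp (s * t) - (\<Sum>k \<le> 2. (\<i> * of_real (s * t)) ^ k / fact k)) \<le> \<bar>s * t\<bar> ^ Suc 2 / fact (Suc 2)"
      by (rule iexp_approx1)
    also have "\<dots> \<le> \<bar>s * t\<bar> ^ 3" by (simp add: fact_numeral)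
    also have "(\<Sum>k \<le> 2. (\<i> * complex_of_real (s * t)) ^ k / fact k) = 1 + \<i> * of_real s * of_real t - of_real (s\<^sup>2 / 2) * of_real (t\<^sup>2)"
      by (simp add: numeral_2_eq_2 power2_eq_square algebra_simps)
    finally show "norm (iexp (s * t) - 1 - \<i> * of_real s * of_real t - - of_real (s\<^sup>2 / 2) * of_real (t\<^sup>2)) \<le> \<bar>s\<bar> ^ 3 * \<bar>t\<bar> ^ 3"
      by (simp add: power_mult_distrib abs_mult algebra_simps)
  qed (use G[of 1] G[of 2] in auto)
  moreover have "(LINT t|M n. iexp (s * t) - 1) = char (M n) s - 1" for n
  proof -
    interpret real_distribution "M n" by (rule M)
    have "integrable (M n) (\<lambda>t. iexp (s * t))" by (rule integrable_bounded_complex[where B = 1]) auto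
    thus ?thesis by (simp add: char_def)
  qed
  ultimately show ?thesis by simp
qed

lemma exp_first_order:
  fixes z :: complex
  assumes "norm z \<le> 1" shows "norm (exp z - 1 - z) \<le> 3 * (norm z)\<^sup>2"
proof -
  have "norm (exp z - (\<Sum>i\<le>1. z ^ i / fact i)) \<le> exp (norm z) * (norm z ^ Suc 1) / fact 1"
    by (rule Taylor_exp_field)
  also have "\<dots> \<le> 3 * (norm z)\<^sup>2"
  proof -
    have "exp (norm z) \<le> exp 1" using assms by simp
    also have "\<dots> \<le> 3" by (rule exp_le)
    finally show ?thesis by (simp add: power2_eq_square mult_right_mono)
  qed
  finally show ?thesis by (simp add: algebra_simps)
qed

text \<open>Compare with \<open>w n = exp (- s^2 / (2 n))\<close>: for numbers of modulus at most 1
  the difference of \<open>n\<close>-th powers is at most \<open>n\<close> times the difference, so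
  equal first order limits suffice and no logarithm appears.\<close>

lemma classical_weak_conv_if:
  assumes \<mu>: "real_distribution \<mu>" and B: "\<And>n. B n > 0"
    and G: "\<And>y. y > 0 \<Longrightarrow> gaussian_increments (\<lambda>n. dilation (1 / B n) \<mu>) (\<i> * of_real y)"
  shows "weak_conv_m (\<lambda>n. dilation (1 / B n) (convolution_power convolution \<mu> n)) std_normal_distribution"
proof -
  interpret \<mu>: real_distribution \<mu> by fact
  let ?M = "\<lambda>n. dilation (1 / B n) \<mu>"
  have M: "real_distribution (?M n)" for n by (rule \<mu>.real_distribution_dilation)
  show ?thesis
  proof (rule levy_continuity[OF _ real_dist_normal_dist])
    fix n show "real_distribution (dilation (1 / B n) (convolution_power convolution \<mu> n))"
      by (intro real_distribution.real_distribution_dilation classical_convolution_power \<mu>)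
  next
    fix s :: real
    define w where "w n = exp (- complex_of_real (s\<^sup>2 / 2) / of_nat n)" for n
    have L: "(\<lambda>n. of_nat n * (char (?M n) s - 1)) \<longlonglongrightarrow> - of_real (s\<^sup>2 / 2)"
      by (rule char_gaussian_increments[OF M G])
    have w_lim: "(\<lambda>n. of_nat n * (w n - 1)) \<longlonglongrightarrow> - of_real (s\<^sup>2 / 2)"
    proof (rule LIM_zero_cancel, rule Lim_null_comparison)
      show "(\<lambda>n. (3 * (s\<^sup>2 / 2)\<^sup>2) / real n) \<longlonglongrightarrow> 0" by (rule lim_const_over_n)
      obtain N where N: "real N \<ge> s\<^sup>2 / 2" using real_arch_simple by blast
      show "\<forall>\<^sub>F n in sequentially. norm (of_nat n * (w n - 1) - - complex_of_real (s\<^sup>2 / 2)) \<le> (3 * (s\<^sup>2 / 2)\<^sup>2) / real n"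
      proof (rule eventually_mono[OF eventually_ge_at_top[of "max 1 N"]])
        fix n assume n: "n \<ge> max 1 N"
        let ?z = "- complex_of_real (s\<^sup>2 / 2) / of_nat n"
        have nz: "norm ?z = (s\<^sup>2 / 2) / real n" by (simp only: norm_divide norm_minus_cancel norm_of_real norm_of_nat) simp
        also have "\<dots> \<le> 1" using n N by (simp add: divide_le_eq)
        finally have "norm (exp ?z - 1 - ?z) \<le> 3 * (norm ?z)\<^sup>2" by (rule exp_first_order)
        hence "real n * norm (exp ?z - 1 - ?z) \<le> real n * (3 * ((s\<^sup>2 / 2) / real n)\<^sup>2)"
          unfolding nz by (intro mult_left_mono) auto
        also have "\<dots> = (3 * (s\<^sup>2 / 2)\<^sup>2) / real n" using n by (simp add: power2_eq_square)
        also have "real n * norm (exp ?z - 1 - ?z) = norm (of_nat n * (exp ?z - 1 - ?z))" by (simp add: norm_mult)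
        also have "of_nat n * (exp ?z - 1 - ?z) = of_nat n * (w n - 1) - - complex_of_real (s\<^sup>2 / 2)"
        proof -
          have "of_nat n * ?z = - complex_of_real (s\<^sup>2 / 2)" using n by simp
          thus ?thesis by (simp only: w_def right_diff_distrib)
        qed
        finally show "norm (of_nat n * (w n - 1) - - complex_of_real (s\<^sup>2 / 2)) \<le> (3 * (s\<^sup>2 / 2)\<^sup>2) / real n" .
      qed
    qed
    have "(\<lambda>n. of_nat n * (char (?M n) s - 1) - of_nat n * (w n - 1)) \<longlonglongrightarrow> - of_real (s\<^sup>2 / 2) - - of_real (s\<^sup>2 / 2)"
      by (intro tendsto_diff L w_lim)
    hence D: "(\<lambda>n. norm (of_nat n * (char (?M n) s - w n))) \<longlonglongrightarrow> 0"
      using tendsto_norm_zero by (fastforce simp: right_diff_distrib)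
    have "(\<lambda>n. char (?M n) s ^ n - w n ^ n) \<longlonglongrightarrow> 0"
    proof (rule Lim_null_comparison[OF always_eventually D], rule allI)
      fix n
      have "norm (w n) \<le> 1" by (simp add: w_def norm_exp_eq_Re)
      thus "norm (char (?M n) s ^ n - w n ^ n) \<le> norm (of_nat n * (char (?M n) s - w n))"
        using norm_power_diff[OF real_distribution.cmod_char_le_1[OF M]] by (simp add: norm_mult)
    qed
    moreover have "(\<lambda>n. w n ^ n) \<longlonglongrightarrow> exp (- of_real (s\<^sup>2 / 2))"
    proof (rule tendsto_eventually, rule eventually_mono[OF eventually_gt_at_top[of 0]])
      fix n :: nat assume "n > 0"
      thus "w n ^ n = exp (- complex_of_real (s\<^sup>2 / 2))"
        by (simp add: w_def exp_of_nat_mult [symmetric])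
    qed
    ultimately have "(\<lambda>n. char (?M n) s ^ n) \<longlonglongrightarrow> 0 + exp (- of_real (s\<^sup>2 / 2))"
      using tendsto_add by fastforce
    moreover have "exp (- complex_of_real (s\<^sup>2 / 2)) = char std_normal_distribution s"
      by (simp add: char_std_normal_distribution exp_of_real [symmetric] del: exp_of_real)
    ultimately show "(\<lambda>n. char (dilation (1 / B n) (convolution_power convolution \<mu> n)) s) \<longlonglongrightarrow> char std_normal_distribution s"
      by (simp add: real_distribution.char_dilation classical_convolution_power[OF \<mu>] \<mu>)
  qed
qed

section \<open>The classical converse: characteristic functions of the summands\<close>

lemma char_uniformly_convergent:
  assumes M: "\<And>n. real_distribution (M n)" "real_distribution N" "weak_conv_m M N" and e: "\<epsilon> > 0"
  shows "\<forall>\<^sub>F n in sequentially. \<forall>t. \<bar>t\<bar> \<le> T \<longrightarrow> norm (char (M n) t - char N t) < \<epsilon>"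
proof -
  \<comment> \<open>On a common probability space the bound
    \<open>|iexp a - iexp b| \<le> min 2 |a - b|\<close> makes the estimate uniform over bounded
    \<open>t\<close>.\<close>
  obtain \<Omega> and Y_seq :: "nat \<Rightarrow> real \<Rightarrow> real" and Y where \<Omega>: "prob_space \<Omega>"
    and Ys: "\<And>n. Y_seq n \<in> measurable \<Omega> borel" "\<And>n. distr \<Omega> borel (Y_seq n) = M n"
    and Y: "Y \<in> measurable \<Omega> lborel" "distr \<Omega> borel Y = N"
    and conv: "\<And>x. x \<in> space \<Omega> \<Longrightarrow> (\<lambda>n. Y_seq n x) \<longlonglongrightarrow> Y x"
    using Skorohod[OF M] by blast
  interpret \<Omega>: prob_space \<Omega> by fact
  have Y': "Y \<in> borel_measurable \<Omega>" using Y by simp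
  note [measurable] = Ys(1) Y'
  have lip: "norm (iexp a - iexp b) \<le> \<bar>a - b\<bar>" for a b :: real
  proof -
    have "iexp a - iexp b = iexp b * (iexp (a - b) - 1)" by (simp add: right_diff_distrib exp_add [symmetric] algebra_simps)
    hence "norm (iexp a - iexp b) = norm (iexp (a - b) - 1)" by (simp add: norm_mult)
    thus ?thesis using iexp_approx1[of "a - b" 0] by simp
  qed
  let ?d = "\<lambda>n. LINT x|\<Omega>. min 2 (\<bar>T\<bar> * \<bar>Y_seq n x - Y x\<bar>)"
  have int_min: "integrable \<Omega> (\<lambda>x. min 2 (\<bar>T\<bar> * \<bar>Y_seq n x - Y x\<bar>))" for n
    by (rule \<Omega>.integrable_const_bound[where B = 2]) auto
  have est: "norm (char (M n) t - char N t) \<le> ?d n" if t: "\<bar>t\<bar> \<le> T" for n t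
  proof -
    have cn: "char (M n) t = (LINT x|\<Omega>. iexp (t * Y_seq n x))"
      unfolding char_def Ys(2)[of n, symmetric] by (rule integral_distr) auto
    have cN: "char N t = (LINT x|\<Omega>. iexp (t * Y x))"
      unfolding char_def Y(2)[symmetric] by (rule integral_distr) (use Y' in auto)
    have i1: "integrable \<Omega> (\<lambda>x. iexp (t * Y_seq n x))" and i2: "integrable \<Omega> (\<lambda>x. iexp (t * Y x))"
      by (rule \<Omega>.integrable_const_bound[where B = 1]; simp)+
    have "norm (char (M n) t - char N t) = norm (LINT x|\<Omega>. iexp (t * Y_seq n x) - iexp (t * Y x))"
      unfolding cn cN Bochner_Integration.integral_diff[OF i1 i2] ..
    also have "\<dots> \<le> (LINT x|\<Omega>. norm (iexp (t * Y_seq n x) - iexp (t * Y x)))" by (rule integral_norm_bound)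
    also have "\<dots> \<le> ?d n"
    proof (rule integral_mono[OF _ int_min])
      show "integrable \<Omega> (\<lambda>x. norm (iexp (t * Y_seq n x) - iexp (t * Y x)))"
        by (rule integrable_norm, rule Bochner_Integration.integrable_diff[OF i1 i2])
      fix x
      have "norm (iexp (t * Y_seq n x) - iexp (t * Y x)) \<le> \<bar>t\<bar> * \<bar>Y_seq n x - Y x\<bar>"
        using lip[of "t * Y_seq n x" "t * Y x"] by (simp add: right_diff_distrib [symmetric] abs_mult)
      also have "\<dots> \<le> \<bar>T\<bar> * \<bar>Y_seq n x - Y x\<bar>" using t by (intro mult_right_mono) auto
      finally have "norm (iexp (t * Y_seq n x) - iexp (t * Y x)) \<le> \<bar>T\<bar> * \<bar>Y_seq n x - Y x\<bar>" .
      moreover have "norm (iexp (t * Y_seq n x) - iexp (t * Y x)) \<le> 2"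
        using norm_triangle_ineq4[of "iexp (t * Y_seq n x)" "iexp (t * Y x)"] by simp
      ultimately show "norm (iexp (t * Y_seq n x) - iexp (t * Y x)) \<le> min 2 (\<bar>T\<bar> * \<bar>Y_seq n x - Y x\<bar>)" by simp
    qed
    finally show ?thesis .
  qed
  have "?d \<longlonglongrightarrow> (LINT x|\<Omega>. 0)"
  proof (rule integral_dominated_convergence[where w = "\<lambda>_. 2"])
    show "AE x in \<Omega>. (\<lambda>n. min 2 (\<bar>T\<bar> * \<bar>Y_seq n x - Y x\<bar>)) \<longlonglongrightarrow> 0"
    proof (rule AE_I2)
      fix x assume "x \<in> space \<Omega>"
      from conv[OF this] have "(\<lambda>n. min 2 (\<bar>T\<bar> * \<bar>Y_seq n x - Y x\<bar>)) \<longlonglongrightarrow> min 2 (\<bar>T\<bar> * \<bar>Y x - Y x\<bar>)"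
        by (intro tendsto_intros)
      thus "(\<lambda>n. min 2 (\<bar>T\<bar> * \<bar>Y_seq n x - Y x\<bar>)) \<longlonglongrightarrow> 0" by simp
    qed
  qed auto
  hence "\<forall>\<^sub>F n in sequentially. ?d n < \<epsilon>" using e by (intro order_tendstoD) auto
  thus ?thesis by eventually_elim (use est le_less_trans in blast)
qed

lemma weak_conv_char_tendsto:
  assumes M: "\<And>n. real_distribution (M n)" "real_distribution N" "weak_conv_m M N" and s: "s \<longlonglongrightarrow> l"
  shows "(\<lambda>n. char (M n) (s n)) \<longlonglongrightarrow> char N l"
proof -
  have N_lim: "(\<lambda>n. char N (s n)) \<longlonglongrightarrow> char N l"
    by (rule isCont_tendsto_compose[OF real_distribution.isCont_char[OF M(2)] s])
  obtain T where T: "\<And>n. \<bar>s n\<bar> \<le> T"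
    using convergent_imp_Bseq[OF convergentI[OF s]] unfolding Bseq_def real_norm_def by blast
  have "(\<lambda>n. char (M n) (s n) - char N (s n)) \<longlonglongrightarrow> 0"
  proof (rule tendstoI)
    fix \<epsilon> :: real assume "\<epsilon> > 0"
    from char_uniformly_convergent[OF M this, of T]
    show "\<forall>\<^sub>F n in sequentially. dist (char (M n) (s n) - char N (s n)) 0 < \<epsilon>"
      by eventually_elim (use T in simp)
  qed
  from tendsto_add[OF this N_lim] show ?thesis by simp
qed

lemma weak_conv_m_subseq: "weak_conv_m M N \<Longrightarrow> strict_mono r \<Longrightarrow> weak_conv_m (\<lambda>n. M (r n)) N"
  unfolding weak_conv_m_def weak_conv_def using LIMSEQ_subseq_LIMSEQ by (fastforce simp: o_def)

lemma frequently_subseq: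
  assumes "\<exists>\<^sub>F n in sequentially. P n"
  shows "\<exists>r :: nat \<Rightarrow> nat. strict_mono r \<and> (\<forall>n. P (r n))"
proof -
  have inf: "infinite {n. P n}"
    using assms by (simp add: frequently_cofinite cofinite_eq_sequentially [symmetric])
  show ?thesis
    using strict_mono_enumerate[OF inf] enumerate_in_set[OF inf] by auto
qed

lemma subseq_bounded_if_not_at_top:
  fixes B :: "nat \<Rightarrow> real"
  assumes B: "\<And>n. B n > 0" and "\<not> filterlim B at_top sequentially"
  obtains r b where "strict_mono r" "(\<lambda>n. B (r n)) \<longlonglongrightarrow> b" "b \<ge> 0"
proof -
  obtain K where "\<not> (\<forall>\<^sub>F n in sequentially. K \<le> B n)"
    using assms(2) by (auto simp: filterlim_at_top)
  hence "\<exists>\<^sub>F n in sequentially. B n < K" by (simp add: frequently_def not_less)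
  from frequently_subseq[OF this] obtain r :: "nat \<Rightarrow> nat" where r: "strict_mono r" and rK: "\<And>n. B (r n) < K" by blast
  have "bounded (range (\<lambda>n. B (r n)))"
    unfolding bounded_iff using rK B by (intro exI[of _ K]) (auto simp: abs_of_pos less_imp_le)
  then obtain b s where s: "strict_mono s" "((\<lambda>n. B (r n)) \<circ> s) \<longlonglongrightarrow> b"
    using bounded_imp_convergent_subsequence by blast
  have lim: "(\<lambda>n. B ((r \<circ> s) n)) \<longlonglongrightarrow> b" using s(2) by (simp add: o_def)
  have "b \<ge> 0" by (rule LIMSEQ_le_const[OF lim]) (use B less_imp_le in blast)
  thus ?thesis using that[of "r \<circ> s" b] lim strict_mono_o[OF r s(1)] by simp
qed

text \<open>Along a bounded subsequence \<open>B (r n)\<close>, the powers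
  \<open>char \<mu> s ^ r n\<close> are values of the normalised characteristic functions at
  convergent arguments, so they have a nonzero limit. This forces \<open>|char \<mu> s| = 1\<close>
  for every \<open>s\<close>, which the normal limit contradicts at argument 1.\<close>

lemma classical_norming_at_top:
  assumes \<mu>: "real_distribution \<mu>" and B: "\<And>n. B n > 0"
    and wc: "weak_conv_m (\<lambda>n. dilation (1 / B n) (convolution_power convolution \<mu> n)) std_normal_distribution"
  shows "filterlim B at_top sequentially"
proof (rule ccontr)
  assume "\<not> filterlim B at_top sequentially"
  then obtain r b where r: "strict_mono r" and b: "(\<lambda>n. B (r n)) \<longlonglongrightarrow> b" "b \<ge> 0"
    using subseq_bounded_if_not_at_top[of B] B by blast
  interpret \<mu>: real_distribution \<mu> by fact
  let ?R = "\<lambda>n. dilation (1 / B n) (convolution_power convolution \<mu> n)"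
  have R: "real_distribution (?R n)" for n
    by (intro real_distribution.real_distribution_dilation classical_convolution_power \<mu>)
  have R_char: "char (?R n) t = char \<mu> (t / B n) ^ n" for n t
    by (simp add: real_distribution.char_dilation classical_convolution_power[OF \<mu>])
  have std: "char std_normal_distribution t = of_real (exp (- (t\<^sup>2) / 2))" for t
    by (simp add: char_std_normal_distribution)
  have one: "norm (char \<mu> s) = 1" for s
  proof (rule ccontr)
    assume "norm (char \<mu> s) \<noteq> 1"
    hence lt: "norm (char \<mu> s) < 1" using \<mu>.cmod_char_le_1[of s] by simp
    have lim0: "(\<lambda>n. norm (char \<mu> s) ^ r n) \<longlonglongrightarrow> 0"
      using LIMSEQ_subseq_LIMSEQ[OF LIMSEQ_realpow_zero[OF norm_ge_zero lt] r] by (simp add: o_def)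
    let ?s = "\<lambda>n. s * B (r n)"
    have "(\<lambda>n. char (?R (r n)) (?s n)) \<longlonglongrightarrow> char std_normal_distribution (s * b)"
      by (rule weak_conv_char_tendsto[OF R real_dist_normal_dist weak_conv_m_subseq[OF wc r]])
         (intro tendsto_intros b)
    from tendsto_norm[OF this] have "(\<lambda>n. norm (char (?R (r n)) (?s n))) \<longlonglongrightarrow> exp (- ((s * b)\<^sup>2) / 2)"
      by (simp add: std)
    moreover have "norm (char (?R (r n)) (?s n)) = norm (char \<mu> s) ^ r n" for n
      using B[of "r n"] by (simp add: R_char norm_power)
    ultimately have "(\<lambda>n. norm (char \<mu> s) ^ r n) \<longlonglongrightarrow> exp (- ((s * b)\<^sup>2) / 2)" by simp
    from LIMSEQ_unique[OF lim0 this] show False by simp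
  qed
  have "(\<lambda>n. norm (char (?R n) 1)) \<longlonglongrightarrow> norm (char std_normal_distribution 1)"
    by (intro tendsto_norm levy_continuity1[OF R real_dist_normal_dist wc])
  moreover have "norm (char (?R n) 1) = 1" for n unfolding R_char norm_power one by simp
  ultimately have "norm (char std_normal_distribution 1) = 1" by (simp add: LIMSEQ_const_iff)
  thus False by (simp add: std)
qed

text \<open>The branch of the logarithm is controlled by continuity: a continuous \<open>L\<close> with \<open>L 0 = 0\<close> and \<open>exp L\<close> close
  to \<open>1\<close> has imaginary part in \<open>(- \<pi> / 2, \<pi> / 2)\<close>.\<close>

lemma small_if_exp_near_1:
  fixes L :: "real \<Rightarrow> complex"
  assumes cont: "continuous_on {- T..T} L" and L0: "L 0 = 0"
    and near: "\<And>t. \<bar>t\<bar> \<le> T \<Longrightarrow> norm (exp (L t) - 1) < \<delta>" and \<delta>: "\<delta> \<le> 1/2" and t: "\<bar>t\<bar> \<le> T"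
  shows "norm (L t) \<le> 2 * \<delta>"
proof -
  have Re_pos: "Re (exp (L s)) > 0" if "\<bar>s\<bar> \<le> T" for s
    using near[OF that] \<delta> abs_Re_le_cmod[of "exp (L s) - 1"] by simp
  have Im: "\<bar>Im (L t)\<bar> < pi / 2"
  proof (rule ccontr)
    assume c: "\<not> \<bar>Im (L t)\<bar> < pi / 2"
    have sub: "closed_segment 0 t \<subseteq> {- T..T}" using t by (auto simp: closed_segment_eq_real_ivl split: if_splits)
    have cont': "continuous_on (closed_segment 0 t) (\<lambda>s. \<bar>Im (L s)\<bar>)"
      by (intro continuous_intros continuous_on_subset[OF cont sub])
    have "connected ((\<lambda>s. \<bar>Im (L s)\<bar>) ` closed_segment 0 t)"
      by (intro connected_continuous_image cont') auto
    moreover have "0 \<in> (\<lambda>s. \<bar>Im (L s)\<bar>) ` closed_segment 0 t" by (rule image_eqI[of _ _ 0]) (auto simp: L0)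
    moreover have "\<bar>Im (L t)\<bar> \<in> (\<lambda>s. \<bar>Im (L s)\<bar>) ` closed_segment 0 t" by auto
    ultimately have "{0..\<bar>Im (L t)\<bar>} \<subseteq> (\<lambda>s. \<bar>Im (L s)\<bar>) ` closed_segment 0 t"
      by (rule connected_contains_Icc)
    moreover have "pi / 2 \<in> {0..\<bar>Im (L t)\<bar>}" using c by simp
    ultimately have "pi / 2 \<in> (\<lambda>s. \<bar>Im (L s)\<bar>) ` closed_segment 0 t" by blast
    then obtain s where s: "s \<in> closed_segment 0 t" "pi / 2 = \<bar>Im (L s)\<bar>" by (rule imageE) auto
    have "Im (L s) = pi / 2 \<or> Im (L s) = - (pi / 2)" using s(2) by linarith
    hence "cos (Im (L s)) = 0" by (elim disjE) (simp_all only: cos_minus cos_pi_half)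
    hence "Re (exp (L s)) = 0" by (simp add: Re_exp)
    moreover have "\<bar>s\<bar> \<le> T"
    proof -
      have "s \<in> {- T..T}" using sub s(1) by blast
      thus ?thesis by (auto simp: abs_le_iff)
    qed
    ultimately show False using Re_pos by fastforce
  qed
  have "L t = Ln (exp (L t))" using Im pi_gt_zero by (intro Ln_exp [symmetric]) linarith+
  also have "\<dots> = Ln (1 + (exp (L t) - 1))" by simp
  finally have "norm (L t) \<le> 2 * norm (exp (L t) - 1)"
    using norm_Ln_le[of "exp (L t) - 1"] near[OF t] \<delta> by simp
  thus ?thesis using near[OF t] by linarith
qed

text \<open>The function \<open>L t = n Ln (char \<mu> (t / B n)) + t^2 / 2\<close> has exponential
  close to 1 and \<open>L 0 = 0\<close>, hence is small itself. Replacing the logarithm by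
  \<open>char \<mu> - 1\<close> costs a quadratic error, negligible since \<open>n\<close> times the
  logarithm stays bounded. Divergence of \<open>B\<close> keeps the arguments near 0, where the
  logarithm is defined.\<close>

lemma classical_char_increments:
  assumes \<mu>: "real_distribution \<mu>" and B: "\<And>n. B n > 0"
    and wc: "weak_conv_m (\<lambda>n. dilation (1 / B n) (convolution_power convolution \<mu> n)) std_normal_distribution"
  shows "\<epsilon> > 0 \<Longrightarrow> \<forall>\<^sub>F n in sequentially. \<forall>t. \<bar>t\<bar> \<le> T \<longrightarrow>
     norm (of_nat n * (char \<mu> (t / B n) - 1) + of_real (t\<^sup>2 / 2)) \<le> \<epsilon>"
proof -
  assume e: "\<epsilon> > 0"
  interpret \<mu>: real_distribution \<mu> by fact
  have B_top: "filterlim B at_top sequentially" by (rule classical_norming_at_top[OF \<mu> B wc])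
  let ?R = "\<lambda>n. dilation (1 / B n) (convolution_power convolution \<mu> n)"
  have R: "real_distribution (?R n)" for n
    by (intro real_distribution.real_distribution_dilation classical_convolution_power \<mu>)
  have R_char: "char (?R n) t = char \<mu> (t / B n) ^ n" for n t
    by (simp add: real_distribution.char_dilation classical_convolution_power[OF \<mu>])
  define S where "S = \<bar>T\<bar>\<^sup>2 / 2"
  define \<delta> where "\<delta> = min (1/2) (\<epsilon> / 4)"
  have \<delta>: "\<delta> > 0" "\<delta> \<le> 1/2" "2 * \<delta> \<le> \<epsilon> / 2" using e by (auto simp: \<delta>_def)
  have S0: "S \<ge> 0" by (simp add: S_def)
  \<comment> \<open>The factor \<open>exp (- S)\<close> compensates the multiplication by
    \<open>exp (t^2 / 2)\<close> in \<open>exp (L t)\<close>.\<close>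
  have "\<delta> * exp (- S) > 0" using \<delta> by simp
  from char_uniformly_convergent[OF R real_dist_normal_dist wc this, of T]
  have ev1: "\<forall>\<^sub>F n in sequentially. \<forall>t. \<bar>t\<bar> \<le> T \<longrightarrow> norm (char (?R n) t - char std_normal_distribution t) < \<delta> * exp (- S)" .
  obtain \<eta> where \<eta>: "\<eta> > 0" "\<And>s. \<bar>s\<bar> < \<eta> \<Longrightarrow> norm (char \<mu> s - 1) < 1/2"
    using \<mu>.isCont_char[of 0] unfolding continuous_at_eps_delta
    by (metis \<mu>.char_zero dist_norm diff_zero half_gt_zero_iff real_norm_def zero_less_one)
  have ev2: "\<forall>\<^sub>F n in sequentially. B n > \<bar>T\<bar> / \<eta>"
    using B_top by (rule filterlim_at_top_dense[THEN iffD1, rule_format])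
  \<comment> \<open>\<open>n \<ge> S + 1\<close> makes the logarithm \<open>u\<close> have modulus
    at most 1, and \<open>n \<ge> 6 (S + 1)^2 / \<epsilon>\<close> makes the quadratic error
    \<open>3 (S + 1)^2 / n\<close> at most \<open>\<epsilon> / 2\<close>.\<close>
  define K where "K = max 1 (max (S + 1) (6 * (S + 1)\<^sup>2 / \<epsilon>))"
  have ev3: "\<forall>\<^sub>F n in sequentially. real n \<ge> K"
    using filterlim_real_sequentially by (rule filterlim_at_top[THEN iffD1, rule_format])
  show ?thesis
    using ev1 ev2 ev3
  proof eventually_elim
    case (elim n)
    have n: "real n \<ge> 1" "real n \<ge> S + 1" "real n \<ge> 6 * (S + 1)\<^sup>2 / \<epsilon>" using elim(3) by (auto simp: K_def)
    have near1: "norm (char \<mu> (t / B n) - 1) < 1/2" if "\<bar>t\<bar> \<le> T" for t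
    proof (rule \<eta>(2))
      have "\<bar>T\<bar> < B n * \<eta>" using elim(2) \<eta>(1) by (simp add: pos_divide_less_eq)
      hence "\<bar>t\<bar> < B n * \<eta>" using that by linarith
      thus "\<bar>t / B n\<bar> < \<eta>" using B[of n] by (simp add: pos_divide_less_eq mult.commute)
    qed
    have Re1: "Re (char \<mu> (t / B n)) > 0" if "\<bar>t\<bar> \<le> T" for t
      using near1[OF that] abs_Re_le_cmod[of "char \<mu> (t / B n) - 1"] by simp
    define L where "L t = of_nat n * Ln (char \<mu> (t / B n)) + of_real (t\<^sup>2 / 2)" for t
    have expL: "exp (L t) = char (?R n) t * exp (of_real (t\<^sup>2 / 2))" if "\<bar>t\<bar> \<le> T" for t
    proof -
      have "char \<mu> (t / B n) \<noteq> 0" using Re1[OF that] by auto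
      thus ?thesis by (simp add: L_def exp_add exp_of_nat_mult R_char)
    qed
    have L_small: "norm (L t) \<le> 2 * \<delta>" if "\<bar>t\<bar> \<le> T" for t
    proof (rule small_if_exp_near_1[OF _ _ _ \<delta>(2) that])
      have "continuous_on {- T..T} (\<lambda>t. char \<mu> (t / B n))"
        using B[of n] by (intro continuous_at_imp_continuous_on ballI isCont_o2[OF _ \<mu>.isCont_char] continuous_intros) auto
      thus "continuous_on {- T..T} L" unfolding L_def
        using Re1 by (intro continuous_intros) (force simp: complex_nonpos_Reals_iff abs_le_iff)+
      show "L 0 = 0" by (simp add: L_def \<mu>.char_zero)
      fix s assume s: "\<bar>s\<bar> \<le> T"
      have sS: "s\<^sup>2 / 2 \<le> S" using s by (simp add: S_def abs_le_square_iff [symmetric])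
      have "exp (L s) - 1 = (char (?R n) s - char std_normal_distribution s) * exp (of_real (s\<^sup>2 / 2))"
        unfolding expL[OF s] by (simp add: char_std_normal_distribution left_diff_distrib exp_of_real [symmetric] exp_add [symmetric] del: exp_of_real)
      hence "norm (exp (L s) - 1) = norm (char (?R n) s - char std_normal_distribution s) * exp (s\<^sup>2 / 2)"
        by (simp add: norm_mult)
      also have "\<dots> < (\<delta> * exp (- S)) * exp (s\<^sup>2 / 2)" using elim(1) s by (intro mult_strict_right_mono) auto
      also have "\<dots> \<le> (\<delta> * exp (- S)) * exp S" using sS \<delta> by (intro mult_left_mono) auto
      also have "\<dots> = \<delta>" by (simp add: exp_minus)
      finally show "norm (exp (L s) - 1) < \<delta>" .
    qed
    show ?case
    proof (intro allI impI)
      fix t assume t: "\<bar>t\<bar> \<le> T"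
      have tS: "t\<^sup>2 / 2 \<le> S" using t by (simp add: S_def abs_le_square_iff [symmetric])
      define u where "u = Ln (char \<mu> (t / B n))"
      have "char \<mu> (t / B n) \<noteq> 0" using Re1[OF t] by auto
      hence u: "exp u = char \<mu> (t / B n)" by (simp add: u_def)
      have Lu: "L t = of_nat n * u + of_real (t\<^sup>2 / 2)" by (simp add: L_def u_def)
      have nu: "real n * norm u \<le> S + 1"
      proof -
        have "norm (of_nat n * u) = norm (L t - of_real (t\<^sup>2 / 2))" by (simp add: Lu)
        also have "\<dots> \<le> norm (L t) + norm (complex_of_real (t\<^sup>2 / 2))" by (rule norm_triangle_ineq4)
        also have "norm (complex_of_real (t\<^sup>2 / 2)) = t\<^sup>2 / 2" by (simp only: norm_of_real) simp
        finally show ?thesis using L_small[OF t] \<delta> tS by (simp add: norm_mult)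
      qed
      hence u1: "norm u \<le> (S + 1) / real n" using n by (simp add: pos_le_divide_eq mult.commute)
      also have "\<dots> \<le> 1" using n by (simp add: divide_le_eq)
      finally have "norm (exp u - 1 - u) \<le> 3 * (norm u)\<^sup>2" by (rule exp_first_order)
      hence "real n * norm (exp u - 1 - u) \<le> real n * (3 * (norm u)\<^sup>2)" by (intro mult_left_mono) auto
      also have "\<dots> = 3 * ((real n * norm u) * norm u)" by (simp add: power2_eq_square)
      also have "\<dots> \<le> 3 * ((S + 1) * ((S + 1) / real n))" using nu u1 S0 by (intro mult_left_mono mult_mono) auto
      also have "\<dots> \<le> \<epsilon> / 2"
        using n e by (simp add: field_simps power2_eq_square)
      finally have 1: "real n * norm (exp u - 1 - u) \<le> \<epsilon> / 2" .
      have "of_nat n * (char \<mu> (t / B n) - 1) + of_real (t\<^sup>2 / 2) = of_nat n * (exp u - 1 - u) + L t"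
        by (simp add: u [symmetric] Lu algebra_simps)
      hence "norm (of_nat n * (char \<mu> (t / B n) - 1) + of_real (t\<^sup>2 / 2)) \<le> norm (of_nat n * (exp u - 1 - u)) + norm (L t)"
        by (metis norm_triangle_ineq)
      also have "\<dots> \<le> \<epsilon> / 2 + \<epsilon> / 2"
        using 1 L_small[OF t] \<delta> by (intro add_mono) (auto simp: norm_mult)
      finally show "norm (of_nat n * (char \<mu> (t / B n) - 1) + of_real (t\<^sup>2 / 2)) \<le> \<epsilon>" by simp
    qed
  qed
qed

section \<open>The classical converse: from characteristic functions to Cauchy transforms\<close>

lemma (in real_distribution) char_doubling:
  "norm (char M (2 * t) - 1) \<le> 4 * norm (char M t - 1)"
proof -
  have int: "integrable M (\<lambda>x. iexp (s * x))" for s :: real by (rule integrable_bounded_complex[where B = 1]) auto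
  \<comment> \<open>The square has modulus \<open>2 (1 - cos (t x))\<close>, whose integral is
    \<open>- 2 Re (char M t - 1)\<close>. So the value at \<open>2 t\<close> is controlled by the
    value at \<open>t\<close> without second moments.\<close>
  have sq: "(iexp (t * x) - 1)\<^sup>2 = iexp (2 * t * x) - 1 - 2 * (iexp (t * x) - 1)" for x
  proof -
    have "iexp (2 * t * x) = (iexp (t * x))\<^sup>2" by (simp add: exp_double [symmetric] mult_ac)
    thus ?thesis by (simp add: power2_eq_square algebra_simps)
  qed
  have nsq: "norm ((iexp (t * x) - 1)\<^sup>2) = 2 * (1 - Re (iexp (t * x)))" for x
  proof -
    have "norm ((iexp (t * x) - 1)\<^sup>2) = (cos (t * x) - 1)\<^sup>2 + (sin (t * x))\<^sup>2"
      by (simp add: norm_power cmod_power2 Re_exp Im_exp)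
    also have "\<dots> = 2 * (1 - cos (t * x))"
      using sin_cos_squared_add[of "t * x"] by (simp add: power2_diff algebra_simps)
    finally show ?thesis by (simp add: Re_exp)
  qed
  have eq: "char M (2 * t) - 1 = (LINT x|M. (iexp (t * x) - 1)\<^sup>2) + 2 * (char M t - 1)"
    unfolding sq char_def using int[of t] int[of "2 * t"] by simp
  have "norm (LINT x|M. (iexp (t * x) - 1)\<^sup>2) \<le> (LINT x|M. 2 * (1 - Re (iexp (t * x))))"
    using integral_norm_bound[of M "\<lambda>x. (iexp (t * x) - 1)\<^sup>2"] unfolding nsq .
  also have "\<dots> = - (2 * Re (char M t - 1))"
  proof -
    have "(LINT x|M. Re (iexp (t * x))) = Re (char M t)" unfolding char_def by (rule integral_Re[OF int])
    thus ?thesis using integrable_Re[OF int[of t]] by simp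
  qed
  also have "\<dots> \<le> 2 * norm (char M t - 1)" using abs_Re_le_cmod[of "char M t - 1"] by linarith
  finally have "norm (LINT x|M. (iexp (t * x) - 1)\<^sup>2) \<le> 2 * norm (char M t - 1)" .
  moreover have "norm (char M (2 * t) - 1) \<le> norm (LINT x|M. (iexp (t * x) - 1)\<^sup>2) + norm (2 * (char M t - 1))"
    unfolding eq by (rule norm_triangle_ineq)
  moreover have "norm (2 * (char M t - 1)) = 2 * norm (char M t - 1)" by (simp only: norm_mult norm_numeral)
  ultimately show ?thesis by linarith
qed

text \<open>Reaching \<open>|t| \<le> 2 ^ k\<close> takes \<open>k\<close> doublings at the cost
  \<open>4 ^ k\<close>, and the least such \<open>k\<close> has
  \<open>4 ^ k \<le> 1 + 4 t^2\<close>. This supplies the dominating function for integration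
  against the exponential law.\<close>

lemma (in real_distribution) char_quadratic_growth:
  assumes c: "\<And>s. \<bar>s\<bar> \<le> 1 \<Longrightarrow> norm (char M s - 1) \<le> c"
  shows "norm (char M t - 1) \<le> c * (1 + 4 * t\<^sup>2)"
proof -
  have c0: "c \<ge> 0" using order_trans[OF norm_ge_zero c[of 0]] by simp
  have step: "norm (char M t - 1) \<le> 4 ^ k * c" if "\<bar>t\<bar> \<le> 2 ^ k" for k t
    using that
  proof (induction k arbitrary: t)
    case (Suc k)
    have "norm (char M (2 * (t / 2)) - 1) \<le> 4 * norm (char M (t / 2) - 1)" by (rule char_doubling)
    also have "\<dots> \<le> 4 * (4 ^ k * c)" using Suc by (intro mult_left_mono Suc.IH) auto
    finally show ?case by simp
  qed (use c in simp)
  define k where "k = (LEAST k. \<bar>t\<bar> \<le> 2 ^ k)"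
  obtain j where "\<bar>t\<bar> \<le> 2 ^ j" using real_arch_pow[of 2 "\<bar>t\<bar>"] by (auto intro: less_imp_le)
  hence k: "\<bar>t\<bar> \<le> 2 ^ k" unfolding k_def by (rule LeastI)
  have "4 ^ k \<le> 1 + 4 * t\<^sup>2"
  proof (cases k)
    case (Suc m)
    have "\<not> \<bar>t\<bar> \<le> 2 ^ m" using not_less_Least[of m "\<lambda>k. \<bar>t\<bar> \<le> 2 ^ k"] Suc by (simp add: k_def)
    hence "(2 ^ m)\<^sup>2 \<le> \<bar>t\<bar>\<^sup>2" by (intro power_mono) auto
    moreover have "(2 ^ m :: real)\<^sup>2 = 4 ^ m" by (simp add: power2_eq_square power_mult_distrib [symmetric])
    ultimately show ?thesis using Suc by simp
  qed simp
  hence "4 ^ k * c \<le> (1 + 4 * t\<^sup>2) * c" using c0 by (intro mult_right_mono)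
  thus ?thesis using step[OF k] by (simp add: mult.commute)
qed

text \<open>For an exponential variable \<open>Y\<close> with rate \<open>y\<close> one has
  \<open>E (char M Y) = \<integral> y / (y - \<i> x) dM(x)\<close>, the conjugate of \<open>\<i> y G(\<i> y)\<close>: this links characteristic
  functions and Cauchy transforms.\<close>

lemma integral_exponential_iexp:
  assumes y: "y > 0"
  shows "(LINT s|density lborel (exponential_density y). iexp (s * x)) = of_real y / (of_real y - \<i> * of_real x)"
proof -
  let ?c = "\<i> * complex_of_real x - of_real y"
  let ?f = "\<lambda>s. of_real y * exp (?c * of_real s)"
  let ?F = "\<lambda>s. of_real y / ?c * exp (?c * of_real s)"
  have c0: "?c \<noteq> 0" using y by (simp add: complex_eq_iff)
  have nf: "norm (?f s) = y * exp (- y * s)" for s using y by (simp add: norm_mult norm_exp_eq_Re)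
  interpret X: prob_space "density lborel (exponential_density y)" by (rule prob_space_exponential_density[OF y])
  have ed_meas: "exponential_density y \<in> borel_measurable borel" by measurable
  have ed_nonneg: "exponential_density y s \<ge> 0" for s by (rule exponential_density_nonneg[OF y])
  have "integrable (density lborel (exponential_density y)) (\<lambda>s. iexp (s * x))"
    by (rule X.integrable_const_bound[where B = 1]) auto
  hence int: "integrable lborel (\<lambda>s. exponential_density y s *\<^sub>R iexp (s * x))"
    by (subst (asm) integrable_density) (use ed_meas ed_nonneg in auto)
  \<comment> \<open>Only almost everywhere: the exponential density is positive at 0, which the open
    interval excludes.\<close>
  have ae: "AE s in lborel. exponential_density y s *\<^sub>R iexp (s * x) = indicator (einterval 0 \<infinity>) s *\<^sub>R ?f s"
    using AE_lborel_singleton[of "0::real"]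
  proof eventually_elim
    case (elim s)
    show ?case
    proof (cases "s > 0")
      case True
      have "?c * of_real s = \<i> * of_real (s * x) + of_real (- (s * y))" by (simp add: algebra_simps)
      hence "exp (?c * of_real s) = iexp (s * x) * of_real (exp (- (s * y)))"
        by (simp only: exp_add exp_of_real)
      thus ?thesis using True by (simp add: exponential_density_def einterval_def scaleR_conv_of_real mult_ac)
    next
      case False
      thus ?thesis using elim by (simp add: exponential_density_def einterval_def)
    qed
  qed
  have "set_integrable lborel (einterval 0 \<infinity>) ?f"
    unfolding set_integrable_def
    by (rule integrable_cong_AE_imp[OF int _ ae]) (simp add: einterval_def)
  moreover have "(?F has_vector_derivative ?f s) (at s)" for s
  proof -
    have "((\<lambda>z. of_real y / ?c * exp (?c * z)) has_field_derivative of_real y / ?c * (exp (?c * of_real s) * ?c)) (at (of_real s))"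
      by (auto intro!: derivative_eq_intros)
    from has_vector_derivative_real_field[OF this, of UNIV] show ?thesis using y by simp
  qed
  moreover have "isCont ?f s" for s by (intro continuous_intros)
  moreover have "((?F \<circ> real_of_ereal) \<longlongrightarrow> of_real y / ?c) (at_right 0)"
  proof -
    have "(?F \<longlongrightarrow> ?F 0) (at_right 0)"
    proof (rule tendsto_within_subset[OF isContD subset_UNIV])
      show "isCont ?F 0" by (intro continuous_intros c0)
    qed
    thus ?thesis by (simp add: zero_ereal_def ereal_tendsto_simps del: ereal_eq_0)
  qed
  moreover have "((?F \<circ> real_of_ereal) \<longlongrightarrow> 0) (at_left \<infinity>)"
  proof -
    have "((\<lambda>s. norm (of_real y / ?c) * exp (- y * s)) \<longlongrightarrow> norm (of_real y / ?c) * 0) at_top"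
      using y by (intro tendsto_mult tendsto_const) real_asymp
    moreover have "norm (?F s) = norm (of_real y / ?c) * exp (- y * s)" for s
    proof -
      have "norm (exp (?c * of_real s)) = exp (- y * s)" by (simp add: norm_exp_eq_Re)
      thus ?thesis by (simp only: norm_mult)
    qed
    ultimately have "(?F \<longlongrightarrow> 0) at_top" using tendsto_norm_zero_iff[of ?F at_top] by simp
    thus ?thesis by (simp add: ereal_tendsto_simps)
  qed
  ultimately have "(LBINT s=0..\<infinity>. ?f s) = 0 - of_real y / ?c"
    by (intro interval_integral_FTC_integrable) auto
  moreover have "(LBINT s=0..\<infinity>. ?f s) = (LBINT s. exponential_density y s *\<^sub>R iexp (s * x))"
    unfolding interval_lebesgue_integral_def set_lebesgue_integral_def
    using integral_cong_AE[OF _ _ ae] ed_meas by (simp add: einterval_def)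
  moreover have "(LINT s|density lborel (exponential_density y). iexp (s * x)) = (LBINT s. exponential_density y s *\<^sub>R iexp (s * x))"
    by (rule integral_density) (use ed_meas ed_nonneg in auto)
  moreover have "0 - of_real y / ?c = of_real y / (of_real y - \<i> * of_real x)"
    using c0 by (metis diff_0 minus_diff_eq divide_minus_right)
  ultimately show ?thesis by simp
qed

lemma (in real_distribution) integral_exponential_char:
  assumes y: "y > 0"
  shows "(LINT s|density lborel (exponential_density y). char M s - 1)
     = cnj (LINT t|M. of_real t / (\<i> * of_real y - of_real t))"
proof -
  interpret X: prob_space "density lborel (exponential_density y)" by (rule prob_space_exponential_density[OF y])
  interpret P: pair_prob_space "density lborel (exponential_density y)" M ..
  let ?X = "density lborel (exponential_density y)"
  have int: "integrable (?X \<Otimes>\<^sub>M M) (\<lambda>(s, x). iexp (s * x))"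
    by (rule P.integrable_const_bound[where B = 1]) (auto simp: split_beta)
  have char_int: "integrable ?X (char M)"
    by (rule X.integrable_const_bound[where B = 1]) (auto intro: cmod_char_le_1)
  have ki: "integrable M (\<lambda>x. of_real y / (of_real y - \<i> * of_real x))"
  proof (rule integrable_bounded_complex[where B = 1])
    fix x :: real
    have "y \<le> norm (of_real y - \<i> * complex_of_real x)"
      using abs_Re_le_cmod[of "of_real y - \<i> * complex_of_real x"] by simp
    thus "norm (of_real y / (of_real y - \<i> * complex_of_real x)) \<le> 1" using y by (simp add: norm_divide divide_le_eq_1)
  qed measurable
  have "(LINT s|?X. char M s) = (LINT s|?X. LINT x|M. iexp (s * x))" by (simp add: char_def)
  also have "\<dots> = (LINT x|M. LINT s|?X. iexp (s * x))"
    using P.Fubini_integral[OF int] by simp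
  also have "\<dots> = (LINT x|M. of_real y / (of_real y - \<i> * of_real x))"
    unfolding integral_exponential_iexp[OF y] ..
  finally have "(LINT s|?X. char M s - 1) = (LINT x|M. of_real y / (of_real y - \<i> * of_real x)) - 1"
    using char_int X.prob_space by simp
  also have "\<dots> = (LINT x|M. of_real y / (of_real y - \<i> * of_real x) - 1)" using ki by simp
  also have "(\<lambda>x. of_real y / (of_real y - \<i> * of_real x) - 1) = (\<lambda>x. cnj (of_real x / (\<i> * of_real y - of_real x)))"
  proof
    fix x :: real
    have "of_real y - \<i> * complex_of_real x \<noteq> 0" "- \<i> * of_real y - complex_of_real x \<noteq> 0"
      using y by (auto simp: complex_eq_iff)
    thus "of_real y / (of_real y - \<i> * of_real x) - 1 = cnj (of_real x / (\<i> * of_real y - of_real x))"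
      by (simp add: divide_simps) (simp add: algebra_simps)
  qed
  also have "(LINT x|M. cnj (of_real x / (\<i> * of_real y - of_real x))) = cnj (LINT t|M. of_real t / (\<i> * of_real y - of_real t))"
    by (rule Bochner_Integration.integral_cnj)
  finally show ?thesis .
qed

lemma exponential_second_moment:
  assumes y: "y > 0"
  shows "integrable (density lborel (exponential_density y)) (\<lambda>s. s\<^sup>2)"
    and "(LINT s|density lborel (exponential_density y). s\<^sup>2) = 2 / y\<^sup>2"
proof -
  interpret X: prob_space "density lborel (exponential_density y)" by (rule prob_space_exponential_density[OF y])
  have D: "distributed (density lborel (exponential_density y)) lborel (\<lambda>s. s) (erlang_density 0 y)"
    unfolding distributed_def by (auto simp: distr_id2 intro!: distr_id2)
  have "has_bochner_integral (density lborel (exponential_density y)) (\<lambda>s. s ^ 2) (fact (0 + 2) / (fact 0 * y ^ 2))"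
    by (rule X.has_bochner_integral_erlang_ith_moment[OF y D])
  hence "has_bochner_integral (density lborel (exponential_density y)) (\<lambda>s. s ^ 2) (2 / y\<^sup>2)" by (simp add: fact_numeral)
  thus "integrable (density lborel (exponential_density y)) (\<lambda>s. s\<^sup>2)"
    and "(LINT s|density lborel (exponential_density y). s\<^sup>2) = 2 / y\<^sup>2"
    by (auto simp: has_bochner_integral_iff)
qed

text \<open>Integrate \<open>n (char - 1) \<rightarrow> - t^2 / 2\<close> against the exponential
  law of rate \<open>y\<close>. Its second moment \<open>2 / y^2\<close> yields the limit
  \<open>- 1 / y^2\<close>, which is \<open>1 / (\<i> y)^2\<close>; quadratic growth justifies the
  interchange.\<close>

lemma classical_gaussian_increments:
  assumes \<mu>: "real_distribution \<mu>" and B: "\<And>n. B n > 0"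
    and wc: "weak_conv_m (\<lambda>n. dilation (1 / B n) (convolution_power convolution \<mu> n)) std_normal_distribution"
    and y: "y > 0"
  shows "gaussian_increments (\<lambda>n. dilation (1 / B n) \<mu>) (\<i> * of_real y)"
proof -
  interpret \<mu>: real_distribution \<mu> by fact
  let ?M = "\<lambda>n. dilation (1 / B n) \<mu>"
  let ?X = "density lborel (exponential_density y)"
  interpret X: prob_space ?X by (rule prob_space_exponential_density[OF y])
  have M: "real_distribution (?M n)" for n by (rule \<mu>.real_distribution_dilation)
  have Mc: "char (?M n) t = char \<mu> (t / B n)" for n t by (simp add: \<mu>.char_dilation)
  note inc = classical_char_increments[OF \<mu> B wc]
  have ptw: "(\<lambda>n. of_nat n * (char (?M n) t - 1)) \<longlonglongrightarrow> - of_real (t\<^sup>2 / 2)" for t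
  proof (rule LIM_zero_cancel, rule tendstoI)
    fix \<epsilon> :: real assume "\<epsilon> > 0"
    with inc[of "\<epsilon> / 2" "\<bar>t\<bar>"] show "\<forall>\<^sub>F n in sequentially. dist (of_nat n * (char (?M n) t - 1) - - of_real (t\<^sup>2 / 2)) 0 < \<epsilon>"
      by (auto simp: Mc elim!: eventually_mono dest!: spec[of _ t])
  qed
  have "\<forall>\<^sub>F n in sequentially. \<forall>t. \<bar>t\<bar> \<le> 1 \<longrightarrow> norm (of_nat n * (char (?M n) t - 1) + of_real (t\<^sup>2 / 2)) \<le> 1"
    using inc[of 1 1] by (simp add: Mc)
  then obtain n0 where n0: "\<And>n t. n \<ge> n0 \<Longrightarrow> \<bar>t\<bar> \<le> 1 \<Longrightarrow> norm (of_nat n * (char (?M n) t - 1) + of_real (t\<^sup>2 / 2)) \<le> 1"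
    by (auto simp: eventually_sequentially)
  have growth: "norm (of_nat n * (char (?M n) t - 1)) \<le> 2 * (1 + 4 * t\<^sup>2)" if n: "n \<ge> max 1 n0" for n t
  proof -
    have "norm (char (?M n) s - 1) \<le> 2 / real n" if s: "\<bar>s\<bar> \<le> 1" for s
    proof -
      have "s\<^sup>2 / 2 \<le> 1" using s by (simp add: abs_square_le_1 [symmetric])
      moreover have "norm (of_nat n * (char (?M n) s - 1)) \<le> norm (of_nat n * (char (?M n) s - 1) + of_real (s\<^sup>2 / 2)) + norm (complex_of_real (s\<^sup>2 / 2))"
        by (metis add_diff_cancel_right' norm_triangle_ineq4)
      moreover have "norm (complex_of_real (s\<^sup>2 / 2)) = s\<^sup>2 / 2" by (simp only: norm_of_real) simp
      ultimately have "norm (of_nat n * (char (?M n) s - 1)) \<le> 2" using n0[of n s] n s by linarith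
      thus ?thesis using n by (simp add: norm_mult pos_le_divide_eq mult.commute)
    qed
    from real_distribution.char_quadratic_growth[OF M this]
    have "norm (char (?M n) t - 1) \<le> 2 / real n * (1 + 4 * t\<^sup>2)" .
    hence "real n * norm (char (?M n) t - 1) \<le> real n * (2 / real n * (1 + 4 * t\<^sup>2))" by (intro mult_left_mono) auto
    thus ?thesis using n by (simp add: norm_mult)
  qed
  have meas: "(\<lambda>s. of_nat n * (char (?M n) s - 1)) \<in> borel_measurable ?X" for n
    using real_distribution.char_measurable[OF M] by simp
  define N where "N = max 1 n0"
  have "(\<lambda>n. LINT s|?X. of_nat (n + N) * (char (?M (n + N)) s - 1)) \<longlonglongrightarrow> (LINT s|?X. - of_real (s\<^sup>2 / 2))"
  proof (rule integral_dominated_convergence[where w = "\<lambda>s. 2 * (1 + 4 * s\<^sup>2)"])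
    show "integrable ?X (\<lambda>s. 2 * (1 + 4 * s\<^sup>2))"
      using exponential_second_moment(1)[OF y] by simp
    show "AE s in ?X. (\<lambda>n. of_nat (n + N) * (char (?M (n + N)) s - 1)) \<longlonglongrightarrow> - of_real (s\<^sup>2 / 2)"
      by (rule AE_I2) (rule LIMSEQ_ignore_initial_segment[OF ptw])
    show "AE s in ?X. norm (of_nat (n + N) * (char (?M (n + N)) s - 1)) \<le> 2 * (1 + 4 * s\<^sup>2)" for n
      by (rule AE_I2) (rule growth, simp add: N_def)
    show "(\<lambda>s. of_nat (n + N) * (char (?M (n + N)) s - 1)) \<in> borel_measurable ?X" for n by (rule meas)
  qed simp
  hence "(\<lambda>n. LINT s|?X. of_nat n * (char (?M n) s - 1)) \<longlonglongrightarrow> (LINT s|?X. - complex_of_real (s\<^sup>2 / 2))"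
    by (rule LIMSEQ_offset)
  moreover have "(LINT s|?X. of_nat n * (char (?M n) s - 1)) = of_nat n * cnj (LINT t|?M n. of_real t / (\<i> * of_real y - of_real t))" for n
    unfolding integral_mult_right_zero real_distribution.integral_exponential_char[OF M y] ..
  moreover have "(LINT s|?X. - complex_of_real (s\<^sup>2 / 2)) = - 1 / of_real (y\<^sup>2)"
  proof -
    have i: "integrable ?X (\<lambda>s. s\<^sup>2 / 2)" by (rule integrable_divide_zero) (rule exponential_second_moment(1)[OF y])
    have "(LINT s|?X. complex_of_real (s\<^sup>2 / 2)) = of_real (LINT s|?X. s\<^sup>2 / 2)" by (rule integral_of_real[OF i])
    also have "(LINT s|?X. s\<^sup>2 / 2) = 1 / y\<^sup>2"
      unfolding integral_divide_zero exponential_second_moment(2)[OF y] by simp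
    finally show ?thesis by simp
  qed
  ultimately have "(\<lambda>n. of_nat n * cnj (LINT t|?M n. of_real t / (\<i> * of_real y - of_real t))) \<longlonglongrightarrow> - 1 / of_real (y\<^sup>2)"
    by (simp only:)
  from tendsto_cnj[OF this]
  have "(\<lambda>n. of_nat n * (LINT t|?M n. of_real t / (\<i> * of_real y - of_real t))) \<longlonglongrightarrow> 1 / (\<i> * of_real y)\<^sup>2"
    by (simp add: power_mult_distrib)
  thus ?thesis using gaussian_increments_iff[OF M, of "\<i> * of_real y"] y by simp
qed

subsection \<open>Equicontinuity\<close>

text \<open>Maps into the closed half-plane that are bounded at moving points \<open>a n\<close> are
  equicontinuous near the limit of these points; this allows evaluation points to be
  exchanged.\<close>

lemma schwarz_pick_sequence:
  assumes hol: "\<And>n. f n holomorphic_on upper_half_plane"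
    and nonneg: "\<And>n z. Im z > 0 \<Longrightarrow> Im (f n z) \<ge> 0"
    and ab: "a \<longlonglongrightarrow> u" "b \<longlonglongrightarrow> u" and u: "Im u > 0"
    and bound: "\<forall>\<^sub>F n in sequentially. norm (f n (a n)) \<le> C"
  shows "(\<lambda>n. f n (b n) - f n (a n)) \<longlonglongrightarrow> 0"
proof (rule Lim_null_comparison)
  let ?s = "Im u / 2"
  have ev1: "\<forall>\<^sub>F n in sequentially. Im (a n) > ?s"
    using u by (intro order_tendstoD[OF tendsto_Im[OF ab(1)]]) simp
  have d: "(\<lambda>n. norm (b n - a n)) \<longlonglongrightarrow> 0"
    using tendsto_norm_zero[OF LIM_zero[OF ab(2)]] tendsto_norm[OF tendsto_diff[OF ab(2,1)]] by simp
  have ev2: "\<forall>\<^sub>F n in sequentially. norm (b n - a n) < ?s / 2"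
    using u by (intro order_tendstoD[OF d]) simp
  show "\<forall>\<^sub>F n in sequentially. norm (f n (b n) - f n (a n)) \<le> norm (b n - a n) * (2 * C / ?s)"
    using ev1 ev2 bound
  proof eventually_elim
    case (elim n)
    have a: "Im (a n) > 0" and ba: "norm (b n - a n) < Im (a n)" using elim u by linarith+
    have "norm (f n (b n) - f n (a n)) * (?s / 2) \<le> norm (f n (b n) - f n (a n)) * (Im (a n) - norm (b n - a n))"
      using elim by (intro mult_left_mono) auto
    also have "\<dots> \<le> norm (b n - a n) * Im (f n (a n))"
      by (rule schwarz_pick_local[OF hol nonneg a ba])
    also have "\<dots> \<le> norm (b n - a n) * C"
      using elim abs_Im_le_cmod[of "f n (a n)"] by (intro mult_left_mono) auto
    finally show ?case using u by (simp add: field_simps)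
  qed
  have "(\<lambda>n. norm (b n - a n) * (2 * C / ?s)) \<longlonglongrightarrow> 0 * (2 * C / ?s)" by (intro tendsto_intros d)
  thus "(\<lambda>n. norm (b n - a n) * (2 * C / ?s)) \<longlonglongrightarrow> 0" by simp
qed

lemma schwarz_pick_tendsto:
  assumes hol: "\<And>n. f n holomorphic_on upper_half_plane"
    and nonneg: "\<And>n z. Im z > 0 \<Longrightarrow> Im (f n z) \<ge> 0"
    and ab: "a \<longlonglongrightarrow> u" "b \<longlonglongrightarrow> u" and u: "Im u > 0"
    and lim: "(\<lambda>n. f n (a n)) \<longlonglongrightarrow> l"
  shows "(\<lambda>n. f n (b n)) \<longlonglongrightarrow> l"
proof -
  obtain C where C: "\<And>n. norm (f n (a n)) \<le> C"
    using convergent_imp_Bseq[OF convergentI[OF lim]] by (auto simp: Bseq_def)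
  have "(\<lambda>n. (f n (b n) - f n (a n)) + f n (a n)) \<longlonglongrightarrow> 0 + l"
    by (intro tendsto_add lim schwarz_pick_sequence[OF hol nonneg ab u always_eventually]) (use C in auto)
  thus ?thesis by simp
qed

text \<open>Otherwise bad points \<open>z n\<close> in \<open>K\<close> would accumulate at some
  \<open>u\<close>, where equicontinuity together with convergence at \<open>u\<close> itself gives
  a contradiction.\<close>

lemma schwarz_pick_uniform_limit:
  assumes hol: "\<And>n. f n holomorphic_on upper_half_plane"
    and nonneg: "\<And>n z. Im z > 0 \<Longrightarrow> Im (f n z) \<ge> 0"
    and K: "compact K" "\<And>z. z \<in> K \<Longrightarrow> Im z > 0" and g: "continuous_on K g"
    and lim: "\<And>z. z \<in> K \<Longrightarrow> (\<lambda>n. f n z) \<longlonglongrightarrow> g z" and e: "\<epsilon> > 0"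
  shows "\<forall>\<^sub>F n in sequentially. \<forall>z\<in>K. norm (f n z - g z) < \<epsilon>"
proof (rule ccontr)
  assume "\<not> ?thesis"
  hence "\<exists>\<^sub>F n in sequentially. \<exists>z\<in>K. norm (f n z - g z) \<ge> \<epsilon>" by (simp add: frequently_def not_le)
  from frequently_subseq[OF this]
  obtain r :: "nat \<Rightarrow> nat" where r: "strict_mono r" and "\<And>n. \<exists>z\<in>K. norm (f (r n) z - g z) \<ge> \<epsilon>" by blast
  then obtain z where z: "\<And>n. z n \<in> K" "\<And>n. norm (f (r n) (z n) - g (z n)) \<ge> \<epsilon>" by metis
  obtain u s where s: "u \<in> K" "strict_mono s" "(z \<circ> s) \<longlonglongrightarrow> u"
    using K(1) z(1) unfolding compact_def by metis
  let ?f = "\<lambda>n. f (r (s n))"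
  have zs: "(\<lambda>n. z (s n)) \<longlonglongrightarrow> u" using s(3) by (simp add: o_def)
  have "(\<lambda>n. ?f n u) \<longlonglongrightarrow> g u"
    using LIMSEQ_subseq_LIMSEQ[OF lim[OF s(1)] strict_mono_o[OF r s(2)]] by (simp add: o_def)
  hence "(\<lambda>n. ?f n (z (s n))) \<longlonglongrightarrow> g u"
  proof (rule schwarz_pick_tendsto[where f = ?f and a = "\<lambda>_. u" and u = u, rotated -1])
    show "?f n holomorphic_on upper_half_plane" for n by (rule hol)
    show "Im (?f n v) \<ge> 0" if "Im v > 0" for n v by (rule nonneg[OF that])
  qed (use zs K(2)[OF s(1)] in simp_all)
  moreover have "(\<lambda>n. g (z (s n))) \<longlonglongrightarrow> g u"
    by (rule continuous_on_tendsto_compose[OF g zs s(1)]) (use z in auto)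
  ultimately have "(\<lambda>n. norm (?f n (z (s n)) - g (z (s n)))) \<longlonglongrightarrow> norm (g u - g u)"
    by (intro tendsto_intros)
  hence "(\<lambda>n. norm (?f n (z (s n)) - g (z (s n)))) \<longlonglongrightarrow> 0" by simp
  moreover have "\<epsilon> \<le> norm (?f n (z (s n)) - g (z (s n)))" for n using z(2) by simp
  ultimately have "\<epsilon> \<le> 0" by (intro LIMSEQ_le_const) auto
  with e show False by simp
qed

lemma scaled_increment:
  assumes M: "real_distribution M"
  shows "(\<lambda>z. of_nat n * (F_transform M z - z)) holomorphic_on upper_half_plane"
    and "Im z > 0 \<Longrightarrow> Im (of_nat n * (F_transform M z - z)) \<ge> 0"
  using real_distribution.holomorphic_F_transform_minus_id[OF M] real_distribution.Im_F_transform_ge[OF M, of z]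
  by (auto intro!: holomorphic_intros)

subsection \<open>The free central limit theorem\<close>

text \<open>The subordination equation is homogeneous: \<open>w = \<omega> (b z) / b\<close> solves
  it for the dilated measure.\<close>

lemma free_power_scaled:
  assumes \<mu>: "real_distribution \<mu>" and b: "b > 0" and z: "Im z > 0"
  defines "M \<equiv> dilation (1 / b) \<mu>"
  shows "\<exists>w. Im w \<ge> Im z \<and> w = z + of_nat k * (F_transform M w - w)
     \<and> F_transform (dilation (1 / b) (convolution_power free_convolution \<mu> (Suc k))) z = F_transform M w"
proof -
  let ?P = "convolution_power free_convolution \<mu> (Suc k)"
  have P: "real_distribution ?P" by (rule free_convolution_power(1)[OF \<mu>])
  obtain \<omega> where \<omega>: "subordinated \<mu> k ?P \<omega>" using free_convolution_power(2)[OF \<mu> refl] by blast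
  let ?z = "of_real b * z"
  have bz: "Im ?z > 0" using b z by simp
  have s: "Im (\<omega> ?z) \<ge> Im ?z" "F_transform ?P ?z = F_transform \<mu> (\<omega> ?z)"
    "\<omega> ?z = ?z + of_nat k * (F_transform \<mu> (\<omega> ?z) - \<omega> ?z)"
    using \<omega> bz unfolding subordinated_def by blast+
  define w where "w = \<omega> ?z / of_real b"
  have bw: "of_real b * w = \<omega> ?z" using b by (simp add: w_def)
  have FM: "F_transform M w = F_transform \<mu> (\<omega> ?z) / of_real b"
    using real_distribution.F_transform_dilation[OF \<mu> b, of w] by (simp add: M_def bw)
  show ?thesis
  proof (intro exI[of _ w] conjI)
    show "Im z \<le> Im w" using s(1) b by (simp add: w_def field_simps)
    have "w = (?z + of_nat k * (F_transform \<mu> (\<omega> ?z) - \<omega> ?z)) / of_real b"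
      unfolding w_def by (rule arg_cong[OF s(3)])
    also have "\<dots> = z + of_nat k * (F_transform M w - w)"
    proof -
      have "F_transform M w - w = (F_transform \<mu> (\<omega> ?z) - \<omega> ?z) / of_real b"
        unfolding FM by (simp add: w_def diff_divide_distrib)
      thus ?thesis using b by (simp add: add_divide_distrib)
    qed
    finally show "w = z + of_nat k * (F_transform M w - w)" .
    show "F_transform (dilation (1 / b) ?P) z = F_transform M w"
      by (simp add: real_distribution.F_transform_dilation[OF P b] FM s(2))
  qed
qed

text \<open>For two solutions \<open>f a - f b = a - b\<close>, so Schwarz-Pick yields
  \<open>|a - cnj b| \<le> |a - cnj b - 2 \<i> Im z|\<close>. This requires
  \<open>Im a + Im b \<le> Im z\<close>, whereas both heights are at least
  \<open>Im z\<close>.\<close>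

lemma subordination_fixed_point_unique:
  assumes hol: "f holomorphic_on upper_half_plane" and nonneg: "\<And>z. Im z > 0 \<Longrightarrow> Im (f z) \<ge> 0"
    and z: "Im z > 0" and a: "Im a \<ge> Im z" "a = z + f a" and b: "Im b \<ge> Im z" "b = z + f b"
  shows "a = b"
proof (rule ccontr)
  assume ne: "a \<noteq> b"
  have a0: "Im a > 0" and b0: "Im b > 0" using a b z by auto
  have fa: "f a = a - z" using a(2) by (metis add_diff_cancel_left')
  have fb: "f b = b - z" using b(2) by (metis add_diff_cancel_left')
  have "norm (f a - f b) * norm (a - cnj b) \<le> norm (a - b) * norm (f a - cnj (f b))"
    by (rule schwarz_pick[OF hol nonneg a0 b0])
  hence "norm (a - b) * norm (a - cnj b) \<le> norm (a - b) * norm (a - cnj b - (z - cnj z))"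
    unfolding fa fb by (simp add: algebra_simps)
  hence "norm (a - cnj b) \<le> norm (a - cnj b - (z - cnj z))" using ne by simp
  hence "(norm (a - cnj b))\<^sup>2 \<le> (norm (a - cnj b - (z - cnj z)))\<^sup>2" by (intro power_mono) auto
  hence "(Im a + Im b)\<^sup>2 \<le> (Im a + Im b - 2 * Im z)\<^sup>2" by (simp add: cmod_power2)
  hence "Im z * (Im a + Im b) \<le> Im z * Im z" by (simp add: power2_eq_square algebra_simps)
  hence "Im a + Im b \<le> Im z" using z by simp
  thus False using a b z by linarith
qed

text \<open>Forward, the subordination equation expresses the increment at the moving point
  \<open>w n\<close> through the transform of the power, and \<open>w n\<close> tends to the
  semicircle transform \<open>?S z\<close>; equicontinuity moves the increment to that limit point.
  Backward, a perturbed fixed point is located by Brouwer and identified with the subordination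
  point by uniqueness.\<close>

theorem free_weak_conv_iff:
  assumes \<mu>: "real_distribution \<mu>" and B: "\<And>n. B n > 0"
  shows "weak_conv_m (\<lambda>n. dilation (1 / B n) (convolution_power free_convolution \<mu> n)) semicircle_distribution
    \<longleftrightarrow> (\<forall>z. Im z > 0 \<longrightarrow> gaussian_increments (\<lambda>n. dilation (1 / B n) \<mu>) z)"
proof -
  interpret \<mu>: real_distribution \<mu> by fact
  let ?R = "\<lambda>n. dilation (1 / B n) (convolution_power free_convolution \<mu> n)"
  let ?M = "\<lambda>n. dilation (1 / B n) \<mu>"
  let ?S = "F_transform semicircle_distribution"
  have R: "real_distribution (?R n)" for n
    by (intro real_distribution.real_distribution_dilation free_convolution_power \<mu>)
  have M: "real_distribution (?M n)" for n by (rule \<mu>.real_distribution_dilation)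
  have S_ge: "Im (?S z) \<ge> Im z" if "Im z > 0" for z by (rule semicircle.Im_F_transform_ge[OF that])
  define h where "h n w = F_transform (?M n) w - w" for n w
  have ex: "\<exists>w. Im w \<ge> Im z \<and> w = z + of_nat (n - 1) * h n w \<and> F_transform (?R n) z = F_transform (?M n) w"
    if n: "n \<ge> 1" and z: "Im z > 0" for n z
  proof (cases n)
    case (Suc m)
    show ?thesis using free_power_scaled[OF \<mu> B[of n] z, of m] unfolding h_def Suc by simp
  qed (use n in simp)
  show ?thesis
  proof
    assume wc: "weak_conv_m ?R semicircle_distribution"
    have inc: "gaussian_increments ?M (?S z)" if z: "Im z > 0" for z
    proof -
      let ?u = "?S z"
      have u0: "Im ?u > 0" using S_ge[OF z] z by simp
      have F_lim: "(\<lambda>n. F_transform (?R n) z) \<longlonglongrightarrow> ?u"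
        by (rule weak_conv_imp_F_transform[OF R semicircle_distribution_props(1) wc z])
      obtain w' where w': "\<And>n. n \<ge> 1 \<Longrightarrow> Im (w' n) \<ge> Im z \<and> w' n = z + of_nat (n - 1) * h n (w' n) \<and> F_transform (?R n) z = F_transform (?M n) (w' n)"
        using ex[OF _ z] by metis
      define w where "w n = w' (Suc n)" for n
      have w: "w n = z + of_nat n * h (Suc n) (w n)" "F_transform (?R (Suc n)) z = w n + h (Suc n) (w n)" for n
        using w'[of "Suc n"] by (simp_all add: w_def h_def)
      \<comment> \<open>Subordination contributes \<open>n\<close> increments and the outer
        application of \<open>F\<close> one more, which makes the full factor
        \<open>Suc n\<close>.\<close>
      have nh: "of_nat (Suc n) * h (Suc n) (w n) = F_transform (?R (Suc n)) z - z" for n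
        using w[of n] by (simp add: algebra_simps)
      have F_lim': "(\<lambda>n. F_transform (?R (Suc n)) z) \<longlonglongrightarrow> ?u" by (rule LIMSEQ_Suc[OF F_lim])
      have "(\<lambda>n. of_nat (Suc n) * h (Suc n) (w n)) \<longlonglongrightarrow> ?u - z" unfolding nh by (intro tendsto_intros F_lim')
      moreover have "?u - z = - 1 / ?u" using F_transform_semicircle[OF z] by (simp add: algebra_simps)
      ultimately have L: "(\<lambda>n. of_nat (Suc n) * h (Suc n) (w n)) \<longlonglongrightarrow> - 1 / ?u" by simp
      have "(\<lambda>n. (1 / of_nat (Suc n)) * (of_nat (Suc n) * h (Suc n) (w n))) \<longlonglongrightarrow> 0 * (- 1 / ?u)"
        by (intro tendsto_mult L LIMSEQ_Suc[OF lim_1_over_n])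
      hence "(\<lambda>n. h (Suc n) (w n)) \<longlonglongrightarrow> 0" by (simp del: of_nat_Suc)
      hence "(\<lambda>n. F_transform (?R (Suc n)) z - h (Suc n) (w n)) \<longlonglongrightarrow> ?u - 0" by (intro tendsto_diff F_lim')
      hence w_lim: "w \<longlonglongrightarrow> ?u" by (simp add: w(2))
      have "(\<lambda>n. of_nat (Suc n) * h (Suc n) ?u) \<longlonglongrightarrow> - 1 / ?u"
        unfolding h_def
        by (rule schwarz_pick_tendsto[where f = "\<lambda>n w. of_nat (Suc n) * (F_transform (?M (Suc n)) w - w)",
              OF scaled_increment(1)[OF M] scaled_increment(2)[OF M] w_lim tendsto_const u0])
           (assumption, rule L[unfolded h_def])
      hence "(\<lambda>n. of_nat n * h n ?u) \<longlonglongrightarrow> - 1 / ?u" by (rule LIMSEQ_imp_Suc)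
      thus ?thesis unfolding gaussian_increments_def h_def .
    qed
    \<comment> \<open>The point \<open>\<i> y\<close> is the semicircle transform of
      \<open>\<i> (y - 1 / y)\<close>, which lies in the upper half-plane for \<open>y > 1\<close>.
      Two such points determine the limits everywhere.\<close>
    have axis: "gaussian_increments ?M (\<i> * of_real y)" if y: "y > 1" for y :: real
    proof -
      let ?z = "\<i> * complex_of_real (y - 1 / y)"
      have z: "Im ?z > 0" using y by (simp add: field_simps) (metis less_1_mult mult.commute mult.right_neutral order_less_trans less_1_mult)
      have yy: "Im (\<i> * complex_of_real y) \<ge> Im ?z" "\<i> * complex_of_real y = ?z + (- 1 / (\<i> * of_real y))"
        using y by (auto simp: complex_eq_iff Re_divide Im_divide power2_eq_square)
      have SS: "?S ?z = ?z + (- 1 / ?S ?z)" using F_transform_semicircle[OF z] by (simp add: algebra_simps)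
      have "\<i> * complex_of_real y = ?S ?z"
        by (rule subordination_fixed_point_unique[of "\<lambda>w. - 1 / w" ?z, OF _ _ z yy S_ge[OF z] SS])
           (auto intro!: holomorphic_intros simp: Im_divide)
      thus ?thesis using inc[OF z] by simp
    qed
    show "\<forall>z. Im z > 0 \<longrightarrow> gaussian_increments ?M z"
    proof (intro allI impI)
      fix z :: complex assume "Im z > 0"
      from gaussian_increments_everywhere[of ?M 2 3, OF M _ _ _ axis[of 2] axis[of 3] this]
      show "gaussian_increments ?M z" by simp
    qed
  next
    assume G: "\<forall>z. Im z > 0 \<longrightarrow> gaussian_increments ?M z"
    show "weak_conv_m ?R semicircle_distribution"
    \<comment> \<open>Above height 3, balls of radius at most 1 around \<open>?u\<close> keep
      \<open>|x|\<close> and \<open>|?u|\<close> at least 2, so \<open>x \<mapsto> - 1 / x\<close>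
      shrinks distances to \<open>?u\<close> by a factor of at least 4.\<close>
    proof (rule F_transform_imp_weak_conv[OF R semicircle_distribution_props(1), of 3])
      fix z :: complex assume z3: "Im z > 3"
      hence z: "Im z > 0" by simp
      let ?u = "?S z"
      have u3: "Im ?u > 3" using S_ge[OF z] z3 by simp
      have u_eq: "?u = z + (- 1 / ?u)" using F_transform_semicircle[OF z] by (simp add: algebra_simps)
      let ?f = "\<lambda>n w. of_nat (n - 1) * h n w"
      have f_hol: "?f n holomorphic_on upper_half_plane" for n
        unfolding h_def by (rule scaled_increment(1)[OF M])
      have f_nonneg: "Im (?f n w) \<ge> 0" if "Im w > 0" for n w
        unfolding h_def by (rule scaled_increment(2)[OF M that])
      have f_lim: "(\<lambda>n. ?f n w) \<longlonglongrightarrow> - 1 / w" if w: "Im w > 0" for w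
      proof -
        have L: "(\<lambda>n. of_nat n * h n w) \<longlonglongrightarrow> - 1 / w" using G w by (simp add: gaussian_increments_def h_def)
        have "(\<lambda>n. of_nat n * h n w - h n w) \<longlonglongrightarrow> - 1 / w - 0"
          by (intro tendsto_diff L of_nat_mult_tendsto_imp_tendsto_0[OF L])
        moreover have "\<forall>\<^sub>F n in sequentially. of_nat n * h n w - h n w = ?f n w"
          using eventually_ge_at_top[of 1] by eventually_elim (simp add: of_nat_diff algebra_simps)
        ultimately show ?thesis by (simp add: Lim_transform_eventually)
      qed
      obtain w where w: "\<And>n. n \<ge> 1 \<Longrightarrow> Im (w n) \<ge> Im z \<and> w n = z + ?f n (w n) \<and> F_transform (?R n) z = F_transform (?M n) (w n)"
        using ex[OF _ z] by metis
      \<comment> \<open>The map \<open>x \<mapsto> z + ?f n x\<close> has distance at most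
        \<open>r / 2 + r / 4\<close> from \<open>?u\<close> on the ball of radius \<open>r\<close>,
        so the ball is invariant and contains a fixed point, necessarily \<open>w n\<close>.\<close>
      have w_near: "\<forall>\<^sub>F n in sequentially. norm (w n - ?u) \<le> r" if r: "0 < r" "r \<le> 1" for r
      proof -
        have K_pos: "Im x > 2" if "x \<in> cball ?u r" for x
          using that u3 r abs_Im_le_cmod[of "?u - x"] by (auto simp: dist_norm)
        have "\<forall>\<^sub>F n in sequentially. \<forall>x\<in>cball ?u r. norm (?f n x - (- 1 / x)) < r / 2"
        proof (rule schwarz_pick_uniform_limit[OF f_hol f_nonneg])
          show "continuous_on (cball ?u r) (\<lambda>x. - 1 / x)"
            using K_pos by (intro continuous_intros) fastforce
          show "Im x > 0" if "x \<in> cball ?u r" for x using K_pos[OF that] by simp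
          show "(\<lambda>n. ?f n x) \<longlonglongrightarrow> - 1 / x" if "x \<in> cball ?u r" for x using K_pos[OF that] by (intro f_lim) simp
        qed (use r in auto)
        thus ?thesis using eventually_ge_at_top[of 1]
        proof eventually_elim
          case (elim n)
          have maps: "z + ?f n x \<in> cball ?u r" if x: "x \<in> cball ?u r" for x
          proof -
            have x2: "norm x \<ge> 2" using K_pos[OF x] abs_Im_le_cmod[of x] by linarith
            have u2: "norm ?u \<ge> 2" using u3 abs_Im_le_cmod[of ?u] by linarith
            have nz: "x \<noteq> 0" "?u \<noteq> 0" using x2 u2 by auto
            have "z + ?f n x - ?u = z + ?f n x - (z + (- 1 / ?u))" using u_eq by simp
            also have "\<dots> = (?f n x - (- 1 / x)) + (?u - x) * (- 1 / (x * ?u))" using nz by (simp add: field_simps)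
            finally have "norm (z + ?f n x - ?u) \<le> norm (?f n x - (- 1 / x)) + norm (?u - x) * norm (1 / (x * ?u))"
              by (metis norm_triangle_ineq norm_mult norm_minus_cancel minus_divide_left)
            also have "\<dots> \<le> r / 2 + r * (1 / (2 * 2))"
            proof (intro add_mono mult_mono)
              show "norm (?f n x - (- 1 / x)) \<le> r / 2" using elim x by (intro less_imp_le) blast
              show "norm (?u - x) \<le> r" using x by (simp add: dist_norm)
              have "2 * 2 \<le> norm x * norm ?u" using x2 u2 by (intro mult_mono) auto
              thus "norm (1 / (x * ?u)) \<le> 1 / (2 * 2)" by (simp add: norm_divide norm_mult frac_le)
            qed (use r in auto)
            also have "\<dots> \<le> r" using r by simp
            finally show ?thesis by (simp add: dist_norm norm_minus_commute)
          qed
          have "\<exists>x\<in>cball ?u r. z + ?f n x = x"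
          proof (rule brouwer[of "cball ?u r" "\<lambda>x. z + ?f n x"])
            show "continuous_on (cball ?u r) (\<lambda>x. z + ?f n x)"
            proof (intro continuous_on_add continuous_on_const continuous_on_subset[OF holomorphic_on_imp_continuous_on[OF f_hol]] subsetI)
              fix x assume "x \<in> cball ?u r"
              thus "x \<in> upper_half_plane" using K_pos[of x] by simp
            qed
          qed (use maps r in auto)
          then obtain x where x: "x \<in> cball ?u r" "z + ?f n x = x" by blast
          have xp: "Im x > 0" using K_pos[OF x(1)] by simp
          have zx: "Im z \<le> Im x" using arg_cong[OF x(2), of Im] f_nonneg[OF xp, of n] by simp
          have "w n = x"
          proof (rule subordination_fixed_point_unique[of "?f n" z])
            show "?f n holomorphic_on upper_half_plane" by (rule f_hol)
            show "Im (?f n v) \<ge> 0" if "Im v > 0" for v by (rule f_nonneg[OF that])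
            show "Im (w n) \<ge> Im z" "w n = z + ?f n (w n)" using w[OF elim(2)] by blast+
          qed (use z zx x(2) in simp_all)
          thus ?case using x(1) by (simp add: dist_norm norm_minus_commute)
        qed
      qed
      have w_lim: "w \<longlonglongrightarrow> ?u"
      proof (rule tendstoI)
        fix \<epsilon> :: real assume e: "\<epsilon> > 0"
        have "\<forall>\<^sub>F n in sequentially. norm (w n - ?u) \<le> min 1 (\<epsilon> / 2)" using e by (intro w_near) auto
        thus "\<forall>\<^sub>F n in sequentially. dist (w n) ?u < \<epsilon>"
          by eventually_elim (use e in \<open>auto simp: dist_norm min_def split: if_splits\<close>)
      qed
      have "(\<lambda>n. of_nat n * h n (w n)) \<longlonglongrightarrow> - 1 / ?u"
        unfolding h_def
        by (rule schwarz_pick_tendsto[where f = "\<lambda>n w. of_nat n * (F_transform (?M n) w - w)",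
              OF scaled_increment(1)[OF M] scaled_increment(2)[OF M] tendsto_const w_lim])
           (use G u3 in \<open>auto simp: gaussian_increments_def\<close>)
      hence "(\<lambda>n. h n (w n)) \<longlonglongrightarrow> 0" by (rule of_nat_mult_tendsto_imp_tendsto_0)
      hence "(\<lambda>n. w n + h n (w n)) \<longlonglongrightarrow> ?u + 0" by (intro tendsto_add w_lim)
      moreover have "\<forall>\<^sub>F n in sequentially. w n + h n (w n) = F_transform (?R n) z"
        using eventually_ge_at_top[of 1] by eventually_elim (use w in \<open>simp add: h_def\<close>)
      ultimately show "(\<lambda>n. F_transform (?R n) z) \<longlonglongrightarrow> ?u" by (simp add: Lim_transform_eventually)
    qed
  qed
qed

subsection \<open>The arc-sine limit theorem\<close>

text \<open>Euler's method for \<open>dw/dt = c / w\<close>, whose solutions satisfy \<open>w(t)\<^sup>2 = w(0)\<^sup>2 + 2 c t\<close>.\<close>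

lemma euler_square_limit:
  fixes f :: "nat \<Rightarrow> complex \<Rightarrow> complex" and N :: "nat \<Rightarrow> nat"
  assumes hol: "\<And>n. (\<lambda>z. of_nat (N n) * (f n z - z)) holomorphic_on upper_half_plane"
    and nonneg: "\<And>n z. Im z > 0 \<Longrightarrow> Im (of_nat (N n) * (f n z - z)) \<ge> 0"
    and lim: "\<And>z. Im z > 0 \<Longrightarrow> (\<lambda>n. of_nat (N n) * (f n z - z)) \<longlonglongrightarrow> c / z"
    and N: "filterlim N at_top sequentially" and z: "Im z > 2 * norm c + 2"
  shows "(\<lambda>n. ((f n ^^ N n) z)\<^sup>2) \<longlonglongrightarrow> z\<^sup>2 + 2 * c"
proof (rule LIM_zero_cancel, rule tendstoI)
  fix \<epsilon> :: real assume e: "\<epsilon> > 0"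
  let ?V = "\<lambda>n w. of_nat (N n) * (f n w - w)"
  define D where "D = 2 * (norm z + 1)"
  have D: "D > 0" by (simp add: D_def add_nonneg_pos)
  define \<delta> where "\<delta> = min (1/2) (\<epsilon> / (2 * (D + 1)))"
  have \<delta>: "\<delta> > 0" "\<delta> \<le> 1/2" "D * \<delta> < \<epsilon> / 2"
  proof -
    have "\<delta> \<le> \<epsilon> / (2 * (D + 1))" by (simp add: \<delta>_def)
    hence "D * \<delta> \<le> D * (\<epsilon> / (2 * (D + 1)))" using D by (intro mult_left_mono) auto
    also have "\<dots> < \<epsilon> / 2" using D e by (simp add: field_simps)
    finally show "D * \<delta> < \<epsilon> / 2" .
    show "\<delta> \<le> 1/2" unfolding \<delta>_def by (rule min.cobounded1)
  qed (use e D in \<open>auto simp: \<delta>_def\<close>)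
  \<comment> \<open>On this ball \<open>|c / w| \<le> 1/2\<close>. With the error
    \<open>\<delta> \<le> 1/2\<close> each Euler step has length at most \<open>1 / N n\<close>, so
    \<open>N n\<close> steps cannot leave the ball.\<close>
  have K_Im: "Im w > 2 * norm c + 1" if "w \<in> cball z 1" for w
    using that z abs_Im_le_cmod[of "z - w"] by (auto simp: dist_norm)
  have K_pos: "Im w > 0" if "w \<in> cball z 1" for w
    by (rule le_less_trans[OF _ K_Im[OF that]]) (simp add: add_nonneg_nonneg)
  have cont: "continuous_on (cball z 1) (\<lambda>w. c / w)"
  proof (intro continuous_intros ballI notI)
    fix w :: complex assume "w \<in> cball z 1" "w = 0"
    with K_pos[of w] show False by simp
  qed
  have ev1: "\<forall>\<^sub>F n in sequentially. \<forall>w\<in>cball z 1. norm (?V n w - c / w) < \<delta>"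
    by (rule schwarz_pick_uniform_limit[where f = ?V, OF hol nonneg compact_cball K_pos cont lim[OF K_pos] \<delta>(1)])
  have ev2: "\<forall>\<^sub>F n in sequentially. real (N n) > 2 / \<epsilon>"
    using filterlim_compose[OF filterlim_real_sequentially N]
    by (rule filterlim_at_top_dense[THEN iffD1, rule_format])
  show "\<forall>\<^sub>F n in sequentially. dist (((f n ^^ N n) z)\<^sup>2 - (z\<^sup>2 + 2 * c)) 0 < \<epsilon>"
    using ev1 ev2
  proof eventually_elim
    case (elim n)
    have N0: "real (N n) > 0" and N2: "1 / real (N n) < \<epsilon> / 2"
    proof -
      have "2 / \<epsilon> > 0" using e by simp
      thus "real (N n) > 0" using elim(2) by linarith
      thus "1 / real (N n) < \<epsilon> / 2" using elim(2) e by (simp add: field_simps)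
    qed
    have V_bound: "norm (f n w - w) \<le> 1 / real (N n)" if w: "w \<in> cball z 1" for w
    proof -
      have "norm (c / w) \<le> 1 / 2"
      proof -
        have "norm w \<ge> 2 * norm c" "norm w > 0" using K_Im[OF w] K_pos[OF w] abs_Im_le_cmod[of w] by linarith+
        thus ?thesis by (simp add: norm_divide divide_le_eq)
      qed
      moreover have "norm (?V n w) \<le> norm (?V n w - c / w) + norm (c / w)"
        by (rule norm_triangle_sub[of "?V n w" "c / w", unfolded add.commute[of "norm (c / w)"]])
      moreover have "norm (?V n w - c / w) < \<delta>" using elim(1) w by blast
      ultimately have "norm (?V n w) \<le> 1" using \<delta> by linarith
      thus ?thesis using N0 by (simp add: norm_mult pos_le_divide_eq mult.commute)
    qed
    define w where "w k = (f n ^^ k) z" for k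
    have wS: "w (Suc k) = f n (w k)" for k by (simp add: w_def)
    have w_near: "norm (w k - z) \<le> real k / real (N n)" if "k \<le> N n" for k
      using that
    proof (induction k)
      case (Suc k)
      hence IH: "norm (w k - z) \<le> real k / real (N n)" by simp
      also have "\<dots> \<le> 1" using Suc.prems N0 by (simp add: divide_le_eq)
      finally have wk: "w k \<in> cball z 1" by (simp add: dist_norm norm_minus_commute)
      have "norm (w (Suc k) - z) \<le> norm (f n (w k) - w k) + norm (w k - z)"
        unfolding wS using norm_triangle_ineq[of "f n (w k) - w k" "w k - z"] by simp
      also have "\<dots> \<le> 1 / real (N n) + real k / real (N n)" by (intro add_mono V_bound wk IH)
      finally show ?case by (simp add: add_divide_distrib)
    qed (simp add: w_def)
    have w_in: "w k \<in> cball z 1" if "k \<le> N n" for k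
    proof -
      have "real k / real (N n) \<le> 1" using that N0 by (simp add: divide_le_eq)
      thus ?thesis using w_near[OF that] by (simp add: dist_norm norm_minus_commute)
    qed
    \<comment> \<open>Bounds the deviation of one increment of \<open>w k\<close> squared from
      \<open>2 c / N n\<close>: passing to squares makes the drift constant, and \<open>N n\<close>
      such errors add up to \<open>D \<delta> + 1 / N n\<close>.\<close>
    let ?s = "(D * \<delta> + 1 / real (N n)) / real (N n)"
    have sq: "norm ((w k)\<^sup>2 - z\<^sup>2 - 2 * c * of_real (real k / real (N n))) \<le> real k * ?s" if "k \<le> N n" for k
      using that
    proof (induction k)
      case (Suc k)
      let ?h = "f n (w k) - w k"
      have wk: "w k \<in> cball z 1" using w_in Suc.prems by simp
      have wk0: "w k \<noteq> 0" using K_pos[OF wk] by auto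
      have hV: "?h = ?V n (w k) / of_nat (N n)" using N0 by simp
      have "(w (Suc k))\<^sup>2 - (w k)\<^sup>2 - 2 * c / of_nat (N n) = 2 * w k * ?h + ?h\<^sup>2 - 2 * c / of_nat (N n)"
        unfolding wS by (simp add: power2_eq_square algebra_simps)
      also have "\<dots> = 2 * w k * (?V n (w k) - c / w k) / of_nat (N n) + ?h\<^sup>2"
        using wk0 N0 by (simp add: field_simps)
      finally have "norm ((w (Suc k))\<^sup>2 - (w k)\<^sup>2 - 2 * c / of_nat (N n))
          \<le> norm (2 * w k * (?V n (w k) - c / w k) / of_nat (N n)) + norm (?h\<^sup>2)"
        by (simp only: norm_triangle_ineq)
      also have "\<dots> \<le> D * \<delta> / real (N n) + (1 / real (N n))\<^sup>2"
      proof (intro add_mono)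
        have "norm (w k) \<le> norm z + 1"
          using wk norm_triangle_sub[of "w k" z] by (simp add: dist_norm norm_minus_commute)
        hence "2 * norm (w k) * norm (?V n (w k) - c / w k) \<le> D * \<delta>"
          using elim(1) wk by (intro mult_mono) (auto simp: D_def less_imp_le)
        thus "norm (2 * w k * (?V n (w k) - c / w k) / of_nat (N n)) \<le> D * \<delta> / real (N n)"
          using N0 by (simp add: norm_mult norm_divide divide_right_mono)
        show "norm (?h\<^sup>2) \<le> (1 / real (N n))\<^sup>2"
          unfolding norm_power by (intro power_mono V_bound wk) simp
      qed
      also have "\<dots> = ?s" by (simp add: add_divide_distrib power2_eq_square)
      finally have step: "norm ((w (Suc k))\<^sup>2 - (w k)\<^sup>2 - 2 * c / of_nat (N n)) \<le> ?s" .
      have "(w (Suc k))\<^sup>2 - z\<^sup>2 - 2 * c * of_real (real (Suc k) / real (N n))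
        = ((w (Suc k))\<^sup>2 - (w k)\<^sup>2 - 2 * c / of_nat (N n)) + ((w k)\<^sup>2 - z\<^sup>2 - 2 * c * of_real (real k / real (N n)))"
        by (simp add: add_divide_distrib algebra_simps)
      hence "norm ((w (Suc k))\<^sup>2 - z\<^sup>2 - 2 * c * of_real (real (Suc k) / real (N n))) \<le> ?s + real k * ?s"
        using step Suc by (metis (no_types, lifting) Suc_leD add_mono norm_triangle_le)
      also have "\<dots> = real (Suc k) * ?s" by (simp only: of_nat_Suc distrib_right mult_1)
      finally show ?case .
    qed (simp add: w_def)
    have "norm ((w (N n))\<^sup>2 - z\<^sup>2 - 2 * c * of_real (real (N n) / real (N n))) \<le> real (N n) * ?s"
      by (rule sq) simp
    hence "norm ((w (N n))\<^sup>2 - (z\<^sup>2 + 2 * c)) \<le> D * \<delta> + 1 / real (N n)"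
      using N0 by (simp add: diff_diff_eq)
    thus ?case using \<delta>(3) N2 by (simp add: w_def)
  qed
qed

text \<open>Selection of the branch: in \<open>g^2 - F^2 = (g - F) (g + F)\<close> the second factor
  has imaginary part at least \<open>Im z\<close>, so convergence of squares implies
  convergence.\<close>

lemma F_transform_arcsine_unique:
  assumes z: "Im z > 0" and lim: "(\<lambda>n. (g n)\<^sup>2) \<longlonglongrightarrow> z\<^sup>2 - 2" and g: "\<And>n. Im (g n) \<ge> Im z"
  shows "g \<longlonglongrightarrow> F_transform arcsine_distribution z"
proof (rule LIM_zero_cancel, rule Lim_null_comparison)
  let ?F = "F_transform arcsine_distribution z"
  have F: "Im ?F \<ge> Im z" by (rule arcsine.Im_F_transform_ge[OF z])
  have sum: "norm (g n + ?F) \<ge> Im z" for n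
    using g[of n] F z abs_Im_le_cmod[of "g n + ?F"] by simp
  show "\<forall>\<^sub>F n in sequentially. norm (g n - ?F) \<le> norm ((g n)\<^sup>2 - (z\<^sup>2 - 2)) / Im z"
  proof (rule always_eventually, rule allI)
    fix n
    have "(g n)\<^sup>2 - (z\<^sup>2 - 2) = (g n - ?F) * (g n + ?F)"
      unfolding F_transform_arcsine[OF z, symmetric] by (simp add: power2_eq_square algebra_simps)
    hence "norm ((g n)\<^sup>2 - (z\<^sup>2 - 2)) = norm (g n - ?F) * norm (g n + ?F)" by (simp add: norm_mult)
    also have "\<dots> \<ge> norm (g n - ?F) * Im z" using sum by (intro mult_left_mono) auto
    finally show "norm (g n - ?F) \<le> norm ((g n)\<^sup>2 - (z\<^sup>2 - 2)) / Im z" using z by (simp add: pos_le_divide_eq)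
  qed
  have "(\<lambda>n. norm ((g n)\<^sup>2 - (z\<^sup>2 - 2)) / Im z) \<longlonglongrightarrow> norm ((z\<^sup>2 - 2) - (z\<^sup>2 - 2)) / Im z"
    using z by (intro tendsto_intros lim) auto
  thus "(\<lambda>n. norm ((g n)\<^sup>2 - (z\<^sup>2 - 2)) / Im z) \<longlonglongrightarrow> 0" by simp
qed

lemma monotone_power_scaled:
  assumes \<mu>: "real_distribution \<mu>" and b: "b > 0" and z: "Im z > 0"
  shows "F_transform (dilation (1 / b) (convolution_power monotone_convolution \<mu> n)) z
     = (F_transform (dilation (1 / b) \<mu>) ^^ n) z"
proof -
  have bz: "Im (of_real b * z) > 0" using b z by simp
  have iter: "(F_transform (dilation (1 / b) \<mu>) ^^ n) z = (F_transform \<mu> ^^ n) (of_real b * z) / of_real b"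
    by (induction n) (use b in \<open>auto simp: real_distribution.F_transform_dilation[OF \<mu> b]\<close>)
  show ?thesis
    unfolding iter real_distribution.F_transform_dilation[OF monotone_convolution_power(1)[OF \<mu>] b]
      monotone_convolution_power(2)[OF \<mu> bz] ..
qed

lemma Im_F_transform_funpow:
  assumes "real_distribution M" "Im z > 0" shows "Im ((F_transform M ^^ n) z) \<ge> Im z"
proof (induction n)
  case (Suc n)
  have "Im ((F_transform M ^^ n) z) \<le> Im (F_transform M ((F_transform M ^^ n) z))"
    by (rule real_distribution.Im_F_transform_ge[OF assms(1)]) (use Suc assms in simp)
  thus ?case using Suc by simp
qed simp

lemma monotone_weak_conv_if:
  assumes \<mu>: "real_distribution \<mu>" and B: "\<And>n. B n > 0"
    and G: "\<And>z. Im z > 0 \<Longrightarrow> gaussian_increments (\<lambda>n. dilation (1 / B n) \<mu>) z"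
  shows "weak_conv_m (\<lambda>n. dilation (1 / B n) (convolution_power monotone_convolution \<mu> n)) arcsine_distribution"
\<comment> \<open>The height 4 is \<open>2 |c| + 2\<close> for \<open>c = - 1\<close>, as
  \<open>euler_square_limit\<close> demands.\<close>
proof (rule F_transform_imp_weak_conv[OF _ arcsine_distribution_props(1), of _ 4])
  let ?M = "\<lambda>n. dilation (1 / B n) \<mu>"
  have M: "real_distribution (?M n)" for n by (rule real_distribution.real_distribution_dilation[OF \<mu>])
  show "real_distribution (dilation (1 / B n) (convolution_power monotone_convolution \<mu> n))" for n
    by (intro real_distribution.real_distribution_dilation monotone_convolution_power \<mu>)
  fix z :: complex assume z4: "Im z > 4"
  hence z: "Im z > 0" by simp
  have "(\<lambda>n. ((F_transform (?M n) ^^ n) z)\<^sup>2) \<longlonglongrightarrow> z\<^sup>2 + 2 * (- 1)"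
  proof (rule euler_square_limit[where N = "\<lambda>n. n" and f = "\<lambda>n. F_transform (?M n)"])
    show "(\<lambda>n. of_nat n * (F_transform (?M n) w - w)) \<longlonglongrightarrow> - 1 / w" if "Im w > 0" for w
      using G[OF that] by (simp add: gaussian_increments_def)
  qed (use scaled_increment[OF M] z4 in \<open>auto simp: filterlim_ident\<close>)
  hence "(\<lambda>n. (F_transform (?M n) ^^ n) z) \<longlonglongrightarrow> F_transform arcsine_distribution z"
    by (intro F_transform_arcsine_unique z Im_F_transform_funpow M) simp
  thus "(\<lambda>n. F_transform (dilation (1 / B n) (convolution_power monotone_convolution \<mu> n)) z)
    \<longlonglongrightarrow> F_transform arcsine_distribution z"
    by (simp only: monotone_power_scaled[OF \<mu> B z])
qed

text \<open>If \<open>B\<close> had a bounded subsequence, then along it \<open>\<mu>\<close>-powers would converge weakly, say with limit transform \<open>H\<close>.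
  As \<open>Im F\<^sup>n\<close> increases in \<open>n\<close>, this forces \<open>Im (F (H z)) = Im (H z)\<close>, so \<open>F\<close> would be a translation.\<close>

lemma monotone_norming_at_top:
  assumes \<mu>: "real_distribution \<mu>" and B: "\<And>n. B n > 0"
    and wc: "weak_conv_m (\<lambda>n. dilation (1 / B n) (convolution_power monotone_convolution \<mu> n)) arcsine_distribution"
  shows "filterlim B at_top sequentially"
proof (rule ccontr)
  assume "\<not> filterlim B at_top sequentially"
  then obtain r b where r: "strict_mono r" and b: "(\<lambda>n. B (r n)) \<longlonglongrightarrow> b" "b \<ge> 0"
    using subseq_bounded_if_not_at_top[of B] B by blast
  interpret \<mu>: real_distribution \<mu> by fact
  let ?P = "\<lambda>n. convolution_power monotone_convolution \<mu> n"
  let ?R = "\<lambda>n. dilation (1 / B n) (?P n)"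
  have P: "real_distribution (?P n)" for n by (rule monotone_convolution_power[OF \<mu>])
  have R: "real_distribution (?R n)" for n by (intro real_distribution.real_distribution_dilation P)
  have F_iter: "F_transform (?P n) z = (F_transform \<mu> ^^ n) z" if "Im z > 0" for n z
    by (rule monotone_convolution_power(2)[OF \<mu> that])
  \<comment> \<open>The value \<open>b = 0\<close> is included; then this is the point mass at
    0.\<close>
  let ?H = "dilation b arcsine_distribution"
  have H: "real_distribution ?H" by (rule arcsine.real_distribution_dilation)
  have "weak_conv_m (\<lambda>n. ?P (r n)) ?H"
  proof (rule levy_continuity[OF P H])
    fix t :: real
    have "(\<lambda>n. char (?R (r n)) (B (r n) * t)) \<longlonglongrightarrow> char arcsine_distribution (b * t)"
      by (rule weak_conv_char_tendsto[OF R arcsine_distribution_props(1) weak_conv_m_subseq[OF wc r]])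
         (intro tendsto_intros b)
    moreover have "char (?R (r n)) (B (r n) * t) = char (?P (r n)) t" for n
      using B[of "r n"] by (simp add: real_distribution.char_dilation[OF P])
    ultimately show "(\<lambda>n. char (?P (r n)) t) \<longlonglongrightarrow> char ?H t"
      by (simp add: arcsine.char_dilation)
  qed
  hence H_lim: "(\<lambda>n. (F_transform \<mu> ^^ r n) z) \<longlonglongrightarrow> F_transform ?H z" if "Im z > 0" for z
    using weak_conv_imp_F_transform[OF P H _ that] F_iter[OF that] by simp
  have mono: "incseq (\<lambda>n. Im ((F_transform \<mu> ^^ n) \<i>))"
  proof (rule incseq_SucI)
    fix n
    have "Im ((F_transform \<mu> ^^ n) \<i>) > 0" using Im_F_transform_funpow[OF \<mu>, of \<i> n] by simp
    from \<mu>.Im_F_transform_ge[OF this] show "Im ((F_transform \<mu> ^^ n) \<i>) \<le> Im ((F_transform \<mu> ^^ Suc n) \<i>)" by simp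
  qed
  let ?u = "F_transform ?H \<i>"
  have u: "Im ?u > 0" using real_distribution.Im_F_transform_ge[OF H, of \<i>] by simp
  note lim = H_lim[of \<i>, simplified]
  have upper: "Im ((F_transform \<mu> ^^ m) \<i>) \<le> Im ?u" for m
  proof (rule LIMSEQ_le_const[OF tendsto_Im[OF lim]])
    show "\<exists>N. \<forall>n\<ge>N. Im ((F_transform \<mu> ^^ m) \<i>) \<le> Im ((F_transform \<mu> ^^ r n) \<i>)"
      using seq_suble[OF r] by (intro exI[of _ m] allI impI incseqD[OF mono]) (meson order_trans)
  qed
  have "(\<lambda>n. F_transform \<mu> ((F_transform \<mu> ^^ r n) \<i>)) \<longlonglongrightarrow> F_transform \<mu> ?u"
    using holomorphic_on_imp_continuous_on[OF \<mu>.holomorphic_F_transform] u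
    by (intro isCont_tendsto_compose[OF _ lim]) (simp add: continuous_on_eq_continuous_at)
  hence "Im (F_transform \<mu> ?u) \<le> Im ?u"
    using upper[of "Suc (r _)"] by (intro LIMSEQ_le_const2[OF tendsto_Im]) auto
  hence flat: "Im (F_transform \<mu> ?u - ?u) = 0" using \<mu>.Im_F_transform_ge[OF u] by simp
  define a where "a = F_transform \<mu> ?u - ?u"
  have "Im a = 0" using flat by (simp add: a_def)
  have translation: "F_transform \<mu> w = w + a" if w: "Im w > 0" for w
  proof -
    have "F_transform \<mu> w - w = F_transform \<mu> ?u - ?u"
      by (rule schwarz_pick_constant[OF \<mu>.holomorphic_F_transform_minus_id _ w u flat])
         (use \<mu>.Im_F_transform_ge in auto)
    thus ?thesis by (simp add: a_def algebra_simps)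
  qed
  have Im_iter: "Im ((F_transform \<mu> ^^ n) w) = Im w" if w: "Im w > 0" for n w
    by (induction n) (use w translation \<open>Im a = 0\<close> in auto)
  \<comment> \<open>A translation preserves imaginary parts, but the arc-sine transform at
    \<open>\<i>\<close> squares to -3, so its imaginary part cannot be 1.\<close>
  have "Im (F_transform (?R n) \<i>) = 1" for n
    using B[of n] by (simp add: real_distribution.F_transform_dilation[OF P B] F_iter Im_iter)
  moreover have "(\<lambda>n. Im (F_transform (?R n) \<i>)) \<longlonglongrightarrow> Im (F_transform arcsine_distribution \<i>)"
    by (intro tendsto_Im weak_conv_imp_F_transform[OF R arcsine_distribution_props(1) wc]) simp
  ultimately have Im1: "Im (F_transform arcsine_distribution \<i>) = 1" by (simp add: LIMSEQ_const_iff)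
  have sq: "(F_transform arcsine_distribution \<i>)\<^sup>2 = - 3" using F_transform_arcsine[of \<i>] by simp
  have "Re (F_transform arcsine_distribution \<i>) = 0" using arg_cong[OF sq, of Im] Im1 by (simp add: power2_eq_square)
  thus False using arg_cong[OF sq, of Re] Im1 by (simp add: power2_eq_square)
qed

text \<open>By the Schwarz--Pick lemma the hyperbolic length of the steps of an orbit does not increase, so an orbit
  with bounded imaginary part whose first step is short has short steps only.\<close>

lemma orbit_step_bound:
  assumes hol: "f holomorphic_on upper_half_plane" and ge: "\<And>z. Im z > 0 \<Longrightarrow> Im (f z) \<ge> Im z"
    and z: "Im z = 8" and step: "norm (f z - z) \<le> 1/4" and up: "Im ((f ^^ k) z) \<le> 33/4"
  shows "norm ((f ^^ Suc k) z - (f ^^ k) z) < 1"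
proof -
  define w where "w j = (f ^^ j) z" for j
  have wS: "w (Suc j) = f (w j)" for j by (simp add: w_def)
  have w8: "Im (w j) \<ge> 8" for j
  proof (induction j)
    case (Suc j)
    have "Im (w j) \<le> Im (w (Suc j))" unfolding wS by (rule ge) (use Suc in simp)
    thus ?case using Suc by simp
  qed (simp add: w_def z)
  define D where "D j = norm (w (Suc j) - w j)" for j
  define S where "S j = norm (w (Suc j) - cnj (w j))" for j
  have S16: "S j \<ge> 16" for j
    using abs_Im_le_cmod[of "w (Suc j) - cnj (w j)"] w8[of j] w8[of "Suc j"] by (simp add: S_def)
  have nonneg: "Im (f v) \<ge> 0" if "Im v > 0" for v using ge[OF that] that by simp
  have decr: "D (Suc j) * S j \<le> D j * S (Suc j)" for j
  proof -
    have p: "Im (w (Suc j)) > 0" "Im (w j) > 0" using w8[of j] w8[of "Suc j"] by linarith+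
    show ?thesis unfolding D_def S_def
      using schwarz_pick[OF hol nonneg p] by (simp only: wS [symmetric])
  qed
  \<comment> \<open>The pseudo-hyperbolic length \<open>D j / S j\<close> of a step is
    nonincreasing; the quotient is cleared of denominators.\<close>
  have all: "D j * S 0 \<le> D 0 * S j" for j
  proof (induction j)
    case (Suc j)
    have "(D (Suc j) * S 0) * S j = (D (Suc j) * S j) * S 0" by simp
    also have "\<dots> \<le> (D j * S (Suc j)) * S 0" using S16[of 0] by (intro mult_right_mono decr) simp
    also have "\<dots> = (D j * S 0) * S (Suc j)" by simp
    also have "\<dots> \<le> (D 0 * S j) * S (Suc j)" using S16[of "Suc j"] by (intro mult_right_mono Suc) simp
    also have "\<dots> = (D 0 * S (Suc j)) * S j" by simp
    finally show ?case using S16[of j] by (simp add: mult_le_cancel_right)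
  qed simp
  have "S k \<le> D k + 2 * Im (w k)"
  proof -
    have "w (Suc k) - cnj (w k) = (w (Suc k) - w k) + 2 * \<i> * of_real (Im (w k))" by (simp add: complex_eq_iff)
    hence "S k \<le> D k + norm (2 * \<i> * of_real (Im (w k)))" unfolding S_def D_def by (metis norm_triangle_ineq)
    thus ?thesis using w8[of k] by (simp add: norm_mult)
  qed
  hence "S k \<le> D k + 33/2" using up by (simp add: w_def)
  hence "D 0 * S k \<le> 1/4 * (D k + 33/2)" using step S16[of k]
    by (intro mult_mono) (auto simp: D_def w_def)
  moreover have "D k * 16 \<le> D k * S 0" by (intro mult_left_mono S16) (simp add: D_def)
  \<comment> \<open>Solving for \<open>D k\<close> gives \<open>D k \<le> 11/42\<close>.\<close>
  ultimately have "D k * 16 \<le> 1/4 * (D k + 33/2)" using all[of k] by linarith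
  thus ?thesis by (simp add: D_def w_def)
qed

text \<open>An orbit from \<open>8 \<i>\<close> that returns close to the imaginary axis cannot have left a fixed neighbourhood of
  \<open>8 \<i>\<close>: there the real parts of all increments have the sign of the first one (or are dominated by the
  imaginary parts), and the orbit cannot jump over the neighbourhood.\<close>

lemma orbit_increment_bound:
  assumes hol: "f holomorphic_on upper_half_plane" and ge: "\<And>z. Im z > 0 \<Longrightarrow> Im (f z) \<ge> Im z"
    and z: "z = 8 * \<i>" and step: "norm (f z - z) \<le> 1/4"
    and up: "Im ((f ^^ n) z) \<le> 33/4" and axis: "\<bar>Re ((f ^^ n) z)\<bar> < 1"
  shows "real n * norm (f z - z) \<le> 4"
proof -
  define h where "h w = f w - w" for w
  define w where "w j = (f ^^ j) z" for j
  have wS: "w (Suc j) = w j + h (w j)" for j by (simp add: w_def h_def)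
  have w0: "w 0 = 8 * \<i>" by (simp add: w_def z)
  have h_hol: "h holomorphic_on upper_half_plane" unfolding h_def by (intro holomorphic_intros hol)
  have h_nonneg: "Im (h v) \<ge> 0" if "Im v > 0" for v using ge[OF that] by (simp add: h_def)
  have w8: "Im (w j) \<ge> 8" for j
  proof (induction j)
    case (Suc j)
    show ?case unfolding wS using h_nonneg[of "w j"] Suc by simp
  qed (simp add: w0)
  have w_mono: "incseq (\<lambda>j. Im (w j))"
  proof (rule incseq_SucI)
    fix j show "Im (w j) \<le> Im (w (Suc j))" unfolding wS using h_nonneg[of "w j"] w8[of j] by simp
  qed
  have w_up: "Im (w j) \<le> 33/4" if "j \<le> n" for j
    using incseqD[OF w_mono that] up by (simp add: w_def)
  have short: "norm (h (w j)) < 1" if "j < n" for j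
    using orbit_step_bound[OF hol ge _ step, of j] w_up[of j] that by (simp add: z w_def h_def)
  define p where "p = Re (h z)"
  define q where "q = Im (h z)"
  have q0: "q \<ge> 0" unfolding q_def by (rule h_nonneg) (simp add: z)
  \<comment> \<open>Within the strip the orbit is at distance at most \<open>2 + 1/4 = 9/4\<close>
    from \<open>8 \<i>\<close>, leaving at least \<open>9/2\<close> of the height 8. The Harnack
    bound then compares the increments up to \<open>q / 2\<close>; this is why the starting height
    is 8.\<close>
  have near: "norm (h (w j) - h z) \<le> q / 2" if j: "j \<le> n" and re: "\<bar>Re (w j)\<bar> \<le> 2" for j
  proof -
    have "norm (w j - z) \<le> \<bar>Re (w j - z)\<bar> + \<bar>Im (w j - z)\<bar>" by (rule cmod_le)
    also have "\<dots> \<le> 9/4" using re w8[of j] w_up[OF j] by (simp add: z)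
    finally have d: "norm (w j - z) \<le> 9/4" .
    have "norm (h (w j) - h z) * (Im z - norm (w j - z)) \<le> norm (w j - z) * Im (h z)"
      by (rule schwarz_pick_local[OF h_hol h_nonneg]) (use d in \<open>simp_all add: z\<close>)
    also have "\<dots> \<le> 9/4 * q" unfolding q_def[symmetric] using d q0 by (intro mult_right_mono)
    finally have 1: "norm (h (w j) - h z) * (Im z - norm (w j - z)) \<le> 9/4 * q" .
    have "norm (h (w j) - h z) * (9/2) \<le> norm (h (w j) - h z) * (Im z - norm (w j - z))"
      using d by (intro mult_left_mono) (auto simp: z)
    with 1 show ?thesis by simp
  qed
  have Re_near: "\<bar>Re (h (w j)) - p\<bar> \<le> q / 2" and Im_near: "Im (h (w j)) \<ge> q / 2"
    if "j \<le> n" "\<bar>Re (w j)\<bar> \<le> 2" for j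
    using near[OF that] abs_Re_le_cmod[of "h (w j) - h z"] abs_Im_le_cmod[of "h (w j) - h z"]
    unfolding p_def q_def minus_complex.sel by linarith+
  have hz: "norm (f z - z) \<le> \<bar>p\<bar> + q"
    using cmod_le[of "h z"] q0 by (simp add: h_def p_def q_def)
  show ?thesis
  \<comment> \<open>If the imaginary part dominates, each step climbs at least \<open>q / 2\<close>
    out of a total allowance of \<open>1/4\<close>. Hence \<open>n q \<le> 1/2\<close>, and the real
    drift, at most \<open>3/2 n q\<close>, never leaves the strip.\<close>
  proof (cases "\<bar>p\<bar> \<le> q")
    case True
    have "\<bar>Re (w j)\<bar> \<le> 3/2 * (real j * q) \<and> Im (w j) \<ge> 8 + real j * q / 2" if "j \<le> n" for j
      using that
    proof (induction j)
      case (Suc j)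
      hence j: "j \<le> n" and IH: "\<bar>Re (w j)\<bar> \<le> 3/2 * (real j * q)" "Im (w j) \<ge> 8 + real j * q / 2" by auto
      have "real j * q \<le> 1/2" using IH(2) w_up[OF j] by simp
      hence re: "\<bar>Re (w j)\<bar> \<le> 2" using IH(1) by linarith
      have "\<bar>Re (h (w j))\<bar> \<le> 3/2 * q" using Re_near[OF j re] True by linarith
      hence "\<bar>Re (w (Suc j))\<bar> \<le> 3/2 * (real j * q) + 3/2 * q" unfolding wS using IH(1) by simp
      moreover have "Im (w (Suc j)) \<ge> 8 + real j * q / 2 + q / 2" unfolding wS using Im_near[OF j re] IH(2) by simp
      moreover have "real (Suc j) * q = real j * q + q" by (simp add: distrib_right)
      ultimately show ?case by linarith
    qed (simp add: w0)
    from this[of n] have "real n * q \<le> 1/2" using w_up[of n] by simp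
    have "real n * norm (f z - z) \<le> real n * (2 * q)" using hz True by (intro mult_left_mono) auto
    also have "\<dots> = 2 * (real n * q)" by simp
    also have "\<dots> \<le> 4" using \<open>real n * q \<le> 1/2\<close> by linarith
    finally show ?thesis .
  next
    case False
    define \<sigma> where "\<sigma> = sgn p"
    have \<sigma>: "\<bar>\<sigma>\<bar> = 1" "\<sigma> * p = \<bar>p\<bar>" using False q0 by (auto simp: \<sigma>_def sgn_if)
    define x where "x j = \<sigma> * Re (w j)" for j
    have abs_x: "\<bar>x j\<bar> = \<bar>Re (w j)\<bar>" for j by (simp add: x_def abs_mult \<sigma>)
    have xS: "x (Suc j) = x j + \<sigma> * Re (h (w j))" for j unfolding x_def wS by (simp add: distrib_left)
    have forward: "x (Suc j) \<ge> x j + \<bar>p\<bar> / 2" if "j \<le> n" "\<bar>x j\<bar> \<le> 2" for j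
    proof -
      have "\<bar>Re (h (w j)) - p\<bar> \<le> q / 2" using Re_near[of j] that abs_x by simp
      hence "\<bar>\<sigma> * (Re (h (w j)) - p)\<bar> \<le> q / 2" by (simp add: abs_mult \<sigma>)
      moreover have "\<sigma> * (Re (h (w j)) - p) = \<sigma> * Re (h (w j)) - \<bar>p\<bar>" by (simp only: right_diff_distrib \<sigma>(2))
      ultimately have "\<sigma> * Re (h (w j)) \<ge> \<bar>p\<bar> - q / 2" by linarith
      thus ?thesis unfolding xS using False by linarith
    qed
    have small: "\<bar>x (Suc j) - x j\<bar> < 1" if "j < n" for j
      using short[OF that] abs_Re_le_cmod[of "h (w j)"] by (simp add: xS abs_mult \<sigma>)
    have xn: "\<bar>x n\<bar> < 1" using axis by (simp add: abs_x w_def)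
    \<comment> \<open>Once beyond 2 the orbit cannot return to \<open>|x| < 1\<close>: steps are
      shorter than 1, and between 1 and 2 it moves forward. So the end condition keeps the whole
      orbit in the strip.\<close>
    have inside: "x m \<le> 2" if m: "m \<le> n" for m
    proof (rule ccontr)
      assume out: "\<not> x m \<le> 2"
      have "x j \<ge> 1" if "m \<le> j" "j \<le> n" for j
        using that
      proof (induction j rule: dec_induct)
        case (step j)
        show ?case
        proof (cases "x j \<le> 2")
          case True
          thus ?thesis using forward[of j] step by simp
        next
          case False
          thus ?thesis using small[of j] step by simp
        qed
      qed (use out in simp)
      from this[of n] m xn show False by simp
    qed
    have "x j \<ge> real j * (\<bar>p\<bar> / 2)" if "j \<le> n" for j
      using that
    proof (induction j)
      case (Suc j)
      have "0 \<le> real j * (\<bar>p\<bar> / 2)" by simp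
      also have "\<dots> \<le> x j" by (rule Suc.IH) (use Suc.prems in simp)
      finally have "\<bar>x j\<bar> \<le> 2" using Suc.prems inside[of j] by simp
      thus ?case using forward[of j] Suc by (simp add: algebra_simps)
    qed (simp add: x_def w0)
    from this[of n] xn have np: "real n * \<bar>p\<bar> \<le> 2" by simp
    have "real n * norm (f z - z) \<le> real n * (2 * \<bar>p\<bar>)" using hz False by (intro mult_left_mono) auto
    also have "\<dots> = 2 * (real n * \<bar>p\<bar>)" by simp
    finally show ?thesis using np by linarith
  qed
qed

text \<open>The value is \<open>\<i> sqrt 66\<close>, and \<open>sqrt 66 < 33/4\<close>: along the
  limit flow \<open>8 \<i>\<close> rises by less than \<open>1/4\<close> without leaving the axis,
  as the orbit lemmas require of the end point.\<close>

lemma F_transform_arcsine_8i: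
  "Re (F_transform arcsine_distribution (8 * \<i>)) = 0" "Im (F_transform arcsine_distribution (8 * \<i>)) < 33/4"
proof -
  let ?F = "F_transform arcsine_distribution (8 * \<i>)"
  have sq: "?F\<^sup>2 = - 66" using F_transform_arcsine[of "8 * \<i>"] by (simp add: power_mult_distrib)
  have Im: "Im ?F \<ge> 8" using arcsine.Im_F_transform_ge[of "8 * \<i>"] by simp
  have "2 * (Re ?F * Im ?F) = 0" using arg_cong[OF sq, of Im] by (simp add: power2_eq_square disj_commute)
  moreover have "Im ?F \<noteq> 0" using Im by linarith
  ultimately show Re: "Re ?F = 0" by simp
  have "(Im ?F)\<^sup>2 < (33/4)\<^sup>2" using arg_cong[OF sq, of Re] Re by (simp add: power2_eq_square)
  thus "Im ?F < 33/4" by (rule power_less_imp_less_base) simp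
qed

text \<open>Rescaled, this is the asymptotics \<open>F (\<i> v) - \<i> v = o(v)\<close> at
  \<open>v = B n y\<close>.\<close>

lemma dilated_F_transform_tendsto_id:
  assumes \<mu>: "real_distribution \<mu>" and B: "\<And>n. B n > 0" "filterlim B at_top sequentially" and y: "y > 0"
  shows "(\<lambda>n. F_transform (dilation (1 / B n) \<mu>) (\<i> * of_real y)) \<longlonglongrightarrow> \<i> * of_real y"
proof (rule tendstoI)
  fix \<epsilon> :: real assume e: "\<epsilon> > 0"
  obtain b where b: "\<And>v. v > b \<Longrightarrow> norm (F_transform \<mu> (\<i> * of_real v) - \<i> * of_real v) \<le> \<epsilon> / (2 * y) * v"
    using real_distribution.F_transform_near_identity[OF \<mu>, of "\<epsilon> / (2 * y)"] e y by auto
  have "\<forall>\<^sub>F n in sequentially. B n > b / y"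
    using B(2) by (rule filterlim_at_top_dense[THEN iffD1, rule_format])
  thus "\<forall>\<^sub>F n in sequentially. dist (F_transform (dilation (1 / B n) \<mu>) (\<i> * of_real y)) (\<i> * of_real y) < \<epsilon>"
  proof eventually_elim
    case (elim n)
    let ?v = "B n * y"
    have "?v > b" using elim y by (simp add: pos_divide_less_eq)
    note bv = b[OF this]
    have Bn: "B n > 0" by (rule B)
    have eq: "F_transform (dilation (1 / B n) \<mu>) (\<i> * of_real y) - \<i> * of_real y
      = (F_transform \<mu> (\<i> * of_real ?v) - \<i> * of_real ?v) / of_real (B n)"
      unfolding real_distribution.F_transform_dilation[OF \<mu> Bn] using Bn
      by (simp add: diff_divide_distrib mult_ac)
    have "dist (F_transform (dilation (1 / B n) \<mu>) (\<i> * of_real y)) (\<i> * of_real y)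
       = norm (F_transform \<mu> (\<i> * of_real ?v) - \<i> * of_real ?v) / B n"
      unfolding dist_norm eq using Bn by (simp add: norm_divide)
    also have "\<dots> \<le> (\<epsilon> / (2 * y) * ?v) / B n" using bv Bn by (intro divide_right_mono) auto
    also have "\<dots> = \<epsilon> / 2" using Bn y by simp
    finally show ?case using e by simp
  qed
qed

text \<open>The norming tends to infinity, so the first step from \<open>8 \<i>\<close> is short;
  weak convergence places the end of the orbit near \<open>\<i> sqrt 66\<close>.\<close>

lemma monotone_increments_bounded:
  assumes \<mu>: "real_distribution \<mu>" and B: "\<And>n. B n > 0"
    and wc: "weak_conv_m (\<lambda>n. dilation (1 / B n) (convolution_power monotone_convolution \<mu> n)) arcsine_distribution"
  shows "\<forall>\<^sub>F n in sequentially. norm (of_nat n * (F_transform (dilation (1 / B n) \<mu>) (8 * \<i>) - 8 * \<i>)) \<le> 4"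
proof -
  let ?M = "\<lambda>n. dilation (1 / B n) \<mu>"
  let ?R = "\<lambda>n. dilation (1 / B n) (convolution_power monotone_convolution \<mu> n)"
  let ?z = "8 * \<i>"
  have M: "real_distribution (?M n)" for n by (rule real_distribution.real_distribution_dilation[OF \<mu>])
  have R: "real_distribution (?R n)" for n
    by (intro real_distribution.real_distribution_dilation monotone_convolution_power \<mu>)
  have z: "Im ?z > 0" by simp
  have "(\<lambda>n. F_transform (?R n) ?z) \<longlonglongrightarrow> F_transform arcsine_distribution ?z"
    by (rule weak_conv_imp_F_transform[OF R arcsine_distribution_props(1) wc z])
  hence lim: "(\<lambda>n. (F_transform (?M n) ^^ n) ?z) \<longlonglongrightarrow> F_transform arcsine_distribution ?z"
    by (simp only: monotone_power_scaled[OF \<mu> B z])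
  have "(\<lambda>n. F_transform (?M n) (\<i> * of_real 8) - \<i> * of_real 8) \<longlonglongrightarrow> \<i> * of_real 8 - \<i> * of_real 8"
    by (intro tendsto_diff tendsto_const dilated_F_transform_tendsto_id[OF \<mu> B monotone_norming_at_top[OF \<mu> B wc]]) simp
  hence "(\<lambda>n. norm (F_transform (?M n) ?z - ?z)) \<longlonglongrightarrow> 0"
    by (intro tendsto_norm_zero) (simp add: mult.commute)
  hence ev1: "\<forall>\<^sub>F n in sequentially. norm (F_transform (?M n) ?z - ?z) < 1/4" by (intro order_tendstoD) auto
  have ev2: "\<forall>\<^sub>F n in sequentially. Im ((F_transform (?M n) ^^ n) ?z) < 33/4"
    using F_transform_arcsine_8i by (intro order_tendstoD[OF tendsto_Im[OF lim]])
  have "(\<lambda>n. \<bar>Re ((F_transform (?M n) ^^ n) ?z)\<bar>) \<longlonglongrightarrow> \<bar>0\<bar>"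
    using tendsto_Re[OF lim] F_transform_arcsine_8i(1) by (intro tendsto_rabs) simp
  hence ev3: "\<forall>\<^sub>F n in sequentially. \<bar>Re ((F_transform (?M n) ^^ n) ?z)\<bar> < 1" by (intro order_tendstoD) auto
  show ?thesis using ev1 ev2 ev3
  proof eventually_elim
    case (elim n)
    have "real n * norm (F_transform (?M n) ?z - ?z) \<le> 4"
      by (rule orbit_increment_bound[OF real_distribution.holomorphic_F_transform[OF M] real_distribution.Im_F_transform_ge[OF M] refl])
         (use elim in simp_all)
    thus ?case by (simp add: norm_mult)
  qed
qed

section \<open>The monotone converse: identifying the limit of the increments\<close>

lemma weak_conv_F_transform_increment:
  assumes R: "\<And>n. real_distribution (R n)" and N: "real_distribution N" and wc: "weak_conv_m R N"
    and z: "Im z > 0" and h: "h \<longlonglongrightarrow> 0"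
  obtains K where "\<forall>\<^sub>F n in sequentially. F_transform (R n) (z + h n) - F_transform (R n) z = h n * K n"
    and "K \<longlonglongrightarrow> deriv (F_transform N) z"
proof
  interpret N: real_distribution N by (rule N)
  let ?y = "Im z"
  let ?I = "\<lambda>M. LINT t|M. 1 / (z - of_real t)\<^sup>2"
  \<comment> \<open>The divided difference of the Cauchy transform with reversed sign. Keeping it as
    an integral avoids dividing by \<open>h n\<close>, which may be 0.\<close>
  define J where "J n = (LINT t|R n. 1 / ((z - of_real t) * (z + h n - of_real t)))" for n
  define K where "K n = J n * F_transform (R n) z * F_transform (R n) (z + h n)" for n
  have bound2: "norm (1 / (z - of_real t)\<^sup>2) \<le> 1 / ?y\<^sup>2" for t
    using norm_diff_of_real_ge[OF z, of t] z by (simp add: norm_divide norm_power frac_le power_mono)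
  have evh: "\<forall>\<^sub>F n in sequentially. norm (h n) < ?y / 2"
    using tendsto_norm_zero[OF h] z by (intro order_tendstoD) auto
  have near: "Im (z + h n) > ?y / 2" if "norm (h n) < ?y / 2" for n
    using that abs_Im_le_cmod[of "h n"] by simp
  have bound: "norm (1 / ((z - of_real t) * (z + h n - of_real t))) \<le> 2 / ?y\<^sup>2"
    and bound3: "norm (h n / ((z - of_real t)\<^sup>2 * (z + h n - of_real t))) \<le> norm (h n) * (2 / ?y ^ 3)"
    if hn: "norm (h n) < ?y / 2" for n t
  proof -
    have zh: "Im (z + h n) > 0" using near[OF hn] z by linarith
    have ge: "norm (z - of_real t) \<ge> ?y" "norm (z + h n - of_real t) \<ge> ?y / 2"
      using norm_diff_of_real_ge[OF z, of t] norm_diff_of_real_ge[OF zh, of t] near[OF hn] by linarith+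
    have "?y * (?y / 2) \<le> norm (z - of_real t) * norm (z + h n - of_real t)"
      using ge z by (intro mult_mono) auto
    hence "1 / (norm (z - of_real t) * norm (z + h n - of_real t)) \<le> 1 / (?y * (?y / 2))"
      using z by (intro frac_le) auto
    thus "norm (1 / ((z - of_real t) * (z + h n - of_real t))) \<le> 2 / ?y\<^sup>2"
      by (simp add: norm_divide norm_mult power2_eq_square)
    have "?y\<^sup>2 * (?y / 2) \<le> (norm (z - of_real t))\<^sup>2 * norm (z + h n - of_real t)"
      using ge z by (intro mult_mono power_mono) auto
    hence "norm (h n) / ((norm (z - of_real t))\<^sup>2 * norm (z + h n - of_real t)) \<le> norm (h n) / (?y\<^sup>2 * (?y / 2))"
      using z by (intro frac_le) auto
    thus "norm (h n / ((z - of_real t)\<^sup>2 * (z + h n - of_real t))) \<le> norm (h n) * (2 / ?y ^ 3)"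
      by (simp add: norm_divide norm_mult norm_power power2_eq_square power3_eq_cube)
  qed
  have lim_F: "(\<lambda>n. F_transform (R n) z) \<longlonglongrightarrow> F_transform N z"
    by (rule weak_conv_imp_F_transform[OF R N wc z])
  have lim_Fh: "(\<lambda>n. F_transform (R n) (z + h n)) \<longlonglongrightarrow> F_transform N z"
  proof (rule schwarz_pick_tendsto[where a = "\<lambda>_. z" and u = z, OF real_distribution.holomorphic_F_transform[OF R] _ tendsto_const _ z lim_F])
    show "Im (F_transform (R n) w) \<ge> 0" if "Im w > 0" for n w
      using real_distribution.Im_F_transform_ge[OF R that] that by (meson less_imp_le order_trans)
    show "(\<lambda>n. z + h n) \<longlonglongrightarrow> z" using tendsto_add[OF tendsto_const h, of z] by simp
  qed
  have lim_I: "(\<lambda>n. ?I (R n)) \<longlonglongrightarrow> ?I N"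
  proof (rule weak_conv_imp_integral_bdd_continuous_conv[OF R N wc _ bound2])
    show "isCont (\<lambda>t. 1 / (z - complex_of_real t)\<^sup>2) x" for x
      using diff_of_real_nonzero[OF z] by (intro continuous_intros) auto
  qed
  have "(\<lambda>n. J n - ?I (R n)) \<longlonglongrightarrow> 0"
  proof (rule Lim_null_comparison)
    show "\<forall>\<^sub>F n in sequentially. norm (J n - ?I (R n)) \<le> norm (h n) * (2 / ?y ^ 3)"
      using evh
    proof eventually_elim
      case (elim n)
      interpret R: real_distribution "R n" by (rule R)
      have zh: "Im (z + h n) > 0" using near[OF elim] z by linarith
      have eq: "1 / ((z - of_real t) * (z + h n - of_real t)) - 1 / (z - of_real t)\<^sup>2
          = - (h n / ((z - of_real t)\<^sup>2 * (z + h n - of_real t)))" for t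
        using diff_of_real_nonzero[OF z, of t] diff_of_real_nonzero[OF zh, of t]
        by (simp add: divide_simps power2_eq_square)
      have "J n - ?I (R n) = (LINT t|R n. - (h n / ((z - of_real t)\<^sup>2 * (z + h n - of_real t))))"
        unfolding J_def eq [symmetric]
        by (intro Bochner_Integration.integral_diff [symmetric] R.integrable_bounded_complex[OF _ bound[OF elim]]
            R.integrable_bounded_complex[OF _ bound2]) simp_all
      also have "norm \<dots> \<le> (LINT t|R n. norm (- (h n / ((z - of_real t)\<^sup>2 * (z + h n - of_real t)))))"
        by (rule integral_norm_bound)
      also have "\<dots> = (LINT t|R n. norm (h n / ((z - of_real t)\<^sup>2 * (z + h n - of_real t))))"
        by (simp only: norm_minus_cancel)
      also have "\<dots> \<le> (LINT t|R n. norm (h n) * (2 / ?y ^ 3))"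
        by (intro integral_mono integrable_norm R.integrable_bounded_complex[OF _ bound3[OF elim]] bound3[OF elim]) auto
      finally show ?case by (simp add: R.prob_space)
    qed
    show "(\<lambda>n. norm (h n) * (2 / ?y ^ 3)) \<longlonglongrightarrow> 0"
      using tendsto_mult_right[OF tendsto_norm_zero[OF h], of "2 / ?y ^ 3"] by simp
  qed
  from tendsto_add[OF this lim_I] have "J \<longlonglongrightarrow> ?I N" by simp
  hence "K \<longlonglongrightarrow> ?I N * F_transform N z * F_transform N z"
    unfolding K_def by (intro tendsto_intros lim_F lim_Fh)
  moreover have "deriv (F_transform N) z = ?I N * F_transform N z * F_transform N z"
  proof (rule DERIV_imp_deriv)
    have "(F_transform N has_field_derivative (0 * cauchy_transform N z - 1 * (LINT t|N. - 1 / (z - of_real t)\<^sup>2)) /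
       (cauchy_transform N z * cauchy_transform N z)) (at z)"
      unfolding F_transform_def
      by (intro DERIV_divide DERIV_const N.has_field_derivative_cauchy_transform z N.cauchy_transform_nonzero)
    thus "(F_transform N has_field_derivative ?I N * F_transform N z * F_transform N z) (at z)"
      by (simp add: F_transform_def)
  qed
  ultimately show "K \<longlonglongrightarrow> deriv (F_transform N) z" by simp
  show "\<forall>\<^sub>F n in sequentially. F_transform (R n) (z + h n) - F_transform (R n) z = h n * K n"
    using evh
  proof eventually_elim
    case (elim n)
    interpret R: real_distribution "R n" by (rule R)
    have zh: "Im (z + h n) > 0" using near[OF elim] z by linarith
    have eq: "1 / (z - of_real t) - 1 / (z + h n - of_real t) = h n * (1 / ((z - of_real t) * (z + h n - of_real t)))" for t
      using diff_of_real_nonzero[OF z, of t] diff_of_real_nonzero[OF zh, of t] by (simp add: field_simps)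
    have "cauchy_transform (R n) z - cauchy_transform (R n) (z + h n)
        = (LINT t|R n. 1 / (z - of_real t) - 1 / (z + h n - of_real t))"
      unfolding cauchy_transform_def
      by (intro Bochner_Integration.integral_diff [symmetric] R.integrable_cauchy_kernel z zh)
    also have "\<dots> = h n * J n" unfolding eq J_def by (rule integral_mult_right_zero)
    finally have G: "cauchy_transform (R n) z - cauchy_transform (R n) (z + h n) = h n * J n" .
    have "h n * K n = (h n * J n) * F_transform (R n) z * F_transform (R n) (z + h n)"
      by (simp add: K_def)
    also have "\<dots> = F_transform (R n) (z + h n) - F_transform (R n) z"
      unfolding G [symmetric] F_transform_def
      using R.cauchy_transform_nonzero[OF z] R.cauchy_transform_nonzero[OF zh] by (simp add: field_simps)
    finally show ?case ..
  qed
qed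

text \<open>Implicit differentiation of \<open>F^2 = z^2 - 2\<close>.\<close>

lemma deriv_F_transform_arcsine:
  assumes z: "Im z > 0"
  shows "deriv (F_transform arcsine_distribution) z = z / F_transform arcsine_distribution z"
proof -
  let ?F = "F_transform arcsine_distribution"
  have F0: "?F z \<noteq> 0" using arcsine.Im_F_transform_ge[OF z] z by auto
  have "(?F has_field_derivative deriv ?F z) (at z)"
    by (rule holomorphic_derivI[OF arcsine.holomorphic_F_transform]) (use z in auto)
  hence "((\<lambda>w. (?F w)\<^sup>2) has_field_derivative 2 * ?F z * deriv ?F z) (at z)"
    by (auto intro!: derivative_eq_intros)
  hence "((\<lambda>w. w\<^sup>2 - 2) has_field_derivative 2 * ?F z * deriv ?F z) (at z)"
    by (rule has_field_derivative_transform_within_open[OF _ open_upper_half_plane])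
       (use z F_transform_arcsine in auto)
  moreover have "((\<lambda>w. w\<^sup>2 - 2) has_field_derivative 2 * z) (at z)"
    by (auto intro!: derivative_eq_intros)
  ultimately have "2 * ?F z * deriv ?F z = 2 * z" by (rule DERIV_unique)
  thus ?thesis using F0 by (simp add: field_simps)
qed

text \<open>The bound at \<open>8 \<i>\<close> is transferred to \<open>w\<close> by the
  Schwarz-Pick distance estimate, with a constant independent of \<open>n\<close>.\<close>

lemma monotone_increments_bounded_everywhere:
  assumes \<mu>: "real_distribution \<mu>" and B: "\<And>n. B n > 0"
    and wc: "weak_conv_m (\<lambda>n. dilation (1 / B n) (convolution_power monotone_convolution \<mu> n)) arcsine_distribution"
    and w: "Im w > 0"
  obtains C where "\<forall>\<^sub>F n in sequentially. norm (of_nat n * (F_transform (dilation (1 / B n) \<mu>) w - w)) \<le> C"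
proof
  let ?V = "\<lambda>n w. of_nat n * (F_transform (dilation (1 / B n) \<mu>) w - w)"
  let ?z = "8 * \<i>"
  let ?d = "norm (w - cnj ?z) - norm (w - ?z)"
  have M: "real_distribution (dilation (1 / B n) \<mu>)" for n by (rule real_distribution.real_distribution_dilation[OF \<mu>])
  have d: "?d > 0" using norm_diff_less_norm_diff_cnj[of w ?z] w by simp
  show "\<forall>\<^sub>F n in sequentially. norm (?V n w) \<le> 4 + 8 * norm (w - ?z) / ?d"
    using monotone_increments_bounded[OF \<mu> B wc]
  proof eventually_elim
    case (elim n)
    have "norm (?V n w - ?V n ?z) * ?d \<le> 2 * norm (w - ?z) * Im (?V n ?z)"
      by (rule schwarz_pick_distance[OF scaled_increment(1)[OF M] scaled_increment(2)[OF M] w]) simp_all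
    also have "\<dots> \<le> 2 * norm (w - ?z) * 4"
      using elim abs_Im_le_cmod[of "?V n ?z"] by (intro mult_left_mono) (linarith, simp)
    finally have "norm (?V n w - ?V n ?z) \<le> 8 * norm (w - ?z) / ?d"
      using d by (simp add: pos_le_divide_eq)
    thus ?case using elim norm_triangle_sub[of "?V n w" "?V n ?z"] by linarith
  qed
qed

text \<open>The increment of the orbit at its end point can be computed in two ways, since \<open>f (f\<^sup>n w) = f\<^sup>n (f w)\<close>.
  In the limit \<open>w (f w - w)\<close> becomes invariant under \<open>F_transform arcsine_distribution\<close>.\<close>

lemma monotone_increments_invariant:
  assumes \<mu>: "real_distribution \<mu>" and B: "\<And>n. B n > 0"
    and wc: "weak_conv_m (\<lambda>n. dilation (1 / B n) (convolution_power monotone_convolution \<mu> n)) arcsine_distribution"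
    and w: "Im w > 0"
  defines "U \<equiv> \<lambda>n w. w * (of_nat n * (F_transform (dilation (1 / B n) \<mu>) w - w))"
  shows "(\<lambda>n. U n (F_transform arcsine_distribution w) - U n w) \<longlonglongrightarrow> 0"
proof -
  let ?f = "\<lambda>n. F_transform (dilation (1 / B n) \<mu>)"
  let ?R = "\<lambda>n. dilation (1 / B n) (convolution_power monotone_convolution \<mu> n)"
  define V where "V n w = of_nat n * (?f n w - w)" for n w
  define h where "h n = ?f n w - w" for n
  define \<Phi> where "\<Phi> = F_transform arcsine_distribution w"
  have M: "real_distribution (dilation (1 / B n) \<mu>)" for n by (rule real_distribution.real_distribution_dilation[OF \<mu>])
  have R: "real_distribution (?R n)" for n
    by (intro real_distribution.real_distribution_dilation monotone_convolution_power \<mu>)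
  have \<Phi>: "Im \<Phi> > 0" using arcsine.Im_F_transform_ge[OF w] w by (simp add: \<Phi>_def)
  hence \<Phi>0: "\<Phi> \<noteq> 0" by auto
  obtain C where C: "\<forall>\<^sub>F n in sequentially. norm (V n w) \<le> C"
    using monotone_increments_bounded_everywhere[OF \<mu> B wc w] unfolding V_def by blast
  obtain C' where C': "\<forall>\<^sub>F n in sequentially. norm (V n \<Phi>) \<le> C'"
    using monotone_increments_bounded_everywhere[OF \<mu> B wc \<Phi>] unfolding V_def by blast
  have h: "h \<longlonglongrightarrow> 0"
  proof (rule Lim_null_comparison)
    show "\<forall>\<^sub>F n in sequentially. norm (h n) \<le> C / real n" using C eventually_gt_at_top[of 0]
      by eventually_elim (simp add: V_def h_def norm_mult pos_le_divide_eq mult.commute)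
    show "(\<lambda>n. C / real n) \<longlonglongrightarrow> 0" by (rule lim_const_over_n)
  qed
  obtain K where K: "\<forall>\<^sub>F n in sequentially. F_transform (?R n) (w + h n) - F_transform (?R n) w = h n * K n"
    and "K \<longlonglongrightarrow> deriv (F_transform arcsine_distribution) w"
    by (rule weak_conv_F_transform_increment[OF R arcsine_distribution_props(1) wc w h])
  hence K_lim: "K \<longlonglongrightarrow> w / \<Phi>" by (simp add: deriv_F_transform_arcsine[OF w] \<Phi>_def)
  define g where "g n = F_transform (?R n) w" for n
  have g: "g \<longlonglongrightarrow> \<Phi>" unfolding g_def \<Phi>_def by (rule weak_conv_imp_F_transform[OF R arcsine_distribution_props(1) wc w])
  \<comment> \<open>Commutation: \<open>?f n\<close> applied to the end point \<open>g n\<close>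
    equals the \<open>n\<close>-th iterate at \<open>w + h n\<close>, whose displacement from
    \<open>g n\<close> is \<open>h n * K n\<close>.\<close>
  have Vg: "\<forall>\<^sub>F n in sequentially. V n (g n) = V n w * K n"
    using K
  proof eventually_elim
    case (elim n)
    have wh: "Im (w + h n) > 0" using real_distribution.Im_F_transform_ge[OF M w, of n] w by (simp add: h_def)
    have "?f n (g n) = (?f n ^^ n) (w + h n)"
      unfolding g_def monotone_power_scaled[OF \<mu> B w] h_def by (simp add: funpow_swap1)
    also have "\<dots> = F_transform (?R n) (w + h n)" by (rule monotone_power_scaled[OF \<mu> B wh, symmetric])
    finally have "?f n (g n) - g n = h n * K n" using elim by (simp add: g_def)
    thus ?case by (simp add: V_def h_def)
  qed
  have 1: "(\<lambda>n. V n (g n) - V n \<Phi>) \<longlonglongrightarrow> 0"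
  proof (rule schwarz_pick_sequence[where f = V, OF _ _ tendsto_const g \<Phi> C'])
    show "V n holomorphic_on upper_half_plane" for n unfolding V_def by (rule scaled_increment(1)[OF M])
    show "Im (V n v) \<ge> 0" if "Im v > 0" for n v unfolding V_def by (rule scaled_increment(2)[OF M that])
  qed
  have 2: "(\<lambda>n. V n w * (\<Phi> * K n - w)) \<longlonglongrightarrow> 0"
  proof (rule Lim_null_comparison)
    show "\<forall>\<^sub>F n in sequentially. norm (V n w * (\<Phi> * K n - w)) \<le> C * norm (\<Phi> * K n - w)"
      using C by eventually_elim (simp add: norm_mult mult_right_mono)
    have "(\<lambda>n. C * norm (\<Phi> * K n - w)) \<longlonglongrightarrow> C * norm (\<Phi> * (w / \<Phi>) - w)" by (intro tendsto_intros K_lim)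
    thus "(\<lambda>n. C * norm (\<Phi> * K n - w)) \<longlonglongrightarrow> 0" using \<Phi>0 by simp
  qed
  \<comment> \<open>Since \<open>K\<close> tends to \<open>w / \<Phi>\<close>, multiplying the
    commutation relation by \<open>\<Phi>\<close> turns it into invariance of
    \<open>U n v = v * V n v\<close>.\<close>
  have "(\<lambda>n. V n w * (\<Phi> * K n - w) - \<Phi> * (V n (g n) - V n \<Phi>)) \<longlonglongrightarrow> 0 - \<Phi> * 0"
    by (intro tendsto_intros 1 2)
  moreover have "\<forall>\<^sub>F n in sequentially. V n w * (\<Phi> * K n - w) - \<Phi> * (V n (g n) - V n \<Phi>) = U n \<Phi> - U n w"
    using Vg
  proof eventually_elim
    case (elim n)
    have "U n v = v * V n v" for v by (simp add: U_def V_def)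
    thus ?case by (simp add: elim algebra_simps)
  qed
  ultimately have "(\<lambda>n. U n \<Phi> - U n w) \<longlonglongrightarrow> 0" using tendsto_cong by fastforce
  thus ?thesis by (simp add: \<Phi>_def)
qed

lemma F_transform_arcsine_funpow:
  assumes w: "Im w > 0"
  shows "((F_transform arcsine_distribution ^^ k) w)\<^sup>2 = w\<^sup>2 - 2 * of_nat k"
proof (induction k)
  case (Suc k)
  have "Im ((F_transform arcsine_distribution ^^ k) w) > 0"
    using Im_F_transform_funpow[OF arcsine_distribution_props(1) w, of k] w by linarith
  from F_transform_arcsine[OF this] show ?case by (simp add: Suc algebra_simps)
qed simp

text \<open>Under iteration of \<open>F_transform arcsine_distribution\<close> two points become hyperbolically close.\<close>

lemma monotone_increments_asymptotically_constant:
  assumes \<mu>: "real_distribution \<mu>" and B: "\<And>n. B n > 0"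
    and wc: "weak_conv_m (\<lambda>n. dilation (1 / B n) (convolution_power monotone_convolution \<mu> n)) arcsine_distribution"
    and w: "Im w > 0" and w': "Im w' > 0"
  defines "U \<equiv> \<lambda>n w. w * (of_nat n * (F_transform (dilation (1 / B n) \<mu>) w - w))"
  shows "(\<lambda>n. U n w - U n w') \<longlonglongrightarrow> 0"
proof (rule tendstoI)
  fix \<epsilon> :: real assume e: "\<epsilon> > 0"
  let ?\<Phi> = "F_transform arcsine_distribution"
  define V where "V n w = of_nat n * (F_transform (dilation (1 / B n) \<mu>) w - w)" for n w
  have UV: "U n v = v * V n v" for n v by (simp add: U_def V_def)
  have M: "real_distribution (dilation (1 / B n) \<mu>)" for n by (rule real_distribution.real_distribution_dilation[OF \<mu>])
  have pos: "Im ((?\<Phi> ^^ k) v) > 0" if "Im v > 0" for k v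
    using Im_F_transform_funpow[OF arcsine_distribution_props(1) that, of k] that by linarith
  have iter: "(\<lambda>n. U n ((?\<Phi> ^^ k) v) - U n v) \<longlonglongrightarrow> 0" if v: "Im v > 0" for k v
  proof (induction k)
    case (Suc k)
    have "(\<lambda>n. U n (?\<Phi> ((?\<Phi> ^^ k) v)) - U n ((?\<Phi> ^^ k) v)) \<longlonglongrightarrow> 0"
      unfolding U_def by (rule monotone_increments_invariant[OF \<mu> B wc pos[OF v]])
    from tendsto_add[OF this Suc] show ?case by simp
  qed simp
  obtain C where C: "\<forall>\<^sub>F n in sequentially. norm (V n w') \<le> C"
    using monotone_increments_bounded_everywhere[OF \<mu> B wc w'] unfolding V_def by blast
  define D where "D = norm w' * \<bar>C\<bar> + 1"
  have D: "D > 0" by (simp add: D_def add_nonneg_pos)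
  define d where "d = norm (w\<^sup>2 - w'\<^sup>2)"
  have d: "d \<ge> 0" by (simp add: d_def)
  \<comment> \<open>Each application of \<open>?\<Phi>\<close> lowers the real part of the square by
    2. After \<open>k\<close> applications \<open>(Im b)^2\<close> is at least
    \<open>2 d + 12 d D / \<epsilon>\<close>: the first term keeps \<open>a\<close> within
    \<open>Im b / 2\<close> of \<open>b\<close>, the second makes the final error at most
    \<open>\<epsilon> / 3\<close>.\<close>
  obtain k where k: "real k > \<bar>Re (w'\<^sup>2)\<bar> + 2 * d + 12 * d * D / \<epsilon>"
    using reals_Archimedean2 by blast
  define a where "a = (?\<Phi> ^^ k) w"
  define b where "b = (?\<Phi> ^^ k) w'"
  define v where "v = Im b"
  have a: "Im a > 0" and b: "Im b > 0" by (simp_all add: a_def b_def pos w w')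
  have v: "v > 0" using b by (simp add: v_def)
  have "Re (b\<^sup>2) = Re (w'\<^sup>2) - 2 * real k" by (simp add: b_def F_transform_arcsine_funpow[OF w'])
  hence v2: "v\<^sup>2 \<ge> 2 * d + 12 * d * D / \<epsilon>"
  proof -
    assume *: "Re (b\<^sup>2) = Re (w'\<^sup>2) - 2 * real k"
    have "(Re b)\<^sup>2 - v\<^sup>2 = Re (b\<^sup>2)" by (simp add: v_def power2_eq_square)
    moreover have "(Re b)\<^sup>2 \<ge> 0" by simp
    moreover have "2 * d + 12 * d * D / \<epsilon> \<ge> 0" using d D e by simp
    ultimately show ?thesis using * k by linarith
  qed
  have v2d: "2 * d \<le> v\<^sup>2"
  proof -
    have "12 * d * D / \<epsilon> \<ge> 0" using d D e by simp
    with v2 show ?thesis by linarith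
  qed
  have v2D: "4 * d / v\<^sup>2 * D \<le> \<epsilon> / 3"
  proof -
    have "12 * d * D / \<epsilon> \<le> v\<^sup>2" using v2 d by linarith
    hence "12 * d * D \<le> v\<^sup>2 * \<epsilon>" using e by (simp add: pos_divide_le_eq)
    thus ?thesis using v by (simp add: field_simps)
  qed
  \<comment> \<open>The difference of squares \<open>a^2 - b^2\<close> is invariant under the
    iteration, while \<open>|a + b|\<close> exceeds the growing height \<open>v\<close>.\<close>
  have ab: "norm (a - b) \<le> d / v"
  proof -
    have "(a - b) * (a + b) = a\<^sup>2 - b\<^sup>2" by (simp add: power2_eq_square algebra_simps)
    also have "\<dots> = w\<^sup>2 - w'\<^sup>2" by (simp add: a_def b_def F_transform_arcsine_funpow w w')
    finally have "norm (a - b) * norm (a + b) = d" unfolding d_def by (metis norm_mult)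
    moreover have "norm (a + b) \<ge> v" using abs_Im_le_cmod[of "a + b"] a by (simp add: v_def)
    hence "norm (a - b) * v \<le> norm (a - b) * norm (a + b)" by (intro mult_left_mono) auto
    ultimately show ?thesis using v by (simp add: pos_le_divide_eq)
  qed
  have dv: "d / v \<le> v / 2" using v2d v by (simp add: field_simps power2_eq_square)
  have vb: "v \<le> norm b" unfolding v_def using abs_Im_le_cmod[of b] by simp
  \<comment> \<open>The constant is \<open>4 = 3/2 * 2 + 1\<close>: variation of \<open>V\<close>
    weighted by \<open>|a| \<le> 3/2 |b|\<close>, plus variation of the factor in front of
    \<open>V\<close>.\<close>
  have close: "norm (U n a - U n b) \<le> 4 * d / v\<^sup>2 * norm (U n b)" for n
  proof -
    have less: "norm (a - b) < Im b" using ab dv v unfolding v_def [symmetric] by linarith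
    have Vb0: "Im (V n b) \<ge> 0" unfolding V_def by (rule scaled_increment(2)[OF M b])
    have "norm (V n a - V n b) * (v / 2) \<le> norm (V n a - V n b) * (Im b - norm (a - b))"
      using ab dv unfolding v_def [symmetric] by (intro mult_left_mono) (linarith, simp)
    also have "\<dots> \<le> norm (a - b) * Im (V n b)" unfolding V_def
      by (rule schwarz_pick_local[OF scaled_increment(1)[OF M] scaled_increment(2)[OF M] b less])
    also have "\<dots> \<le> d / v * norm (V n b)"
      using ab abs_Im_le_cmod[of "V n b"] d v Vb0 by (intro mult_mono) auto
    finally have 1: "norm (V n a - V n b) \<le> 2 * d / v\<^sup>2 * norm (V n b)"
      using v by (simp add: field_simps power2_eq_square)
    have "norm a \<le> norm b + norm (a - b)" by (rule norm_triangle_sub)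
    hence na: "norm a \<le> 3/2 * norm b" using ab dv vb by linarith
    have "d / v = d / v\<^sup>2 * v" using v by (simp add: power2_eq_square)
    also have "\<dots> \<le> d / v\<^sup>2 * norm b" using vb d v by (intro mult_left_mono) auto
    finally have 2: "norm (a - b) \<le> d / v\<^sup>2 * norm b" using ab by linarith
    have "U n a - U n b = a * (V n a - V n b) + (a - b) * V n b" by (simp add: UV algebra_simps)
    hence "norm (U n a - U n b) \<le> norm a * norm (V n a - V n b) + norm (a - b) * norm (V n b)"
      by (metis norm_mult norm_triangle_ineq)
    also have "\<dots> \<le> (3/2 * norm b) * (2 * d / v\<^sup>2 * norm (V n b)) + (d / v\<^sup>2 * norm b) * norm (V n b)"
      using d by (intro add_mono mult_mono na 1 2) auto
    also have "\<dots> = 4 * d / v\<^sup>2 * norm (U n b)" by (simp add: UV norm_mult)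
    finally show ?thesis .
  qed
  have ev1: "\<forall>\<^sub>F n in sequentially. norm (U n a - U n w) < \<epsilon> / 3"
    using tendsto_norm_zero[OF iter[OF w, of k]] e by (intro order_tendstoD) (auto simp: a_def)
  have ev2: "\<forall>\<^sub>F n in sequentially. norm (U n b - U n w') < min (\<epsilon> / 3) 1"
    using tendsto_norm_zero[OF iter[OF w', of k]] e by (intro order_tendstoD) (auto simp: b_def)
  show "\<forall>\<^sub>F n in sequentially. dist (U n w - U n w') 0 < \<epsilon>"
    using ev1 ev2 C
  proof eventually_elim
    case (elim n)
    have "norm (U n w') \<le> norm w' * \<bar>C\<bar>" using elim(3) by (simp add: UV norm_mult mult_left_mono)
    hence "norm (U n b) \<le> D" using elim(2) norm_triangle_sub[of "U n b" "U n w'"] by (simp add: D_def)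
    hence "4 * d / v\<^sup>2 * norm (U n b) \<le> 4 * d / v\<^sup>2 * D" using d by (intro mult_left_mono) auto
    hence "norm (U n a - U n b) \<le> \<epsilon> / 3" using close[of n] v2D by linarith
    moreover have "norm (U n w - U n w') \<le> norm (U n a - U n b) + norm (U n a - U n w) + norm (U n b - U n w')"
    proof -
      have "norm (U n w - U n w') = norm ((U n a - U n b) - (U n a - U n w) + (U n b - U n w'))" by simp
      thus ?thesis using norm_triangle_ineq[of "(U n a - U n b) - (U n a - U n w)" "U n b - U n w'"]
          norm_triangle_ineq4[of "U n a - U n b" "U n a - U n w"] by linarith
    qed
    ultimately show ?case using elim(1,2) by simp
  qed
qed

text \<open>The sequence \<open>U n ?p\<close> is bounded. Along a subsequence with limit
  \<open>c\<close>, asymptotic constancy gives \<open>V n w \<rightarrow> c / w\<close> everywhere,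
  so Euler's method sends \<open>w^2\<close> to \<open>w^2 + 2 c\<close>; the arc-sine limit
  requires \<open>w^2 - 2\<close>, hence \<open>c = - 1\<close>.\<close>

lemma monotone_gaussian_increments:
  assumes \<mu>: "real_distribution \<mu>" and B: "\<And>n. B n > 0"
    and wc: "weak_conv_m (\<lambda>n. dilation (1 / B n) (convolution_power monotone_convolution \<mu> n)) arcsine_distribution"
    and z: "Im z > 0"
  shows "gaussian_increments (\<lambda>n. dilation (1 / B n) \<mu>) z"
proof -
  let ?M = "\<lambda>n. dilation (1 / B n) \<mu>"
  let ?R = "\<lambda>n. dilation (1 / B n) (convolution_power monotone_convolution \<mu> n)"
  let ?p = "8 * \<i>"
  define V where "V n w = of_nat n * (F_transform (?M n) w - w)" for n w
  define U where "U n w = w * V n w" for n w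
  have M: "real_distribution (?M n)" for n by (rule real_distribution.real_distribution_dilation[OF \<mu>])
  have R: "real_distribution (?R n)" for n
    by (intro real_distribution.real_distribution_dilation monotone_convolution_power \<mu>)
  have const: "(\<lambda>n. U n w - U n ?p) \<longlonglongrightarrow> 0" if "Im w > 0" for w
    unfolding U_def V_def by (rule monotone_increments_asymptotically_constant[OF \<mu> B wc that]) simp
  have V: "(\<lambda>n. V (r n) w) \<longlonglongrightarrow> c / w"
    if w: "Im w > 0" and r: "strict_mono r" and c: "(\<lambda>n. U (r n) ?p) \<longlonglongrightarrow> c" for w r c
  proof -
    have "w \<noteq> 0" using w by auto
    have "(\<lambda>n. U (r n) w - U (r n) ?p + U (r n) ?p) \<longlonglongrightarrow> 0 + c"
      using LIMSEQ_subseq_LIMSEQ[OF const[OF w] r] by (intro tendsto_add c) (simp add: o_def)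
    hence "(\<lambda>n. U (r n) w / w) \<longlonglongrightarrow> c / w" using \<open>w \<noteq> 0\<close> by (intro tendsto_divide tendsto_const) auto
    thus ?thesis using \<open>w \<noteq> 0\<close> by (simp add: U_def)
  qed
  have limit: "c = - 1" if r: "strict_mono r" and c: "(\<lambda>n. U (r n) ?p) \<longlonglongrightarrow> c" for r c
  proof -
    \<comment> \<open>A point above the height \<open>2 |c| + 2\<close> that the Euler limit
      demands.\<close>
    define w where "w = \<i> * of_real (2 * norm c + 3)"
    have "(\<lambda>n. ((F_transform (?M (r n)) ^^ r n) w)\<^sup>2) \<longlonglongrightarrow> w\<^sup>2 + 2 * c"
    proof (rule euler_square_limit[where N = r and f = "\<lambda>n. F_transform (?M (r n))"])
      show "(\<lambda>n. of_nat (r n) * (F_transform (?M (r n)) v - v)) \<longlonglongrightarrow> c / v" if "Im v > 0" for v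
        using V[OF that r c] by (simp add: V_def)
      show "Im w > 2 * norm c + 2" by (simp add: w_def)
    qed (use scaled_increment[OF M] filterlim_subseq[OF r] in auto)
    moreover have w: "Im w > 0" by (simp add: w_def add_nonneg_pos)
    have "(\<lambda>n. (F_transform (?R n) w)\<^sup>2) \<longlonglongrightarrow> (F_transform arcsine_distribution w)\<^sup>2"
      by (intro tendsto_power weak_conv_imp_F_transform[OF R arcsine_distribution_props(1) wc w])
    from LIMSEQ_subseq_LIMSEQ[OF this r]
    have "(\<lambda>n. ((F_transform (?M (r n)) ^^ r n) w)\<^sup>2) \<longlonglongrightarrow> w\<^sup>2 - 2"
      by (simp add: o_def monotone_power_scaled[OF \<mu> B w] F_transform_arcsine[OF w])
    ultimately have "w\<^sup>2 + 2 * c = w\<^sup>2 - 2" by (rule LIMSEQ_unique)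
    hence "c = (- 2) / 2" by (simp add: eq_divide_eq)
    thus ?thesis by simp
  qed
  have "(\<lambda>n. U n ?p) \<longlonglongrightarrow> - 1"
  proof (rule ccontr)
    assume "\<not> ?thesis"
    then obtain \<epsilon> where e: "\<epsilon> > 0" and "\<not> (\<forall>\<^sub>F n in sequentially. dist (U n ?p) (- 1) < \<epsilon>)"
      by (auto simp: tendsto_iff)
    hence "\<exists>\<^sub>F n in sequentially. dist (U n ?p) (- 1) \<ge> \<epsilon>" by (simp add: not_eventually not_less)
    moreover have "\<forall>\<^sub>F n in sequentially. norm (U n ?p) \<le> 32"
      using monotone_increments_bounded[OF \<mu> B wc] by eventually_elim (simp add: U_def V_def norm_mult)
    ultimately have "\<exists>\<^sub>F n in sequentially. norm (U n ?p) \<le> 32 \<and> dist (U n ?p) (- 1) \<ge> \<epsilon>"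
      by (rule frequently_eventually_conj)
    from frequently_subseq[OF this] obtain r :: "nat \<Rightarrow> nat" where r: "strict_mono r"
      and bound: "\<And>n. norm (U (r n) ?p) \<le> 32" and far: "\<And>n. dist (U (r n) ?p) (- 1) \<ge> \<epsilon>" by blast
    have "bounded (range (\<lambda>n. U (r n) ?p))" using bound by (intro boundedI) auto
    then obtain c s where s: "strict_mono s" and c: "((\<lambda>n. U (r n) ?p) \<circ> s) \<longlonglongrightarrow> c"
      using bounded_imp_convergent_subsequence by blast
    have c': "(\<lambda>n. U ((r \<circ> s) n) ?p) \<longlonglongrightarrow> c" using c by (simp add: o_def)
    have "\<epsilon> \<le> dist c (- 1)"
      using far by (intro LIMSEQ_le_const[OF tendsto_dist[OF c' tendsto_const]]) auto
    with limit[OF strict_mono_o[OF r s] c'] e show False by simp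
  qed
  from V[OF z, of "\<lambda>n. n", OF _ this] show ?thesis
    by (simp add: gaussian_increments_def V_def strict_mono_def)
qed

section \<open>The equivalences for fixed norming constants and the equality of the domains\<close>

lemma monotone_weak_conv_iff:
  assumes \<mu>: "real_distribution \<mu>" and B: "\<And>n. B n > 0"
  shows "weak_conv_m (\<lambda>n. dilation (1 / B n) (convolution_power monotone_convolution \<mu> n)) arcsine_distribution
     \<longleftrightarrow> (\<forall>z. Im z > 0 \<longrightarrow> gaussian_increments (\<lambda>n. dilation (1 / B n) \<mu>) z)"
    (is "?W \<longleftrightarrow> ?G")
proof
  assume ?W
  show ?G by (intro allI impI) (rule monotone_gaussian_increments[OF \<mu> B \<open>?W\<close>])
next
  assume G: ?G
  show ?W by (rule monotone_weak_conv_if[OF \<mu> B]) (use G in simp)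
qed

lemma classical_weak_conv_iff:
  assumes \<mu>: "real_distribution \<mu>" and B: "\<And>n. B n > 0"
  shows "weak_conv_m (\<lambda>n. dilation (1 / B n) (convolution_power convolution \<mu> n)) std_normal_distribution
     \<longleftrightarrow> (\<forall>z. Im z > 0 \<longrightarrow> gaussian_increments (\<lambda>n. dilation (1 / B n) \<mu>) z)"
    (is "?W \<longleftrightarrow> ?G")
proof
  assume ?W
  note G = classical_gaussian_increments[OF \<mu> B \<open>?W\<close>]
  show ?G
    using gaussian_increments_everywhere[OF real_distribution.real_distribution_dilation[OF \<mu>] _ _ _ G[of 1] G[of 2]] by simp
next
  assume ?G
  thus ?W by (intro classical_weak_conv_if \<mu> B) simp
qed

theorem corollary3p2:
  "strict_domain_of_attraction monotone_convolution arcsine_distribution =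
     strict_domain_of_attraction convolution std_normal_distribution \<and>
   strict_domain_of_attraction convolution std_normal_distribution =
     strict_domain_of_attraction free_convolution semicircle_distribution"
proof -
  have "strict_domain_of_attraction conv \<nu> = {\<mu>. real_distribution \<mu> \<and>
      (\<exists>B. (\<forall>n. B n > 0) \<and> (\<forall>z. Im z > 0 \<longrightarrow> gaussian_increments (\<lambda>n. dilation (1 / B n) \<mu>) z))}"
    if "\<And>\<mu> B. real_distribution \<mu> \<Longrightarrow> (\<And>n. B n > 0) \<Longrightarrow>
      weak_conv_m (\<lambda>n. dilation (1 / B n) (convolution_power conv \<mu> n)) \<nu>
        \<longleftrightarrow> (\<forall>z. Im z > 0 \<longrightarrow> gaussian_increments (\<lambda>n. dilation (1 / B n) \<mu>) z)" for conv \<nu>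
    unfolding strict_domain_of_attraction_def using that
    by (intro Collect_cong conj_cong refl ex_cong1) blast
  note eq = this
  show ?thesis
    by (simp only: eq[OF monotone_weak_conv_iff] eq[OF classical_weak_conv_iff] eq[OF free_weak_conv_iff])
qed

end
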